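(* Take $\phi \in L^1(\mathbb{R}^d)$ with $\int_{\mathbb{R}^d} \phi\,dx = 1$, and suppose $\phi$ is a Schwartz function with $\widehat{\phi}$ supported in $\mathcal{C}_0 b^{-1}$. Then for all $f\in H^1(\mathbb{R}^d)$, $$\| f \|_{H^1} \approx \| Tf \|_{\ell^\infty(h^1)} = \sup_{j > 0} \| \{ \langle f,\phi_{j,k} \rangle \}_{k\in\mathbb{Z}^d} \|_{h^1} \, |\det b| ,$$ i.e. each side is bounded by a positive constant, independent of $f$, times the other.
   Context: Fix $d\in\mathbb{N}$. The dilation matrices are isotropic and expanding: $a_j=\alpha_j I$ ($j=1,2,3,\ldots$), where $\alpha_j$ are nonzero real numbers with $|\alpha_j|\to\infty$ as $j\to\infty$. The translation matrix $b$ is an invertible $d\times d$ real matrix. Functions are complex-valued; $j>0$ means $j=1,2,3,\ldots$. Here (taking $p=1$, $q=\infty$) $\phi_{j,k}(x)=\phi(a_jx-bk)$ for $k\in\mathbb{Z}^d$, $\langle f,\phi_{j,k}\rangle=\int_{\mathbb{R}^d} f\,\overline{\phi_{j,k}}\,dx$, and the analysis operator is $Tf=\{|\det b|\langle f,\phi_{j,k}\rangle\}_{j>0,k\in\mathbb{Z}^d}$. The Fourier transform is $\widehat f(\xi)=\int_{\mathbb{R}^d} f(x)e^{-2\pi i\xi x}\,dx$ for row vectors $\xi$. $\mathcal{C}_0=(-1/2,1/2)^d$ (row vectors) and $\mathcal{C}_0b^{-1}=\{\xi b^{-1}:\xi\in\mathcal{C}_0\}$. Hardy space: let $C_d=\Gamma((d+1)/2)\pi^{-(d+1)/2}$,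 $Z(x)=C_d\,x/|x|^{d+1}$ for $x\ne0$ and $Z(0)=0$. The (vector-valued) Riesz transform of $f\in L^1(\mathbb{R}^d)$ is $Rf(x)=(f*Z)(x)=\text{p.v.}\int f(x-y)Z(y)\,dy$. $H^1=H^1(\mathbb{R}^d)=\{f\in L^1: Rf\in L^1\}$ with $\|f\|_{H^1}=\|f\|_1+\|Rf\|_1$. Discrete Hardy space: fix a smooth, compactly supported cut-off function $\nu$ supported in $\mathcal{C}_0$ with $\nu\equiv1$ near the origin. The discrete Riesz kernel $z=\{z_k\}_{k\in\mathbb{Z}^d}\in\ell^2$, $z_k\in\mathbb{C}^d$, is defined by its Fourier series $$\zeta(\xi)=\sum_{k\in\mathbb{Z}^d} z_k e^{-2\pi i\xi k}:=-i\frac{\xi b^{-1}}{|\xi b^{-1}|}\nu(\xi),\qquad \xi\in\mathcal{C}_0,$$ with $\xi$ a row vector and $k$ a column vector. Then $h^1=\{s\in\ell^1(\mathbb{Z}^d): s*z\in\ell^1\}$ with norm $\|s\|_{h^1}=\|s\|_{\ell^1}+\|s*z\|_{\ell^1}$. The norm on $\ell^\infty(h^1)$ is $\|c\|_{\ell^\infty(h^1)}=\sup_{j>0}\|\{c_{j,k}\}_{k\in\mathbb{Z}^d}\|_{h^1}$. *)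

theory Defs
  imports "HOL-Analysis.Analysis"
begin

section \<open>Smooth and Schwartz functions\<close>

definition partial_derivative ::
    "'d::finite \<Rightarrow> (real^'d \<Rightarrow> complex) \<Rightarrow> real^'d \<Rightarrow> complex" where
  "partial_derivative i f x = frechet_derivative f (at x) (axis i 1)"

text \<open>The list \<open>[i\<^sub>1, \<dots>, i\<^sub>m]\<close> stands for \<open>\<partial>\<^bsub>i\<^sub>1\<^esub> \<dots> \<partial>\<^bsub>i\<^sub>m\<^esub> f\<close>.\<close>

definition iterated_partial ::
    "'d::finite list \<Rightarrow> (real^'d \<Rightarrow> complex) \<Rightarrow> real^'d \<Rightarrow> complex" where
  "iterated_partial ks f = foldr partial_derivative ks f"

text \<open>Total differentiability of every iterated partial derivative is equivalent to
  \<open>C\<^sup>\<infinity>\<close>: it makes all partial derivatives of all orders exist and be continuous.\<close>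

definition smooth_fun :: "(real^'d::finite \<Rightarrow> complex) \<Rightarrow> bool" where
  "smooth_fun f \<longleftrightarrow> (\<forall>ks x. iterated_partial ks f differentiable (at x))"

definition schwartz_fun :: "(real^'d::finite \<Rightarrow> complex) \<Rightarrow> bool" where
  "schwartz_fun f \<longleftrightarrow> smooth_fun f \<and>
     (\<forall>(n::nat) ks. \<exists>B. \<forall>x. norm x ^ n * norm (iterated_partial ks f x) \<le> B)"

definition fun_support :: "(real^'d::finite \<Rightarrow> complex) \<Rightarrow> (real^'d) set" where
  "fun_support f = closure {x. f x \<noteq> 0}"


section \<open>Fourier transform and pairing\<close>

definition fourier :: "(real^'d::finite \<Rightarrow> complex) \<Rightarrow> real^'d \<Rightarrow> complex" where
  "fourier f \<xi> = (LINT x|lebesgue. f x * exp (- (2 * complex_of_real pi * \<i> * complex_of_real (\<xi> \<bullet> x))))"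

definition pairing :: "(real^'d::finite \<Rightarrow> complex) \<Rightarrow> (real^'d \<Rightarrow> complex) \<Rightarrow> complex" where
  "pairing f g = (LINT x|lebesgue. f x * cnj (g x))"

definition unit_cube :: "(real^'d::finite) set" where
  "unit_cube = {\<xi>. \<forall>i. - (1/2) < \<xi> $ i \<and> \<xi> $ i < 1/2}"


section \<open>Riesz transform and Hardy space\<close>

text \<open>The value at \<open>0\<close> is \<open>0\<close>, since the vector factor vanishes there.\<close>

definition riesz_kernel :: "real^'d::finite \<Rightarrow> real^'d" where
  "riesz_kernel x =
     (Gamma ((real CARD('d) + 1) / 2) * pi powr (- ((real CARD('d) + 1) / 2))
        / norm x ^ (CARD('d) + 1)) *\<^sub>R x"

definition truncated_riesz ::
    "real \<Rightarrow> (real^'d::finite \<Rightarrow> complex) \<Rightarrow> real^'d \<Rightarrow> complex^'d" where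
  "truncated_riesz \<epsilon> f x =
     (LINT y:{y. \<epsilon> < norm y}|lebesgue. (\<chi> i. f (x - y) * complex_of_real (riesz_kernel y $ i)))"

definition riesz_transform :: "(real^'d::finite \<Rightarrow> complex) \<Rightarrow> real^'d \<Rightarrow> complex^'d" where
  "riesz_transform f x = Lim (at_right 0) (\<lambda>\<epsilon>. truncated_riesz \<epsilon> f x)"

text \<open>The principal value of an integrable function exists almost everywhere; the second
  conjunct records this, so that the third does not refer to arbitrary values of \<open>Lim\<close>.\<close>

definition hardy_space :: "(real^'d::finite \<Rightarrow> complex) set" where
  "hardy_space = {f. integrable lebesgue f \<and>
     (AE x in lebesgue. \<exists>l. ((\<lambda>\<epsilon>. truncated_riesz \<epsilon> f x) \<longlongrightarrow> l) (at_right 0)) \<and>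
     integrable lebesgue (riesz_transform f)}"

definition hardy_norm :: "(real^'d::finite \<Rightarrow> complex) \<Rightarrow> real" where
  "hardy_norm f = (LINT x|lebesgue. norm (f x)) + (LINT x|lebesgue. norm (riesz_transform f x))"


section \<open>Discrete Hardy space\<close>

definition lattice_vec :: "int^'d \<Rightarrow> real^'d::finite" where
  "lattice_vec k = (\<chi> i. of_int (k $ i))"

definition cutoff_fun :: "(real^'d::finite \<Rightarrow> complex) \<Rightarrow> bool" where
  "cutoff_fun \<nu> \<longleftrightarrow> smooth_fun \<nu> \<and> compact (fun_support \<nu>) \<and> fun_support \<nu> \<subseteq> unit_cube \<and>
     (\<forall>\<^sub>F \<xi> in nhds 0. \<nu> \<xi> = 1)"

text \<open>The row vector \<open>\<xi> b\<^sup>-\<^sup>1\<close> is \<open>\<xi> v* matrix_inv b\<close>.\<close>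

definition riesz_symbol ::
    "real^'d^'d \<Rightarrow> (real^'d \<Rightarrow> complex) \<Rightarrow> real^'d::finite \<Rightarrow> complex^'d" where
  "riesz_symbol b \<nu> \<xi> =
     (\<chi> i. - \<i> * complex_of_real ((\<xi> v* matrix_inv b) $ i / norm (\<xi> v* matrix_inv b)) * \<nu> \<xi>)"

text \<open>The sequence whose Fourier series \<open>\<Sum>\<^sub>k z\<^sub>k e\<^bsup>-2\<pi>i\<xi>k\<^esup>\<close> is the symbol on the unit cube, i.e.
  the sequence of its Fourier coefficients (the series itself converges in \<open>L\<^sup>2\<close> only).\<close>

definition discrete_riesz_kernel ::
    "real^'d^'d \<Rightarrow> (real^'d \<Rightarrow> complex) \<Rightarrow> int^'d::finite \<Rightarrow> complex^'d" where
  "discrete_riesz_kernel b \<nu> k =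
     (LINT \<xi>:unit_cube|lebesgue.
        exp (2 * complex_of_real pi * \<i> * complex_of_real (\<xi> \<bullet> lattice_vec k)) *s riesz_symbol b \<nu> \<xi>)"

definition seq_conv ::
    "(int^'d \<Rightarrow> complex) \<Rightarrow> (int^'d \<Rightarrow> complex^'d) \<Rightarrow> int^'d::finite \<Rightarrow> complex^'d" where
  "seq_conv s z k = (\<Sum>\<^sub>\<infinity>m. s m *s z (k - m))"

definition discrete_hardy_space ::
    "real^'d^'d \<Rightarrow> (real^'d \<Rightarrow> complex) \<Rightarrow> (int^'d::finite \<Rightarrow> complex) set" where
  "discrete_hardy_space b \<nu> =
     {s. (\<lambda>k. norm (s k)) summable_on UNIV \<and>
         (\<lambda>k. norm (seq_conv s (discrete_riesz_kernel b \<nu>) k)) summable_on UNIV}"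

definition discrete_hardy_norm ::
    "real^'d^'d \<Rightarrow> (real^'d \<Rightarrow> complex) \<Rightarrow> (int^'d::finite \<Rightarrow> complex) \<Rightarrow> real" where
  "discrete_hardy_norm b \<nu> s =
     (\<Sum>\<^sub>\<infinity>k. norm (s k)) + (\<Sum>\<^sub>\<infinity>k. norm (seq_conv s (discrete_riesz_kernel b \<nu>) k))"

text \<open>Scales are the positive naturals: the value at index \<open>0\<close> is never used.\<close>

definition linf_hardy_space ::
    "real^'d^'d \<Rightarrow> (real^'d \<Rightarrow> complex) \<Rightarrow> (nat \<Rightarrow> int^'d::finite \<Rightarrow> complex) set" where
  "linf_hardy_space b \<nu> =
     {c. (\<forall>j>0. c j \<in> discrete_hardy_space b \<nu>) \<and>
         bdd_above ((\<lambda>j. discrete_hardy_norm b \<nu> (c j)) ` {0<..})}"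

definition linf_hardy_norm ::
    "real^'d^'d \<Rightarrow> (real^'d \<Rightarrow> complex) \<Rightarrow> (nat \<Rightarrow> int^'d::finite \<Rightarrow> complex) \<Rightarrow> real" where
  "linf_hardy_norm b \<nu> c = (SUP j\<in>{0<..}. discrete_hardy_norm b \<nu> (c j))"


section \<open>Analysis operator\<close>

text \<open>The normalization is the one for \<open>p = 1\<close>, \<open>q = \<infinity>\<close>: no determinant factor in \<open>\<phi>\<^bsub>j,k\<^esub>\<close>.\<close>

definition affine_system ::
    "(nat \<Rightarrow> real^'d^'d) \<Rightarrow> real^'d^'d \<Rightarrow> (real^'d \<Rightarrow> complex) \<Rightarrow>
     nat \<Rightarrow> int^'d \<Rightarrow> real^'d::finite \<Rightarrow> complex" where
  "affine_system a b \<phi> j k x = \<phi> (a j *v x - b *v lattice_vec k)"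

definition analysis_op ::
    "(nat \<Rightarrow> real^'d^'d) \<Rightarrow> real^'d^'d \<Rightarrow> (real^'d \<Rightarrow> complex) \<Rightarrow>
     (real^'d \<Rightarrow> complex) \<Rightarrow> nat \<Rightarrow> int^'d::finite \<Rightarrow> complex" where
  "analysis_op a b \<phi> f j k = complex_of_real \<bar>det b\<bar> * pairing f (affine_system a b \<phi> j k)"

end

theory Submission imports Defs "HOL-Probability.Probability"
begin

text \<open>Let \<open>s\<^sub>k\<close> be the samples of \<open>f\<close> at scale \<open>\<alpha>\<close>. On the Fourier side, Poisson summation turns
  \<open>s\<close> into \<open>cnj (ft \<phi> \<xi>)\<close> times \<open>ft f (\<alpha> \<xi>)\<close>, and the discrete Riesz kernel multiplies this by
  \<open>-\<i> \<nu>(\<xi> b) \<xi> / |\<xi>|\<close>. As \<open>\<xi> / |\<xi>|\<close> is homogeneous, \<open>s * z\<close> consists, up to sign, of the samples of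
  \<open>Rf\<close> against the kernel with Fourier transform \<open>\<nu>(\<xi> b) cnj (ft \<phi> \<xi>)\<close>, which is integrable with integral 1.
  So both parts of the \<open>h\<^sup>1\<close> norm are sums of samples of an \<open>L\<^sup>1\<close> function \<open>F\<close> against an integrable
  kernel whose lattice translates are uniformly summable. Such sums are bounded by the \<open>L\<^sup>1\<close> norm of \<open>F\<close>, and as
  \<open>|\<alpha>| \<longlongrightarrow> \<infinity>\<close> the step functions built from the samples of continuous functions converge in \<open>L\<^sup>1\<close>, giving
  the reverse inequality.

  The Riesz transform is only known as an almost everywhere limit, so the exchange of \<open>R\<close> with the
  kernel rests on the weak type (1,1) inequality, proved by a Calderon-Zygmund
  decomposition of point masses.\<close>

section \<open>Affine and linear changes of variables\<close>

text \<open>The obstacle is that R does not map L^1 to itself, so an L^1 approximation of a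
  mollified \<open>f\<close> by translates says nothing about the L^1 distance of the Riesz
  transforms. It does control them in measure, which is just what a weak type bound gives; a limit
  in measure identifies functions almost everywhere, and continuity of both sides then gives every
  point, hence the samples.

  The truncated kernels are Gaussian superpositions because three facts then become explicit: the
  Fourier multiplier is a direction cosine times a difference of Gaussian integrals, which gives
  uniform L^2 bounds; the Hormander integral is an arctangent; and the return to sharp truncations
  is a weighted average over radii, which turns the principal value into a limit of smooth
  truncations without a maximal function.

  The cut-off enters twice: its support confines the symbol to one period, and its smoothness makes
  the product kernel integrable. The Jacobian of \<open>b\<close> and the constants relating the
  kernels are carried as positive numbers, since the claim is up to constants.\<close>

lemma lborel_distr_affine:
  fixes t :: "'a::euclidean_space"
  assumes "c \<noteq> 0"
  shows "distr lborel borel (\<lambda>x. t + c *\<^sub>R x) = density lborel (\<lambda>_. ennreal (inverse (\<bar>c\<bar> ^ DIM('a))))"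
proof -
  have "density lborel (\<lambda>_. ennreal (inverse (\<bar>c\<bar> ^ DIM('a)))) =
     density (density (distr lborel borel (\<lambda>x. t + c *\<^sub>R x)) (\<lambda>_. ennreal (\<bar>c\<bar> ^ DIM('a)))) (\<lambda>_. ennreal (inverse (\<bar>c\<bar> ^ DIM('a))))"
    using lborel_affine[OF assms, of t] by simp
  also have "... = density (distr lborel borel (\<lambda>x. t + c *\<^sub>R x)) (\<lambda>_. ennreal (\<bar>c\<bar> ^ DIM('a)) * ennreal (inverse (\<bar>c\<bar> ^ DIM('a))))"
    by (subst density_density_eq) auto
  also have "(\<lambda>_::'a. ennreal (\<bar>c\<bar> ^ DIM('a)) * ennreal (inverse (\<bar>c\<bar> ^ DIM('a)))) = (\<lambda>_. 1)"
    using assms by (simp flip: ennreal_mult)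
  finally show ?thesis by (simp add: density_1)
qed

lemma nn_integral_lborel_affine:
  fixes t :: "'a::euclidean_space"
  assumes [measurable]: "f \<in> borel_measurable borel" and "c \<noteq> 0"
  shows "(\<integral>\<^sup>+x. f (t + c *\<^sub>R x) \<partial>lborel) = ennreal (inverse (\<bar>c\<bar> ^ DIM('a))) * (\<integral>\<^sup>+x. f x \<partial>lborel)"
proof -
  have "(\<integral>\<^sup>+x. f (t + c *\<^sub>R x) \<partial>lborel) = (\<integral>\<^sup>+x. f x \<partial>distr lborel borel (\<lambda>x. t + c *\<^sub>R x))"
    by (subst nn_integral_distr) auto
  then show ?thesis unfolding lborel_distr_affine[OF assms(2)]
    by (simp add: nn_integral_density nn_integral_cmult)
qed

lemma AE_lborel_affine:
  fixes t :: "'a::euclidean_space"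
  assumes "AE x in lborel. P x" "c \<noteq> 0"
  shows "AE x in lborel. P (t + c *\<^sub>R x)"
proof -
  have "AE x in density lborel (\<lambda>_::'a. ennreal (inverse (\<bar>c\<bar> ^ DIM('a)))). P x"
    using assms(1) by (subst AE_density) auto
  then have "AE x in distr lborel borel (\<lambda>x. t + c *\<^sub>R x). P x"
    unfolding lborel_distr_affine[OF assms(2)] .
  then show ?thesis by (rule AE_distrD[rotated]) auto
qed

lemma integrable_lborel_affine:
  fixes t :: "'a::euclidean_space" and f :: "'a \<Rightarrow> 'b::{banach, second_countable_topology}"
  assumes f: "integrable lborel f" and c: "c \<noteq> 0"
  shows "integrable lborel (\<lambda>x. f (t + c *\<^sub>R x))"
proof -
  have "integrable (distr lborel borel (\<lambda>x. t + c *\<^sub>R x)) f"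
    using f c by (simp add: lborel_distr_affine integrable_density)
  then show ?thesis by (subst (asm) integrable_distr_eq) (use f in auto)
qed

lemma integrable_lborel_affine_iff:
  fixes t :: "'a::euclidean_space" and f :: "'a \<Rightarrow> 'b::{banach, second_countable_topology}"
  assumes c: "c \<noteq> 0"
  shows "integrable lborel (\<lambda>x. f (t + c *\<^sub>R x)) \<longleftrightarrow> integrable lborel f"
  using integrable_lborel_affine[of f c t] c
    integrable_lborel_affine[of "\<lambda>x. f (t + c *\<^sub>R x)" "inverse c" "- inverse c *\<^sub>R t"]
  by (auto simp: algebra_simps)

lemma integral_lborel_affine:
  fixes t :: "'a::euclidean_space" and f :: "'a \<Rightarrow> 'b::{banach, second_countable_topology}"
  assumes c: "c \<noteq> 0"
  shows "(LBINT x. f (t + c *\<^sub>R x)) = inverse (\<bar>c\<bar> ^ DIM('a)) *\<^sub>R (LBINT x. f x)"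
proof (cases "integrable lborel f")
  case True
  then have [measurable]: "f \<in> borel_measurable borel" by auto
  have "(LBINT x. f (t + c *\<^sub>R x)) = (LINT x|distr lborel borel (\<lambda>x. t + c *\<^sub>R x). f x)"
    by (subst integral_distr) auto
  then show ?thesis using c
    by (simp add: lborel_distr_affine integral_density)
next
  \<comment> \<open>A non-integrable function has Bochner integral 0 on both sides, so the formula
    holds for every \<open>f\<close>.\<close>
  case False
  then show ?thesis using integrable_lborel_affine_iff[OF c, of f t]
    by (simp add: not_integrable_integral_eq)
qed

lemma
  fixes a :: "'a::euclidean_space" and f :: "'a \<Rightarrow> 'b::{banach, second_countable_topology}"
  shows integral_lborel_translate: "(LBINT x. f (x + a)) = (LBINT x. f x)"
    and integral_lborel_reflect: "(LBINT x. f (a - x)) = (LBINT x. f x)"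
    and integrable_lborel_translate: "integrable lborel (\<lambda>x. f (x + a)) \<longleftrightarrow> integrable lborel f"
    and integrable_lborel_reflect: "integrable lborel (\<lambda>x. f (a - x)) \<longleftrightarrow> integrable lborel f"
  using integral_lborel_affine[of 1 f a] integral_lborel_affine[of "-1" f a]
    integrable_lborel_affine_iff[of 1 f a] integrable_lborel_affine_iff[of "-1" f a]
  by (simp_all add: add.commute)

lemma
  fixes a :: "'a::euclidean_space" and f :: "'a \<Rightarrow> 'b::{banach, second_countable_topology}"
  shows integral_lborel_shift: "(LBINT x. f (x - a)) = (LBINT x. f x)"
    and integrable_lborel_shift: "integrable lborel (\<lambda>x. f (x - a)) \<longleftrightarrow> integrable lborel f"
  using integral_lborel_translate[of f "-a"] integrable_lborel_translate[of f "-a"] by simp_all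

lemma
  fixes a :: "'a::euclidean_space" and f :: "'a \<Rightarrow> ennreal"
  assumes [measurable]: "f \<in> borel_measurable borel"
  shows nn_integral_lborel_translate: "(\<integral>\<^sup>+x. f (x + a) \<partial>lborel) = (\<integral>\<^sup>+x. f x \<partial>lborel)"
  using nn_integral_lborel_affine[OF assms, of 1 a] by (simp add: add.commute)

text \<open>The library's linear change of variables needs a well-ordered index type; the following
  argument shows instead, by Fubini, that a translation invariant measure is a multiple of
  Lebesgue measure. The value of the multiple is never used.\<close>

lemma translation_invariant_measure:
  fixes M :: "'a::euclidean_space measure"
  assumes [measurable_cong]: "sets M = sets borel" and sf: "sigma_finite_measure M"
    and inv: "\<And>a. distr M borel (\<lambda>x. a + x) = M"
    and [measurable]: "g \<in> borel_measurable borel"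
  shows "(\<integral>\<^sup>+x. g x \<partial>M) = emeasure M (cbox (- One) 0) * (\<integral>\<^sup>+x. g x \<partial>lborel)"
proof -
  interpret M: sigma_finite_measure M by fact
  interpret P: pair_sigma_finite M "lborel :: 'a measure" ..
  \<comment> \<open>The unit cube has Lebesgue measure 1, so multiplying by the integral of this
    indicator changes nothing; Fubini then moves the translation from one measure to the
    other.\<close>
  let ?f = "indicator (cbox 0 One) :: 'a \<Rightarrow> ennreal"
  have "(\<integral>\<^sup>+x. ?f x \<partial>lborel) * (\<integral>\<^sup>+y. g y \<partial>M) = (\<integral>\<^sup>+x. ?f x * (\<integral>\<^sup>+y. g y \<partial>M) \<partial>lborel)"
    by (subst nn_integral_multc) auto
  also have "... = (\<integral>\<^sup>+x. ?f x * (\<integral>\<^sup>+y. g (x + y) \<partial>M) \<partial>lborel)"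
  proof (rule nn_integral_cong)
    fix x
    have "(\<integral>\<^sup>+y. g y \<partial>M) = (\<integral>\<^sup>+y. g y \<partial>distr M borel (\<lambda>y. x + y))" by (simp add: inv)
    then show "?f x * (\<integral>\<^sup>+y. g y \<partial>M) = ?f x * (\<integral>\<^sup>+y. g (x + y) \<partial>M)" by (simp add: nn_integral_distr)
  qed
  also have "... = (\<integral>\<^sup>+x. (\<integral>\<^sup>+y. ?f x * g (x + y) \<partial>M) \<partial>lborel)"
    by (intro nn_integral_cong nn_integral_cmult[symmetric]) measurable
  also have "... = (\<integral>\<^sup>+y. (\<integral>\<^sup>+x. ?f x * g (x + y) \<partial>lborel) \<partial>M)"
    by (intro P.Fubini') measurable
  also have "... = (\<integral>\<^sup>+y. (\<integral>\<^sup>+x. ?f (x - y) * g x \<partial>lborel) \<partial>M)"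
  proof (rule nn_integral_cong)
    fix y :: 'a
    show "(\<integral>\<^sup>+x. ?f x * g (x + y) \<partial>lborel) = (\<integral>\<^sup>+x. ?f (x - y) * g x \<partial>lborel)"
      using nn_integral_lborel_translate[of "\<lambda>x. ?f (x - y) * g x" y] by simp
  qed
  also have "... = (\<integral>\<^sup>+x. (\<integral>\<^sup>+y. ?f (x - y) * g x \<partial>M) \<partial>lborel)"
    by (intro P.Fubini'[symmetric]) measurable
  also have "... = (\<integral>\<^sup>+x. emeasure M (cbox (- One) 0) * g x \<partial>lborel)"
  proof (rule nn_integral_cong)
    fix x :: 'a
    have "(\<integral>\<^sup>+y. ?f (x - y) * g x \<partial>M) = (\<integral>\<^sup>+y. ?f (x - y) \<partial>M) * g x"
      by (rule nn_integral_multc) measurable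
    also have "(\<integral>\<^sup>+y. ?f (x - y) \<partial>M) = (\<integral>\<^sup>+y. ?f (x - y) \<partial>distr M borel (\<lambda>y. x + y))" by (simp add: inv)
    \<comment> \<open>Invariance has removed \<open>x\<close>; reflecting the unit cube produces the
      cube \<open>cbox (- One) 0\<close> of the statement.\<close>
    also have "... = (\<integral>\<^sup>+y. ?f (- y) \<partial>M)" by (subst nn_integral_distr) auto
    also have "... = (\<integral>\<^sup>+y. indicator (cbox (- One) 0) y \<partial>M)"
      by (intro nn_integral_cong) (auto simp: indicator_def mem_box)
    also have "... = emeasure M (cbox (- One) 0)" by simp
    finally show "(\<integral>\<^sup>+y. ?f (x - y) * g x \<partial>M) = emeasure M (cbox (- One) 0) * g x" .
  qed
  also have "... = emeasure M (cbox (- One) 0) * (\<integral>\<^sup>+x. g x \<partial>lborel)"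
    by (rule nn_integral_cmult) measurable
  finally show ?thesis by simp
qed

text \<open>The image measure is translation invariant because
  \<open>a + h x = h (h' a + x)\<close>, and finite on boxes because \<open>h'\<close> maps boxes to
  bounded sets, so it is a multiple of Lebesgue measure. The inverse is given as a map
  \<open>h'\<close>, which avoids determinants.\<close>

lemma lborel_linear_image:
  fixes h h' :: "'a::euclidean_space \<Rightarrow> 'a"
  assumes "linear h" "linear h'" and hh: "\<And>x. h (h' x) = x" "\<And>x. h' (h x) = x"
  obtains c where "c > 0" "distr lborel borel h = density lborel (\<lambda>_. ennreal c)"
proof -
  have [measurable]: "h \<in> borel_measurable borel" "h' \<in> borel_measurable borel"
    using assms by (auto intro!: borel_measurable_continuous_onI linear_continuous_on simp: linear_conv_bounded_linear)
  define M where "M = distr lborel borel h"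
  have sM: "sets M = sets borel" "space M = UNIV" by (auto simp: M_def)
  have fin: "emeasure M (cbox a b) < \<infinity>" for a b
  proof -
    have "h -` cbox a b = h' ` cbox a b" using hh by (auto simp: image_iff) metis
    moreover have "bounded (h' ` cbox a b)" "compact (h' ` cbox a b)"
      using assms by (auto intro!: bounded_linear_image compact_continuous_image linear_continuous_on simp: linear_conv_bounded_linear)
    ultimately show ?thesis
      using emeasure_bounded_finite[of "h' ` cbox a b"] by (auto simp: M_def emeasure_distr)
  qed
  have sf: "sigma_finite_measure M"
  proof
    have "(\<Union>n::nat. cbox (- (real n *\<^sub>R One)) (real n *\<^sub>R One)) = (UNIV :: 'a set)"
    proof -
      have "(\<Union>n::nat. box (- (real n *\<^sub>R One)) (real n *\<^sub>R One)) \<subseteq> (\<Union>n::nat. cbox (- (real n *\<^sub>R One)) (real n *\<^sub>R One :: 'a))"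
        by (intro UN_mono box_subset_cbox) simp
      then show ?thesis unfolding UN_box_eq_UNIV by auto
    qed
    then show "\<exists>A. countable A \<and> A \<subseteq> sets M \<and> \<Union> A = space M \<and> (\<forall>a\<in>A. emeasure M a \<noteq> \<infinity>)"
      using fin by (intro exI[of _ "range (\<lambda>n::nat. cbox (- (real n *\<^sub>R One)) (real n *\<^sub>R One))"])
        (auto simp: sM less_top[symmetric])
  qed
  have inv: "distr M borel (\<lambda>x. a + x) = M" for a
  proof -
    have "distr M borel (\<lambda>x. a + x) = distr lborel borel (\<lambda>x. a + h x)"
      unfolding M_def by (subst distr_distr) (auto simp: o_def)
    also have "(\<lambda>x. a + h x) = h \<circ> (\<lambda>x. h' a + x)"
      using assms by (auto simp: linear_add)
    also have "distr lborel borel (h \<circ> (\<lambda>x. h' a + x)) = distr (distr lborel borel (\<lambda>x. h' a + x)) borel h"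
      by (subst distr_distr) auto
    also have "... = M" using lborel_distr_plus[of "h' a"] by (simp add: M_def)
    finally show ?thesis .
  qed
  let ?c = "emeasure M (cbox (- One) 0)"
  have eq: "emeasure M A = ?c * emeasure lborel A" if "A \<in> sets borel" for A
    using translation_invariant_measure[OF sM(1) sf inv, of "indicator A"] that by (simp add: sM)
  have M: "M = density lborel (\<lambda>_. ?c)"
  proof (rule measure_eqI)
    fix A assume "A \<in> sets M"
    then have A: "A \<in> sets borel" by (simp add: sM)
    then have "emeasure (density lborel (\<lambda>_. ?c)) A = ?c * emeasure lborel A"
      by (simp add: emeasure_density nn_integral_cmult)
    then show "emeasure M A = emeasure (density lborel (\<lambda>_. ?c)) A"
      by (subst eq[OF A]) (rule sym)
  qed (simp add: sM)
  have "?c \<noteq> 0"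
  proof
    assume "?c = 0"
    then have "emeasure M UNIV = 0" by (subst eq) simp_all
    then show False by (simp add: M_def emeasure_distr)
  qed
  moreover have "?c < \<infinity>" by (rule fin)
  ultimately have c: "enn2real ?c > 0" "ennreal (enn2real ?c) = ?c"
    by (simp_all add: enn2real_positive_iff zero_less_iff_neq_zero)
  show thesis
    by (rule that[OF c(1)]) (unfold c(2) M_def[symmetric], rule M)
qed

lemma linear_change_of_variables:
  fixes h h' :: "'a::euclidean_space \<Rightarrow> 'a"
  assumes "linear h" "linear h'" and hh: "\<And>x. h (h' x) = x" "\<And>x. h' (h x) = x"
  obtains c where "c > 0"
    "\<And>f::'a \<Rightarrow> complex. integrable lborel f \<Longrightarrow> integrable lborel (\<lambda>x. f (h x))"
    "\<And>f::'a \<Rightarrow> complex. integrable lborel f \<Longrightarrow> (LBINT x. f (h x)) = of_real c * (LBINT x. f x)"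
proof -
  have [measurable]: "h \<in> borel_measurable borel"
    using assms by (auto intro!: borel_measurable_continuous_onI linear_continuous_on simp: linear_conv_bounded_linear)
  obtain c where c: "c > 0" "distr lborel borel h = density lborel (\<lambda>_. ennreal c)"
    by (rule lborel_linear_image[OF assms])
  show thesis
  proof (rule that[OF c(1)])
    fix f :: "'a \<Rightarrow> complex" assume f: "integrable lborel f"
    then have [measurable]: "f \<in> borel_measurable borel" by auto
    have "integrable (distr lborel borel h) f"
      using f c by (simp add: integrable_density)
    then show "integrable lborel (\<lambda>x. f (h x))"
      by (subst (asm) integrable_distr_eq) auto
    have "(LBINT x. f (h x)) = (LINT x|distr lborel borel h. f x)"
      by (subst integral_distr) auto
    then show "(LBINT x. f (h x)) = of_real c * (LBINT x. f x)" using c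
      using f by (subst (asm) c(2), subst (asm) integral_density) (auto simp: scaleR_conv_of_real)
  qed
qed

section \<open>Approximation and convolution of integrable functions\<close>

text \<open>Continuity at a point of a metric space can be tested on sequences, where dominated
  convergence applies. The measure is arbitrary so that the same lemma serves Fourier integrals and,
  with \<open>count_space\<close>, lattice series.\<close>

lemma isCont_lebesgue_integral:
  fixes F :: "'b::metric_space \<Rightarrow> 'a \<Rightarrow> 'c::{banach, second_countable_topology}"
  assumes meas: "\<And>h. F h \<in> borel_measurable M"
    and cont: "\<And>x. x \<in> space M \<Longrightarrow> isCont (\<lambda>h. F h x) h0"
    and bound: "\<forall>\<^sub>F h in nhds h0. \<forall>x\<in>space M. norm (F h x) \<le> w x" and w: "integrable M w"
  shows "isCont (\<lambda>h. LINT x|M. F h x) h0"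
  unfolding continuous_at_sequentially
proof (intro allI impI)
  fix X :: "nat \<Rightarrow> 'b" assume X: "X \<longlonglongrightarrow> h0"
  then have "\<forall>\<^sub>F n in sequentially. \<forall>x\<in>space M. norm (F (X n) x) \<le> w x"
    using bound by (rule eventually_compose_filterlim[rotated])
  \<comment> \<open>Domination is assumed only near \<open>h0\<close>, so the first \<open>N\<close>
    terms of the sequence are dropped.\<close>
  then obtain N where N: "\<And>n x. n \<ge> N \<Longrightarrow> x \<in> space M \<Longrightarrow> norm (F (X n) x) \<le> w x"
    unfolding eventually_sequentially by blast
  have "(\<lambda>n. LINT x|M. F (X (n + N)) x) \<longlonglongrightarrow> (LINT x|M. F h0 x)"
  proof (rule integral_dominated_convergence[OF meas meas w])
    show "AE x in M. (\<lambda>n. F (X (n + N)) x) \<longlonglongrightarrow> F h0 x"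
    proof (rule AE_I2)
      fix x assume "x \<in> space M"
      then have "(\<lambda>n. F (X n) x) \<longlonglongrightarrow> F h0 x"
        using cont X unfolding continuous_at_sequentially by (auto simp: o_def)
      then show "(\<lambda>n. F (X (n + N)) x) \<longlonglongrightarrow> F h0 x" by (rule LIMSEQ_ignore_initial_segment)
    qed
    show "AE x in M. norm (F (X (n + N)) x) \<le> w x" for n
      using N by (intro AE_I2) auto
  qed
  then show "((\<lambda>h. LINT x|M. F h x) \<circ> X) \<longlonglongrightarrow> (LINT x|M. F h0 x)"
    unfolding o_def by (rule LIMSEQ_offset)
qed

lemma norm_triangle_diff:
  fixes a b c d :: "'a::real_normed_vector"
  shows "norm (a - c) \<le> norm (a - b) + norm (b - c)"
    and "norm (a - d) \<le> norm (a - b) + norm (b - c) + norm (d - c)"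
  using dist_triangle[of a c b] dist_triangle[of a d b] dist_triangle[of b d c]
  by (simp_all add: dist_norm norm_minus_commute[of c d])

text \<open>Induction over integrable functions leaves only indicators to treat: regularity puts
  \<open>A\<close> between a closed \<open>T\<close> and an open \<open>U\<close> of nearly the same
  measure, and a Urysohn function for this pair differs from the indicator only on
  \<open>U - T\<close>.\<close>

lemma L1_approx_continuous:
  fixes f :: "'a::euclidean_space \<Rightarrow> complex"
  assumes "integrable lborel f" "e > 0"
  shows "\<exists>g. continuous_on UNIV g \<and> integrable lborel g \<and> (LBINT x. norm (f x - g x)) < e"
  using assms
proof (induction f arbitrary: e rule: integrable_induct)
  case (base A c)
  show ?case
  proof (cases "c = 0")
    case True then show ?thesis using base by (intro exI[of _ "\<lambda>_. 0"]) auto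
  next
    case c: False
    \<comment> \<open>The values differ by at most \<open>norm c\<close> on a set of measure at most
      \<open>d\<close>, so this choice makes the error at most \<open>e / 2\<close>.\<close>
    define d where "d = e / (2 * norm c)"
    have d: "d > 0" using c base by (simp add: d_def)
    have A: "A \<in> sets lebesgue" "A \<in> sets borel" using base by auto
    obtain U where U: "open U" "A \<subseteq> U" "emeasure lebesgue (U - A) < ennreal (d/2)"
      by (rule sets_lebesgue_outer_open[OF A(1), of "d/2"]) (use d in simp_all)
    obtain T where T: "closed T" "T \<subseteq> A" "emeasure lebesgue (A - T) < ennreal (d/2)"
      by (rule sets_lebesgue_inner_closed[OF A(1), of "d/2"]) (use d in simp_all)
    have [measurable]: "U \<in> sets borel" "T \<in> sets borel" "A \<in> sets borel" using U T A by auto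
    have m1: "emeasure lborel (U - A) < ennreal (d/2)" "emeasure lborel (A - T) < ennreal (d/2)"
      using U T by simp_all
    have "emeasure lborel (U - T) \<le> emeasure lborel ((U - A) \<union> (A - T))"
      by (intro emeasure_mono) auto
    also have "... \<le> emeasure lborel (U - A) + emeasure lborel (A - T)"
      by (intro emeasure_subadditive) auto
    also have "... \<le> ennreal (d/2) + ennreal (d/2)" using m1 by (intro add_mono) auto
    also have "... = ennreal d" using d by (simp flip: ennreal_plus)
    finally have m2: "emeasure lborel (U - T) \<le> ennreal d" .
    have "emeasure lborel U \<le> emeasure lborel ((U - A) \<union> A)" by (intro emeasure_mono) auto
    also have "... \<le> emeasure lborel (U - A) + emeasure lborel A"
      by (intro emeasure_subadditive) auto
    also have "... < \<infinity>" using m1 base by (auto simp: less_top[symmetric] top_unique)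
    finally have Ufin: "emeasure lborel U < \<infinity>" .
    obtain g :: "'a \<Rightarrow> real" where g: "continuous_on UNIV g" "\<And>x. g x \<in> closed_segment 0 1"
      "\<And>x. x \<in> - U \<Longrightarrow> g x = 0" "\<And>x. x \<in> T \<Longrightarrow> g x = 1"
      by (rule Urysohn[of "- U" T "0::real" 1]) (use U T in \<open>auto simp: closed_def\<close>)
    have g01: "0 \<le> g x" "g x \<le> 1" for x using g(2)[of x] by (auto simp: closed_segment_eq_real_ivl)
    have [measurable]: "g \<in> borel_measurable borel" using g by (auto intro: borel_measurable_continuous_onI)
    have iU: "integrable lborel (\<lambda>x. indicator U x :: real)" "integrable lborel (\<lambda>x. indicator (U - T) x :: real)"
      using Ufin m2 by (auto simp: less_top[symmetric] top_unique intro!: integrable_real_indicator)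
    have ig: "integrable lborel g"
      by (rule Bochner_Integration.integrable_bound[OF iU(1)]) (use g01 g in \<open>auto simp: indicator_def split: if_splits\<close>)
    have bd: "norm (indicator A x *\<^sub>R c - g x *\<^sub>R c) \<le> norm c * indicator (U - T) x" for x
    proof -
      have "norm (indicator A x *\<^sub>R c - g x *\<^sub>R c) = \<bar>indicator A x - g x\<bar> * norm c"
        by (simp flip: scaleR_left_diff_distrib)
      also have "... \<le> indicator (U - T) x * norm c"
        using g01[of x] g(3,4)[of x] U(2) T(2) by (intro mult_right_mono) (auto simp: indicator_def)
      finally show ?thesis by (simp add: mult.commute)
    qed
    have "(LBINT x. norm (indicator A x *\<^sub>R c - g x *\<^sub>R c)) \<le> (LBINT x. norm c * indicator (U - T) x)"
      using iU ig base bd by (intro integral_mono) auto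
    also have "... = norm c * measure lborel (U - T)" by simp
    also have "... \<le> norm c * d"
      using m2 d by (intro mult_left_mono) (auto simp: measure_def enn2real_leI)
    also have "... < e" using c base by (simp add: d_def)
    finally show ?thesis using ig g(1)
      by (intro exI[of _ "\<lambda>x. g x *\<^sub>R c"]) (auto intro!: continuous_intros)
  qed
next
  case (add f1 f2)
  obtain g1 g2 where g: "continuous_on UNIV g1" "integrable lborel g1" "(LBINT x. norm (f1 x - g1 x)) < e/2"
    "continuous_on UNIV g2" "integrable lborel g2" "(LBINT x. norm (f2 x - g2 x)) < e/2"
    using add(3)[of "e/2"] add(4)[of "e/2"] add(5) by auto
  have "(LBINT x. norm (f1 x + f2 x - (g1 x + g2 x))) \<le> (LBINT x. norm (f1 x - g1 x) + norm (f2 x - g2 x))"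
    using add g by (intro integral_mono) (auto simp: norm_triangle_ineq add_diff_add)
  also have "... < e" using add g by simp
  finally show ?case using g by (intro exI[of _ "\<lambda>x. g1 x + g2 x"]) (auto intro!: continuous_intros)
next
  case (lim f s)
  have "(\<lambda>i. LINT x|lborel. norm (f x - s i x)) \<longlonglongrightarrow> (LBINT x. 0 * norm (f x))"
  proof (rule integral_dominated_convergence[where w="\<lambda>x. 3 * norm (f x)"])
    show "AE x in lborel. (\<lambda>i. norm (f x - s i x)) \<longlonglongrightarrow> 0 * norm (f x)"
    proof (rule AE_I2)
      fix x :: 'a assume "x \<in> space lborel"
      then have "(\<lambda>i. norm (f x - s i x)) \<longlonglongrightarrow> norm (f x - f x)"
        using lim by (intro tendsto_intros) auto
      then show "(\<lambda>i. norm (f x - s i x)) \<longlonglongrightarrow> 0 * norm (f x)" by simp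
    qed
    show "AE x in lborel. norm (norm (f x - s i x)) \<le> 3 * norm (f x)" for i
    proof (rule AE_I2)
      fix x :: 'a
      have "norm (s i x) \<le> 2 * norm (f x)" using lim by simp
      then show "norm (norm (f x - s i x)) \<le> 3 * norm (f x)"
        using norm_triangle_ineq4[of "f x" "s i x"] by simp
    qed
  qed (use lim in auto)
  then have "\<forall>\<^sub>F i in sequentially. (LBINT x. norm (f x - s i x)) < e/2"
    by (rule order_tendstoD) (use lim in auto)
  then obtain i where i: "(LBINT x. norm (f x - s i x)) < e/2"
    by (auto simp: eventually_sequentially)
  obtain g where g: "continuous_on UNIV g" "integrable lborel g" "(LBINT x. norm (s i x - g x)) < e/2"
    using lim.IH[of "e/2" i] lim.prems by auto
  have "(LBINT x. norm (f x - g x)) \<le> (LBINT x. norm (f x - s i x) + norm (s i x - g x))"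
    using lim g by (intro integral_mono) (auto simp: norm_triangle_diff)
  also have "... < e" using lim g i by simp
  finally show ?case using g by blast
qed

lemma L1_approx_compact_support:
  fixes f :: "'a::euclidean_space \<Rightarrow> complex"
  assumes f: "integrable lborel f" and e: "e > 0"
  shows "\<exists>g R. continuous_on UNIV g \<and> (\<forall>x. norm x > R \<longrightarrow> g x = 0) \<and> integrable lborel g \<and>
    (LBINT x. norm (f x - g x)) < e"
proof -
  obtain g where g: "continuous_on UNIV g" "integrable lborel g" "(LBINT x. norm (f x - g x)) < e/2"
    using L1_approx_continuous[OF f, of "e/2"] e by auto
  \<comment> \<open>A continuous ramp equal to 1 on the ball of radius \<open>n - 1\<close> and to 0
    outside the ball of radius \<open>n\<close>.\<close>
  define s where "s n x = max 0 (min 1 (real n - norm x))" for n :: nat and x :: 'a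
  have s: "0 \<le> s n x" "s n x \<le> 1" for n x by (auto simp: s_def)
  have sc: "continuous_on UNIV (s n)" for n unfolding s_def by (intro continuous_intros)
  have [measurable]: "g \<in> borel_measurable borel" "s n \<in> borel_measurable borel" for n
    using g sc by (auto intro: borel_measurable_continuous_onI)
  have "(\<lambda>n. LINT x|lborel. norm (g x - s n x *\<^sub>R g x)) \<longlonglongrightarrow> (LINT x|(lborel::'a measure). 0)"
  proof (rule integral_dominated_convergence[where w="\<lambda>x. norm (g x)"])
    show "AE x in lborel. (\<lambda>n. norm (g x - s n x *\<^sub>R g x)) \<longlonglongrightarrow> 0"
    proof (rule AE_I2)
      fix x :: 'a
      obtain N :: nat where "norm x + 1 \<le> real N" using real_arch_simple by blast
      then have "s n x = 1" if "n \<ge> N" for n using that by (auto simp: s_def)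
      then have "\<forall>\<^sub>F n in sequentially. norm (g x - s n x *\<^sub>R g x) = 0"
        unfolding eventually_sequentially by (intro exI[of _ N]) auto
      then show "(\<lambda>n. norm (g x - s n x *\<^sub>R g x)) \<longlonglongrightarrow> 0" by (rule tendsto_eventually)
    qed
    show "AE x in lborel. norm (norm (g x - s n x *\<^sub>R g x)) \<le> norm (g x)" for n
    proof (rule AE_I2)
      fix x
      have "g x - s n x *\<^sub>R g x = (1 - s n x) *\<^sub>R g x" by (simp add: scaleR_left_diff_distrib)
      then show "norm (norm (g x - s n x *\<^sub>R g x)) \<le> norm (g x)"
        using s[of n x] by (simp add: mult_left_le_one_le)
    qed
  qed (use g in auto)
  then have "\<forall>\<^sub>F n in sequentially. (LBINT x. norm (g x - s n x *\<^sub>R g x)) < e/2"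
    by (rule order_tendstoD) (use e in auto)
  then obtain n where n: "(LBINT x. norm (g x - s n x *\<^sub>R g x)) < e/2"
    by (auto simp: eventually_sequentially)
  have ig: "integrable lborel (\<lambda>x. s n x *\<^sub>R g x)"
    by (rule Bochner_Integration.integrable_bound[OF g(2)]) (use s[of n] in \<open>auto simp: mult_left_le_one_le\<close>)
  have "(LBINT x. norm (f x - s n x *\<^sub>R g x)) \<le> (LBINT x. norm (f x - g x) + norm (g x - s n x *\<^sub>R g x))"
    using f g ig by (intro integral_mono) (auto simp: norm_triangle_diff)
  also have "... < e" using f g ig n by simp
  finally show ?thesis
    using ig g sc by (intro exI[of _ "\<lambda>x. s n x *\<^sub>R g x"] exI[of _ "real n"]) (auto intro!: continuous_intros simp: s_def)
qed

text \<open>For a continuous \<open>g\<close> of compact support the differences with |h| < 1 live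
  on one fixed ball and are uniformly bounded, so dominated convergence applies. Passing from
  \<open>f\<close> to \<open>g\<close> costs the same L^1 distance before and after the
  translation.\<close>

lemma L1_translation_continuous:
  fixes f :: "'a::euclidean_space \<Rightarrow> complex"
  assumes f: "integrable lborel f"
  shows "((\<lambda>h. LINT x|lborel. norm (f (x - h) - f x)) \<longlongrightarrow> 0) (at 0)"
proof (rule tendstoI)
  fix e :: real assume e: "e > 0"
  then have e3: "e / 3 > 0" by simp
  obtain g R where g: "continuous_on UNIV g" "\<And>x. norm x > R \<Longrightarrow> g x = 0" "integrable lborel g"
    "(LBINT x. norm (f x - g x)) < e/3"
    using L1_approx_compact_support[OF f e3] by blast
  have [measurable]: "g \<in> borel_measurable borel" using g by auto
  obtain B where B: "\<And>x. norm (g x) \<le> B"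
  proof -
    have "compact (g ` cball 0 R)"
      using g by (intro compact_continuous_image) (auto intro: continuous_on_subset)
    then obtain B where "\<And>x. x \<in> cball 0 R \<Longrightarrow> norm (g x) \<le> B"
      using compact_imp_bounded bounded_iff by (metis imageI)
    then have B: "\<And>x. norm x \<le> R \<Longrightarrow> norm (g x) \<le> B" by simp
    have "norm (g x) \<le> max B 0" for x using g(2) B[of x] by (cases "norm x > R") (auto simp: le_max_iff_disj)
    then show thesis by (rule that)
  qed
  have isCont: "isCont (\<lambda>h. LINT x|lborel. norm (g (x - h) - g x)) 0"
  proof (rule isCont_lebesgue_integral[where w="\<lambda>x. 2 * B * indicator (cball 0 (R + 1)) x"])
    show "\<forall>\<^sub>F h in nhds 0. \<forall>x\<in>space lborel. norm (norm (g (x - h) - g x)) \<le> 2 * B * indicator (cball 0 (R + 1)) x"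
    proof -
      have "norm (norm (g (x - h) - g x)) \<le> 2 * B * indicator (cball 0 (R + 1)) x" if "norm h < 1" for x h :: 'a
      proof (cases "norm x \<le> R + 1")
        case True
        then show ?thesis using norm_triangle_ineq4[of "g (x - h)" "g x"] B[of x] B[of "x-h"] by auto
      next
        case False
        then have "norm x > R" "norm (x - h) > R" using that norm_triangle_ineq2[of x h] by auto
        then show ?thesis using g(2) False by simp
      qed
      moreover have "\<forall>\<^sub>F h in nhds (0::'a). norm h < 1"
        unfolding eventually_nhds_metric by (intro exI[of _ 1]) auto
      ultimately show ?thesis by (auto elim: eventually_mono)
    qed
    show "integrable lborel (\<lambda>x::'a. 2 * B * indicator (cball 0 (R + 1)) x)"
      using emeasure_bounded_finite[OF bounded_cball, of "0::'a" "R+1"]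
      by (intro integrable_mult_right integrable_real_indicator) auto
    show "isCont (\<lambda>h. norm (g (x - h) - g x)) 0" for x
    proof -
      have "continuous_on UNIV (\<lambda>h. g (x - h))"
        using g(1) by (intro continuous_on_compose2[OF g(1)]) (auto intro!: continuous_intros)
      then have "isCont (\<lambda>h. g (x - h)) 0" by (simp add: continuous_on_eq_continuous_at)
      then show ?thesis by (intro continuous_intros)
    qed
  qed auto
  have "\<forall>\<^sub>F h in at 0. (LBINT x. norm (g (x - h) - g x)) < e/3"
  proof (rule order_tendstoD(2))
    show "((\<lambda>h. LINT x|lborel. norm (g (x - h) - g x)) \<longlongrightarrow> 0) (at 0)"
      using isCont unfolding isCont_def by simp
  qed (use e in simp)
  then show "\<forall>\<^sub>F h in at 0. dist (LBINT x. norm (f (x - h) - f x)) 0 < e"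
  proof eventually_elim
    fix h assume h: "(LBINT x. norm (g (x - h) - g x)) < e/3"
    have i: "integrable lborel (\<lambda>x. g (x - h))" "integrable lborel (\<lambda>x. f (x - h))"
      using f g by (auto simp: integrable_lborel_shift)
    have "(LBINT x. norm (f (x - h) - f x)) \<le>
      (LBINT x. norm (f (x - h) - g (x - h)) + norm (g (x - h) - g x) + norm (f x - g x))"
      using f g i by (intro integral_mono) (auto simp: norm_triangle_diff)
    also have "... = (LBINT x. norm (f (x - h) - g (x - h))) + (LBINT x. norm (g (x - h) - g x)) + (LBINT x. norm (f x - g x))"
      using f g i by simp
    also have "(LBINT x. norm (f (x - h) - g (x - h))) = (LBINT x. norm (f x - g x))"
      using integral_lborel_shift[of "\<lambda>x. norm (f x - g x)" h] by simp
    finally have "(LBINT x. norm (f (x - h) - f x)) < e" using h g by simp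
    then show "dist (LBINT x. norm (f (x - h) - f x)) 0 < e" by simp
  qed
qed

section \<open>Convolutions and integrability on products\<close>

lemma integrable_convolution:
  fixes f g :: "'a::euclidean_space \<Rightarrow> 'b::{real_normed_field, banach, second_countable_topology}"
  assumes f: "integrable lborel f" and g: "integrable lborel g"
  shows "integrable (lborel \<Otimes>\<^sub>M lborel) (\<lambda>(x, y). f y * g (x - y))"
proof -
  have [measurable]: "f \<in> borel_measurable borel" "g \<in> borel_measurable borel" using f g by auto
  have "integrable (lborel \<Otimes>\<^sub>M lborel) (\<lambda>(y, x). f y * g (x - y))"
  proof (rule lborel_pair.Fubini_integrable)
    have "(LBINT x. norm (f y * g (x - y))) = norm (f y) * (LBINT x. norm (g x))" for y
      using integral_lborel_shift[of "\<lambda>x. norm (g x)" y] by (simp add: norm_mult)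
    then show "integrable lborel (\<lambda>x. LINT y|lborel. norm (case (x, y) of (y, x) \<Rightarrow> f y * g (x - y)))"
      using f by simp
    show "AE x in lborel. integrable lborel (\<lambda>y. case (x, y) of (y, x) \<Rightarrow> f y * g (x - y))"
      using g by (intro AE_I2) (simp add: integrable_lborel_shift)
  qed measurable
  from lborel_pair.integrable_product_swap[OF this] show ?thesis by (simp add: case_prod_unfold)
qed

lemma integrable_convolution_fst:
  fixes f g :: "'a::euclidean_space \<Rightarrow> 'b::{real_normed_field, banach, second_countable_topology}"
  assumes f: "integrable lborel f" and g: "integrable lborel g"
  shows "integrable lborel (\<lambda>x. LINT y|lborel. f y * g (x - y))"
  using lborel_pair.integrable_fst[OF integrable_convolution[OF assms]] .

lemma integrable_mult_bounded:
  fixes f g :: "'a::euclidean_space \<Rightarrow> complex"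
  assumes f: "integrable lborel f" and [measurable]: "g \<in> borel_measurable borel" and B: "\<And>x. norm (g x) \<le> B"
  shows "integrable lborel (\<lambda>x. f x * g x)" "integrable lborel (\<lambda>x. g x * f x)"
proof -
  have [measurable]: "f \<in> borel_measurable borel" using f by auto
  have "norm (f x * g x) \<le> norm (B * norm (f x))" for x
    using mult_right_mono[OF B[of x], of "norm (f x)"] by (simp add: norm_mult mult.commute)
  then show *: "integrable lborel (\<lambda>x. f x * g x)"
    by (intro Bochner_Integration.integrable_bound[OF integrable_mult_right[OF integrable_norm[OF f], where c=B]] AE_I2)
      auto
  then show "integrable lborel (\<lambda>x. g x * f x)" by (simp add: mult.commute)
qed

lemma integrable_prod_bounded:
  fixes f :: "'a::euclidean_space \<Rightarrow> complex" and g :: "'b::euclidean_space \<Rightarrow> complex"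
  assumes f: "integrable lborel f" and g: "integrable lborel g"
    and [measurable]: "(\<lambda>(x, y). K x y) \<in> borel_measurable (borel \<Otimes>\<^sub>M borel)"
    and B: "\<And>x y. norm (K x y) \<le> B"
  shows "integrable (lborel \<Otimes>\<^sub>M lborel) (\<lambda>(x, y). f x * g y * K x y)"
proof -
  have [measurable]: "f \<in> borel_measurable borel" "g \<in> borel_measurable borel" using f g by auto
  have "integrable (lborel \<Otimes>\<^sub>M lborel) (\<lambda>(x, y). f x * g y)"
  proof (rule lborel_pair.Fubini_integrable)
    show "integrable lborel (\<lambda>x. LINT y|lborel. norm (case (x, y) of (x, y) \<Rightarrow> f x * g y))"
      using f g by (simp add: norm_mult)
    show "AE x in lborel. integrable lborel (\<lambda>y. case (x, y) of (x, y) \<Rightarrow> f x * g y)"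
      using g by (intro AE_I2) simp
  qed measurable
  then have "integrable (lborel \<Otimes>\<^sub>M lborel) (\<lambda>z. B * norm (case z of (x, y) \<Rightarrow> f x * g y))"
    by (intro integrable_mult_right integrable_norm)
  then show ?thesis
  proof (rule Bochner_Integration.integrable_bound)
    show "AE z in lborel \<Otimes>\<^sub>M lborel. norm (case z of (x, y) \<Rightarrow> f x * g y * K x y) \<le> norm (B * norm (case z of (x, y) \<Rightarrow> f x * g y))"
    proof (rule AE_I2, clarify)
      fix x y
      have "norm (f x * g y * K x y) = norm (K x y) * norm (f x * g y)" by (simp add: norm_mult)
      also have "... \<le> B * norm (f x * g y)" using B by (intro mult_right_mono) auto
      finally show "norm (f x * g y * K x y) \<le> norm (B * norm (f x * g y))" by simp
    qed
  qed measurable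
qed

section \<open>Discretising a convolution by point masses on a grid\<close>

definition grid_index :: "nat \<Rightarrow> real^'d \<Rightarrow> int^'d" where
  "grid_index N y = (\<chi> j. \<lfloor>real N * y $ j\<rfloor>)"

definition grid_point :: "nat \<Rightarrow> int^'d \<Rightarrow> real^'d" where
  "grid_point N k = (\<chi> j. of_int (k $ j) / real N)"

text \<open>It limits the grid to finitely many cells, while every fixed point lies inside from some
  \<open>N\<close> on.\<close>

definition grid_box :: "nat \<Rightarrow> (real^'d) set" where
  "grid_box N = {y. \<forall>j. - real N \<le> y $ j \<and> y $ j < real N}"

lemma measurable_vec_nth[measurable]: "(\<lambda>x::real^'d. x $ i) \<in> borel_measurable borel"
  by (intro borel_measurable_continuous_onI continuous_intros)

lemma measurable_grid_index[measurable]: "grid_index N \<in> borel \<rightarrow>\<^sub>M count_space (UNIV :: (int^'d) set)"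
proof (rule measurable_count_space_eq2_countable[THEN iffD2], intro conjI ballI)
  fix k :: "int^'d"
  have "grid_index N -` {k} \<inter> space borel = {y\<in>space borel. \<forall>j\<in>UNIV. \<lfloor>real N * y $ j\<rfloor> = k $ j}"
    by (auto simp: grid_index_def vec_eq_iff)
  also have "... \<in> sets borel" by measurable
  finally show "grid_index N -` {k} \<inter> space borel \<in> sets borel" .
qed auto

lemma measurable_grid_point[measurable]: "(\<lambda>y. grid_point N (grid_index N y)) \<in> borel_measurable (borel :: (real^'d) measure)"
  by (rule measurable_compose[OF measurable_grid_index]) simp

lemma sets_grid_box[measurable]: "grid_box N \<in> sets borel"
proof -
  have "(grid_box N :: (real^'d) set) = {y\<in>space borel. \<forall>j\<in>UNIV. - real N \<le> y $ j \<and> y $ j < real N}"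
    by (auto simp: grid_box_def)
  also have "... \<in> sets borel" by measurable
  finally show ?thesis .
qed

lemma finite_vec_bounded: "finite {k :: int^'d. \<forall>j. a \<le> k $ j \<and> k $ j \<le> b}"
proof -
  have "{k :: int^'d. \<forall>j. a \<le> k $ j \<and> k $ j \<le> b} \<subseteq> vec_lambda ` (UNIV \<rightarrow>\<^sub>E {a..b})"
    by (auto simp: image_iff intro!: bexI[of _ "vec_nth _"])
  then show ?thesis by (rule finite_subset) (auto intro!: finite_PiE)
qed

lemma finite_grid: "finite (grid_index N ` grid_box N :: (int^'d) set)"
proof (rule finite_subset)
  show "grid_index N ` grid_box N \<subseteq> {k :: int^'d. \<forall>j. \<lfloor>- (real N * real N)\<rfloor> \<le> k $ j \<and> k $ j \<le> \<lfloor>real N * real N\<rfloor>}"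
  proof (rule image_subsetI, intro CollectI allI)
    fix y :: "real^'d" and j assume y: "y \<in> grid_box N"
    then have "- real N \<le> y $ j" "y $ j \<le> real N" by (auto simp: grid_box_def less_imp_le)
    then have "real N * (- real N) \<le> real N * y $ j" "real N * y $ j \<le> real N * real N"
      by (intro mult_left_mono; simp)+
    then show "\<lfloor>- (real N * real N)\<rfloor> \<le> grid_index N y $ j \<and> grid_index N y $ j \<le> \<lfloor>real N * real N\<rfloor>"
      by (auto simp: grid_index_def intro!: floor_mono)
  qed
qed (rule finite_vec_bounded)

lemma grid_point_close: "N > 0 \<Longrightarrow> norm (y - grid_point N (grid_index N y) :: real^'d) \<le> real CARD('d) / real N"
proof -
  assume N: "N > 0"
  have "norm (y - grid_point N (grid_index N y)) \<le> (\<Sum>j\<in>UNIV. \<bar>(y - grid_point N (grid_index N y)) $ j\<bar>)"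
    by (rule norm_le_l1_cart)
  also have "... \<le> (\<Sum>j\<in>(UNIV::'d set). 1 / real N)"
  proof (rule sum_mono)
    fix j
    have "real N * \<bar>y $ j - of_int \<lfloor>real N * y $ j\<rfloor> / real N\<bar> = \<bar>real N * y $ j - of_int \<lfloor>real N * y $ j\<rfloor>\<bar>"
      using N by (simp add: abs_mult_pos' right_diff_distrib)
    also have "... \<le> 1" by linarith
    finally show "\<bar>(y - grid_point N (grid_index N y)) $ j\<bar> \<le> 1 / real N"
      using N by (simp add: grid_index_def grid_point_def field_simps)
  qed
  finally show ?thesis by simp
qed

lemma eventually_in_grid_box: "\<forall>\<^sub>F N in sequentially. (y :: real^'d) \<in> grid_box N"
proof -
  obtain M :: nat where M: "norm y < real M" using reals_Archimedean2 by blast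
  have "y \<in> grid_box N" if "N \<ge> M" for N
    using M that component_le_norm_cart[of y] by (auto simp: grid_box_def) (smt (verit) of_nat_mono)+
  then show ?thesis unfolding eventually_sequentially by blast
qed

text \<open>The mass that \<open>h\<close> gives to one cell; placing it at
  \<open>grid_point N k\<close> turns \<open>h\<close> into a finite combination of point
  masses.\<close>

definition grid_weight :: "(real^'d \<Rightarrow> complex) \<Rightarrow> nat \<Rightarrow> int^'d \<Rightarrow> complex" where
  "grid_weight h N k = (LBINT y. h y * indicator (grid_box N \<inter> grid_index N -` {k}) y)"

lemma sets_grid_cell[measurable]: "grid_box N \<inter> grid_index N -` {k :: int^'d} \<in> sets borel"
  using measurable_sets[OF measurable_grid_index, of "{k}" N] by auto

lemma grid_sum_eq:
  fixes h :: "real^'d \<Rightarrow> complex"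
  assumes h: "integrable lborel h"
  shows "(LBINT y. h y * indicator (grid_box N) y * G (grid_point N (grid_index N y))) =
    (\<Sum>k\<in>grid_index N ` grid_box N. grid_weight h N k * G (grid_point N k))"
proof -
  let ?I = "grid_index N ` grid_box N :: (int^'d) set"
  let ?c = "\<lambda>k. grid_box N \<inter> grid_index N -` {k}"
  have i: "integrable lborel (\<lambda>y. h y * indicator (?c k) y)" for k :: "int^'d"
    by (rule integrable_mult_bounded[where B=1, OF h]) (auto simp: indicator_def)
  have "h y * indicator (grid_box N) y * G (grid_point N (grid_index N y)) =
    (\<Sum>k\<in>?I. h y * indicator (?c k) y * G (grid_point N k))" for y
  proof (cases "y \<in> grid_box N")
    case True
    have "(\<Sum>k\<in>?I. h y * indicator (?c k) y * G (grid_point N k)) =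
      (\<Sum>k\<in>{grid_index N y}. h y * indicator (?c k) y * G (grid_point N k))"
      by (intro sum.mono_neutral_right finite_grid) (use True in \<open>auto simp: indicator_def\<close>)
    then show ?thesis using True by simp
  qed (auto simp: indicator_def)
  then have "(LBINT y. h y * indicator (grid_box N) y * G (grid_point N (grid_index N y))) =
    (LBINT y. (\<Sum>k\<in>?I. h y * indicator (?c k) y * G (grid_point N k)))" by presburger
  also have "... = (\<Sum>k\<in>?I. grid_weight h N k * G (grid_point N k))"
    using i by (subst Bochner_Integration.integral_sum) (auto simp: grid_weight_def)
  finally show ?thesis .
qed

lemma sum_grid_weight_le:
  fixes h :: "real^'d \<Rightarrow> complex"
  assumes h: "integrable lborel h"
  shows "(\<Sum>k\<in>grid_index N ` grid_box N. norm (grid_weight h N k)) \<le> (LBINT y. norm (h y))"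
proof -
  let ?I = "grid_index N ` grid_box N :: (int^'d) set"
  let ?c = "\<lambda>k. grid_box N \<inter> grid_index N -` {k}"
  have i: "integrable lborel (\<lambda>y. h y * indicator (?c k) y)" for k :: "int^'d"
    by (rule integrable_mult_bounded[where B=1, OF h]) (auto simp: indicator_def)
  have "(\<Sum>k\<in>?I. norm (grid_weight h N k)) \<le> (\<Sum>k\<in>?I. LINT y|lborel. norm (h y * indicator (?c k) y))"
    unfolding grid_weight_def by (intro sum_mono integral_norm_bound)
  also have "... = (LBINT y. (\<Sum>k\<in>?I. norm (h y * indicator (?c k) y)))"
    using i by (intro Bochner_Integration.integral_sum[symmetric]) auto
  also have "... \<le> (LBINT y. norm (h y))"
  proof (intro integral_mono)
    fix y
    have "(\<Sum>k\<in>?I. norm (h y * indicator (?c k) y)) \<le> (\<Sum>k\<in>?I. if k = grid_index N y then norm (h y) else 0)"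
      by (intro sum_mono) (auto simp: indicator_def)
    also have "... \<le> norm (h y)" by (subst sum.delta[OF finite_grid]) auto
    finally show "(\<Sum>k\<in>?I. norm (h y * indicator (?c k) y)) \<le> norm (h y)" .
  qed (use h i in auto)
  finally show ?thesis .
qed

text \<open>The error is \<open>h\<close> integrated against \<open>D N\<close>, in which the
  translation by \<open>y\<close> is compared with the translation by the lower corner of the cell
  of \<open>y\<close>. Its L^1 norm in \<open>x\<close> tends to 0 for each \<open>y\<close> by
  translation continuity and is at most twice the norm of \<open>F\<close>, so dominated convergence
  in \<open>y\<close> finishes the proof.\<close>

lemma grid_convolution_tendsto:
  fixes h F :: "real^'d \<Rightarrow> complex"
  assumes h: "integrable lborel h" and F: "integrable lborel F"
  shows "(\<lambda>N. LINT x|lborel. norm ((LBINT y. h y * F (x - y)) -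
     (\<Sum>k\<in>grid_index N ` grid_box N. grid_weight h N k * F (x - grid_point N k)))) \<longlonglongrightarrow> 0"
proof -
  have [measurable]: "h \<in> borel_measurable borel" "F \<in> borel_measurable borel" using h F by auto
  define p where "p N y = grid_point N (grid_index N y)" for N and y :: "real^'d"
  have [measurable]: "p N \<in> borel_measurable borel" for N unfolding p_def by measurable
  define D where "D N x y = F (x - y) - indicator (grid_box N) y * F (x - p N y)" for N x y
  have [measurable]: "(\<lambda>(x, y). D N x y) \<in> borel_measurable (borel \<Otimes>\<^sub>M borel)" for N
    unfolding D_def by measurable
  have Fs: "integrable lborel (\<lambda>x. F (x - a))" for a using F by (simp add: integrable_lborel_shift)
  have Dx: "integrable lborel (\<lambda>x. D N x y)" for N y
    unfolding D_def using Fs by (intro Bochner_Integration.integrable_diff integrable_mult_right) auto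
  have D0: "(LBINT x. norm (D N x y)) \<le> 2 * (LBINT x. norm (F x))" for N y
  proof -
    have "(LBINT x. norm (D N x y)) \<le> (LBINT x. norm (F (x - y)) + norm (F (x - p N y)))"
      using Dx Fs
      by (intro integral_mono) (auto simp: D_def indicator_def norm_triangle_ineq4)
    also have "... = 2 * (LBINT x. norm (F x))"
      using Fs integral_lborel_shift[of "\<lambda>x. norm (F x)"] by (subst Bochner_Integration.integral_add) auto
    finally show ?thesis .
  qed
  have int: "integrable (lborel \<Otimes>\<^sub>M lborel) (\<lambda>(y, x). h y * D N x y)" for N
  proof (rule lborel_pair.Fubini_integrable)
    show "integrable lborel (\<lambda>y. LINT x|lborel. norm (case (y, x) of (y, x) \<Rightarrow> h y * D N x y))"
    proof (rule Bochner_Integration.integrable_bound[of lborel "\<lambda>y. 2 * (LBINT x. norm (F x)) * norm (h y)"])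
      show "AE y in lborel. norm (LBINT x. norm (case (y, x) of (y, x) \<Rightarrow> h y * D N x y)) \<le>
         norm (2 * (LBINT x. norm (F x)) * norm (h y))"
        using D0 by (intro AE_I2) (auto simp: norm_mult abs_mult intro!: mult_left_mono mult_right_mono simp: mult.commute)
    qed (use h in auto)
    show "AE y in lborel. integrable lborel (\<lambda>x. case (y, x) of (y, x) \<Rightarrow> h y * D N x y)"
      using Dx by (intro AE_I2) auto
  qed measurable
  have eq: "(LBINT y. h y * F (x - y)) - (\<Sum>k\<in>grid_index N ` grid_box N. grid_weight h N k * F (x - grid_point N k))
     = (LBINT y. h y * D N x y)" if "integrable lborel (\<lambda>y. h y * F (x - y))"
     "integrable lborel (\<lambda>y. h y * D N x y)" for x N
  proof -
    have e: "h y * indicator (grid_box N) y * F (x - p N y) = h y * F (x - y) - h y * D N x y" for y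
      by (simp add: D_def algebra_simps)
    have "(\<Sum>k\<in>grid_index N ` grid_box N. grid_weight h N k * F (x - grid_point N k)) =
      (LBINT y. h y * F (x - y)) - (LBINT y. h y * D N x y)"
      using grid_sum_eq[OF h, of N "\<lambda>z. F (x - z)"] that unfolding p_def[symmetric] e by simp
    then show ?thesis by simp
  qed
  have int': "integrable (lborel \<Otimes>\<^sub>M lborel) (\<lambda>(x, y). h y * D N x y)" for N
    using lborel_pair.integrable_product_swap[OF int, of N] by (simp add: case_prod_unfold)
  \<comment> \<open>By Fubini the convolution integrals converge for almost every \<open>x\<close>
    only, so the identity is available almost everywhere.\<close>
  have aeq: "AE x in lborel. (LBINT y. h y * F (x - y)) - (\<Sum>k\<in>grid_index N ` grid_box N. grid_weight h N k * F (x - grid_point N k))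
     = (LBINT y. h y * D N x y)" for N
    using lborel_pair.AE_integrable_fst[OF integrable_convolution[OF h F]] lborel_pair.AE_integrable_fst[OF int', of N]
    by eventually_elim (rule eq)
  have ub: "(LBINT x. norm ((LBINT y. h y * F (x - y)) -
     (\<Sum>k\<in>grid_index N ` grid_box N. grid_weight h N k * F (x - grid_point N k)))) \<le>
     (LBINT y. norm (h y) * (LBINT x. norm (D N x y)))" for N
  proof -
    have "(LBINT x. norm ((LBINT y. h y * F (x - y)) -
     (\<Sum>k\<in>grid_index N ` grid_box N. grid_weight h N k * F (x - grid_point N k)))) =
      (LBINT x. norm (LBINT y. h y * D N x y))"
    proof (rule integral_cong_AE)
      show "AE x in lborel. norm ((LBINT y. h y * F (x - y)) -
         (\<Sum>k\<in>grid_index N ` grid_box N. grid_weight h N k * F (x - grid_point N k))) = norm (LBINT y. h y * D N x y)"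
        using aeq[of N] by eventually_elim simp
    qed measurable
    also have "... \<le> (LBINT x. LBINT y. norm (h y * D N x y))"
    proof (intro integral_mono integral_norm_bound)
      show "integrable lborel (\<lambda>x. norm (LBINT y. h y * D N x y))"
        using lborel_pair.integrable_fst[OF int', of N] by simp
      show "integrable lborel (\<lambda>x. LINT y|lborel. norm (h y * D N x y))"
        using lborel_pair.integrable_fst[of "\<lambda>x y. norm (h y * D N x y)"] integrable_norm[OF int'[of N]]
        by (simp add: case_prod_unfold)
    qed
    also have "... = (LBINT y. LBINT x. norm (h y * D N x y))"
      by (rule lborel_pair.Fubini_integral[symmetric]) (use integrable_norm[OF int'[of N]] in \<open>simp add: case_prod_unfold\<close>)
    finally show ?thesis by (simp add: norm_mult)
  qed
  have lim: "(\<lambda>N. LINT y|lborel. norm (h y) * (LBINT x. norm (D N x y))) \<longlonglongrightarrow> (LINT y|(lborel::(real^'d) measure). 0)"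
  proof (rule integral_dominated_convergence[where w="\<lambda>y. norm (h y) * (2 * (LBINT x. norm (F x)))"])
    show "AE y in lborel. (\<lambda>N. norm (h y) * (LBINT x. norm (D N x y))) \<longlonglongrightarrow> 0"
    proof (rule AE_I2)
      fix y :: "real^'d"
      have pl: "(\<lambda>N. p N y) \<longlonglongrightarrow> y"
      proof (rule LIM_zero_cancel, rule Lim_null_comparison)
        show "\<forall>\<^sub>F N in sequentially. norm (p N y - y) \<le> real CARD('d) / real N"
          using eventually_gt_at_top[of 0]
          by eventually_elim (metis grid_point_close norm_minus_commute p_def)
        show "(\<lambda>N. real CARD('d) / real N) \<longlonglongrightarrow> 0"
          by (rule lim_const_over_n)
      qed
      have "(\<lambda>N. LINT x|lborel. norm (F (x - (p N y - y)) - F x)) \<longlonglongrightarrow> 0"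
      proof (rule tendsto_compose_at[where f="\<lambda>N. p N y - y", simplified o_def, OF _ L1_translation_continuous[OF F]])
        show "(\<lambda>N. p N y - y) \<longlonglongrightarrow> 0" using pl by (simp add: LIM_zero_iff)
      qed auto
      then have "(\<lambda>N. LINT x|lborel. norm (D N x y)) \<longlonglongrightarrow> 0"
      proof (rule Lim_transform_eventually)
        show "\<forall>\<^sub>F N in sequentially. (LBINT x. norm (F (x - (p N y - y)) - F x)) = (LBINT x. norm (D N x y))"
          using eventually_in_grid_box[of y]
        proof eventually_elim
          fix N assume "y \<in> grid_box N"
          then have "D N (x + y) y = F x - F (x - (p N y - y))" for x by (simp add: D_def algebra_simps)
          then show "(LBINT x. norm (F (x - (p N y - y)) - F x)) = (LBINT x. norm (D N x y))"
            using integral_lborel_translate[of "\<lambda>x. norm (D N x y)" y] by (simp add: norm_minus_commute)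
        qed
      qed
      then show "(\<lambda>N. norm (h y) * (LBINT x. norm (D N x y))) \<longlonglongrightarrow> 0"
        by (rule tendsto_mult_right_zero)
    qed
    show "AE y in lborel. norm (norm (h y) * (LBINT x. norm (D N x y))) \<le> norm (h y) * (2 * (LBINT x. norm (F x)))" for N
      using D0 by (intro AE_I2) (auto simp: abs_mult intro!: mult_left_mono)
  qed (use h in auto)
  show ?thesis
    by (rule tendsto_sandwich[OF _ _ tendsto_const]) (use ub lim in auto)
qed

section \<open>The Fourier transform\<close>

definition ee :: "real \<Rightarrow> complex" where
  "ee t = cis (2 * pi * t)"

lemma ee_0[simp]: "ee 0 = 1" by (simp add: ee_def)
lemma ee_add: "ee (s + t) = ee s * ee t" by (simp add: ee_def cis_mult distrib_left)
lemma norm_ee[simp]: "norm (ee t) = 1" by (simp add: ee_def)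
lemma cnj_ee[simp]: "cnj (ee t) = ee (- t)" by (simp add: ee_def cis_cnj)
lemma isCont_ee[continuous_intros]: "isCont f x \<Longrightarrow> isCont (\<lambda>x. ee (f x)) x"
  unfolding ee_def cis_conv_exp by (intro continuous_intros)
lemma continuous_on_ee[continuous_intros]: "continuous_on S f \<Longrightarrow> continuous_on S (\<lambda>x. ee (f x))"
  unfolding ee_def cis_conv_exp by (intro continuous_intros)
lemma measurable_ee[measurable]: "ee \<in> borel_measurable borel"
  by (intro borel_measurable_continuous_onI continuous_intros)
lemma ee_of_int[simp]: "ee (of_int n) = 1"
  by (simp add: ee_def cis_multiple_2pi)
lemma ee_eq_exp: "ee t = exp (2 * complex_of_real pi * \<i> * complex_of_real t)"
  by (simp add: ee_def cis_conv_exp mult_ac)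

text \<open>The transform \<open>fourier\<close> taken over \<open>lborel\<close> instead of its
  completion, so that product measurability and Fubini apply directly.\<close>

definition ft :: "('a::euclidean_space \<Rightarrow> complex) \<Rightarrow> 'a \<Rightarrow> complex" where
  "ft f \<xi> = (LBINT x. f x * ee (- (\<xi> \<bullet> x)))"

lemma integrable_mult_ee:
  fixes f :: "'a::euclidean_space \<Rightarrow> complex"
  assumes "integrable lborel f"
  shows "integrable lborel (\<lambda>x. f x * ee (\<xi> \<bullet> x))" "integrable lborel (\<lambda>x. f x * ee (- (\<xi> \<bullet> x)))"
  by (rule integrable_mult_bounded[where B=1]; use assms in auto)+

lemma norm_ft_le: "norm (ft f \<xi>) \<le> (LBINT x. norm (f x))"
  unfolding ft_def using integral_norm_bound[of lborel "\<lambda>x. f x * ee (- (\<xi> \<bullet> x))"] by (simp add: norm_mult)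

lemma isCont_ft:
  assumes f: "integrable lborel f"
  shows "isCont (ft f) \<xi>"
  unfolding ft_def
  by (rule isCont_lebesgue_integral[where w="\<lambda>x. norm (f x)"])
     (use f in \<open>auto simp: norm_mult intro!: continuous_intros always_eventually\<close>)

lemma measurable_ft[measurable (raw)]:
  assumes f: "integrable lborel f"
  shows "ft f \<in> borel_measurable borel"
  using isCont_ft[OF f] by (intro borel_measurable_continuous_onI) (simp add: continuous_on_eq_continuous_at)

text \<open>Fubini moves the transform from one factor to the other. Inversion, Bessel's inequality
  and the L^2 bound for truncated kernels all use it with a damped or modulated function as
  \<open>g\<close>.\<close>

lemma ft_multiplication_formula:
  assumes f: "integrable lborel f" and g: "integrable lborel g"
  shows "(LBINT \<xi>. ft f \<xi> * g \<xi>) = (LBINT x. f x * ft g x)"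
proof -
  have i: "integrable (lborel \<Otimes>\<^sub>M lborel) (\<lambda>(x, \<xi>). f x * g \<xi> * ee (- (\<xi> \<bullet> x)))"
    by (rule integrable_prod_bounded[OF f g, where B=1]) auto
  have "(LBINT \<xi>. ft f \<xi> * g \<xi>) = (LBINT \<xi>. LBINT x. f x * g \<xi> * ee (- (\<xi> \<bullet> x)))"
    unfolding ft_def by (subst integral_mult_left_zero[symmetric]) (simp add: mult_ac)
  also have "... = (LBINT x. LBINT \<xi>. f x * g \<xi> * ee (- (\<xi> \<bullet> x)))"
    by (rule lborel_pair.Fubini_integral[OF i])
  also have "... = (LBINT x. f x * ft g x)"
    unfolding ft_def by (subst integral_mult_right_zero[symmetric]) (simp add: mult_ac inner_commute)
  finally show ?thesis .
qed

lemma ft_modulate: "ft (\<lambda>x. f x * ee (a \<bullet> x)) \<xi> = ft f (\<xi> - a)"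
  unfolding ft_def by (intro Bochner_Integration.integral_cong refl) (simp add: mult.assoc inner_diff_left flip: ee_add)

lemma ft_cnj: "cnj (ft f \<xi>) = ft (\<lambda>x. cnj (f x)) (- \<xi>)"
proof -
  have "cnj (ft f \<xi>) = (LBINT x. cnj (f x * ee (- (\<xi> \<bullet> x))))"
    unfolding ft_def by (simp only: Bochner_Integration.integral_cnj)
  then show ?thesis by (simp add: ft_def)
qed

lemma
  fixes f :: "'a::euclidean_space \<Rightarrow> real \<Rightarrow> 'b::{real_normed_field, banach, second_countable_topology}"
  assumes "\<And>b. b \<in> Basis \<Longrightarrow> integrable lborel (f b)"
  shows integrable_lborel_prod: "integrable lborel (\<lambda>x. \<Prod>b\<in>Basis. f b (x \<bullet> b))"
    and integral_lborel_prod: "(LBINT x. (\<Prod>b\<in>Basis. f b (x \<bullet> b))) = (\<Prod>b\<in>Basis. LINT x|lborel. f b x)"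
proof -
  interpret product_sigma_finite "\<lambda>_::'a. lborel :: real measure" ..
  have [measurable]: "\<And>b. b \<in> Basis \<Longrightarrow> f b \<in> borel_measurable borel" using assms by auto
  let ?T = "\<lambda>g::'a \<Rightarrow> real. \<Sum>b\<in>Basis. g b *\<^sub>R b"
  let ?P = "\<Pi>\<^sub>M b\<in>(Basis::'a set). (lborel :: real measure)"
  have T[measurable]: "?T \<in> ?P \<rightarrow>\<^sub>M borel" by measurable
  have e: "(\<Prod>b\<in>Basis. f b (?T g \<bullet> b)) = (\<Prod>b\<in>Basis. f b (g b))" for g
    by (intro prod.cong refl arg_cong[where f="f _"]) (simp add: inner_sum_left_Basis)
  have i: "integrable ?P (\<lambda>g. \<Prod>b\<in>Basis. f b (g b))"
    by (rule product_integrable_prod) (use assms in auto)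
  show "integrable lborel (\<lambda>x. \<Prod>b\<in>Basis. f b (x \<bullet> b))"
    by (subst lborel_eq, subst integrable_distr_eq) (use i in \<open>simp_all add: e\<close>)
  show "(LBINT x. (\<Prod>b\<in>Basis. f b (x \<bullet> b))) = (\<Prod>b\<in>Basis. LINT x|lborel. f b x)"
    by (subst lborel_eq, subst integral_distr) (use assms in \<open>simp_all add: e product_integral_prod\<close>)
qed

section \<open>Gaussians and their Fourier transforms\<close>

definition gauss :: "'a::euclidean_space \<Rightarrow> real" where
  "gauss x = exp (- (pi * (x \<bullet> x)))"

lemma gauss_pos[simp]: "gauss x > 0" "gauss x \<ge> 0" and gauss_le_1: "gauss x \<le> 1"
  by (auto simp: gauss_def)

lemma gauss_minus[simp]: "gauss (- x) = gauss x" by (simp add: gauss_def)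

lemma isCont_gauss[continuous_intros]: "isCont f x \<Longrightarrow> isCont (\<lambda>x. gauss (f x)) x"
  unfolding gauss_def by (intro continuous_intros)

lemma measurable_gauss[measurable]: "gauss \<in> borel_measurable borel"
  unfolding gauss_def by measurable

lemma gauss_prod: "gauss x = (\<Prod>b\<in>Basis. gauss (x \<bullet> b))"
proof -
  have "- (pi * (x \<bullet> x)) = (\<Sum>b\<in>Basis. - (pi * ((x \<bullet> b) * (x \<bullet> b))))"
    by (subst euclidean_inner) (simp add: sum_distrib_left sum_negf)
  then show ?thesis unfolding gauss_def by (simp add: exp_sum)
qed

lemma has_bochner_integral_gauss_real:
  "has_bochner_integral lborel (gauss :: real \<Rightarrow> real) 1"
proof -
  have "integrable lborel std_normal_density" "(LBINT x. std_normal_density x) = 1"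
    using integrable_normal_moment[of 1 0 0] integral_std_normal_moment_even[of 0] by simp_all
  then have h: "has_bochner_integral lborel std_normal_density 1" by (simp add: has_bochner_integral_iff)
  have s: "sqrt (2 * pi) \<noteq> 0" by simp
  from h have "has_bochner_integral lborel (\<lambda>x. std_normal_density (0 + sqrt (2 * pi) * x)) (1 /\<^sub>R \<bar>sqrt (2 * pi)\<bar>)"
    by (subst (asm) lborel_has_bochner_integral_real_affine_iff[OF s, of _ _ 0]) simp
  then have "has_bochner_integral lborel (\<lambda>x. sqrt (2 * pi) * std_normal_density (0 + sqrt (2 * pi) * x)) (sqrt (2 * pi) * (1 /\<^sub>R \<bar>sqrt (2 * pi)\<bar>))"
    by (rule has_bochner_integral_mult_right)
  moreover have "sqrt (2 * pi) * std_normal_density (0 + sqrt (2 * pi) * x) = gauss x" for x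
    by (simp add: std_normal_density_def gauss_def power_mult_distrib power2_eq_square)
  ultimately show ?thesis by simp
qed

lemma integrable_gauss_real[simp]: "integrable lborel (gauss :: real \<Rightarrow> real)"
  and integral_gauss_real: "(LBINT x. gauss (x::real)) = 1"
  using has_bochner_integral_gauss_real by (auto simp: has_bochner_integral_iff)

text \<open>This is the characteristic function of the standard normal law after the dilation by
  \<open>sqrt (2 * pi)\<close> that turns its density into \<open>gauss\<close>.\<close>

lemma ft_gauss_real: "(LBINT x. complex_of_real (gauss (x::real)) * ee (- (t * x))) = gauss t"
proof -
  have "complex_of_real (exp (- (t * sqrt (2 * pi))\<^sup>2 / 2)) = char std_normal_distribution (- t * sqrt (2 * pi))"
    by (simp add: char_std_normal_distribution)
  also have "... = (LBINT x. std_normal_density x *\<^sub>R iexp (- t * sqrt (2 * pi) * x))"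
    unfolding char_def by (subst integral_density) auto
  also have "... = sqrt (2 * pi) *\<^sub>R (LBINT x. std_normal_density (0 + sqrt (2 * pi) * x) *\<^sub>R iexp (- t * sqrt (2 * pi) * (0 + sqrt (2 * pi) * x)))"
    by (subst lborel_integral_real_affine[of "sqrt (2 * pi)" _ 0]) simp_all
  also have "... = (LBINT x. complex_of_real (gauss x) * ee (- (t * x)))"
  proof -
    have "sqrt (2 * pi) *\<^sub>R (std_normal_density (0 + sqrt (2 * pi) * x) *\<^sub>R iexp (- t * sqrt (2 * pi) * (0 + sqrt (2 * pi) * x)))
      = complex_of_real (gauss x) * ee (- (t * x))" for x
    proof -
      have "sqrt (2 * pi) * std_normal_density (0 + sqrt (2 * pi) * x) = gauss x"
        by (simp add: std_normal_density_def gauss_def power_mult_distrib power2_eq_square)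
      moreover have "iexp (- t * sqrt (2 * pi) * (0 + sqrt (2 * pi) * x)) = ee (- (t * x))"
      proof -
        have "- t * sqrt (2 * pi) * (0 + sqrt (2 * pi) * x) = 2 * pi * (- (t * x))" by simp
        then show ?thesis by (simp only: ee_def cis_conv_exp)
      qed
      ultimately show ?thesis
        by (simp only: scaleR_scaleR) (simp only: scaleR_conv_of_real)
    qed
    then show ?thesis by (subst integral_scaleR_right[symmetric]) (simp only:)
  qed
  finally show ?thesis by (simp add: gauss_def power_mult_distrib power2_eq_square mult_ac)
qed

lemma integrable_x_gauss_real: "integrable lborel (\<lambda>x::real. x * gauss x)"
proof -
  have s: "1 / sqrt (2 * pi) \<noteq> 0" "1 / sqrt (2 * pi) > 0" by simp_all
  have "integrable lborel (\<lambda>x. normal_density 0 (1 / sqrt (2 * pi)) x * x ^ 1)"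
    using integrable_normal_moment[OF s(2), of 0 1] by simp
  moreover have "normal_density 0 (1 / sqrt (2 * pi)) x * x ^ 1 = x * gauss x" for x
    by (simp add: normal_density_def gauss_def power_divide power2_eq_square real_sqrt_divide)
  ultimately show ?thesis by (simp only:)
qed

lemma tendsto_gauss_real: "((gauss :: real \<Rightarrow> real) \<longlongrightarrow> 0) at_top" "((gauss :: real \<Rightarrow> real) \<longlongrightarrow> 0) at_bot"
proof -
  have "((\<lambda>x::real. exp (- (pi * (x * x)))) \<longlongrightarrow> 0) at_top" by real_asymp
  moreover have "((\<lambda>x::real. exp (- (pi * (x * x)))) \<longlongrightarrow> 0) at_bot" by real_asymp
  ultimately show "((gauss :: real \<Rightarrow> real) \<longlongrightarrow> 0) at_top" "((gauss :: real \<Rightarrow> real) \<longlongrightarrow> 0) at_bot"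
    by (auto simp: gauss_def[abs_def])
qed

text \<open>The function \<open>F\<close>, a Gaussian times a character, vanishes at both ends of
  the line, so its derivative has integral 0. That derivative is a combination of the two
  integrands, which expresses the transform of \<open>x * gauss x\<close> by that of
  \<open>gauss\<close>.\<close>

lemma ft_x_gauss_real:
  "(LBINT x. complex_of_real (x * gauss x) * ee (- (t * x))) = - \<i> * t * gauss t"
proof -
  define F where "F x = complex_of_real (gauss x) * ee (- (t * x))" for x
  define G where "G x = complex_of_real (x * gauss x) * ee (- (t * x))" for x
  define f where "f x = complex_of_real (- (2 * pi)) * G x - (2 * pi * \<i> * t) * F x" for x
  have i1: "integrable lborel G" unfolding G_def
    by (rule integrable_mult_bounded[OF integrable_of_real[OF integrable_x_gauss_real], where B=1]) auto
  have i2: "integrable lborel F" unfolding F_def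
    by (rule integrable_mult_bounded[where B=1]) auto
  have d: "(F has_vector_derivative f x) (at x)" for x
    unfolding F_def f_def G_def gauss_def ee_def cis_conv_exp has_vector_derivative_complex_iff
    by (auto intro!: derivative_eq_intros simp: Re_exp Im_exp algebra_simps)
  have F0: "(F \<longlongrightarrow> 0) at_top" "(F \<longlongrightarrow> 0) at_bot"
    by (rule tendsto_norm_zero_cancel; use tendsto_gauss_real in \<open>simp add: F_def norm_mult\<close>)+
  have "(LBINT x=-\<infinity>..\<infinity>. f x) = 0 - 0"
  proof (rule interval_integral_FTC_integrable[where F=F])
    show "isCont f x" for x unfolding f_def F_def G_def by (intro continuous_intros)
    show "set_integrable lborel (einterval (- \<infinity>) \<infinity>) f"
      unfolding set_integrable_def f_def using i1 i2 by simp
    show "((F \<circ> real_of_ereal) \<longlongrightarrow> 0) (at_right (- \<infinity>))" "((F \<circ> real_of_ereal) \<longlongrightarrow> 0) (at_left \<infinity>)"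
      using F0 by (simp_all add: ereal_tendsto_simps)
  qed (use d in auto)
  then have "(LBINT x. f x) = 0"
    by (simp add: interval_lebesgue_integral_def set_lebesgue_integral_def)
  then have "complex_of_real (- (2 * pi)) * (LBINT x. G x) - (2 * pi * \<i> * t) * (LBINT x. F x) = 0"
    unfolding f_def using i1 i2 by simp
  moreover have "(LBINT x. F x) = gauss t" unfolding F_def by (rule ft_gauss_real)
  ultimately have e0: "complex_of_real (- (2 * pi)) * (LBINT x. G x) - (2 * pi * \<i> * t) * gauss t = 0" by simp
  have "complex_of_real (2 * pi) * ((LBINT x. G x) - (- \<i> * t * gauss t)) =
     - (complex_of_real (- (2 * pi)) * (LBINT x. G x) - (2 * pi * \<i> * t) * gauss t)"
    by (simp add: algebra_simps)
  also have "... = 0" unfolding e0 by simp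
  finally have "(LBINT x. G x) = - \<i> * t * gauss t" by (simp add: eq_neg_iff_add_eq_0)
  then show ?thesis by (simp only: G_def)
qed

lemma integrable_gauss: "integrable lborel (gauss :: 'a::euclidean_space \<Rightarrow> real)"
proof -
  have "gauss = (\<lambda>x::'a. \<Prod>b\<in>Basis. gauss (x \<bullet> b))" by (rule ext) (rule gauss_prod)
  moreover have "integrable lborel (\<lambda>x::'a. \<Prod>b\<in>Basis. gauss (x \<bullet> b))"
    by (rule integrable_lborel_prod) simp
  ultimately show ?thesis by (simp only:)
qed

lemma integral_gauss: "(LBINT x. gauss (x::'a::euclidean_space)) = 1"
proof -
  have "(LBINT x. gauss (x::'a)) = (LINT x|(lborel::'a measure). (\<Prod>b\<in>Basis. gauss (x \<bullet> b)))"
    by (subst gauss_prod) simp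
  also have "... = 1" by (subst integral_lborel_prod) (auto simp: integral_gauss_real)
  finally show ?thesis .
qed

lemma ee_sum: "finite A \<Longrightarrow> ee (\<Sum>a\<in>A. g a) = (\<Prod>a\<in>A. ee (g a))"
  by (induction A rule: finite_induct) (auto simp: ee_add)

lemma ft_gauss: "ft (\<lambda>x. complex_of_real (gauss x)) \<xi> = gauss \<xi>"
proof -
  have "complex_of_real (gauss x) * ee (- (\<xi> \<bullet> x)) = (\<Prod>b\<in>Basis. complex_of_real (gauss (x \<bullet> b)) * ee (- ((\<xi> \<bullet> b) * (x \<bullet> b))))" for x
    unfolding gauss_prod[of x] euclidean_inner[of \<xi> x] sum_negf[symmetric]
    by (simp add: ee_sum prod.distrib)
  then have "ft (\<lambda>x. complex_of_real (gauss x)) \<xi> = (LBINT x. (\<Prod>b\<in>Basis. complex_of_real (gauss (x \<bullet> b)) * ee (- ((\<xi> \<bullet> b) * (x \<bullet> b)))))"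
    unfolding ft_def by simp
  also have "... = (\<Prod>b\<in>Basis. LINT x|lborel. complex_of_real (gauss x) * ee (- ((\<xi> \<bullet> b) * x)))"
    by (rule integral_lborel_prod, rule integrable_mult_bounded[where B=1]) auto
  also have "... = gauss \<xi>"
    unfolding ft_gauss_real gauss_prod[of \<xi>] by simp
  finally show ?thesis .
qed

lemma
  assumes j: "j \<in> Basis"
  shows integrable_inner_gauss: "integrable lborel (\<lambda>x::'a::euclidean_space. (x \<bullet> j) * gauss x)"
    and ft_inner_gauss: "ft (\<lambda>x::'a. complex_of_real ((x \<bullet> j) * gauss x)) \<xi> = - \<i> * (\<xi> \<bullet> j) * gauss \<xi>"
proof -
  \<comment> \<open>The factor \<open>x \<bullet> j\<close> is attached to the \<open>j\<close>-th
    coordinate, so that only one of the one-dimensional transforms changes.\<close>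
  define g where "g b x = (if b = j then x else 1) * gauss (x::real)" for b :: 'a and x
  have g: "integrable lborel (g b)" for b
    using integrable_x_gauss_real by (cases "b = j") (simp_all add: g_def[abs_def])
  have pg: "(x \<bullet> j) * gauss x = (\<Prod>b\<in>Basis. g b (x \<bullet> b))" for x :: 'a
    using j by (simp add: g_def prod.distrib gauss_prod[of x] prod.delta)
  show "integrable lborel (\<lambda>x::'a. (x \<bullet> j) * gauss x)"
    unfolding pg using g by (rule integrable_lborel_prod)
  have "complex_of_real ((x \<bullet> j) * gauss x) * ee (- (\<xi> \<bullet> x)) = (\<Prod>b\<in>Basis. complex_of_real (g b (x \<bullet> b)) * ee (- ((\<xi> \<bullet> b) * (x \<bullet> b))))" for x
    unfolding pg euclidean_inner[of \<xi> x] sum_negf[symmetric]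
    by (simp add: ee_sum prod.distrib)
  then have "ft (\<lambda>x. complex_of_real ((x \<bullet> j) * gauss x)) \<xi> = (LBINT x. (\<Prod>b\<in>Basis. complex_of_real (g b (x \<bullet> b)) * ee (- ((\<xi> \<bullet> b) * (x \<bullet> b)))))"
    unfolding ft_def by simp
  also have "... = (\<Prod>b\<in>Basis. LINT x|lborel. complex_of_real (g b x) * ee (- ((\<xi> \<bullet> b) * x)))"
    by (rule integral_lborel_prod, rule integrable_mult_bounded[where B=1]) (use g in auto)
  also have "... = (\<Prod>b\<in>Basis. (if b = j then - \<i> * (\<xi> \<bullet> j) else 1) * gauss (\<xi> \<bullet> b))"
  proof (intro prod.cong refl)
    fix b :: 'a
    show "(LBINT x. complex_of_real (g b x) * ee (- ((\<xi> \<bullet> b) * x))) = (if b = j then - \<i> * (\<xi> \<bullet> j) else 1) * gauss (\<xi> \<bullet> b)"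
    proof (cases "b = j")
      case True
      then show ?thesis using ft_x_gauss_real[of "\<xi> \<bullet> j"] by (simp add: g_def)
    next
      case False
      then show ?thesis using ft_gauss_real[of "\<xi> \<bullet> b"] by (simp add: g_def)
    qed
  qed
  also have "... = - \<i> * (\<xi> \<bullet> j) * gauss \<xi>"
    using j by (simp add: prod.distrib gauss_prod[of \<xi>] prod.delta)
  finally show "ft (\<lambda>x::'a. complex_of_real ((x \<bullet> j) * gauss x)) \<xi> = - \<i> * (\<xi> \<bullet> j) * gauss \<xi>" .
qed

section \<open>Dilations, Fourier inversion and Bessel's inequality\<close>

lemma ft_scale:
  fixes f :: "'a::euclidean_space \<Rightarrow> complex"
  assumes "c > 0"
  shows "ft (\<lambda>x. f (c *\<^sub>R x)) \<xi> = complex_of_real (inverse (c ^ DIM('a))) * ft f (\<xi> /\<^sub>R c)"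
  using integral_lborel_affine[of c "\<lambda>x. f x * ee (- ((\<xi> /\<^sub>R c) \<bullet> x))" 0] assms
  by (simp add: ft_def scaleR_conv_of_real flip: mult.assoc)

lemma integrable_scale:
  fixes f :: "'a::euclidean_space \<Rightarrow> 'b::{banach, second_countable_topology}"
  assumes "integrable lborel f" "c \<noteq> 0"
  shows "integrable lborel (\<lambda>x. f (c *\<^sub>R x))"
  using integrable_lborel_affine[OF assms, of 0] by simp

text \<open>The heat kernel at time 1 / (4 pi c^2): a Gaussian of total mass 1 that concentrates at
  the origin as \<open>c\<close> grows.\<close>

definition heat :: "real \<Rightarrow> 'a::euclidean_space \<Rightarrow> real" where
  "heat c x = c ^ DIM('a) * gauss (c *\<^sub>R x)"

lemma measurable_heat[measurable]: "heat c \<in> borel_measurable borel"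
  unfolding heat_def by measurable

lemma heat_nonneg[simp]: "c > 0 \<Longrightarrow> heat c x \<ge> 0"
  by (simp add: heat_def)

lemma heat_minus: "heat c (- x) = heat c x"
  by (simp add: heat_def)

lemma heat_swap: "heat c (x - y) = heat c (y - x)"
  using heat_minus[of c "x - y"] by simp

lemma integrable_heat: "c > 0 \<Longrightarrow> integrable lborel (heat c :: 'a::euclidean_space \<Rightarrow> real)"
  unfolding heat_def by (intro integrable_mult_right integrable_scale integrable_gauss) auto

lemma integral_heat: "c > 0 \<Longrightarrow> (LBINT x. heat c (x::'a::euclidean_space)) = 1"
  using integral_lborel_affine[of c "gauss :: 'a \<Rightarrow> real" 0] integral_gauss[where 'a='a]
  unfolding heat_def by (simp add: integrable_gauss integrable_scale)

lemma ft_gauss_scaled: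
  assumes "c > 0"
  shows "ft (\<lambda>x. complex_of_real (gauss (x /\<^sub>R c))) \<xi> = heat c (\<xi> :: 'a::euclidean_space)"
  using ft_scale[of "inverse c" "\<lambda>x::'a. complex_of_real (gauss x)" \<xi>] assms
  by (simp add: ft_gauss heat_def power_inverse)

lemma integrable_gauss_scaled: "c > 0 \<Longrightarrow> integrable lborel (\<lambda>x::'a::euclidean_space. complex_of_real (gauss (x /\<^sub>R c)))"
  by (intro integrable_of_real integrable_scale integrable_gauss) auto

lemma heat_approx_identity:
  fixes F :: "'a::euclidean_space \<Rightarrow> complex"
  assumes [measurable]: "F \<in> borel_measurable borel" and B: "\<And>x. norm (F x) \<le> B" and cont: "isCont F x"
  shows "(\<lambda>n. LINT y|lborel. F y * heat (real (Suc n)) (y - x)) \<longlonglongrightarrow> F x"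
proof -
  have eq: "(LBINT y. F y * heat c (y - x)) = (LBINT u. F (x + u /\<^sub>R c) * gauss u)" if "c > 0" for c
  proof -
    have "(LBINT u. F (x + inverse c *\<^sub>R u) * heat c ((x + inverse c *\<^sub>R u) - x)) =
      inverse (\<bar>inverse c\<bar> ^ DIM('a)) *\<^sub>R (LBINT y. F y * heat c (y - x))"
      by (rule integral_lborel_affine) (use that in simp)
    moreover have "F (x + inverse c *\<^sub>R u) * heat c ((x + inverse c *\<^sub>R u) - x) = c ^ DIM('a) *\<^sub>R (F (x + inverse c *\<^sub>R u) * gauss u)" for u
      using that by (simp add: heat_def scaleR_conv_of_real)
    ultimately have "c ^ DIM('a) *\<^sub>R (LBINT u. F (x + inverse c *\<^sub>R u) * gauss u) =
      c ^ DIM('a) *\<^sub>R (LBINT y. F y * heat c (y - x))"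
      using that by (simp add: power_inverse)
    then show ?thesis using that by (simp only: scaleR_cancel_left power_eq_0_iff) simp
  qed
  have "(\<lambda>n. LINT u|lborel. F (x + u /\<^sub>R real (Suc n)) * gauss u) \<longlonglongrightarrow> (LINT u|(lborel :: 'a measure). F x * gauss u)"
  proof (rule integral_dominated_convergence[where w="\<lambda>u. B * gauss u"])
    show "integrable lborel (\<lambda>u::'a. B * gauss u)" by (intro integrable_mult_right integrable_gauss)
    show "AE u in lborel. (\<lambda>n. F (x + u /\<^sub>R real (Suc n)) * gauss u) \<longlonglongrightarrow> F x * gauss u"
    proof (rule AE_I2, intro tendsto_intros isCont_tendsto_compose[OF cont])
      fix u :: 'a
      have "(\<lambda>n. x + inverse (real (Suc n)) *\<^sub>R u) \<longlonglongrightarrow> x + 0 *\<^sub>R u"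
        by (intro tendsto_intros LIMSEQ_inverse_real_of_nat)
      then show "(\<lambda>n. x + u /\<^sub>R real (Suc n)) \<longlonglongrightarrow> x" by simp
    qed
    show "AE u in lborel. norm (F (x + u /\<^sub>R real (Suc n)) * gauss u) \<le> B * gauss u" for n
      using B by (intro AE_I2) (auto simp: norm_mult intro!: mult_right_mono)
  qed (measurable)
  then show ?thesis by (simp add: eq integral_gauss)
qed

lemma gauss_scaled_tendsto_1: "(\<lambda>n. gauss (x /\<^sub>R real (Suc n))) \<longlonglongrightarrow> 1"
proof -
  have "(\<lambda>n. gauss (inverse (real (Suc n)) *\<^sub>R x)) \<longlonglongrightarrow> gauss (0 *\<^sub>R x)"
    by (rule isCont_tendsto_compose[where g=gauss]) (intro continuous_intros tendsto_intros LIMSEQ_inverse_real_of_nat)+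
  then show ?thesis by (simp add: gauss_def)
qed

text \<open>Damping by the wide Gaussian \<open>E n\<close> makes the multiplication formula
  applicable, and it turns the inversion integral into a heat average of \<open>f\<close> near
  \<open>x\<close>. As \<open>n\<close> grows the damping disappears on one side and the average
  tends to \<open>f x\<close> on the other.\<close>

lemma fourier_inversion:
  fixes f :: "'a::euclidean_space \<Rightarrow> complex"
  assumes f: "integrable lborel f" and B: "\<And>x. norm (f x) \<le> B" and cont: "isCont f x"
    and ftf: "integrable lborel (ft f)"
  shows "(LBINT \<xi>. ft f \<xi> * ee (\<xi> \<bullet> x)) = f x"
proof -
  have [measurable]: "f \<in> borel_measurable borel" using f by auto
  note [measurable] = measurable_ft[OF f]
  define E where "E n \<xi> = complex_of_real (gauss (\<xi> /\<^sub>R real (Suc n)))" for n and \<xi> :: 'a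
  have [measurable]: "E n \<in> borel_measurable borel" for n unfolding E_def by measurable
  have E: "integrable lborel (E n)" for n unfolding E_def by (rule integrable_gauss_scaled) simp
  have eq: "(LBINT \<xi>. ft f \<xi> * (E n \<xi> * ee (x \<bullet> \<xi>))) = (LBINT y. f y * heat (real (Suc n)) (y - x))" for n
  proof -
    have "(LBINT \<xi>. ft f \<xi> * (E n \<xi> * ee (x \<bullet> \<xi>))) = (LBINT y. f y * ft (\<lambda>\<xi>. E n \<xi> * ee (x \<bullet> \<xi>)) y)"
      by (rule ft_multiplication_formula[OF f integrable_mult_ee(1)[OF E]])
    also have "... = (LBINT y. f y * heat (real (Suc n)) (y - x))"
      unfolding ft_modulate unfolding E_def by (simp add: ft_gauss_scaled del: of_nat_Suc)
    finally show ?thesis .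
  qed
  have "(\<lambda>n. LINT \<xi>|lborel. ft f \<xi> * (E n \<xi> * ee (x \<bullet> \<xi>))) \<longlonglongrightarrow> (LBINT \<xi>. ft f \<xi> * ee (x \<bullet> \<xi>))"
  proof (rule integral_dominated_convergence[where w="\<lambda>\<xi>. norm (ft f \<xi>)"])
    show "AE \<xi> in lborel. (\<lambda>n. ft f \<xi> * (E n \<xi> * ee (x \<bullet> \<xi>))) \<longlonglongrightarrow> ft f \<xi> * ee (x \<bullet> \<xi>)"
    proof (rule AE_I2)
      fix \<xi> :: 'a
      have "(\<lambda>n. ft f \<xi> * (E n \<xi> * ee (x \<bullet> \<xi>))) \<longlonglongrightarrow> ft f \<xi> * (complex_of_real 1 * ee (x \<bullet> \<xi>))"
        unfolding E_def by (intro tendsto_intros gauss_scaled_tendsto_1)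
      then show "(\<lambda>n. ft f \<xi> * (E n \<xi> * ee (x \<bullet> \<xi>))) \<longlonglongrightarrow> ft f \<xi> * ee (x \<bullet> \<xi>)" by simp
    qed
    show "AE \<xi> in lborel. norm (ft f \<xi> * (E n \<xi> * ee (x \<bullet> \<xi>))) \<le> norm (ft f \<xi>)" for n
      by (intro AE_I2) (auto simp: norm_mult E_def gauss_le_1 mult_left_le)
  qed (use ftf in auto)
  moreover have "(\<lambda>n. LINT \<xi>|lborel. ft f \<xi> * (E n \<xi> * ee (x \<bullet> \<xi>))) \<longlonglongrightarrow> f x"
    unfolding eq by (rule heat_approx_identity[OF _ B cont]) measurable
  ultimately have "(LBINT \<xi>. ft f \<xi> * ee (x \<bullet> \<xi>)) = f x" by (rule LIMSEQ_unique)
  then show ?thesis by (simp add: inner_commute)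
qed

lemma measurable_cnj[measurable]: "cnj \<in> borel_measurable borel"
  by (intro borel_measurable_continuous_onI continuous_intros)

text \<open>Fatou's lemma, with integrability of the limit as part of the conclusion.\<close>

lemma integrable_limit_bounded:
  fixes v :: "'a \<Rightarrow> real"
  assumes u: "\<And>n. integrable M (u n)" and nonneg: "\<And>n x. x \<in> space M \<Longrightarrow> 0 \<le> u n x"
    and lim: "\<And>x. x \<in> space M \<Longrightarrow> (\<lambda>n. u n x) \<longlonglongrightarrow> v x"
    and C: "\<And>n. (LINT x|M. u n x) \<le> C"
  shows "integrable M v" "(LINT x|M. v x) \<le> C"
proof -
  have [measurable]: "\<And>n. u n \<in> borel_measurable M" using u by auto
  have [measurable]: "v \<in> borel_measurable M"
    by (rule borel_measurable_LIMSEQ_real[where u=u]) (use lim in auto)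
  have v0: "0 \<le> v x" if "x \<in> space M" for x
    using lim[OF that] by (rule LIMSEQ_le_const) (use nonneg that in auto)
  have "0 \<le> (LINT x|M. u 0 x)" using nonneg by (intro Bochner_Integration.integral_nonneg) auto
  then have C0: "0 \<le> C" using C[of 0] by simp
  have "(\<integral>\<^sup>+x. ennreal (v x) \<partial>M) = (\<integral>\<^sup>+x. liminf (\<lambda>n. ennreal (u n x)) \<partial>M)"
    using lim by (intro nn_integral_cong lim_imp_Liminf[symmetric]) (auto intro!: tendsto_ennrealI)
  also have "... \<le> liminf (\<lambda>n. \<integral>\<^sup>+x. ennreal (u n x) \<partial>M)"
    by (rule nn_integral_liminf) simp
  also have "... \<le> ennreal C"
  proof (rule Liminf_le)
    show "\<forall>\<^sub>F n in sequentially. (\<integral>\<^sup>+x. ennreal (u n x) \<partial>M) \<le> ennreal C"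
      using u nonneg C by (intro always_eventually allI) (simp add: nn_integral_eq_integral ennreal_leI)
  qed simp
  finally have b: "(\<integral>\<^sup>+x. ennreal (v x) \<partial>M) \<le> ennreal C" .
  show v: "integrable M v"
    by (rule integrableI_nonneg) (use v0 b in \<open>auto intro: le_less_trans\<close>)
  have "ennreal (LINT x|M. v x) \<le> ennreal C"
    using b nn_integral_eq_integral[OF v] v0 by simp
  then show "(LINT x|M. v x) \<le> C" using C0 by simp
qed

text \<open>One half of Plancherel's theorem. With Gaussian damping the left side becomes the
  pairing of \<open>g\<close> with its own heat average, which is at most the square norm because
  the heat kernel has mass 1 in each variable; Fatou removes the damping.\<close>

lemma bessel_inequality:
  fixes g :: "'a::euclidean_space \<Rightarrow> complex"
  assumes g: "integrable lborel g" and B: "\<And>x. norm (g x) \<le> B"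
  shows "integrable lborel (\<lambda>\<xi>. (norm (ft g \<xi>))\<^sup>2)"
    and "(LBINT \<xi>. (norm (ft g \<xi>))\<^sup>2) \<le> (LBINT x. (norm (g x))\<^sup>2)"
proof -
  have [measurable]: "g \<in> borel_measurable borel" using g by auto
  note [measurable] = measurable_ft[OF g]
  have g2: "integrable lborel (\<lambda>x. (norm (g x))\<^sup>2)"
  proof (rule Bochner_Integration.integrable_bound[where f="\<lambda>x. B * norm (g x)"])
    show "AE x in lborel. norm ((norm (g x))\<^sup>2) \<le> norm (B * norm (g x))"
      using B by (intro AE_I2) (auto simp: power2_eq_square abs_mult intro!: mult_right_mono order_trans[OF B])
  qed (use g in auto)
  define E where "E n \<xi> = complex_of_real (gauss (\<xi> /\<^sub>R real (Suc n)))" for n and \<xi> :: 'a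
  have [measurable]: "E n \<in> borel_measurable borel" for n unfolding E_def by measurable
  have E: "integrable lborel (E n)" for n unfolding E_def by (rule integrable_gauss_scaled) simp
  have E1: "norm (E n \<xi>) \<le> 1" for n \<xi> by (simp add: E_def gauss_le_1)
  have cE: "cnj (E n \<xi>) = E n \<xi>" for n \<xi> by (simp add: E_def)
  define A where "A = (LBINT x. norm (g x))"
  have iE: "integrable lborel (\<lambda>\<xi>. E n \<xi> * cnj (ft g \<xi>))" for n
    by (rule integrable_mult_bounded(1)[OF E, where B=A]) (auto simp: A_def norm_ft_le)
  have H: "heat (real (Suc n)) (x :: 'a) \<ge> 0" for n x by (intro heat_nonneg) simp
  have iH: "integrable lborel (\<lambda>y. heat (real (Suc n)) (y - x))" for n and x :: 'a
    using integrable_heat[of "real (Suc n)"] by (subst integrable_lborel_shift) simp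
  have HI: "(LBINT y. heat (real (Suc n)) (y - x)) = 1" for n and x :: 'a
    using integral_heat[of "real (Suc n)"] by (subst integral_lborel_shift) simp
  have ftE: "ft (\<lambda>\<xi>. E n \<xi> * cnj (ft g \<xi>)) x = cnj (LBINT y. g y * heat (real (Suc n)) (y - x))" for n x
  proof -
    have "ft (\<lambda>\<xi>. E n \<xi> * cnj (ft g \<xi>)) x = (LBINT \<xi>. cnj (ft g \<xi> * (E n \<xi> * ee (x \<bullet> \<xi>))))"
      unfolding ft_def[of "\<lambda>\<xi>. E n \<xi> * cnj (ft g \<xi>)"] by (simp add: cE mult_ac)
    also have "... = cnj (LBINT \<xi>. ft g \<xi> * (E n \<xi> * ee (x \<bullet> \<xi>)))"
      by (rule Bochner_Integration.integral_cnj)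
    also have "(LBINT \<xi>. ft g \<xi> * (E n \<xi> * ee (x \<bullet> \<xi>))) = (LBINT y. g y * ft (\<lambda>\<xi>. E n \<xi> * ee (x \<bullet> \<xi>)) y)"
      by (rule ft_multiplication_formula[OF g integrable_mult_ee(1)[OF E]])
    also have "... = (LBINT y. g y * heat (real (Suc n)) (y - x))"
      unfolding ft_modulate unfolding E_def by (simp add: ft_gauss_scaled del: of_nat_Suc)
    finally show ?thesis .
  qed
  define K where "K n x = (LBINT y. (norm (g y))\<^sup>2 * heat (real (Suc n)) (x - y))" for n x
  have iK2: "integrable (lborel \<Otimes>\<^sub>M lborel) (\<lambda>(x, y). (norm (g y))\<^sup>2 * heat (real (Suc n)) (x - y))" for n
    by (rule integrable_convolution[OF g2 integrable_heat]) simp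
  have iK: "integrable lborel (K n)" for n
    unfolding K_def using lborel_pair.integrable_fst[OF iK2] .
  have KI: "(LBINT x. K n x) = (LBINT x. (norm (g x))\<^sup>2)" for n
  proof -
    have "(LBINT x. K n x) = (LBINT y. LBINT x. (norm (g y))\<^sup>2 * heat (real (Suc n)) (x - y))"
      unfolding K_def by (rule lborel_pair.Fubini_integral[OF iK2, symmetric])
    then show ?thesis using HI by (simp del: of_nat_Suc)
  qed
  have K0: "0 \<le> K n x" for n x
    unfolding K_def using H by (intro Bochner_Integration.integral_nonneg) auto
  \<comment> \<open>The product of two values of |g| is at most half the sum of their squares.
    Integrated in \<open>y\<close> against the kernel, the square at \<open>x\<close> keeps its
    weight and the square at \<open>y\<close> becomes \<open>K n x\<close>.\<close>
  have bound: "norm (g x) * norm (LBINT y. g y * heat (real (Suc n)) (y - x)) \<le> ((norm (g x))\<^sup>2 + K n x) / 2"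
    if "integrable lborel (\<lambda>y. (norm (g y))\<^sup>2 * heat (real (Suc n)) (x - y))" for n x
  proof -
    have "norm (LBINT y. g y * heat (real (Suc n)) (y - x)) \<le> (LBINT y. norm (g y) * heat (real (Suc n)) (y - x))"
      using integral_norm_bound[of lborel "\<lambda>y. g y * heat (real (Suc n)) (y - x)"] H by (simp add: norm_mult del: of_nat_Suc)
    then have "norm (g x) * norm (LBINT y. g y * heat (real (Suc n)) (y - x)) \<le>
      (LBINT y. norm (g x) * (norm (g y) * heat (real (Suc n)) (y - x)))"
      by (simp add: mult_left_mono)
    also have "... \<le> (LBINT y. (norm (g x))\<^sup>2 / 2 * heat (real (Suc n)) (y - x) + (norm (g y))\<^sup>2 * heat (real (Suc n)) (x - y) / 2)"
    proof (intro integral_mono)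
      show "integrable lborel (\<lambda>y. norm (g x) * (norm (g y) * heat (real (Suc n)) (y - x)))"
      proof (intro integrable_mult_right Bochner_Integration.integrable_bound[OF integrable_mult_right[OF iH, where c=B]] AE_I2)
        fix y show "norm (norm (g y) * heat (real (Suc n)) (y - x)) \<le> norm (B * heat (real (Suc n)) (y - x))"
          using H[of n "y - x"] B[of y] by (auto simp: abs_mult intro!: mult_right_mono)
      qed measurable
      show "integrable lborel (\<lambda>y. (norm (g x))\<^sup>2 / 2 * heat (real (Suc n)) (y - x) + (norm (g y))\<^sup>2 * heat (real (Suc n)) (x - y) / 2)"
        using that iH by (intro Bochner_Integration.integrable_add integrable_mult_right integrable_divide) auto
      fix y
      have "norm (g x) * norm (g y) \<le> ((norm (g x))\<^sup>2 + (norm (g y))\<^sup>2) / 2"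
        using sum_squares_bound[of "norm (g x)" "norm (g y)"] by simp
      then have "norm (g x) * norm (g y) * heat (real (Suc n)) (y - x) \<le> ((norm (g x))\<^sup>2 + (norm (g y))\<^sup>2) / 2 * heat (real (Suc n)) (y - x)"
        using H by (intro mult_right_mono) auto
      then show "norm (g x) * (norm (g y) * heat (real (Suc n)) (y - x)) \<le>
        (norm (g x))\<^sup>2 / 2 * heat (real (Suc n)) (y - x) + (norm (g y))\<^sup>2 * heat (real (Suc n)) (x - y) / 2"
        by (simp add: heat_swap[of _ x y] add_divide_distrib distrib_right mult.assoc)
    qed
    also have "... = ((norm (g x))\<^sup>2 + K n x) / 2"
      using that iH[of n x] by (subst Bochner_Integration.integral_add) (auto simp: K_def HI add_divide_distrib simp del: of_nat_Suc)
    finally show ?thesis .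
  qed
  have est: "(LBINT \<xi>. (norm (ft g \<xi>))\<^sup>2 * gauss (\<xi> /\<^sub>R real (Suc n))) \<le> (LBINT x. (norm (g x))\<^sup>2)" for n
  proof -
    have "complex_of_real (LBINT \<xi>. (norm (ft g \<xi>))\<^sup>2 * gauss (\<xi> /\<^sub>R real (Suc n))) =
       (LBINT \<xi>. ft g \<xi> * (E n \<xi> * cnj (ft g \<xi>)))"
      by (subst integral_complex_of_real[symmetric], intro Bochner_Integration.integral_cong refl)
         (simp add: E_def complex_norm_square[unfolded of_real_power] mult_ac del: of_nat_Suc)
    also have "... = (LBINT x. g x * ft (\<lambda>\<xi>. E n \<xi> * cnj (ft g \<xi>)) x)"
      by (rule ft_multiplication_formula[OF g iE])
    also have "... = (LBINT x. g x * cnj (LBINT y. g y * heat (real (Suc n)) (y - x)))"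
      unfolding ftE ..
    finally have "norm (complex_of_real (LBINT \<xi>. (norm (ft g \<xi>))\<^sup>2 * gauss (\<xi> /\<^sub>R real (Suc n)))) \<le>
       (LBINT x. norm (g x * cnj (LBINT y. g y * heat (real (Suc n)) (y - x))))"
      by (simp only: integral_norm_bound)
    also have "... \<le> (LBINT x. ((norm (g x))\<^sup>2 + K n x) / 2)"
    proof (intro integral_mono_AE')
      show "integrable lborel (\<lambda>x. ((norm (g x))\<^sup>2 + K n x) / 2)" using g2 iK by simp
      show "AE x in lborel. norm (g x * cnj (LBINT y. g y * heat (real (Suc n)) (y - x))) \<le> ((norm (g x))\<^sup>2 + K n x) / 2"
        using lborel_pair.AE_integrable_fst[OF iK2, of n]
        by eventually_elim (use bound in \<open>simp add: norm_mult del: of_nat_Suc\<close>)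
    qed (use K0 in auto)
    also have "... = (LBINT x. (norm (g x))\<^sup>2)" using g2 iK KI by simp
    finally show ?thesis by (simp del: of_nat_Suc)
  qed
  have iu: "integrable lborel (\<lambda>\<xi>. (norm (ft g \<xi>))\<^sup>2 * gauss (\<xi> /\<^sub>R real (Suc n)))" for n
  proof (rule Bochner_Integration.integrable_bound[where f="\<lambda>\<xi>. A\<^sup>2 * norm (E n \<xi>)"])
    show "AE \<xi> in lborel. norm ((norm (ft g \<xi>))\<^sup>2 * gauss (\<xi> /\<^sub>R real (Suc n))) \<le> norm (A\<^sup>2 * norm (E n \<xi>))"
      using norm_ft_le[of g] by (intro AE_I2) (auto simp: abs_mult E_def A_def intro!: mult_right_mono power_mono simp del: of_nat_Suc)
  qed (use E in auto)
  have lim: "(\<lambda>n. (norm (ft g \<xi>))\<^sup>2 * gauss (\<xi> /\<^sub>R real (Suc n))) \<longlonglongrightarrow> (norm (ft g \<xi>))\<^sup>2" for \<xi>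
    using tendsto_mult_left[OF gauss_scaled_tendsto_1[of \<xi>], of "(norm (ft g \<xi>))\<^sup>2"] by simp
  show "integrable lborel (\<lambda>\<xi>. (norm (ft g \<xi>))\<^sup>2)"
    by (rule integrable_limit_bounded(1)[OF iu _ lim est]) auto
  show "(LBINT \<xi>. (norm (ft g \<xi>))\<^sup>2) \<le> (LBINT x. (norm (g x))\<^sup>2)"
    by (rule integrable_limit_bounded(2)[OF iu _ lim est]) auto
qed

section \<open>Truncated Riesz kernels\<close>

text \<open>One integrable function that dominates \<open>profile\<close>, \<open>profile\<close>
  multiplied by the norm of its argument, and the derivative of \<open>profile\<close> in every unit
  direction.\<close>

definition gauss_majorant :: "'a::euclidean_space \<Rightarrow> real" where
  "gauss_majorant w = (1 + 2 * pi * (w \<bullet> w)) * gauss w"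

lemma gauss_majorant_nonneg[simp]: "0 \<le> gauss_majorant w"
  unfolding gauss_majorant_def by (intro mult_nonneg_nonneg add_nonneg_nonneg) auto

lemma measurable_gauss_majorant[measurable]: "gauss_majorant \<in> borel_measurable borel"
  unfolding gauss_majorant_def by measurable

lemma gauss_majorant_le_2: "gauss_majorant w \<le> 2"
proof -
  let ?u = "pi * (w \<bullet> w)"
  have "1 + 2 * ?u \<le> 2 * exp ?u" using exp_ge_add_one_self[of ?u] by linarith
  then have "(1 + 2 * ?u) * exp (- ?u) \<le> 2 * exp ?u * exp (- ?u)" by (intro mult_right_mono) auto
  then show ?thesis by (simp add: gauss_majorant_def gauss_def mult.assoc exp_minus_inverse)
qed

lemma integrable_gauss_majorant: "integrable lborel (gauss_majorant :: 'a::euclidean_space \<Rightarrow> real)"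
proof (rule Bochner_Integration.integrable_bound[where f="\<lambda>w::'a. 4 * gauss ((1 / sqrt 2) *\<^sub>R w)"])
  show "integrable lborel (\<lambda>w::'a. 4 * gauss ((1 / sqrt 2) *\<^sub>R w))"
    by (intro integrable_mult_right integrable_scale integrable_gauss) simp
  show "AE w in lborel. norm (gauss_majorant (w :: 'a)) \<le> norm (4 * gauss ((1 / sqrt 2) *\<^sub>R w))"
  proof (rule AE_I2)
    fix w :: 'a
    let ?u = "pi * (w \<bullet> w)"
    have e: "exp (?u / 2) * exp (- ?u) = exp (- (?u / 2))" by (simp flip: exp_add)
    have "1 + 2 * ?u \<le> 4 * exp (?u / 2)" using exp_ge_add_one_self[of "?u / 2"] by linarith
    then have "(1 + 2 * ?u) * exp (- ?u) \<le> 4 * exp (?u / 2) * exp (- ?u)" by (intro mult_right_mono) auto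
    also have "... = 4 * exp (- (?u / 2))" by (simp only: mult.assoc e)
    also have "... = 4 * gauss ((1 / sqrt 2) *\<^sub>R w)" by (simp add: gauss_def)
    finally have "gauss_majorant w \<le> 4 * gauss ((1 / sqrt 2) *\<^sub>R w)" by (simp add: gauss_majorant_def gauss_def mult.assoc)
    then show "norm (gauss_majorant w) \<le> norm (4 * gauss ((1 / sqrt 2) *\<^sub>R w))" by simp
  qed
qed measurable

text \<open>The partial derivative of \<open>gauss\<close> in direction \<open>j\<close>, divided by
  -2 pi; hence its Fourier transform is again explicit.\<close>

definition profile :: "'a::euclidean_space \<Rightarrow> 'a \<Rightarrow> real" where
  "profile j x = (x \<bullet> j) * gauss x"

lemma measurable_profile[measurable]: "profile j \<in> borel_measurable borel"
  unfolding profile_def by measurable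

lemma norm_profile_le:
  assumes j: "j \<in> Basis"
  shows "\<bar>profile j w\<bar> \<le> gauss_majorant w" "norm w * \<bar>profile j w\<bar> \<le> gauss_majorant w"
proof -
  have 1: "\<bar>w \<bullet> j\<bar> \<le> norm w" using Basis_le_norm[OF j] by simp
  have 2: "norm w \<le> 1 + (w \<bullet> w)" unfolding dot_square_norm using sum_squares_bound[of "norm w" 1] by (simp add: power2_eq_square) (smt (verit) zero_le_square)
  have 3: "w \<bullet> w \<le> 2 * pi * (w \<bullet> w)"
    using pi_gt3 by (intro mult_right_mono[of 1 "2 * pi", simplified]) auto
  have "\<bar>w \<bullet> j\<bar> \<le> 1 + 2 * pi * (w \<bullet> w)" using 1 2 3 by linarith
  then show "\<bar>profile j w\<bar> \<le> gauss_majorant w"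
    unfolding profile_def gauss_majorant_def abs_mult by (simp add: mult_right_mono)
  have "norm w * \<bar>w \<bullet> j\<bar> \<le> norm w * norm w" using 1 by (intro mult_left_mono) auto
  also have "... = w \<bullet> w" by (simp add: dot_square_norm power2_eq_square)
  finally have "norm w * \<bar>w \<bullet> j\<bar> \<le> 1 + 2 * pi * (w \<bullet> w)" using 3 by linarith
  then show "norm w * \<bar>profile j w\<bar> \<le> gauss_majorant w"
    unfolding profile_def gauss_majorant_def abs_mult by (simp add: mult_right_mono mult.assoc[symmetric])
qed

text \<open>The fundamental theorem of calculus along the segment from \<open>x\<close> to
  \<open>x - h\<close>. Keeping the average over the segment, rather than a supremum, allows
  integration over \<open>x\<close> by Fubini in \<open>profile_L1_diff\<close>.\<close>

lemma profile_diff_le: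
  assumes j: "j \<in> Basis"
  shows "\<bar>profile j x - profile j (x - h)\<bar> \<le> norm h * (LBINT s. gauss_majorant (x - s *\<^sub>R h) * indicator {0..1} s)"
proof -
  define F where "F s = profile j (x - s *\<^sub>R h)" for s
  define f where "f s = (- (h \<bullet> j) + (((x - s *\<^sub>R h) \<bullet> j) * (2 * pi * ((x - s *\<^sub>R h) \<bullet> h)))) * gauss (x - s *\<^sub>R h)" for s
  have "(F has_real_derivative f s) (at s)" for s
  proof -
    have e: "F = (\<lambda>s. (x \<bullet> j - s * (h \<bullet> j)) * exp (- (pi * (x \<bullet> x - 2 * s * (x \<bullet> h) + s * s * (h \<bullet> h)))))"
      by (rule ext) (simp add: F_def profile_def gauss_def inner_diff_left inner_diff_right inner_commute[of h x] algebra_simps)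
    show ?thesis unfolding e f_def gauss_def
      by (auto intro!: derivative_eq_intros simp: inner_diff_left inner_diff_right inner_commute[of h x] algebra_simps)
  qed
  moreover have fc: "isCont f s" for s unfolding f_def by (intro continuous_intros)
  ultimately have "(LBINT s. f s * indicator {0..1} s) = F 1 - F 0"
    by (intro integral_FTC_Icc_real) auto
  then have "\<bar>profile j x - profile j (x - h)\<bar> = \<bar>LINT s|lborel. f s * indicator {0..1} s\<bar>"
    by (simp add: F_def)
  also have "... \<le> (LBINT s. \<bar>f s * indicator {0..1} s\<bar>)" by (rule integral_abs_bound)
  also have "... \<le> (LBINT s. norm h * (gauss_majorant (x - s *\<^sub>R h) * indicator {0..1} s))"
  proof (rule integral_mono_AE')
    have "integrable lborel (\<lambda>s. indicator {0..1} s *\<^sub>R gauss_majorant (x - s *\<^sub>R h))"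
      unfolding gauss_majorant_def by (intro borel_integrable_compact continuous_intros continuous_at_imp_continuous_on ballI isCont_gauss compact_Icc)
    then show "integrable lborel (\<lambda>s. norm h * (gauss_majorant (x - s *\<^sub>R h) * indicator {0..1} s))"
      by (simp add: mult.commute)
    show "AE s in lborel. \<bar>f s * indicator {0..1} s\<bar> \<le> norm h * (gauss_majorant (x - s *\<^sub>R h) * indicator {0..1} s)"
    proof (rule AE_I2)
      fix s
      let ?w = "x - s *\<^sub>R h"
      have hj: "\<bar>h \<bullet> j\<bar> \<le> norm h" "\<bar>?w \<bullet> j\<bar> \<le> norm ?w" using Basis_le_norm[OF j] by auto
      have wh: "\<bar>?w \<bullet> h\<bar> \<le> norm ?w * norm h" by (rule Cauchy_Schwarz_ineq2)
      have "\<bar>?w \<bullet> j\<bar> * (2 * pi * \<bar>?w \<bullet> h\<bar>) \<le> norm ?w * (2 * pi * (norm ?w * norm h))"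
        using hj wh by (intro mult_mono) auto
      also have "... = norm h * (2 * pi * (?w \<bullet> ?w))" by (simp add: dot_square_norm power2_eq_square)
      finally have "\<bar>- (h \<bullet> j) + ((?w \<bullet> j) * (2 * pi * (?w \<bullet> h)))\<bar> \<le> norm h + norm h * (2 * pi * (?w \<bullet> ?w))"
        using hj by (intro order_trans[OF abs_triangle_ineq] add_mono) (auto simp: abs_mult)
      then have "\<bar>f s\<bar> \<le> norm h * gauss_majorant ?w"
        unfolding f_def gauss_majorant_def abs_mult mult.assoc[symmetric] by (intro mult_mono) (auto simp: algebra_simps)
      then show "\<bar>f s * indicator {0..1} s\<bar> \<le> norm h * (gauss_majorant ?w * indicator {0..1} s)"
        by (auto simp: indicator_def)
    qed
  qed auto
  also have "... = norm h * (LBINT s. gauss_majorant (x - s *\<^sub>R h) * indicator {0..1} s)" by simp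
  finally show ?thesis .
qed

lemma profile_lipschitz:
  assumes j: "j \<in> Basis"
  shows "\<bar>profile j x - profile j y\<bar> \<le> 2 * norm (x - y)"
proof -
  have i: "integrable lborel (\<lambda>s. 2 * indicator {0..1::real} s :: real)" by simp
  have "(LBINT s. gauss_majorant (x - s *\<^sub>R (x - y)) * indicator {0..1} s) \<le> (LBINT s. 2 * indicator {0..1::real} s)"
    by (rule integral_mono_AE'[OF i]) (auto simp: gauss_majorant_le_2 indicator_def)
  also have "... = 2" by simp
  finally have "norm (x - y) * (LBINT s. gauss_majorant (x - s *\<^sub>R (x - y)) * indicator {0..1} s) \<le> norm (x - y) * 2"
    by (intro mult_left_mono) auto
  then show ?thesis using profile_diff_le[OF j, of x "x - y"] by simp
qed

lemma integrable_profile: "j \<in> Basis \<Longrightarrow> integrable lborel (profile j)"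
  unfolding profile_def by (rule integrable_inner_gauss)

lemma profile_L1_diff:
  fixes j :: "'a::euclidean_space"
  assumes j: "j \<in> Basis"
  shows "(LBINT x. \<bar>profile j x - profile j (x - h)\<bar>) \<le> norm h * (LBINT x. gauss_majorant (x :: 'a))"
proof -
  let ?A = "LINT x|lborel. gauss_majorant (x :: 'a)"
  have sh: "integrable lborel (\<lambda>x. gauss_majorant (x - s *\<^sub>R h))" for s
    by (simp add: integrable_lborel_shift integrable_gauss_majorant)
  have shI: "(LBINT x. gauss_majorant (x - s *\<^sub>R h)) = ?A" for s
    by (rule integral_lborel_shift)
  have i: "integrable (lborel \<Otimes>\<^sub>M lborel) (\<lambda>(s, x). gauss_majorant (x - s *\<^sub>R h) * indicator {0..1::real} s)"
    by (rule lborel_pair.Fubini_integrable) (use sh shI in \<open>auto simp: abs_mult\<close>)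
  have i': "integrable (lborel \<Otimes>\<^sub>M lborel) (\<lambda>(x, s). gauss_majorant (x - s *\<^sub>R h) * indicator {0..1::real} s)"
    using lborel_pair.integrable_product_swap[OF i] by (simp add: case_prod_unfold)
  have "(LBINT x. \<bar>profile j x - profile j (x - h)\<bar>) \<le>
     (LBINT x. norm h * (LBINT s. gauss_majorant (x - s *\<^sub>R h) * indicator {0..1} s))"
    using profile_diff_le[OF j] lborel_pair.integrable_fst[OF i']
    by (intro integral_mono integrable_mult_right integrable_abs Bochner_Integration.integrable_diff)
       (auto simp: integrable_lborel_shift integrable_profile[OF j])
  also have "... = norm h * (LBINT x. LBINT s. gauss_majorant (x - s *\<^sub>R h) * indicator {0..1} s)" by simp
  also have "(LBINT x. LBINT s. gauss_majorant (x - s *\<^sub>R h) * indicator {0..1} s) =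
     (LBINT s. LBINT x. gauss_majorant (x - s *\<^sub>R h) * indicator {0..1::real} s)"
    by (rule lborel_pair.Fubini_integral[OF i])
  also have "... = ?A" by (simp add: shI)
  finally show ?thesis .
qed

text \<open>A dilate of \<open>profile\<close>, weighted so that the integral over all
  \<open>v > 0\<close> is a constant times (y . j) / |y|^(d+1), by the substitution r = v
  |y|.\<close>

definition slice :: "'a::euclidean_space \<Rightarrow> real \<Rightarrow> 'a \<Rightarrow> real" where
  "slice j v y = v ^ DIM('a) * (y \<bullet> j) * gauss (v *\<^sub>R y)"

lemma integrable_indicator_Icc: "integrable lborel (indicator {a..b::real} :: real \<Rightarrow> real)"
  by (rule integrable_real_indicator) (simp_all add: emeasure_lborel_Icc_eq)

lemma measurable_slice[measurable]:
  "(\<lambda>(v, y). slice j v (y :: 'a::euclidean_space)) \<in> borel_measurable (borel \<Otimes>\<^sub>M borel)"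
  unfolding slice_def by measurable

lemma measurable_slice'[measurable (raw)]:
  assumes [measurable]: "f \<in> borel_measurable M" "g \<in> borel_measurable M"
  shows "(\<lambda>x. slice j (f x) (g x :: 'a::euclidean_space)) \<in> borel_measurable M"
  unfolding slice_def by measurable

lemma slice_eq: "v > 0 \<Longrightarrow> slice j v y = v ^ DIM('a) / v * profile j (v *\<^sub>R (y :: 'a::euclidean_space))"
  by (simp add: slice_def profile_def)

lemma integrable_slice:
  fixes j :: "'a::euclidean_space"
  assumes "j \<in> Basis" "v > 0"
  shows "integrable lborel (slice j v)"
proof -
  have "slice j v = (\<lambda>y. v ^ DIM('a) / v * profile j (v *\<^sub>R y))"
    using slice_eq[OF assms(2)] by (rule ext)
  moreover have "integrable lborel (\<lambda>y. v ^ DIM('a) / v * profile j (v *\<^sub>R y))"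
    by (intro integrable_mult_right integrable_scale integrable_profile) (use assms in auto)
  ultimately show ?thesis by (simp only:)
qed

text \<open>Dilation by \<open>v\<close> reduces every integral to one of \<open>profile\<close>.
  The moment bound decays as \<open>v\<close> grows while the difference bound stays finite as
  \<open>v\<close> tends to 0; this interplay makes the Hormander integral converge.\<close>

lemma
  fixes j :: "'a::euclidean_space"
  assumes j: "j \<in> Basis" and v: "v > 0"
  defines "A \<equiv> LINT x|lborel. gauss_majorant (x :: 'a)"
  shows slice_L1: "(LBINT x. \<bar>slice j v x\<bar>) \<le> A / v"
    and slice_moment: "(LBINT x. norm x * \<bar>slice j v x\<bar>) \<le> A / v\<^sup>2"
    and slice_L1_diff: "(LBINT x. \<bar>slice j v x - slice j v (x - h)\<bar>) \<le> A * norm h"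
    and integrable_slice_moment: "integrable lborel (\<lambda>x. norm x * \<bar>slice j v x\<bar>)"
proof -
  have im: "integrable lborel (\<lambda>x. norm x * \<bar>profile j x\<bar>)"
    by (rule Bochner_Integration.integrable_bound[OF integrable_gauss_majorant]) (use norm_profile_le(2)[OF j] in auto)
  have "(LBINT x. \<bar>slice j v x\<bar>) = v ^ DIM('a) / v * (LBINT x. \<bar>profile j (v *\<^sub>R x)\<bar>)"
    using v by (simp add: slice_eq abs_mult)
  also have "(LBINT x. \<bar>profile j (v *\<^sub>R x)\<bar>) = inverse (v ^ DIM('a)) * (LBINT x. \<bar>profile j x\<bar>)"
    using integral_lborel_affine[of v "\<lambda>x. \<bar>profile j x\<bar>" 0] v by simp
  also have "v ^ DIM('a) / v * (inverse (v ^ DIM('a)) * (LBINT x. \<bar>profile j x\<bar>)) = (LBINT x. \<bar>profile j x\<bar>) / v"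
    using v by (simp add: field_simps)
  also have "... \<le> A / v" unfolding A_def
    by (intro divide_right_mono integral_mono integrable_abs integrable_profile j integrable_gauss_majorant norm_profile_le) (use v in auto)
  finally show "(LBINT x. \<bar>slice j v x\<bar>) \<le> A / v" .
  have s: "norm x * \<bar>slice j v x\<bar> = v ^ DIM('a) / v\<^sup>2 * (norm (v *\<^sub>R x) * \<bar>profile j (v *\<^sub>R x)\<bar>)" for x
    using v by (simp add: slice_eq abs_mult power2_eq_square)
  show "integrable lborel (\<lambda>x. norm x * \<bar>slice j v x\<bar>)"
    unfolding s using integrable_scale[OF im, of v] v by (intro integrable_mult_right) auto
  have "(LBINT x. norm x * \<bar>slice j v x\<bar>) = v ^ DIM('a) / v\<^sup>2 * (LBINT x. norm (v *\<^sub>R x) * \<bar>profile j (v *\<^sub>R x)\<bar>)"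
    unfolding s by (rule integral_mult_right_zero)
  also have "(LBINT x. norm (v *\<^sub>R x) * \<bar>profile j (v *\<^sub>R x)\<bar>) = inverse (v ^ DIM('a)) * (LBINT x. norm x * \<bar>profile j x\<bar>)"
    using integral_lborel_affine[of v "\<lambda>x. norm x * \<bar>profile j x\<bar>" 0] v by simp
  also have "v ^ DIM('a) / v\<^sup>2 * (inverse (v ^ DIM('a)) * (LBINT x. norm x * \<bar>profile j x\<bar>)) = (LBINT x. norm x * \<bar>profile j x\<bar>) / v\<^sup>2"
    using v by (simp add: field_simps)
  also have "... \<le> A / v\<^sup>2" unfolding A_def
    by (intro divide_right_mono integral_mono im integrable_gauss_majorant norm_profile_le j) auto
  finally show "(LBINT x. norm x * \<bar>slice j v x\<bar>) \<le> A / v\<^sup>2" .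
  have "(LBINT x. \<bar>slice j v x - slice j v (x - h)\<bar>) = v ^ DIM('a) / v * (LBINT x. \<bar>profile j (v *\<^sub>R x) - profile j (v *\<^sub>R x - v *\<^sub>R h)\<bar>)"
    unfolding slice_eq[OF v] scaleR_diff_right right_diff_distrib[symmetric] abs_mult
    by (subst integral_mult_right_zero) (use v in simp)
  also have "(LBINT x. \<bar>profile j (v *\<^sub>R x) - profile j (v *\<^sub>R x - v *\<^sub>R h)\<bar>) = inverse (v ^ DIM('a)) * (LBINT x. \<bar>profile j x - profile j (x - v *\<^sub>R h)\<bar>)"
    using integral_lborel_affine[of v "\<lambda>x. \<bar>profile j x - profile j (x - v *\<^sub>R h)\<bar>" 0] v by simp
  also have "v ^ DIM('a) / v * (inverse (v ^ DIM('a)) * (LBINT x. \<bar>profile j x - profile j (x - v *\<^sub>R h)\<bar>)) = (LBINT x. \<bar>profile j x - profile j (x - v *\<^sub>R h)\<bar>) / v"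
    using v by (simp add: field_simps)
  also have "... \<le> (norm (v *\<^sub>R h) * A) / v"
    unfolding A_def using v by (intro divide_right_mono profile_L1_diff j) auto
  also have "... = A * norm h" using v by simp
  finally show "(LBINT x. \<bar>slice j v x - slice j v (x - h)\<bar>) \<le> A * norm h" .
qed

text \<open>Up to a constant, \<open>rkern j a b\<close> is the \<open>j\<close>-th Riesz kernel with frequencies outside
  (roughly) \<open>[a, b]\<close> removed; it is at the same time a Gaussian superposition, which gives its Fourier
  transform, and an average of differences of sharp truncations of the Riesz kernel.\<close>

definition rkern :: "'a::euclidean_space \<Rightarrow> real \<Rightarrow> real \<Rightarrow> 'a \<Rightarrow> real" where
  "rkern j a b y = (LBINT v. indicator {a..b} v * slice j v y)"

lemma measurable_rkern[measurable]: "rkern j a b \<in> borel_measurable borel"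
  unfolding rkern_def by measurable

lemma integrable_slice_v:
  "integrable lborel (\<lambda>v. indicator {a..b} v * slice j v (y :: 'a::euclidean_space))"
proof -
  have "integrable lborel (\<lambda>v. indicator {a..b} v *\<^sub>R slice j v y)"
    unfolding slice_def by (intro borel_integrable_compact continuous_intros continuous_at_imp_continuous_on ballI isCont_gauss compact_Icc)
  then show ?thesis by simp
qed

lemma slice_bounds:
  fixes j :: "'a::euclidean_space"
  assumes j: "j \<in> Basis" and v: "0 < v" "v \<le> b"
  shows "\<bar>slice j v y\<bar> \<le> 2 * (b ^ DIM('a) / b)" "\<bar>slice j v x - slice j v y\<bar> \<le> 2 * b ^ DIM('a) * norm (x - y)"
proof -
  \<comment> \<open>As the dimension is positive, \<open>v ^ DIM('a) / v\<close> is the power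
    \<open>v ^ m\<close> and therefore monotone in \<open>v\<close>, also for
    \<open>m = 0\<close>.\<close>
  obtain m where m: "DIM('a) = Suc m" using DIM_positive[where 'a='a] by (auto simp: gr0_conv_Suc)
  have vm: "v ^ DIM('a) / v \<le> b ^ DIM('a) / b" using v by (simp add: m power_mono)
  have "\<bar>slice j v y\<bar> = v ^ DIM('a) / v * \<bar>profile j (v *\<^sub>R y)\<bar>" using v by (simp add: slice_eq abs_mult)
  also have "... \<le> b ^ DIM('a) / b * 2"
    using vm norm_profile_le(1)[OF j, of "v *\<^sub>R y"] gauss_majorant_le_2[of "v *\<^sub>R y"] v by (intro mult_mono) auto
  finally show "\<bar>slice j v y\<bar> \<le> 2 * (b ^ DIM('a) / b)" by (simp only: mult.commute[of _ 2])
  have "\<bar>slice j v x - slice j v y\<bar> = v ^ DIM('a) / v * \<bar>profile j (v *\<^sub>R x) - profile j (v *\<^sub>R y)\<bar>"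
    unfolding slice_eq[OF v(1)] right_diff_distrib[symmetric] abs_mult using v by simp
  also have "... \<le> v ^ DIM('a) / v * (2 * norm (v *\<^sub>R x - v *\<^sub>R y))"
    using v by (intro mult_left_mono profile_lipschitz j) auto
  also have "... = 2 * v ^ DIM('a) * norm (x - y)" using v by (simp flip: scaleR_diff_right)
  also have "... \<le> 2 * b ^ DIM('a) * norm (x - y)" using v by (intro mult_right_mono mult_left_mono power_mono) auto
  finally show "\<bar>slice j v x - slice j v y\<bar> \<le> 2 * b ^ DIM('a) * norm (x - y)" .
qed

lemma
  fixes j :: "'a::euclidean_space"
  assumes j: "j \<in> Basis" and ab: "0 < a" "a \<le> b"
  shows rkern_bounded: "\<bar>rkern j a b y\<bar> \<le> 2 * (b ^ DIM('a) / b) * (b - a)"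
    and rkern_lipschitz: "\<bar>rkern j a b x - rkern j a b y\<bar> \<le> 2 * b ^ DIM('a) * (b - a) * norm (x - y)"
proof -
  have ic: "integrable lborel (\<lambda>v. c * indicator {a..b} v :: real)" for c
    by (intro integrable_mult_right integrable_indicator_Icc)
  have "\<bar>rkern j a b y\<bar> \<le> (LBINT v. \<bar>indicator {a..b} v * slice j v y\<bar>)"
    unfolding rkern_def by (rule integral_abs_bound)
  also have "... \<le> (LBINT v. 2 * (b ^ DIM('a) / b) * indicator {a..b} v)"
    using slice_bounds(1)[OF j, of _ b y] ab
    by (intro integral_mono ic integrable_abs integrable_slice_v) (auto simp: indicator_def)
  also have "... = 2 * (b ^ DIM('a) / b) * (b - a)" using ab by simp
  finally show "\<bar>rkern j a b y\<bar> \<le> 2 * (b ^ DIM('a) / b) * (b - a)" .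
  have "rkern j a b x - rkern j a b y = (LBINT v. indicator {a..b} v * slice j v x - indicator {a..b} v * slice j v y)"
    unfolding rkern_def by (intro Bochner_Integration.integral_diff[symmetric] integrable_slice_v)
  then have "\<bar>rkern j a b x - rkern j a b y\<bar> \<le> (LBINT v. \<bar>indicator {a..b} v * slice j v x - indicator {a..b} v * slice j v y\<bar>)"
    using integral_abs_bound by metis
  also have "... \<le> (LBINT v. 2 * b ^ DIM('a) * norm (x - y) * indicator {a..b} v)"
    using slice_bounds(2)[OF j, of _ b x y] ab
    by (intro integral_mono ic integrable_abs Bochner_Integration.integrable_diff integrable_slice_v) (auto simp: indicator_def)
  also have "... = 2 * b ^ DIM('a) * (b - a) * norm (x - y)" using ab by simp
  finally show "\<bar>rkern j a b x - rkern j a b y\<bar> \<le> 2 * b ^ DIM('a) * (b - a) * norm (x - y)" .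
qed

lemma isCont_rkern:
  assumes j: "j \<in> Basis" and ab: "0 < a" "a \<le> b"
  shows "isCont (rkern j a b) x"
proof -
  have "(\<lambda>y. rkern j a b y - rkern j a b x) \<midarrow>x\<rightarrow> 0"
  proof (rule Lim_null_comparison)
    show "\<forall>\<^sub>F y in at x. norm (rkern j a b y - rkern j a b x) \<le> 2 * b ^ DIM('a) * (b - a) * norm (y - x)"
      using rkern_lipschitz[OF assms] by (intro always_eventually allI) simp
    have "(\<lambda>y. 2 * b ^ DIM('a) * (b - a) * norm (y - x)) \<midarrow>x\<rightarrow> 2 * b ^ DIM('a) * (b - a) * norm (x - x)"
      by (intro tendsto_intros)
    then show "(\<lambda>y. 2 * b ^ DIM('a) * (b - a) * norm (y - x)) \<midarrow>x\<rightarrow> 0" by simp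
  qed
  then show ?thesis unfolding isCont_def by (rule LIM_zero_cancel)
qed

lemma integrable_slice_prod:
  fixes j :: "'a::euclidean_space"
  assumes j: "j \<in> Basis" and ab: "0 < a" "a \<le> b"
  shows "integrable (lborel \<Otimes>\<^sub>M lborel) (\<lambda>(v, x). indicator {a..b} v * slice j v x)"
proof (rule lborel_pair.Fubini_integrable)
  let ?A = "LINT x|lborel. gauss_majorant (x :: 'a)"
  show "integrable lborel (\<lambda>v. LINT x|lborel. norm (case (v, x) of (v, x) \<Rightarrow> indicator {a..b} v * slice j v x))"
  proof (rule Bochner_Integration.integrable_bound[where f="\<lambda>v. ?A / a * indicator {a..b} v"])
    show "AE v in lborel. norm (LBINT x. norm (case (v, x) of (v, x) \<Rightarrow> indicator {a..b} v * slice j v x)) \<le> norm (?A / a * indicator {a..b} v)"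
    proof (rule AE_I2)
      fix v
      have "v \<in> {a..b} \<Longrightarrow> ?A / v \<le> ?A / a" using ab by (intro divide_left_mono) (auto intro!: Bochner_Integration.integral_nonneg)
      then show "norm (LBINT x. norm (case (v, x) of (v, x) \<Rightarrow> indicator {a..b} v * slice j v x)) \<le> norm (?A / a * indicator {a..b} v)"
        using slice_L1[OF j, of v] ab by (auto simp: indicator_def abs_of_nonneg Bochner_Integration.integral_nonneg intro: order_trans)
    qed
    show "integrable lborel (\<lambda>v. ?A / a * indicator {a..b} v)" by (intro integrable_mult_right integrable_indicator_Icc)
  qed auto
  show "AE v in lborel. integrable lborel (\<lambda>x. case (v, x) of (v, x) \<Rightarrow> indicator {a..b} v * slice j v x)"
    using integrable_slice[OF j] ab by (intro AE_I2) (auto simp: indicator_def)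
qed measurable

lemma integrable_slice_prod':
  fixes j :: "'a::euclidean_space"
  assumes j: "j \<in> Basis" and ab: "0 < a" "a \<le> b"
  shows "integrable (lborel \<Otimes>\<^sub>M lborel) (\<lambda>(x, v). indicator {a..b} v * slice j v x)"
  using lborel_pair.integrable_product_swap[OF integrable_slice_prod[OF assms]] by (simp add: case_prod_unfold)

lemma integrable_rkern:
  assumes j: "j \<in> Basis" and ab: "0 < a" "a \<le> b"
  shows "integrable lborel (rkern j a b)"
  unfolding rkern_def using lborel_pair.integrable_fst[OF integrable_slice_prod'[OF assms]] .

text \<open>Hormander's condition with a constant independent of the truncation. For fixed
  \<open>v\<close> the integral is at most A s by the difference bound and at most 2 A / (v^2 s) by
  the moment bound, A being the integral of \<open>gauss_majorant\<close>. Together these are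
  dominated by a multiple of s / (1 + (s v)^2), whose integral over \<open>v\<close> is an
  arctangent.\<close>

lemma rkern_hormander:
  fixes j :: "'a::euclidean_space"
  assumes j: "j \<in> Basis" and ab: "0 < a" "a \<le> b" and h: "norm h \<le> s" "0 < s"
  shows "(LBINT x. indicator {x. 2 * s \<le> norm x} x * \<bar>rkern j a b x - rkern j a b (x - h)\<bar>) \<le>
    4 * pi * (LBINT x. gauss_majorant (x :: 'a))"
proof -
  let ?A = "LINT x|lborel. gauss_majorant (x :: 'a)"
  let ?S = "indicator {x :: 'a. 2 * s \<le> norm x} :: 'a \<Rightarrow> real"
  have A0: "0 \<le> ?A" by (intro Bochner_Integration.integral_nonneg) auto
  have [measurable]: "{x :: 'a. 2 * s \<le> norm x} \<in> sets borel" by measurable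
  have p1: "integrable (lborel \<Otimes>\<^sub>M lborel) (\<lambda>(v, x). indicator {a..b} v * slice j v (x - h))"
  proof -
    have "integrable (lborel \<Otimes>\<^sub>M lborel) (\<lambda>z. (\<lambda>(v, x). indicator {a..b} v * slice j v x) z)"
      using integrable_slice_prod[OF j ab] by simp
    show ?thesis
    proof (rule lborel_pair.Fubini_integrable)
      have "(LBINT x. \<bar>slice j v (x - h)\<bar>) = (LBINT x. \<bar>slice j v x\<bar>)" for v
        by (rule integral_lborel_shift[of "\<lambda>x. \<bar>slice j v x\<bar>"])
      then show "integrable lborel (\<lambda>v. LINT x|lborel. norm (case (v, x) of (v, x) \<Rightarrow> indicator {a..b} v * slice j v (x - h)))"
        using lborel_pair.integrable_fst[of "\<lambda>v x. norm (indicator {a..b} v * slice j v x)"] integrable_norm[OF integrable_slice_prod[OF j ab]]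
        by (simp add: case_prod_unfold abs_mult)
      show "AE v in lborel. integrable lborel (\<lambda>x. case (v, x) of (v, x) \<Rightarrow> indicator {a..b} v * slice j v (x - h))"
        using integrable_slice[OF j] ab by (intro AE_I2) (auto simp: indicator_def integrable_lborel_shift)
    qed measurable
  qed
  define G where "G v x = ?S x * (indicator {a..b} v * \<bar>slice j v x - slice j v (x - h)\<bar>)" for v x
  have G: "integrable (lborel \<Otimes>\<^sub>M lborel) (\<lambda>(v, x). G v x)"
  proof (rule Bochner_Integration.integrable_bound[OF Bochner_Integration.integrable_add[OF integrable_norm[OF integrable_slice_prod[OF j ab]] integrable_norm[OF p1]]])
    show "AE z in lborel \<Otimes>\<^sub>M lborel. norm (case z of (v, x) \<Rightarrow> G v x) \<le>
       norm (norm (case z of (v, x) \<Rightarrow> indicator {a..b} v * slice j v x) + norm (case z of (v, x) \<Rightarrow> indicator {a..b} v * slice j v (x - h)))"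
      by (intro AE_I2) (auto simp: G_def indicator_def split: prod.split)
  qed (unfold G_def, measurable)
  have G': "integrable (lborel \<Otimes>\<^sub>M lborel) (\<lambda>(x, v). G v x)"
    using lborel_pair.integrable_product_swap[OF G] by (simp add: case_prod_unfold)
  have "(LBINT x. ?S x * \<bar>rkern j a b x - rkern j a b (x - h)\<bar>) \<le> (LBINT x. LBINT v. G v x)"
  proof (rule integral_mono)
    show "integrable lborel (\<lambda>x. LINT v|lborel. G v x)" using lborel_pair.integrable_fst[OF G'] .
    show "integrable lborel (\<lambda>x. ?S x * \<bar>rkern j a b x - rkern j a b (x - h)\<bar>)"
    proof (rule Bochner_Integration.integrable_bound[where f="\<lambda>x. \<bar>rkern j a b x - rkern j a b (x - h)\<bar>"])
      show "integrable lborel (\<lambda>x. \<bar>rkern j a b x - rkern j a b (x - h)\<bar>)"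
        by (intro integrable_abs Bochner_Integration.integrable_diff) (auto simp: integrable_lborel_shift integrable_rkern[OF j ab])
    qed (auto simp: indicator_def)
    fix x
    have "rkern j a b x - rkern j a b (x - h) = (LBINT v. indicator {a..b} v * slice j v x - indicator {a..b} v * slice j v (x - h))"
      unfolding rkern_def by (intro Bochner_Integration.integral_diff[symmetric] integrable_slice_v)
    then have "\<bar>rkern j a b x - rkern j a b (x - h)\<bar> \<le> (LBINT v. \<bar>indicator {a..b} v * slice j v x - indicator {a..b} v * slice j v (x - h)\<bar>)"
      using integral_abs_bound by metis
    also have "(\<lambda>v. \<bar>indicator {a..b} v * slice j v x - indicator {a..b} v * slice j v (x - h)\<bar>) = (\<lambda>v. indicator {a..b} v * \<bar>slice j v x - slice j v (x - h)\<bar>)"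
      by (rule ext) (auto simp: indicator_def)
    finally have "?S x * \<bar>rkern j a b x - rkern j a b (x - h)\<bar> \<le> ?S x * (LBINT v. indicator {a..b} v * \<bar>slice j v x - slice j v (x - h)\<bar>)"
      by (intro mult_left_mono) auto
    then show "?S x * \<bar>rkern j a b x - rkern j a b (x - h)\<bar> \<le> (LBINT v. G v x)"
      unfolding G_def by simp
  qed
  also have "... = (LBINT v. LBINT x. G v x)" by (rule lborel_pair.Fubini_integral[OF G])
  also have "... \<le> (LBINT v. 4 * ?A * (s / (1 + (s * v)\<^sup>2) * indicator {a..b} v))"
  proof (rule integral_mono)
    show "integrable lborel (\<lambda>v. LINT x|lborel. G v x)" using lborel_pair.integrable_fst[OF G] .
    have "integrable lborel (\<lambda>v. indicator {a..b} v *\<^sub>R (s / (1 + (s * v)\<^sup>2)))"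
      by (intro borel_integrable_compact continuous_intros compact_Icc) (smt (verit) zero_le_power2)
    then show "integrable lborel (\<lambda>v. 4 * ?A * (s / (1 + (s * v)\<^sup>2) * indicator {a..b} v))"
      by (intro integrable_mult_right) (simp add: mult.commute)
    fix v
    show "(LBINT x. G v x) \<le> 4 * ?A * (s / (1 + (s * v)\<^sup>2) * indicator {a..b} v)"
    proof (cases "v \<in> {a..b}")
      case True
      then have v: "v > 0" using ab by auto
      have idiff: "integrable lborel (\<lambda>x. \<bar>slice j v x - slice j v (x - h)\<bar>)"
        using integrable_slice[OF j v] by (intro integrable_abs Bochner_Integration.integrable_diff) (auto simp: integrable_lborel_shift)
      have [measurable]: "G v \<in> borel_measurable borel" unfolding G_def by measurable
      have iG: "integrable lborel (G v)"
        by (rule Bochner_Integration.integrable_bound[OF idiff]) (auto simp: G_def indicator_def)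
      have "(LBINT x. G v x) \<le> (LBINT x. \<bar>slice j v x - slice j v (x - h)\<bar>)"
        by (rule integral_mono[OF iG idiff]) (auto simp: G_def indicator_def)
      also have "... \<le> ?A * norm h" by (rule slice_L1_diff[OF j v])
      also have "... \<le> ?A * s" using h A0 by (intro mult_left_mono)
      finally have b1: "(LBINT x. G v x) \<le> ?A * s" .
      have "(LBINT x. G v x) \<le> (LBINT x. (norm x * \<bar>slice j v x\<bar> + norm (x - h) * \<bar>slice j v (x - h)\<bar>) / s)"
      proof (rule integral_mono[OF iG])
        show "integrable lborel (\<lambda>x. (norm x * \<bar>slice j v x\<bar> + norm (x - h) * \<bar>slice j v (x - h)\<bar>) / s)"
          using integrable_slice_moment[OF j v] integrable_lborel_shift[of "\<lambda>x. norm x * \<bar>slice j v x\<bar>" h]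
          by (intro integrable_divide Bochner_Integration.integrable_add) auto
        fix x
        have "G v x * s \<le> norm x * \<bar>slice j v x\<bar> + norm (x - h) * \<bar>slice j v (x - h)\<bar>"
        proof (cases "2 * s \<le> norm x")
          case T: True
          \<comment> \<open>Both points are at distance at least \<open>s\<close> from the origin,
            so each kernel value may be weighted by its distance divided by \<open>s\<close>; this
            brings in the first moments.\<close>
          have "norm x \<ge> s" "norm (x - h) \<ge> s" using T h norm_triangle_ineq2[of x h] by auto
          then have "s * \<bar>slice j v x\<bar> + s * \<bar>slice j v (x - h)\<bar> \<le> norm x * \<bar>slice j v x\<bar> + norm (x - h) * \<bar>slice j v (x - h)\<bar>"
            by (intro add_mono mult_right_mono) auto
          moreover have "s * \<bar>slice j v x - slice j v (x - h)\<bar> \<le> s * (\<bar>slice j v x\<bar> + \<bar>slice j v (x - h)\<bar>)"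
            using h by (intro mult_left_mono) auto
          ultimately show ?thesis using T True by (simp add: G_def algebra_simps)
        qed (auto simp: G_def)
        then show "G v x \<le> (norm x * \<bar>slice j v x\<bar> + norm (x - h) * \<bar>slice j v (x - h)\<bar>) / s"
          using h by (simp add: pos_le_divide_eq)
      qed
      also have "... = 2 * (LBINT x. norm x * \<bar>slice j v x\<bar>) / s"
        using integrable_slice_moment[OF j v] integrable_lborel_shift[of "\<lambda>x. norm x * \<bar>slice j v x\<bar>" h]
          integral_lborel_shift[of "\<lambda>x. norm x * \<bar>slice j v x\<bar>" h] by simp
      also have "... \<le> 2 * (?A / v\<^sup>2) / s" using h
        by (intro divide_right_mono mult_left_mono slice_moment[OF j v]) auto
      finally have b2: "(LBINT x. G v x) \<le> 2 * (?A / v\<^sup>2) / s" .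
      \<comment> \<open>Adding the first bound to \<open>(s * v)\<^sup>2\<close> times the second
        merges them into one function integrable in \<open>v\<close>.\<close>
      have pos: "0 < 1 + (s * v)\<^sup>2" by (simp add: add_pos_nonneg)
      have "(LBINT x. G v x) * (1 + (s * v)\<^sup>2) = (LBINT x. G v x) + (LBINT x. G v x) * (s * v)\<^sup>2" by (simp add: distrib_left)
      also have "... \<le> ?A * s + 2 * (?A / v\<^sup>2) / s * (s * v)\<^sup>2"
        using b1 b2 by (intro add_mono mult_right_mono) auto
      also have "... = 3 * ?A * s" using v h by (simp add: power2_eq_square)
      also have "... \<le> 4 * ?A * s" using A0 h by (intro mult_right_mono) auto
      finally have "(LBINT x. G v x) \<le> 4 * ?A * s / (1 + (s * v)\<^sup>2)" using pos by (simp add: pos_le_divide_eq)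
      then show ?thesis using True by simp
    qed (auto simp: G_def)
  qed
  also have "... = 4 * ?A * (LBINT v. s / (1 + (s * v)\<^sup>2) * indicator {a..b} v)"
    by (rule integral_mult_right_zero)
  also have "(LBINT v. s / (1 + (s * v)\<^sup>2) * indicator {a..b} v) = arctan (s * b) - arctan (s * a)"
  proof (rule integral_FTC_Icc_real[OF ab(2)])
    show "((\<lambda>v. arctan (s * v)) has_real_derivative s / (1 + (s * x)\<^sup>2)) (at x)" for x
      by (auto intro!: derivative_eq_intros simp: field_simps)
    show "isCont (\<lambda>v. s / (1 + (s * v)\<^sup>2)) x" for x
      by (intro continuous_intros) (smt (verit) zero_le_power2)
  qed
  \<comment> \<open>The range of the arctangent has length pi, whence a bound free of
    \<open>a\<close>, \<open>b\<close> and \<open>s\<close>.\<close>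
  also have "4 * ?A * (arctan (s * b) - arctan (s * a)) \<le> 4 * ?A * pi"
    using A0 arctan_ubound[of "s * b"] arctan_lbound[of "s * a"] by (intro mult_left_mono) auto
  finally show ?thesis by (simp add: mult_ac)
qed

section \<open>The Fourier multipliers of the truncated kernels\<close>

definition rmult :: "'a::euclidean_space \<Rightarrow> real \<Rightarrow> real \<Rightarrow> 'a \<Rightarrow> real" where
  "rmult j a b \<xi> = (LBINT v. indicator {a..b} v * ((\<xi> \<bullet> j) / v\<^sup>2 * gauss (\<xi> /\<^sub>R v)))"

lemma measurable_rmult[measurable]: "rmult j a b \<in> borel_measurable borel"
  unfolding rmult_def by measurable

lemma ft_slice:
  fixes j :: "'a::euclidean_space"
  assumes j: "j \<in> Basis" and v: "v > 0"
  shows "ft (\<lambda>x. complex_of_real (slice j v x)) \<xi> = - \<i> * ((\<xi> \<bullet> j) / v\<^sup>2 * gauss (\<xi> /\<^sub>R v))"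
proof -
  have "ft (\<lambda>x. complex_of_real (slice j v x)) \<xi> = complex_of_real (v ^ DIM('a) / v) * ft (\<lambda>x. complex_of_real (profile j (v *\<^sub>R x))) \<xi>"
    unfolding ft_def slice_eq[OF v] of_real_mult mult.assoc by (rule integral_mult_right_zero)
  also have "ft (\<lambda>x. complex_of_real (profile j (v *\<^sub>R x))) \<xi> = complex_of_real (inverse (v ^ DIM('a))) * ft (\<lambda>x. complex_of_real (profile j x)) (\<xi> /\<^sub>R v)"
    by (rule ft_scale[OF v])
  also have "ft (\<lambda>x. complex_of_real (profile j x)) (\<xi> /\<^sub>R v) = - \<i> * ((\<xi> /\<^sub>R v) \<bullet> j) * gauss (\<xi> /\<^sub>R v)"
    unfolding profile_def by (rule ft_inner_gauss[OF j])
  finally show ?thesis using v by (simp add: field_simps power2_eq_square)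
qed

lemma ft_rkern:
  fixes j :: "'a::euclidean_space"
  assumes j: "j \<in> Basis" and ab: "0 < a" "a \<le> b"
  shows "ft (\<lambda>x. complex_of_real (rkern j a b x)) \<xi> = - \<i> * rmult j a b \<xi>"
proof -
  have i: "integrable (lborel \<Otimes>\<^sub>M lborel) (\<lambda>(v, x). complex_of_real (indicator {a..b} v * slice j v x) * ee (- (\<xi> \<bullet> x)))"
    by (rule Bochner_Integration.integrable_bound[OF integrable_slice_prod[OF j ab]])
       (auto simp: norm_mult split: prod.split)
  have "ft (\<lambda>x. complex_of_real (rkern j a b x)) \<xi> = (LBINT x. LBINT v. complex_of_real (indicator {a..b} v * slice j v x) * ee (- (\<xi> \<bullet> x)))"
    unfolding ft_def rkern_def by (simp only: integral_mult_left_zero integral_complex_of_real)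
  also have "... = (LBINT v. LBINT x. complex_of_real (indicator {a..b} v * slice j v x) * ee (- (\<xi> \<bullet> x)))"
    by (rule lborel_pair.Fubini_integral[OF i])
  also have "... = (LBINT v. - \<i> * complex_of_real (indicator {a..b} v * ((\<xi> \<bullet> j) / v\<^sup>2 * gauss (\<xi> /\<^sub>R v))))"
  proof (intro Bochner_Integration.integral_cong refl)
    fix v
    show "(LBINT x. complex_of_real (indicator {a..b} v * slice j v x) * ee (- (\<xi> \<bullet> x))) =
      - \<i> * complex_of_real (indicator {a..b} v * ((\<xi> \<bullet> j) / v\<^sup>2 * gauss (\<xi> /\<^sub>R v)))"
      using ft_slice[OF j, of v \<xi>] ab by (cases "v \<in> {a..b}") (auto simp: ft_def)
  qed
  also have "... = - \<i> * rmult j a b \<xi>"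
    unfolding rmult_def by (simp only: integral_mult_right_zero integral_complex_of_real)
  finally show ?thesis .
qed

definition gauss_primitive :: "real \<Rightarrow> real" where
  "gauss_primitive s = (LBINT r. indicator {0..s} r * gauss r)"

text \<open>The limit of \<open>gauss_primitive\<close> at infinity; it bounds all the multipliers
  and is the factor of the direction cosine in their limit.\<close>

definition half_gauss :: real where
  "half_gauss = (LBINT r. indicator {0..} r * gauss (r::real))"

lemma integrable_indicator_gauss: "S \<in> sets borel \<Longrightarrow> integrable lborel (\<lambda>r. indicator S r * gauss (r::real))"
  by (rule Bochner_Integration.integrable_bound[OF integrable_gauss_real]) (auto simp: indicator_def)

lemma gauss_primitive_bounds: "0 \<le> gauss_primitive s" "gauss_primitive s \<le> half_gauss" "s \<ge> 0 \<Longrightarrow> gauss_primitive s \<le> s"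
proof -
  show "0 \<le> gauss_primitive s" unfolding gauss_primitive_def by (intro Bochner_Integration.integral_nonneg) auto
  show "gauss_primitive s \<le> half_gauss" unfolding gauss_primitive_def half_gauss_def
    by (intro integral_mono integrable_indicator_gauss) (auto simp: indicator_def)
  assume s: "s \<ge> 0"
  have "gauss_primitive s \<le> (LBINT r. indicator {0..s} r)" unfolding gauss_primitive_def
    by (intro integral_mono integrable_indicator_gauss integrable_indicator_Icc) (auto simp: indicator_def gauss_le_1)
  then show "gauss_primitive s \<le> s" using s by simp
qed

lemma half_gauss_pos: "half_gauss > 0"
proof -
  have "0 < exp (- pi)" by simp
  also have "... = (LBINT r. exp (- pi) * indicator {0..1::real} r)" by simp
  also have "... \<le> half_gauss" unfolding half_gauss_def
  proof (intro integral_mono integrable_indicator_gauss)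
    show "integrable lborel (\<lambda>r. exp (- pi) * indicator {0..1::real} r)"
      by (intro integrable_mult_right integrable_indicator_Icc)
    show "exp (- pi) * indicator {0..1} r \<le> indicator {0..} r * gauss r" for r :: real
      using mult_mono[of r 1 r 1] by (auto simp: indicator_def gauss_def mult_le_cancel_left1)
  qed auto
  finally show ?thesis .
qed

lemma gauss_primitive_deriv:
  assumes "s > 0"
  shows "(gauss_primitive has_real_derivative gauss s) (at s)"
proof -
  have c: "continuous_on S (gauss :: real \<Rightarrow> real)" for S
    unfolding gauss_def by (intro continuous_intros)
  have e: "gauss_primitive x = integral {0..x} gauss" for x
  proof -
    have "set_integrable lborel {0..x} (gauss :: real \<Rightarrow> real)"
      unfolding set_integrable_def using integrable_indicator_gauss[of "{0..x}"] by simp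
    from set_borel_integral_eq_integral(2)[OF this] show ?thesis
      by (simp add: gauss_primitive_def set_lebesgue_integral_def)
  qed
  have "((\<lambda>x. integral {0..x} gauss) has_real_derivative gauss s) (at s within {0..s+1})"
    by (rule integral_has_real_derivative[OF c]) (use assms in auto)
  then have "((\<lambda>x. integral {0..x} gauss) has_real_derivative gauss s) (at s)"
    using assms by (subst (asm) at_within_interior) auto
  then show ?thesis unfolding e[abs_def] .
qed

text \<open>Apart from the direction cosine, the integrand is the derivative of
  \<open>- gauss_primitive (norm \<xi> / v)\<close> in \<open>v\<close>. The difference of two
  values of a function with range in [0, \<open>half_gauss\<close>] explains both the uniform bound
  and the limit.\<close>

lemma rmult_eq:
  assumes ab: "0 < a" "a \<le> b" and x: "\<xi> \<noteq> 0"
  shows "rmult j a b \<xi> = (\<xi> \<bullet> j) / norm \<xi> * (gauss_primitive (norm \<xi> / a) - gauss_primitive (norm \<xi> / b))"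
proof -
  let ?t = "norm \<xi>"
  have t: "?t > 0" using x by simp
  let ?f = "\<lambda>v. ?t / v\<^sup>2 * gauss (?t / v)"
  have "(LBINT v. ?f v * indicator {a..b} v) = - gauss_primitive (?t / b) - (- gauss_primitive (?t / a))"
  proof (rule integral_FTC_Icc_real[OF ab(2)])
    fix v assume v: "a \<le> v" "v \<le> b"
    then have v0: "v > 0" using ab by simp
    have d1: "((\<lambda>v. ?t / v) has_real_derivative - (?t / v\<^sup>2)) (at v)"
      using v0 by (auto intro!: derivative_eq_intros simp: power2_eq_square field_simps)
    have "((\<lambda>v. gauss_primitive (?t / v)) has_real_derivative gauss (?t / v) * - (?t / v\<^sup>2)) (at v)"
      by (rule DERIV_chain2[OF gauss_primitive_deriv d1]) (use v0 t in simp)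
    then show "((\<lambda>v. - gauss_primitive (?t / v)) has_real_derivative ?f v) (at v)"
      by (auto intro!: derivative_eq_intros)
    show "isCont ?f v" using v0 by (intro continuous_intros) auto
  qed
  moreover have "rmult j a b \<xi> = (LBINT v. (\<xi> \<bullet> j) / ?t * (?f v * indicator {a..b} v))"
    unfolding rmult_def
  proof (intro Bochner_Integration.integral_cong refl)
    fix v :: real
    have "gauss (\<xi> /\<^sub>R v) = gauss (?t / v)"
      by (simp add: gauss_def dot_square_norm power2_eq_square field_simps)
    then show "indicator {a..b} v * ((\<xi> \<bullet> j) / v\<^sup>2 * gauss (\<xi> /\<^sub>R v)) = (\<xi> \<bullet> j) / ?t * (?f v * indicator {a..b} v)"
      using t by simp
  qed
  ultimately show ?thesis by (subst (asm) integral_mult_right_zero) simp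
qed

lemma rmult_0: "rmult j a b 0 = 0"
  by (simp add: rmult_def)

lemma abs_rmult_le:
  assumes j: "j \<in> Basis" and ab: "0 < a" "a \<le> b"
  shows "\<bar>rmult j a b \<xi>\<bar> \<le> half_gauss"
proof (cases "\<xi> = 0")
  case True then show ?thesis using half_gauss_pos by (simp add: rmult_0)
next
  case False
  have "\<bar>(\<xi> \<bullet> j) / norm \<xi>\<bar> \<le> 1" using Basis_le_norm[OF j, of \<xi>] False by simp
  moreover have "\<bar>gauss_primitive (norm \<xi> / a) - gauss_primitive (norm \<xi> / b)\<bar> \<le> half_gauss"
    using gauss_primitive_bounds[of "norm \<xi> / a"] gauss_primitive_bounds[of "norm \<xi> / b"] by linarith
  ultimately have "\<bar>(\<xi> \<bullet> j) / norm \<xi>\<bar> * \<bar>gauss_primitive (norm \<xi> / a) - gauss_primitive (norm \<xi> / b)\<bar> \<le> 1 * half_gauss"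
    by (intro mult_mono) auto
  then show ?thesis using rmult_eq[OF ab False] by (simp add: abs_mult)
qed

lemma rmult_tendsto:
  "(\<lambda>n. rmult j (1 / real (Suc n)) (real (Suc n)) \<xi>) \<longlonglongrightarrow> half_gauss * ((\<xi> \<bullet> j) / norm \<xi>)"
proof (cases "\<xi> = 0")
  \<comment> \<open>At the origin division by zero makes the direction cosine 0, in agreement with
    \<open>rmult_0\<close>.\<close>
  case True then show ?thesis by (simp add: rmult_0)
next
  case False
  let ?t = "norm \<xi>"
  have t: "?t > 0" using False by simp
  have "(\<lambda>n. ?t / real (Suc n)) \<longlonglongrightarrow> 0" using LIMSEQ_Suc[OF lim_const_over_n[of ?t]] .
  then have l1: "(\<lambda>n. gauss_primitive (?t / real (Suc n))) \<longlonglongrightarrow> 0"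
    by (rule tendsto_sandwich[OF _ _ tendsto_const, rotated 2]) (auto simp: gauss_primitive_bounds)
  have l2: "(\<lambda>n. gauss_primitive (?t * real (Suc n))) \<longlonglongrightarrow> half_gauss"
    unfolding gauss_primitive_def half_gauss_def
  proof (rule integral_dominated_convergence[where w="gauss"])
    show "AE r in lborel. (\<lambda>n. indicator {0..?t * real (Suc n)} r * gauss r) \<longlonglongrightarrow> indicator {0..} r * gauss r"
    proof (rule AE_I2)
      fix r :: real
      obtain N :: nat where N: "r / ?t \<le> real N" using real_arch_simple by blast
      have "\<forall>\<^sub>F n in sequentially. indicator {0..} r * gauss r = indicator {0..?t * real (Suc n)} r * gauss r"
        unfolding eventually_sequentially
      proof (intro exI[of _ N] allI impI)
        fix n assume "N \<le> n"
        then have "r / ?t \<le> real (Suc n)" using N by simp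
        then have "r \<le> ?t * real (Suc n)" using t by (simp add: pos_divide_le_eq mult.commute del: of_nat_Suc)
        then show "indicator {0..} r * gauss r = indicator {0..?t * real (Suc n)} r * gauss r"
          by (simp add: indicator_def del: of_nat_Suc)
      qed
      then show "(\<lambda>n. indicator {0..?t * real (Suc n)} r * gauss r) \<longlonglongrightarrow> indicator {0..} r * gauss r"
        by (rule Lim_transform_eventually[OF tendsto_const])
    qed
    show "AE r in lborel. norm (indicator {0..?t * real (Suc n)} r * gauss r) \<le> gauss r" for n
      by (intro AE_I2) (auto simp: indicator_def)
  qed auto
  have "(\<lambda>n. (\<xi> \<bullet> j) / ?t * (gauss_primitive (?t * real (Suc n)) - gauss_primitive (?t / real (Suc n)))) \<longlonglongrightarrow> (\<xi> \<bullet> j) / ?t * (half_gauss - 0)"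
    by (intro tendsto_intros l1 l2)
  moreover have "rmult j (1 / real (Suc n)) (real (Suc n)) \<xi> = (\<xi> \<bullet> j) / ?t * (gauss_primitive (?t * real (Suc n)) - gauss_primitive (?t / real (Suc n)))" for n
  proof -
    have "1 \<le> real (Suc n)" by simp
    then have "1 / real (Suc n) \<le> real (Suc n)"
      by (metis dual_order.trans divide_le_eq_1_pos zero_less_one less_le_trans)
    then show ?thesis by (subst rmult_eq[OF _ _ False]) (simp_all del: of_nat_Suc)
  qed
  ultimately show ?thesis by (simp add: mult.commute del: of_nat_Suc)
qed

text \<open>For \<open>v\<close> in \<open>[a, b]\<close> the Gaussian factor is at most the one at
  \<open>b\<close>, so the multiplier has Gaussian decay. Its integrability allows Fourier inversion
  for \<open>rkern\<close>.\<close>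

lemma integrable_rmult:
  assumes j: "j \<in> Basis" and ab: "0 < a" "a \<le> b"
  shows "integrable lborel (rmult j a b)"
proof -
  have b: "b > 0" using ab by simp
  have "integrable lborel (\<lambda>\<xi>. (b - a) / a\<^sup>2 * (b * \<bar>profile j (inverse b *\<^sub>R \<xi>)\<bar>))"
    using b by (intro integrable_mult_right integrable_abs integrable_scale integrable_profile j) auto
  then show ?thesis
  proof (rule Bochner_Integration.integrable_bound)
    show "AE \<xi> in lborel. norm (rmult j a b \<xi>) \<le> norm ((b - a) / a\<^sup>2 * (b * \<bar>profile j (inverse b *\<^sub>R \<xi>)\<bar>))"
    proof (rule AE_I2)
      fix \<xi>
      have "\<bar>rmult j a b \<xi>\<bar> \<le> (LBINT v. \<bar>indicator {a..b} v * ((\<xi> \<bullet> j) / v\<^sup>2 * gauss (\<xi> /\<^sub>R v))\<bar>)"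
        unfolding rmult_def by (rule integral_abs_bound)
      also have "... \<le> (LBINT v. (b * \<bar>profile j (inverse b *\<^sub>R \<xi>)\<bar>) / a\<^sup>2 * indicator {a..b} v)"
      proof (rule integral_mono_AE')
        show "integrable lborel (\<lambda>v. (b * \<bar>profile j (inverse b *\<^sub>R \<xi>)\<bar>) / a\<^sup>2 * indicator {a..b} v)"
          by (intro integrable_mult_right integrable_indicator_Icc)
        show "AE v in lborel. \<bar>indicator {a..b} v * ((\<xi> \<bullet> j) / v\<^sup>2 * gauss (\<xi> /\<^sub>R v))\<bar> \<le> (b * \<bar>profile j (inverse b *\<^sub>R \<xi>)\<bar>) / a\<^sup>2 * indicator {a..b} v"
        proof (rule AE_I2)
          fix v
          show "\<bar>indicator {a..b} v * ((\<xi> \<bullet> j) / v\<^sup>2 * gauss (\<xi> /\<^sub>R v))\<bar> \<le> (b * \<bar>profile j (inverse b *\<^sub>R \<xi>)\<bar>) / a\<^sup>2 * indicator {a..b} v"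
          proof (cases "v \<in> {a..b}")
            case True
            then have v: "a \<le> v" "v \<le> b" "0 < v" using ab by auto
            have "inverse b * inverse b \<le> inverse v * inverse v"
              using v b by (intro mult_mono le_imp_inverse_le) auto
            then have "(inverse b * inverse b) * (\<xi> \<bullet> \<xi>) \<le> (inverse v * inverse v) * (\<xi> \<bullet> \<xi>)" by (rule mult_right_mono) simp
            then have g: "gauss (\<xi> /\<^sub>R v) \<le> gauss (\<xi> /\<^sub>R b)"
              by (simp add: gauss_def mult.assoc)
            have "a\<^sup>2 \<le> v\<^sup>2" using v ab by (intro power_mono) auto
            then have "\<bar>\<xi> \<bullet> j\<bar> / v\<^sup>2 \<le> \<bar>\<xi> \<bullet> j\<bar> / a\<^sup>2" using v ab by (intro divide_left_mono) auto
            then have "\<bar>\<xi> \<bullet> j\<bar> / v\<^sup>2 * gauss (\<xi> /\<^sub>R v) \<le> \<bar>\<xi> \<bullet> j\<bar> / a\<^sup>2 * gauss (\<xi> /\<^sub>R b)"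
              using g by (intro mult_mono) auto
            moreover have "b * \<bar>profile j (inverse b *\<^sub>R \<xi>)\<bar> = \<bar>\<xi> \<bullet> j\<bar> * gauss (\<xi> /\<^sub>R b)"
            proof -
              have "\<bar>profile j (inverse b *\<^sub>R \<xi>)\<bar> = inverse b * (\<bar>\<xi> \<bullet> j\<bar> * gauss (\<xi> /\<^sub>R b))"
                using b by (simp add: profile_def abs_mult)
              then show ?thesis using b by simp
            qed
            ultimately show ?thesis using True by (simp add: abs_mult)
          qed auto
        qed
      qed (use b in auto)
      also have "... = (b - a) / a\<^sup>2 * (b * \<bar>profile j (inverse b *\<^sub>R \<xi>)\<bar>)" using ab by simp
      finally show "norm (rmult j a b \<xi>) \<le> norm ((b - a) / a\<^sup>2 * (b * \<bar>profile j (inverse b *\<^sub>R \<xi>)\<bar>))"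
        unfolding real_norm_def by (rule order_trans[OF _ abs_ge_self])
    qed
  qed measurable
qed

section \<open>Uniform L^2 bound for the truncated transforms\<close>

definition rtrunc :: "'a::euclidean_space \<Rightarrow> real \<Rightarrow> real \<Rightarrow> ('a \<Rightarrow> complex) \<Rightarrow> 'a \<Rightarrow> complex" where
  "rtrunc j a b g x = (LBINT y. g y * complex_of_real (rkern j a b (x - y)))"

lemma measurable_rtrunc[measurable (raw)]:
  assumes [measurable]: "g \<in> borel_measurable borel"
  shows "rtrunc j a b g \<in> borel_measurable borel"
  unfolding rtrunc_def by measurable

lemma
  assumes j: "j \<in> Basis" and ab: "0 < a" "a \<le> b" and g: "integrable lborel g"
  shows integrable_rtrunc_integrand: "integrable lborel (\<lambda>y. g y * complex_of_real (rkern j a b (x - y)))"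
    and integrable_rtrunc: "integrable lborel (rtrunc j a b g)"
proof -
  have [measurable]: "g \<in> borel_measurable borel" using g by auto
  show "integrable lborel (\<lambda>y. g y * complex_of_real (rkern j a b (x - y)))"
    by (rule integrable_mult_bounded(1)[OF g]) (use rkern_bounded[OF j ab] in auto)
  show "integrable lborel (rtrunc j a b g)"
    unfolding rtrunc_def by (intro integrable_convolution_fst g integrable_of_real integrable_rkern j ab)
qed

lemma integrable_norm_square:
  fixes g :: "'a::euclidean_space \<Rightarrow> complex"
  assumes g: "integrable lborel g" and B: "\<And>x. norm (g x) \<le> B"
  shows "integrable lborel (\<lambda>x. (norm (g x))\<^sup>2)"
proof (rule Bochner_Integration.integrable_bound[where f="\<lambda>x. B * norm (g x)"])
  show "AE x in lborel. norm ((norm (g x))\<^sup>2) \<le> norm (B * norm (g x))"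
    using B by (intro AE_I2) (auto simp: power2_eq_square abs_mult intro!: mult_right_mono order_trans[OF B])
qed (use g in auto)

text \<open>The convolution is the inverse transform of \<open>ft g\<close> times a multiplier
  bounded by \<open>half_gauss\<close>. Pairing it with itself on the Fourier side, splitting the
  product into squares and applying Bessel's inequality to \<open>g\<close> and to the convolution
  \<open>W\<close> leaves half of the square norm of \<open>W\<close> on the right.\<close>

lemma
  fixes g :: "'a::euclidean_space \<Rightarrow> complex"
  assumes j: "j \<in> Basis" and ab: "0 < a" "a \<le> b" and g: "integrable lborel g" and B: "\<And>x. norm (g x) \<le> B"
  shows rtrunc_square_integrable: "integrable lborel (\<lambda>x. (norm (rtrunc j a b g x))\<^sup>2)"
    and rtrunc_L2: "(LBINT x. (norm (rtrunc j a b g x))\<^sup>2) \<le> half_gauss\<^sup>2 * (LBINT x. (norm (g x))\<^sup>2)"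
proof -
  have [measurable]: "g \<in> borel_measurable borel" using g by auto
  let ?K = "\<lambda>x. complex_of_real (rkern j a b x)"
  let ?C = "2 * (b ^ DIM('a) / b) * (b - a)"
  define W where "W = rtrunc j a b g"
  define m where "m \<xi> = - \<i> * complex_of_real (rmult j a b \<xi>)" for \<xi>
  have [measurable]: "m \<in> borel_measurable borel" unfolding m_def by measurable
  have m: "integrable lborel m" unfolding m_def by (intro integrable_mult_right integrable_of_real integrable_rmult j ab)
  have m_le: "norm (m \<xi>) \<le> half_gauss" for \<xi> using abs_rmult_le[OF j ab, of \<xi>] by (simp add: m_def norm_mult)
  have ftK: "ft ?K = m" unfolding m_def by (rule ext) (rule ft_rkern[OF j ab])
  have iK: "integrable lborel ?K" by (intro integrable_of_real integrable_rkern j ab)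
  have Kinv: "(LBINT \<xi>. m \<xi> * ee (\<xi> \<bullet> x)) = ?K x" for x
  proof -
    have "(LBINT \<xi>. ft ?K \<xi> * ee (\<xi> \<bullet> x)) = ?K x"
    proof (rule fourier_inversion[OF iK])
      show "norm (?K x) \<le> ?C" for x using rkern_bounded[OF j ab, of x] by simp
      show "isCont ?K x" by (intro continuous_intros isCont_rkern[OF j ab])
      show "integrable lborel (ft ?K)" using m by (simp add: ftK)
    qed
    then show ?thesis by (simp add: ftK)
  qed
  have W: "integrable lborel W" unfolding W_def by (rule integrable_rtrunc[OF j ab g])
  then have [measurable]: "W \<in> borel_measurable borel" by auto
  have C0: "0 \<le> ?C" using ab by simp
  have WB: "norm (W x) \<le> ?C * (LBINT y. norm (g y))" for x
  proof -
    have "norm (W x) \<le> (LBINT y. norm (g y * ?K (x - y)))" unfolding W_def rtrunc_def by (rule integral_norm_bound)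
    also have "... \<le> (LBINT y. ?C * norm (g y))"
    proof (intro integral_mono integrable_norm integrable_rtrunc_integrand j ab g)
      fix y
      have "norm (g y) * norm (?K (x - y)) \<le> norm (g y) * ?C"
        using rkern_bounded[OF j ab, of "x - y"] by (intro mult_left_mono) auto
      then show "norm (g y * ?K (x - y)) \<le> ?C * norm (g y)" by (simp add: norm_mult mult.commute)
    qed (intro integrable_mult_right integrable_norm g)
    finally show ?thesis by simp
  qed
  note Wsq = integrable_norm_square[OF W WB]
  then show "integrable lborel (\<lambda>x. (norm (rtrunc j a b g x))\<^sup>2)" by (simp add: W_def)
  define p where "p \<xi> = ft g \<xi> * m \<xi>" for \<xi>
  note [measurable] = measurable_ft[OF g] measurable_ft[OF W]
  have p: "integrable lborel p" unfolding p_def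
    by (rule integrable_mult_bounded(2)[OF m, where B="LINT x|lborel. norm (g x)"]) (auto simp: norm_ft_le)
  have Wp: "W x = (LBINT \<xi>. p \<xi> * ee (\<xi> \<bullet> x))" for x
  proof -
    have "(LBINT \<xi>. ft g \<xi> * (m \<xi> * ee (x \<bullet> \<xi>))) = (LBINT y. g y * ft (\<lambda>\<xi>. m \<xi> * ee (x \<bullet> \<xi>)) y)"
      by (rule ft_multiplication_formula[OF g integrable_mult_ee(1)[OF m]])
    also have "... = (LBINT y. g y * ?K (x - y))"
    proof (intro Bochner_Integration.integral_cong refl arg_cong2[where f="(*)"])
      fix y
      show "ft (\<lambda>\<xi>. m \<xi> * ee (x \<bullet> \<xi>)) y = ?K (x - y)"
        unfolding ft_modulate unfolding Kinv[symmetric] ft_def by (simp add: inner_diff_left inner_diff_right inner_commute)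
    qed
    finally show ?thesis by (simp add: W_def rtrunc_def p_def inner_commute mult.assoc)
  qed
  have iN: "integrable (lborel \<Otimes>\<^sub>M lborel) (\<lambda>(x, \<xi>). cnj (W x) * p \<xi> * ee (\<xi> \<bullet> x))"
    by (rule integrable_prod_bounded[where B=1]) (use W p in auto)
  have "complex_of_real (LBINT x. (norm (W x))\<^sup>2) = (LBINT x. cnj (W x) * W x)"
    by (subst integral_complex_of_real[symmetric], intro Bochner_Integration.integral_cong refl)
       (simp add: complex_norm_square[unfolded of_real_power] mult_ac)
  also have "... = (LBINT x. LBINT \<xi>. cnj (W x) * p \<xi> * ee (\<xi> \<bullet> x))"
  proof (intro Bochner_Integration.integral_cong refl)
    fix x
    show "cnj (W x) * W x = (LBINT \<xi>. cnj (W x) * p \<xi> * ee (\<xi> \<bullet> x))"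
      by (subst (2) Wp) (simp add: mult.assoc)
  qed
  also have "... = (LBINT \<xi>. LBINT x. cnj (W x) * p \<xi> * ee (\<xi> \<bullet> x))"
    by (rule lborel_pair.Fubini_integral[OF iN, symmetric])
  also have "... = (LBINT \<xi>. p \<xi> * cnj (ft W \<xi>))"
  proof (intro Bochner_Integration.integral_cong refl)
    fix \<xi>
    have "(LBINT x. cnj (W x) * p \<xi> * ee (\<xi> \<bullet> x)) = (LBINT x. p \<xi> * cnj (W x * ee (- (\<xi> \<bullet> x))))"
      by (simp add: mult_ac)
    also have "... = p \<xi> * (LBINT x. cnj (W x * ee (- (\<xi> \<bullet> x))))" by (rule integral_mult_right_zero)
    also have "... = p \<xi> * cnj (ft W \<xi>)" unfolding ft_def by (simp only: Bochner_Integration.integral_cnj)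
    finally show "(LBINT x. cnj (W x) * p \<xi> * ee (\<xi> \<bullet> x)) = p \<xi> * cnj (ft W \<xi>)" .
  qed
  finally have "norm (complex_of_real (LBINT x. (norm (W x))\<^sup>2)) \<le> (LBINT \<xi>. norm (p \<xi> * cnj (ft W \<xi>)))"
    by (simp only: integral_norm_bound)
  also have "... \<le> (LBINT \<xi>. (half_gauss\<^sup>2 * (norm (ft g \<xi>))\<^sup>2 + (norm (ft W \<xi>))\<^sup>2) / 2)"
  proof (rule integral_mono_AE')
    show "integrable lborel (\<lambda>\<xi>. (half_gauss\<^sup>2 * (norm (ft g \<xi>))\<^sup>2 + (norm (ft W \<xi>))\<^sup>2) / 2)"
      using bessel_inequality(1)[OF g B] bessel_inequality(1)[OF W WB] by simp
    show "AE \<xi> in lborel. norm (p \<xi> * cnj (ft W \<xi>)) \<le> (half_gauss\<^sup>2 * (norm (ft g \<xi>))\<^sup>2 + (norm (ft W \<xi>))\<^sup>2) / 2"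
    proof (rule AE_I2)
      fix \<xi>
      have "norm (p \<xi> * cnj (ft W \<xi>)) \<le> (half_gauss * norm (ft g \<xi>)) * norm (ft W \<xi>)"
        using m_le[of \<xi>] by (auto simp: p_def norm_mult mult.commute[of half_gauss] intro!: mult_right_mono mult_left_mono)
      also have "... \<le> ((half_gauss * norm (ft g \<xi>))\<^sup>2 + (norm (ft W \<xi>))\<^sup>2) / 2"
        using sum_squares_bound[of "half_gauss * norm (ft g \<xi>)" "norm (ft W \<xi>)"] by simp
      finally show "norm (p \<xi> * cnj (ft W \<xi>)) \<le> (half_gauss\<^sup>2 * (norm (ft g \<xi>))\<^sup>2 + (norm (ft W \<xi>))\<^sup>2) / 2"
        by (simp add: power_mult_distrib)
    qed
  qed auto
  also have "... = (half_gauss\<^sup>2 * (LBINT \<xi>. (norm (ft g \<xi>))\<^sup>2) + (LBINT \<xi>. (norm (ft W \<xi>))\<^sup>2)) / 2"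
    using bessel_inequality(1)[OF g B] bessel_inequality(1)[OF W WB] by simp
  also have "... \<le> (half_gauss\<^sup>2 * (LBINT x. (norm (g x))\<^sup>2) + (LBINT x. (norm (W x))\<^sup>2)) / 2"
    by (intro divide_right_mono add_mono mult_left_mono bessel_inequality(2)[OF g B] bessel_inequality(2)[OF W WB]) auto
  \<comment> \<open>The square norm of \<open>W\<close> is a finite number, so its half on the right
    is absorbed into the left side.\<close>
  finally have "(LBINT x. (norm (W x))\<^sup>2) \<le> (half_gauss\<^sup>2 * (LBINT x. (norm (g x))\<^sup>2) + (LBINT x. (norm (W x))\<^sup>2)) / 2"
    by (simp only: norm_of_real)
  then show "(LBINT x. (norm (rtrunc j a b g x))\<^sup>2) \<le> half_gauss\<^sup>2 * (LBINT x. (norm (g x))\<^sup>2)"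
    by (simp add: W_def)
qed

text \<open>Substitute r = v |y|. For a fixed \<open>r\<close> the condition that it lies in the
  interval says that |y| lies between r / b and r / a, so this is an average over \<open>r\<close>
  of the Riesz factor restricted to annuli.\<close>

lemma rkern_eq_truncations:
  fixes y :: "'a::euclidean_space"
  assumes y: "y \<noteq> 0"
  shows "rkern j a b y = (y \<bullet> j) / norm y ^ (DIM('a) + 1) *
    (LBINT r. indicator {a * norm y..b * norm y} r * (r ^ DIM('a) * gauss r))"
proof -
  let ?t = "norm y"
  have t: "?t > 0" using y by simp
  have "(LBINT r. indicator {a * ?t..b * ?t} r * (r ^ DIM('a) * gauss r)) =
     ?t * (LBINT v. indicator {a * ?t..b * ?t} (0 + ?t * v) * ((0 + ?t * v) ^ DIM('a) * gauss (0 + ?t * v)))"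
    using lborel_integral_real_affine[of ?t "\<lambda>r. indicator {a * ?t..b * ?t} r * (r ^ DIM('a) * gauss r)" 0] t by simp
  also have "(\<lambda>v. indicator {a * ?t..b * ?t} (0 + ?t * v) * ((0 + ?t * v) ^ DIM('a) * gauss (0 + ?t * v))) =
     (\<lambda>v. ?t ^ DIM('a) * (indicator {a..b} v * (v ^ DIM('a) * gauss (v *\<^sub>R y))))"
  proof (rule ext)
    fix v
    have "gauss (?t * v) = gauss (v *\<^sub>R y)" by (simp add: gauss_def dot_square_norm power2_eq_square mult_ac)
    moreover have "indicator {a * ?t..b * ?t} (?t * v) = (indicator {a..b} v :: real)"
      using t by (auto simp: indicator_def mult.commute[of ?t])
    ultimately show "indicator {a * ?t..b * ?t} (0 + ?t * v) * ((0 + ?t * v) ^ DIM('a) * gauss (0 + ?t * v)) =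
      ?t ^ DIM('a) * (indicator {a..b} v * (v ^ DIM('a) * gauss (v *\<^sub>R y)))"
      by (simp add: power_mult_distrib)
  qed
  also have "(LBINT v. ?t ^ DIM('a) * (indicator {a..b} v * (v ^ DIM('a) * gauss (v *\<^sub>R y)))) =
     ?t ^ DIM('a) * (LBINT v. indicator {a..b} v * (v ^ DIM('a) * gauss (v *\<^sub>R y)))"
    by (rule integral_mult_right_zero)
  finally have I: "(LBINT r. indicator {a * ?t..b * ?t} r * (r ^ DIM('a) * gauss r)) =
     ?t ^ (DIM('a) + 1) * (LBINT v. indicator {a..b} v * (v ^ DIM('a) * gauss (v *\<^sub>R y)))" by simp
  have "rkern j a b y = (LBINT v. (y \<bullet> j) * (indicator {a..b} v * (v ^ DIM('a) * gauss (v *\<^sub>R y))))"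
    unfolding rkern_def slice_def by (intro Bochner_Integration.integral_cong refl) (simp add: mult_ac)
  also have "... = (y \<bullet> j) * (LBINT v. indicator {a..b} v * (v ^ DIM('a) * gauss (v *\<^sub>R y)))"
    by (rule integral_mult_right_zero)
  finally show ?thesis unfolding I using t by simp
qed

section \<open>The weak type inequality\<close>

lemma One_nth: "(One :: real^'d) $ i = 1"
proof -
  have "(One :: real^'d) \<bullet> axis i 1 = 1"
    by (simp add: inner_sum_left inner_Basis axis_in_Basis_iff sum.delta)
  then show ?thesis by (simp add: inner_axis)
qed

lemma sum_Basis_nth[simp]: "(\<Sum>x\<in>(Basis :: (real^'d) set). x $ i) = 1"
  using One_nth[of i] by (simp only: sum_component)

lemma emeasure_cube: "s \<ge> 0 \<Longrightarrow> emeasure lborel (cbox p (p + s *\<^sub>R One) :: 'a::euclidean_space set) = ennreal (s ^ DIM('a))"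
  by (subst emeasure_lborel_cbox) (auto simp: inner_simps)

lemma
  fixes p :: "real^'d"
  assumes s: "s > 0"
  defines "Q \<equiv> {y. \<forall>i. p $ i \<le> y $ i \<and> y $ i < p $ i + s}"
  shows sets_half_open_cube: "Q \<in> sets borel"
    and emeasure_half_open_cube: "emeasure lborel Q = ennreal (s ^ CARD('d))"
proof -
  have "Q = {y\<in>space borel. \<forall>i\<in>UNIV. p $ i \<le> y $ i \<and> y $ i < p $ i + s}" by (auto simp: Q_def)
  also have "... \<in> sets borel" by measurable
  finally show Q: "Q \<in> sets borel" .
  have "Q \<subseteq> cbox p (p + s *\<^sub>R One)" by (auto simp: Q_def mem_box_cart less_imp_le)
  then have u: "emeasure lborel Q \<le> ennreal (s ^ CARD('d))"
    using emeasure_cube[of s p] s emeasure_mono[of Q "cbox p (p + s *\<^sub>R One)" lborel] by simp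
  have "box p (p + s *\<^sub>R One) \<subseteq> Q" by (auto simp: Q_def mem_box_cart less_imp_le)
  moreover have "emeasure lborel (box p (p + s *\<^sub>R One)) = ennreal (s ^ CARD('d))"
    using s by (subst emeasure_lborel_box) (auto simp: inner_simps)
  ultimately have "ennreal (s ^ CARD('d)) \<le> emeasure lborel Q"
    using emeasure_mono[of "box p (p + s *\<^sub>R One)" Q lborel] Q by simp
  with u show "emeasure lborel Q = ennreal (s ^ CARD('d))" by (rule antisym)
qed

definition hormander_const :: "'a::euclidean_space itself \<Rightarrow> real" where
  "hormander_const _ = 4 * pi * (LBINT x. gauss_majorant (x :: 'a))"

lemma hormander_const_nonneg: "0 \<le> hormander_const TYPE('a::euclidean_space)"
  unfolding hormander_const_def by (intro mult_nonneg_nonneg Bochner_Integration.integral_nonneg) auto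

text \<open>\<open>D\<close> is the truncated transform of a unit mass at \<open>x\<close> minus the
  same mass spread uniformly over \<open>Q\<close>. It is the average over \<open>y\<close> in
  \<open>Q\<close> of differences of two translated kernels, so Hormander's condition with
  \<open>h = y - x\<close> applies on a set \<open>S\<close> far from \<open>x\<close>.\<close>

lemma
  fixes j x :: "'a::euclidean_space"
  assumes j: "j \<in> Basis" and ab: "0 < a" "a \<le> b"
    and [measurable]: "Q \<in> sets borel" "S \<in> sets borel" and Qfin: "emeasure lborel Q = ennreal \<mu>" and \<mu>: "\<mu> > 0"
    and \<rho>: "\<rho> > 0" and Q: "\<And>y. y \<in> Q \<Longrightarrow> norm (y - x) \<le> \<rho>" and S: "\<And>z. z \<in> S \<Longrightarrow> 2 * \<rho> \<le> norm (z - x)"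
  defines "D \<equiv> \<lambda>z. rkern j a b (z - x) - (LBINT y. indicator Q y * rkern j a b (z - y)) / \<mu>"
  shows integrable_rkern_atom: "integrable lborel D"
    and rkern_atom_le: "(LBINT z. indicator S z * \<bar>D z\<bar>) \<le> hormander_const TYPE('a)"
proof -
  let ?K = "rkern j a b"
  have iQ: "integrable lborel (indicator Q :: 'a \<Rightarrow> real)"
    by (rule integrable_real_indicator) (use Qfin in auto)
  have mQ: "(LBINT y. indicator Q y) = \<mu>" using Qfin \<mu> by (simp add: measure_def)
  have iKs: "integrable lborel (\<lambda>z. ?K (z - y))" for y by (simp add: integrable_lborel_shift integrable_rkern[OF j ab])
  have ic: "integrable (lborel \<Otimes>\<^sub>M lborel) (\<lambda>(z, y). indicator Q y * ?K (z - y))"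
    by (rule integrable_convolution[OF iQ integrable_rkern[OF j ab]])
  show D: "integrable lborel D" unfolding D_def
    using lborel_pair.integrable_fst[OF ic] iKs by (intro Bochner_Integration.integrable_diff integrable_divide) auto
  have iQK: "integrable lborel (\<lambda>y. indicator Q y * ?K (z - y))" for z
  proof (rule Bochner_Integration.integrable_bound[OF integrable_mult_right[OF iQ]])
    show "AE y in lborel. norm (indicator Q y * ?K (z - y)) \<le> norm (2 * (b ^ DIM('a) / b) * (b - a) * indicator Q y)"
      by (intro AE_I2) (use order_trans[OF rkern_bounded[OF j ab] abs_ge_self] in \<open>auto simp: indicator_def simp del: times_divide_eq_right times_divide_eq_left\<close>)
  qed measurable
  define G where "G z y = indicator S z * (indicator Q y * \<bar>?K (z - x) - ?K (z - y)\<bar>)" for z y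
  have [measurable]: "(\<lambda>(z, y). G z y) \<in> borel_measurable (borel \<Otimes>\<^sub>M borel)" unfolding G_def by measurable
  have Gy: "integrable lborel (\<lambda>z. G z y)" for y
  proof (rule Bochner_Integration.integrable_bound[where f="\<lambda>z. \<bar>?K (z - x) - ?K (z - y)\<bar>"])
    show "integrable lborel (\<lambda>z. \<bar>?K (z - x) - ?K (z - y)\<bar>)" using iKs by (intro integrable_abs Bochner_Integration.integrable_diff)
  qed (auto simp: G_def indicator_def)
  have GI: "(LBINT z. G z y) \<le> hormander_const TYPE('a) * indicator Q y" for y
  proof (cases "y \<in> Q")
    case True
    let ?E = "\<lambda>z. indicator {z. 2 * \<rho> \<le> norm z} z * \<bar>?K z - ?K (z - (y - x))\<bar>"
    have iE: "integrable lborel ?E"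
    proof (rule Bochner_Integration.integrable_bound[where f="\<lambda>z. \<bar>?K z - ?K (z - (y - x))\<bar>"])
      show "integrable lborel (\<lambda>z. \<bar>?K z - ?K (z - (y - x))\<bar>)"
        using iKs[of 0] iKs[of "y - x"] by (intro integrable_abs Bochner_Integration.integrable_diff) auto
    qed (auto simp: indicator_def)
    have "(LBINT z. G z y) \<le> (LBINT z. ?E (z - x))"
    proof (rule integral_mono[OF Gy])
      show "integrable lborel (\<lambda>z. ?E (z - x))" using iE by (subst integrable_lborel_shift)
      fix z
      show "G z y \<le> ?E (z - x)" using S[of z] by (auto simp: G_def indicator_def)
    qed
    also have "... = (LBINT z. ?E z)" by (rule integral_lborel_shift)
    also have "... \<le> hormander_const TYPE('a)"
      unfolding hormander_const_def by (rule rkern_hormander[OF j ab Q[OF True] \<rho>])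
    finally show ?thesis using True by simp
  qed (auto simp: G_def)
  have G: "integrable (lborel \<Otimes>\<^sub>M lborel) (\<lambda>(y, z). G z y)"
  proof (rule lborel_pair.Fubini_integrable)
    show "integrable lborel (\<lambda>y. LINT z|lborel. norm (case (y, z) of (y, z) \<Rightarrow> G z y))"
    proof (rule Bochner_Integration.integrable_bound[OF integrable_mult_right[OF iQ, where c="hormander_const TYPE('a)"]])
      show "AE y in lborel. norm (LBINT z. norm (case (y, z) of (y, z) \<Rightarrow> G z y)) \<le> norm (hormander_const TYPE('a) * indicator Q y)"
      proof (rule AE_I2)
        fix y
        have G0: "\<bar>G z y\<bar> = G z y" for z by (simp add: G_def)
        have "0 \<le> (LBINT z. G z y)" by (intro Bochner_Integration.integral_nonneg) (simp add: G_def)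
        then show "norm (LBINT z. norm (case (y, z) of (y, z) \<Rightarrow> G z y)) \<le> norm (hormander_const TYPE('a) * indicator Q y)"
          using GI[of y] by (simp add: G0)
      qed
    qed measurable
  qed (use Gy in auto)
  have G': "integrable (lborel \<Otimes>\<^sub>M lborel) (\<lambda>(z, y). G z y)"
    using lborel_pair.integrable_product_swap[OF G] by (simp add: case_prod_unfold)
  have "(LBINT z. indicator S z * \<bar>D z\<bar>) \<le> (LBINT z. (LBINT y. G z y) / \<mu>)"
  proof (rule integral_mono)
    show "integrable lborel (\<lambda>z. (LBINT y. G z y) / \<mu>)" using lborel_pair.integrable_fst[OF G'] by simp
    show "integrable lborel (\<lambda>z. indicator S z * \<bar>D z\<bar>)"
      by (rule Bochner_Integration.integrable_bound[OF D]) (use D in \<open>auto simp: indicator_def\<close>)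
    fix z
    have "D z = (LBINT y. indicator Q y * ?K (z - x) - indicator Q y * ?K (z - y)) / \<mu>"
      using iQ iQK \<mu> mQ by (simp add: D_def diff_divide_distrib)
    then have "\<bar>D z\<bar> = \<bar>LINT y|lborel. indicator Q y * ?K (z - x) - indicator Q y * ?K (z - y)\<bar> / \<mu>" using \<mu> by simp
    also have "... \<le> (LBINT y. \<bar>indicator Q y * ?K (z - x) - indicator Q y * ?K (z - y)\<bar>) / \<mu>"
      using \<mu> by (intro divide_right_mono integral_abs_bound) auto
    also have "(\<lambda>y. \<bar>indicator Q y * ?K (z - x) - indicator Q y * ?K (z - y)\<bar>) = (\<lambda>y. indicator Q y * \<bar>?K (z - x) - ?K (z - y)\<bar>)"
      by (rule ext) (auto simp: indicator_def)
    finally have "indicator S z * \<bar>D z\<bar> \<le> indicator S z * ((LBINT y. indicator Q y * \<bar>?K (z - x) - ?K (z - y)\<bar>) / \<mu>)"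
      by (intro mult_left_mono) auto
    then show "indicator S z * \<bar>D z\<bar> \<le> (LBINT y. G z y) / \<mu>" by (simp add: G_def)
  qed
  also have "... = (LBINT z. LBINT y. G z y) / \<mu>" by simp
  also have "(LBINT z. LBINT y. G z y) = (LBINT y. LBINT z. G z y)"
    by (rule lborel_pair.Fubini_integral[OF G])
  also have "(LBINT y. LBINT z. G z y) / \<mu> \<le> (LBINT y. hormander_const TYPE('a) * indicator Q y) / \<mu>"
    using \<mu> GI iQ lborel_pair.integrable_fst[OF G] by (intro divide_right_mono integral_mono integrable_mult_right) auto
  also have "... = hormander_const TYPE('a)" using \<mu> mQ by simp
  finally show "(LBINT z. indicator S z * \<bar>D z\<bar>) \<le> hormander_const TYPE('a)" .
qed

section \<open>Calderon-Zygmund decomposition by dyadic cubes\<close>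

definition cube_index :: "real \<Rightarrow> nat \<Rightarrow> real^'d \<Rightarrow> int^'d" where
  "cube_index L m y = (\<chi> i. \<lfloor>y $ i / (L / 2 ^ m)\<rfloor>)"

text \<open>Halving commutes with rounding down, as integer division by 2, so the index at a finer
  level determines those at all coarser levels: dyadic cubes are nested.\<close>

lemma cube_index_coarser:
  assumes "cube_index L (m + k) y = cube_index L (m + k) z"
  shows "cube_index L m y = cube_index L m z"
  using assms
proof (induction k)
  case (Suc k)
  have half: "\<lfloor>t / 2\<rfloor> = \<lfloor>t\<rfloor> div 2" for t :: real
  proof (rule floor_unique)
    have "\<lfloor>t\<rfloor> = 2 * (\<lfloor>t\<rfloor> div 2) + \<lfloor>t\<rfloor> mod 2" by simp
    then have e: "real_of_int \<lfloor>t\<rfloor> = 2 * real_of_int (\<lfloor>t\<rfloor> div 2) + real_of_int (\<lfloor>t\<rfloor> mod 2)" by linarith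
    have m: "0 \<le> \<lfloor>t\<rfloor> mod 2" "\<lfloor>t\<rfloor> mod 2 \<le> 1" by auto
    then have m': "0 \<le> real_of_int (\<lfloor>t\<rfloor> mod 2)" "real_of_int (\<lfloor>t\<rfloor> mod 2) \<le> 1" by linarith+
    show "real_of_int (\<lfloor>t\<rfloor> div 2) \<le> t / 2" using e m' of_int_floor_le[of t] by linarith
    show "t / 2 < real_of_int (\<lfloor>t\<rfloor> div 2) + 1" using e m' floor_correct[of t] by linarith
  qed
  have "cube_index L (m + k) y = (\<chi> i. cube_index L (Suc (m + k)) y $ i div 2)" for y :: "real^'d"
    unfolding cube_index_def by (simp add: vec_eq_iff half[symmetric] field_simps)
  then show ?case using Suc by (metis add_Suc_right)
qed simp

text \<open>A stopping rule: each point takes the largest dyadic cube around it whose mass exceeds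
  \<open>\<tau>\<close> times its volume. Small cubes around a point of positive mass do exceed it,
  so the rule always stops. The parent of a chosen cube does not exceed it, which gives the factor
  \<open>2 ^ CARD('d)\<close>; nestedness makes the chosen cubes disjoint.\<close>

lemma calderon_zygmund_cubes:
  fixes x :: "'i \<Rightarrow> real^'d" and w :: "'i \<Rightarrow> real"
  assumes I: "finite I" and w: "\<And>i. i \<in> I \<Longrightarrow> w i > 0" and \<tau>: "\<tau> > 0"
  obtains s :: "nat \<times> (int^'d) \<Rightarrow> real" and Q :: "nat \<times> (int^'d) \<Rightarrow> (real^'d) set" and p :: "nat \<times> (int^'d) \<Rightarrow> real^'d"
    and key :: "'i \<Rightarrow> nat \<times> (int^'d)"
  where "\<And>q. s q > 0" "\<And>q. Q q = {y. \<forall>i. p q $ i \<le> y $ i \<and> y $ i < p q $ i + s q}"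
    "\<And>i. i \<in> I \<Longrightarrow> x i \<in> Q (key i)"
    "\<And>i i' y. i \<in> I \<Longrightarrow> i' \<in> I \<Longrightarrow> y \<in> Q (key i) \<Longrightarrow> y \<in> Q (key i') \<Longrightarrow> key i = key i'"
    "\<And>q. q \<in> key ` I \<Longrightarrow> \<tau> * s q ^ CARD('d) < (\<Sum>i | i \<in> I \<and> key i = q. w i)"
    "\<And>q. q \<in> key ` I \<Longrightarrow> (\<Sum>i | i \<in> I \<and> key i = q. w i) \<le> 2 ^ CARD('d) * \<tau> * s q ^ CARD('d)"
proof -
  define N where "N = (\<Sum>i\<in>I. w i)"
  have N0: "0 \<le> N" unfolding N_def using w by (intro sum_nonneg) (auto intro: less_imp_le)
  \<comment> \<open>The starting cubes are so large that even the total mass \<open>N\<close> is at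
    most \<open>\<tau> * L ^ CARD('d)\<close>; since \<open>L\<close> is at least 1, it is at most
    its own power. So no point stops at level 0 and every chosen cube has a parent.\<close>
  define L where "L = 1 + N / \<tau>"
  have L1: "L \<ge> 1" using N0 \<tau> by (simp add: L_def)
  then have L: "L > 0" by simp
  have "L \<le> L ^ CARD('d)" using L1 by (intro self_le_power) (auto simp: card_gt_0_iff)
  then have "N / \<tau> \<le> L ^ CARD('d)" unfolding L_def by simp
  then have NL: "N \<le> \<tau> * L ^ CARD('d)" using \<tau> by (simp add: field_simps)
  define side where "side m = L / 2 ^ m" for m :: nat
  have side: "side m > 0" for m using L by (simp add: side_def)
  have side_Suc: "side m = 2 * side (Suc m)" for m by (simp add: side_def)
  let ?ix = "cube_index L"
  define mass where "mass m y = (\<Sum>i | i \<in> I \<and> ?ix m (x i) = ?ix m y. w i)" for m y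
  define stop where "stop m y \<longleftrightarrow> \<tau> * side m ^ CARD('d) < mass m y" for m y
  have mass_cong: "mass m y = mass m z" if "?ix m y = ?ix m z" for m y z using that by (simp add: mass_def)
  have w0: "i \<in> I \<Longrightarrow> 0 \<le> w i" for i using w by (simp add: less_imp_le)
  have mass_le: "mass m y \<le> N" for m y unfolding mass_def N_def using I w0 by (intro sum_mono2) auto
  have not0: "\<not> stop 0 y" for y using mass_le[of 0 y] NL by (simp add: stop_def side_def)
  have ex: "\<exists>m. stop m (x i)" if i: "i \<in> I" for i
  proof -
    have "(\<lambda>m. \<tau> * (L * (1 / 2) ^ m) ^ CARD('d)) \<longlonglongrightarrow> \<tau> * (L * 0) ^ CARD('d)"
      by (intro tendsto_intros LIMSEQ_power_zero) simp
    moreover have "\<tau> * (L * 0) ^ CARD('d) < w i" using w[OF i] by (simp add: zero_power)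
    ultimately have "\<forall>\<^sub>F m in sequentially. \<tau> * (L * (1 / 2) ^ m) ^ CARD('d) < w i" by (rule order_tendstoD)
    then obtain m where "\<tau> * (L * (1 / 2) ^ m) ^ CARD('d) < w i" by (auto simp: eventually_sequentially)
    then have "\<tau> * side m ^ CARD('d) < w i" by (simp add: side_def power_one_over)
    also have "w i = (\<Sum>i\<in>{i}. w i)" by simp
    also have "... \<le> mass m (x i)" unfolding mass_def using I i w0 by (intro sum_mono2) auto
    finally show ?thesis unfolding stop_def by blast
  qed
  define lev where "lev i = (LEAST m. stop m (x i))" for i
  have lev: "stop (lev i) (x i)" if "i \<in> I" for i unfolding lev_def using ex[OF that] by (rule LeastI_ex)
  have lev_le: "stop m (x i) \<Longrightarrow> lev i \<le> m" for i m unfolding lev_def by (rule Least_le)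
  define key where "key i = (lev i, ?ix (lev i) (x i))" for i
  have coarse: "?ix m y = ?ix m z" if "m \<le> m'" "?ix m' y = ?ix m' z" for m m' y z
    using cube_index_coarser[of L m "m' - m" y z] that by simp
  \<comment> \<open>A point in the stopping cube of another stops no later; the two then share the
    coarser cube as well, so the other also stops no later.\<close>
  have A: "key i' = key i" if i: "i \<in> I" "i' \<in> I" and e: "?ix (lev i) (x i') = ?ix (lev i) (x i)" for i i'
  proof -
    have "stop (lev i) (x i')" using lev[OF i(1)] mass_cong[OF e] by (simp add: stop_def)
    then have 1: "lev i' \<le> lev i" by (rule lev_le)
    have e': "?ix (lev i') (x i') = ?ix (lev i') (x i)" by (rule coarse[OF 1 e])
    have "stop (lev i') (x i)" using lev[OF i(2)] mass_cong[OF e'] by (simp add: stop_def)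
    then have "lev i \<le> lev i'" by (rule lev_le)
    with 1 e show ?thesis by (simp add: key_def)
  qed
  define Q where "Q q = {y. ?ix (fst q) y = snd q}" for q :: "nat \<times> (int^'d)"
  define s where "s q = side (fst q)" for q :: "nat \<times> (int^'d)"
  define p where "p q = (\<chi> i. of_int (snd q $ i) * s q)" for q :: "nat \<times> (int^'d)"
  show thesis
  proof (rule that[of s Q p key])
    show "s q > 0" for q using side by (simp add: s_def)
    show "Q q = {y. \<forall>i. p q $ i \<le> y $ i \<and> y $ i < p q $ i + s q}" for q
      using side[of "fst q"]
      by (auto simp: Q_def p_def s_def cube_index_def vec_eq_iff floor_eq_iff pos_le_divide_eq pos_divide_less_eq algebra_simps simp flip: side_def)
    show "x i \<in> Q (key i)" for i by (simp add: Q_def key_def)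
    have disj: "key i' = key i" if i: "i \<in> I" "i' \<in> I" and y: "y \<in> Q (key i)" "y \<in> Q (key i')" and le: "lev i \<le> lev i'" for i i' y
    proof (rule A[OF i])
      have "?ix (lev i) y = ?ix (lev i) (x i)" "?ix (lev i') y = ?ix (lev i') (x i')" using y by (auto simp: Q_def key_def)
      then show "?ix (lev i) (x i') = ?ix (lev i) (x i)" using coarse[OF le, of y "x i'"] by simp
    qed
    show "key i = key i'" if "i \<in> I" "i' \<in> I" "y \<in> Q (key i)" "y \<in> Q (key i')" for i i' y
      using disj[OF that] disj[OF that(2) that(1) that(4) that(3)] by (cases "lev i \<le> lev i'") auto
    have mass_key: "(\<Sum>i' | i' \<in> I \<and> key i' = key i. w i') = mass (lev i) (x i)" if i: "i \<in> I" for i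
      unfolding mass_def by (intro sum.cong refl) (use A[OF i] in \<open>auto simp: key_def\<close>)
    fix q assume "q \<in> key ` I"
    then obtain i where i: "i \<in> I" "q = key i" by auto
    show "\<tau> * s q ^ CARD('d) < (\<Sum>i | i \<in> I \<and> key i = q. w i)"
      using lev[OF i(1)] unfolding i(2) mass_key[OF i(1)] by (simp add: stop_def s_def key_def)
    \<comment> \<open>The level is not 0, so the parent level exists; minimality of the level says
      that the parent is not too heavy.\<close>
    obtain m where m: "lev i = Suc m" using lev[OF i(1)] not0 by (cases "lev i") auto
    then have "\<not> stop m (x i)" using lev_le[of m i] by auto
    then have "mass m (x i) \<le> \<tau> * side m ^ CARD('d)" by (simp add: stop_def)
    moreover have "mass (lev i) (x i) \<le> mass m (x i)" unfolding mass_def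
      using I w0 coarse[of m "lev i"] m by (intro sum_mono2) auto
    ultimately show "(\<Sum>i | i \<in> I \<and> key i = q. w i) \<le> 2 ^ CARD('d) * \<tau> * s q ^ CARD('d)"
      unfolding i(2) mass_key[OF i(1)] by (simp add: s_def key_def m side_Suc[of m] power_mult_distrib mult_ac)
  qed
qed

text \<open>The summands come from the enlarged cubes, from the square-integrable good part by
  Chebyshev at height \<open>t / 2\<close>, and from the cancelling bad part by Markov at height
  \<open>t / 2\<close>.\<close>

definition weak_const :: "'d::finite itself \<Rightarrow> real" where
  "weak_const _ = (6 * real CARD('d)) ^ CARD('d) + 4 * half_gauss\<^sup>2 * 2 ^ CARD('d) + 2 * hormander_const TYPE(real^'d)"

lemma weak_const_nonneg: "0 \<le> weak_const TYPE('d::finite)"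
  unfolding weak_const_def using hormander_const_nonneg[where 'a="real^'d"] by (intro add_nonneg_nonneg) auto

text \<open>Inside each stopping cube the point masses are spread uniformly. The resulting
  \<open>g\<close> is bounded and handled by the L^2 bound; what is left is a combination of
  mean-zero atoms, integrable away from their cubes; the enlarged cubes themselves have small total
  measure because chosen cubes are heavy.\<close>

lemma rkern_weak_type_points:
  fixes x :: "'i \<Rightarrow> real^'d" and \<alpha> :: "'i \<Rightarrow> complex"
  assumes j: "j \<in> Basis" and ab: "0 < a" "a \<le> b" and "finite I" and t: "t > 0"
  shows "emeasure lborel {z. t < norm (\<Sum>i\<in>I. \<alpha> i * complex_of_real (rkern j a b (z - x i)))} \<le>
    ennreal (weak_const TYPE('d) / t * (\<Sum>i\<in>I. norm (\<alpha> i)))"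
proof -
  \<comment> \<open>The stopping rule requires strictly positive weights, so vanishing coefficients
    are discarded first.\<close>
  define J where "J = {i\<in>I. \<alpha> i \<noteq> 0}"
  have J: "finite J" "\<And>i. i \<in> J \<Longrightarrow> norm (\<alpha> i) > 0" using \<open>finite I\<close> by (auto simp: J_def)
  have sumJ: "(\<Sum>i\<in>I. norm (\<alpha> i)) = (\<Sum>i\<in>J. norm (\<alpha> i))"
    "(\<Sum>i\<in>I. \<alpha> i * complex_of_real (rkern j a b (z - x i))) = (\<Sum>i\<in>J. \<alpha> i * complex_of_real (rkern j a b (z - x i)))" for z
    unfolding J_def using \<open>finite I\<close> by (auto intro!: sum.mono_neutral_right)
  let ?K = "rkern j a b"
  let ?d = "CARD('d)"
  obtain s :: "nat \<times> (int^'d) \<Rightarrow> real" and Q :: "nat \<times> (int^'d) \<Rightarrow> (real^'d) set" and p :: "nat \<times> (int^'d) \<Rightarrow> real^'d"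
    and key :: "'i \<Rightarrow> nat \<times> (int^'d)" where s: "\<And>q. s q > 0"
    and Q: "\<And>q. Q q = {y. \<forall>i. p q $ i \<le> y $ i \<and> y $ i < p q $ i + s q}"
    and xQ: "\<And>i. i \<in> J \<Longrightarrow> x i \<in> Q (key i)"
    and disj: "\<And>i i' y. i \<in> J \<Longrightarrow> i' \<in> J \<Longrightarrow> y \<in> Q (key i) \<Longrightarrow> y \<in> Q (key i') \<Longrightarrow> key i = key i'"
    and lower: "\<And>q. q \<in> key ` J \<Longrightarrow> t * s q ^ ?d < (\<Sum>i | i \<in> J \<and> key i = q. norm (\<alpha> i))"
    and upper: "\<And>q. q \<in> key ` J \<Longrightarrow> (\<Sum>i | i \<in> J \<and> key i = q. norm (\<alpha> i)) \<le> 2 ^ ?d * t * s q ^ ?d"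
  proof (rule calderon_zygmund_cubes[of J "\<lambda>i. norm (\<alpha> i)" t x, OF J t])
    fix s :: "nat \<times> (int^'d) \<Rightarrow> real" and Q p and key :: "'i \<Rightarrow> nat \<times> (int^'d)"
    assume "\<And>q. s q > 0"
      "\<And>q. Q q = {y. \<forall>i. p q $ i \<le> y $ i \<and> y $ i < p q $ i + s q}"
      "\<And>i. i \<in> J \<Longrightarrow> x i \<in> Q (key i)"
      "\<And>i i' y. i \<in> J \<Longrightarrow> i' \<in> J \<Longrightarrow> y \<in> Q (key i) \<Longrightarrow> y \<in> Q (key i') \<Longrightarrow> key i = key i'"
      "\<And>q. q \<in> key ` J \<Longrightarrow> t * s q ^ ?d < (\<Sum>i | i \<in> J \<and> key i = q. norm (\<alpha> i))"
      "\<And>q. q \<in> key ` J \<Longrightarrow> (\<Sum>i | i \<in> J \<and> key i = q. norm (\<alpha> i)) \<le> 2 ^ ?d * t * s q ^ ?d"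
    then show thesis by (rule that)
  qed
  define \<K> where "\<K> = key ` J"
  have fK: "finite \<K>" using J by (simp add: \<K>_def)
  define u where "u q = s q ^ ?d" for q
  have u: "u q > 0" for q using s by (simp add: u_def)
  have Qs[measurable]: "Q q \<in> sets borel" for q unfolding Q by (rule sets_half_open_cube[OF s])
  have Qm: "emeasure lborel (Q q) = ennreal (u q)" for q unfolding Q u_def by (rule emeasure_half_open_cube[OF s])
  have iQ: "integrable lborel (indicator (Q q) :: real^'d \<Rightarrow> real)" for q
    by (rule integrable_real_indicator) (use Qm in auto)
  have mQ: "(LBINT y. indicator (Q q) y) = u q" for q using Qm[of q] u[of q] by (simp add: measure_def)
  define N where "N = (\<Sum>i\<in>J. norm (\<alpha> i))"
  have N0: "N \<ge> 0" by (simp add: N_def sum_nonneg)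
  define m where "m q = (\<Sum>i | i \<in> J \<and> key i = q. norm (\<alpha> i))" for q
  have Nm: "N = (\<Sum>q\<in>\<K>. m q)" unfolding N_def m_def \<K>_def by (rule sum.image_gen[OF J(1)])
  define c where "c q = (\<Sum>i | i \<in> J \<and> key i = q. \<alpha> i)" for q
  have cm: "norm (c q) \<le> m q" for q unfolding c_def m_def by (rule norm_sum)
  define avg where "avg q z = (LBINT y. indicator (Q q) y * ?K (z - y)) / u q" for q z
  \<comment> \<open>Here \<open>c q\<close> is the total complex mass in the cube \<open>q\<close>.
    The cubes are disjoint, so at each point at most one summand is nonzero, and the upper mass
    bound gives \<open>2 ^ CARD('d) * t\<close>.\<close>
  define g where "g y = (\<Sum>q\<in>\<K>. (c q / u q) * complex_of_real (indicator (Q q) y))" for y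
  have ig: "integrable lborel g" unfolding g_def
    by (intro Bochner_Integration.integrable_sum integrable_mult_right integrable_of_real iQ)
  have gB: "norm (g y) \<le> 2 ^ ?d * t" for y
  proof (cases "\<exists>q_0\<in>\<K>. y \<in> Q q_0")
    case True
    then obtain q_0 where k0: "q_0 \<in> \<K>" "y \<in> Q q_0" by auto
    have "g y = (\<Sum>q\<in>{q_0}. (c q / u q) * complex_of_real (indicator (Q q) y))"
      unfolding g_def
    proof (rule sum.mono_neutral_right[OF fK])
      show "\<forall>q\<in>\<K> - {q_0}. (c q / u q) * complex_of_real (indicator (Q q) y) = 0"
        using disj[of _ _ y] k0 unfolding \<K>_def by (fastforce simp: indicator_def)
    qed (use k0 in auto)
    then have "g y = c q_0 / u q_0" using k0 by simp
    then have "norm (g y) = norm (c q_0) / u q_0" using u[of q_0] by (simp add: norm_divide)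
    also have "... \<le> (2 ^ ?d * t * u q_0) / u q_0"
      using cm[of q_0] upper[of q_0] k0 u[of q_0] by (intro divide_right_mono) (auto simp: m_def u_def \<K>_def)
    also have "... = 2 ^ ?d * t" using u[of q_0] by simp
    finally show ?thesis .
  next
    case False
    then have "g y = 0" unfolding g_def by (intro sum.neutral) auto
    then show ?thesis using t by simp
  qed
  have g1: "(LBINT y. norm (g y)) \<le> N"
  proof -
    have "(LBINT y. norm (g y)) \<le> (LBINT y. (\<Sum>q\<in>\<K>. norm (c q) / u q * indicator (Q q) y))"
    proof (intro integral_mono integrable_norm ig Bochner_Integration.integrable_sum integrable_mult_right iQ)
      fix y
      have "norm (g y) \<le> (\<Sum>q\<in>\<K>. norm ((c q / u q) * complex_of_real (indicator (Q q) y)))" unfolding g_def by (rule norm_sum)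
      also have "... = (\<Sum>q\<in>\<K>. norm (c q) / u q * indicator (Q q) y)"
        using u by (intro sum.cong refl) (simp add: norm_mult norm_divide abs_of_pos)
      finally show "norm (g y) \<le> (\<Sum>q\<in>\<K>. norm (c q) / u q * indicator (Q q) y)" .
    qed
    also have "... = (\<Sum>q\<in>\<K>. norm (c q) / u q * u q)"
    proof -
      have "(LBINT y. (\<Sum>q\<in>\<K>. norm (c q) / u q * indicator (Q q) y)) =
        (\<Sum>q\<in>\<K>. LINT y|lborel. norm (c q) / u q * indicator (Q q) y)"
        by (intro Bochner_Integration.integral_sum integrable_mult_right iQ)
      then show ?thesis unfolding integral_mult_right_zero mQ .
    qed
    also have "... = (\<Sum>q\<in>\<K>. norm (c q))" using u by (intro sum.cong refl) (simp add: less_imp_neq[symmetric])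
    also have "... \<le> N" unfolding Nm by (intro sum_mono cm)
    finally show ?thesis .
  qed
  have g2: "(LBINT y. (norm (g y))\<^sup>2) \<le> 2 ^ ?d * t * N"
  proof -
    have "(LBINT y. (norm (g y))\<^sup>2) \<le> (LBINT y. 2 ^ ?d * t * norm (g y))"
    proof (intro integral_mono integrable_norm_square[OF ig gB] integrable_mult_right integrable_norm ig)
      fix y show "(norm (g y))\<^sup>2 \<le> 2 ^ ?d * t * norm (g y)"
        unfolding power2_eq_square by (intro mult_right_mono gB) simp
    qed
    also have "... \<le> 2 ^ ?d * t * N" using g1 t by (simp add: mult_left_mono)
    finally show ?thesis .
  qed
  define D where "D i z = ?K (z - x i) - avg (key i) z" for i z
  have iQK: "integrable lborel (\<lambda>y. indicator (Q q) y * ?K (z - y))" for q z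
  proof (rule Bochner_Integration.integrable_bound[OF integrable_mult_right[OF iQ]])
    show "AE y in lborel. norm (indicator (Q q) y * ?K (z - y)) \<le> norm (2 * (b ^ DIM(real^'d) / b) * (b - a) * indicator (Q q) y)"
      by (intro AE_I2) (use order_trans[OF rkern_bounded[OF j ab] abs_ge_self] in \<open>auto simp: indicator_def simp del: times_divide_eq_right times_divide_eq_left\<close>)
  qed measurable
  have Tg: "rtrunc j a b g z = (\<Sum>i\<in>J. \<alpha> i * complex_of_real (avg (key i) z))" for z
  proof -
    have "rtrunc j a b g z = (LBINT y. (\<Sum>q\<in>\<K>. (c q / u q) * complex_of_real (indicator (Q q) y * ?K (z - y))))"
      unfolding rtrunc_def g_def by (simp add: sum_distrib_right mult.assoc)
    also have "... = (\<Sum>q\<in>\<K>. LINT y|lborel. (c q / u q) * complex_of_real (indicator (Q q) y * ?K (z - y)))"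
      by (intro Bochner_Integration.integral_sum integrable_mult_right integrable_of_real iQK)
    also have "... = (\<Sum>q\<in>\<K>. c q * complex_of_real (avg q z))"
      unfolding avg_def by (simp only: integral_mult_right_zero integral_complex_of_real) simp
    also have "... = (\<Sum>q\<in>\<K>. \<Sum>i | i \<in> J \<and> key i = q. \<alpha> i * complex_of_real (avg (key i) z))"
      unfolding c_def sum_distrib_right by (intro sum.cong refl) auto
    also have "... = (\<Sum>i\<in>J. \<alpha> i * complex_of_real (avg (key i) z))"
      unfolding \<K>_def by (rule sum.image_gen[OF J(1), symmetric])
    finally show ?thesis .
  qed
  have split: "(\<Sum>i\<in>J. \<alpha> i * complex_of_real (?K (z - x i))) = rtrunc j a b g z + (\<Sum>i\<in>J. \<alpha> i * complex_of_real (D i z))" for z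
    unfolding Tg D_def by (simp add: sum.distrib[symmetric] algebra_simps)
  \<comment> \<open>By the l^1 bound on the norm this exceeds the diameter of the cube. Below,
    \<open>Qb q\<close> is the cube of half-side \<open>3 * \<rho> q\<close> around the corner
    \<open>p q\<close>: leaving it means distance at least 3 rho from the corner, hence at least 2
    rho from every point of the cube.\<close>
  define \<rho> where "\<rho> q = real ?d * s q" for q
  have \<rho>: "\<rho> q > 0" for q using s by (simp add: \<rho>_def card_gt_0_iff)
  define Qb where "Qb q = cbox (p q - (3 * \<rho> q) *\<^sub>R One) ((p q - (3 * \<rho> q) *\<^sub>R One) + (6 * \<rho> q) *\<^sub>R One)" for q
  have Qbm: "emeasure lborel (Qb q) = ennreal ((6 * real ?d) ^ ?d * u q)" for q
    unfolding Qb_def using \<rho>[of q] by (subst emeasure_cube) (auto simp: \<rho>_def u_def power_mult_distrib mult_ac)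
  have near: "norm (y - y') \<le> \<rho> q" if "\<And>i. \<bar>y $ i - y' $ i\<bar> \<le> s q" for y y' :: "real^'d" and q
  proof -
    have "norm (y - y') \<le> (\<Sum>i\<in>UNIV. \<bar>(y - y') $ i\<bar>)" by (rule norm_le_l1_cart)
    also have "... \<le> (\<Sum>i\<in>(UNIV::'d set). s q)" using that by (intro sum_mono) auto
    finally show ?thesis by (simp add: \<rho>_def)
  qed
  have far: "2 * \<rho> q \<le> norm (z - y)" if z: "z \<notin> Qb q" and y: "y \<in> Q q" for z y q
  proof -
    have "\<not> (\<forall>i. p q $ i - 3 * \<rho> q \<le> z $ i \<and> z $ i \<le> p q $ i + 3 * \<rho> q)"
    proof
      assume "\<forall>i. p q $ i - 3 * \<rho> q \<le> z $ i \<and> z $ i \<le> p q $ i + 3 * \<rho> q"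
      then have "z \<in> Qb q" unfolding Qb_def mem_box_cart by (simp add: algebra_simps)
      with z show False by simp
    qed
    then obtain i where "\<not> (p q $ i - 3 * \<rho> q \<le> z $ i \<and> z $ i \<le> p q $ i + 3 * \<rho> q)"
      by blast
    then have "3 * \<rho> q \<le> \<bar>(z - p q) $ i\<bar>" by auto
    also have "... \<le> norm (z - p q)" by (rule component_le_norm_cart)
    also have "... \<le> norm (z - y) + norm (y - p q)" by (rule norm_triangle_diff)
    also have "norm (y - p q) \<le> \<rho> q"
    proof (rule near)
      fix i show "\<bar>y $ i - p q $ i\<bar> \<le> s q" using y unfolding Q by (auto simp: abs_le_iff) (smt (verit) s)+
    qed
    finally show ?thesis by simp
  qed
  have closeQ: "norm (y - y') \<le> \<rho> q" if "y \<in> Q q" "y' \<in> Q q" for y y' q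
  proof (rule near)
    fix i show "\<bar>y $ i - y' $ i\<bar> \<le> s q" using that unfolding Q mem_Collect_eq by (smt (verit))
  qed
  have Qbs[measurable]: "Qb q \<in> sets borel" "- Qb q \<in> sets borel" for q by (auto simp: Qb_def)
  have atom: "integrable lborel (D i)" "(LBINT z. indicator (- Qb (key i)) z * \<bar>D i z\<bar>) \<le> hormander_const TYPE(real^'d)" if i: "i \<in> J" for i
  proof -
    have *: "y \<in> Q (key i) \<Longrightarrow> norm (y - x i) \<le> \<rho> (key i)" "z \<in> - Qb (key i) \<Longrightarrow> 2 * \<rho> (key i) \<le> norm (z - x i)" for y z
      using closeQ[OF _ xQ[OF i]] far[OF _ xQ[OF i]] by auto
    show "integrable lborel (D i)" unfolding D_def avg_def
      by (rule integrable_rkern_atom[OF j ab Qs Qbs(2) Qm u \<rho> *])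
    show "(LBINT z. indicator (- Qb (key i)) z * \<bar>D i z\<bar>) \<le> hormander_const TYPE(real^'d)" unfolding D_def avg_def
      by (rule rkern_atom_le[OF j ab Qs Qbs(2) Qm u \<rho> *])
  qed
  define h where "h z = (\<Sum>i\<in>J. norm (\<alpha> i) * (indicator (- Qb (key i)) z * \<bar>D i z\<bar>))" for z
  have iD: "integrable lborel (\<lambda>z. indicator (- Qb (key i)) z * \<bar>D i z\<bar>)" if "i \<in> J" for i
    by (rule Bochner_Integration.integrable_bound[OF atom(1)[OF that]]) (use atom(1)[OF that] in \<open>auto simp: indicator_def\<close>)
  have ih: "integrable lborel h" unfolding h_def
    using iD by (intro Bochner_Integration.integrable_sum integrable_mult_right) auto
  have h1: "(LBINT z. h z) \<le> N * hormander_const TYPE(real^'d)"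
  proof -
    have "(LBINT z. h z) = (\<Sum>i\<in>J. norm (\<alpha> i) * (LBINT z. indicator (- Qb (key i)) z * \<bar>D i z\<bar>))"
      unfolding h_def using iD by (subst Bochner_Integration.integral_sum) auto
    also have "... \<le> (\<Sum>i\<in>J. norm (\<alpha> i) * hormander_const TYPE(real^'d))"
      using atom(2) by (intro sum_mono mult_left_mono) auto
    finally show ?thesis by (simp add: N_def sum_distrib_right)
  qed
  let ?U = "\<Union>q\<in>\<K>. Qb q"
  let ?G = "{z\<in>space lborel. (\<lambda>z. (norm (rtrunc j a b g z))\<^sup>2) z \<ge> (t / 2)\<^sup>2}"
  let ?H = "{z\<in>space lborel. h z \<ge> t / 2}"
  have [measurable]: "g \<in> borel_measurable borel" "h \<in> borel_measurable borel" using ig ih by auto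
  \<comment> \<open>Off the enlarged cubes the bad part is dominated by \<open>h\<close>, so a sum
    larger than \<open>t\<close> forces the good part or \<open>h\<close> to reach
    \<open>t / 2\<close>.\<close>
  have sub: "{z. t < norm (\<Sum>i\<in>J. \<alpha> i * complex_of_real (?K (z - x i)))} \<subseteq> ?U \<union> (?G \<union> ?H)"
  proof
    fix z assume "z \<in> {z. t < norm (\<Sum>i\<in>J. \<alpha> i * complex_of_real (?K (z - x i)))}"
    then have z: "t < norm (rtrunc j a b g z + (\<Sum>i\<in>J. \<alpha> i * complex_of_real (D i z)))" by (simp add: split)
    show "z \<in> ?U \<union> (?G \<union> ?H)"
    proof (rule ccontr)
      assume n: "z \<notin> ?U \<union> (?G \<union> ?H)"
      then have nG: "norm (rtrunc j a b g z) < t / 2" using t by (auto simp: not_le intro: power_less_imp_less_base)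
      have "norm (\<Sum>i\<in>J. \<alpha> i * complex_of_real (D i z)) \<le> (\<Sum>i\<in>J. norm (\<alpha> i * complex_of_real (D i z)))" by (rule norm_sum)
      also have "... = h z" unfolding h_def using n by (intro sum.cong refl) (auto simp: norm_mult \<K>_def)
      also have "... < t / 2" using n by auto
      finally show False using z nG norm_triangle_ineq[of "rtrunc j a b g z" "\<Sum>i\<in>J. \<alpha> i * complex_of_real (D i z)"] by linarith
    qed
  qed
  have eU: "emeasure lborel ?U \<le> ennreal ((6 * real ?d) ^ ?d * (N / t))"
  proof -
    have "emeasure lborel ?U \<le> (\<Sum>q\<in>\<K>. emeasure lborel (Qb q))"
      using fK by (intro emeasure_subadditive_finite) auto
    also have "... = ennreal (\<Sum>q\<in>\<K>. (6 * real ?d) ^ ?d * u q)"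
      unfolding Qbm using u by (intro sum_ennreal) (auto intro!: mult_nonneg_nonneg less_imp_le)
    also have "... \<le> ennreal ((6 * real ?d) ^ ?d * (N / t))"
    proof (rule ennreal_leI)
      have "(\<Sum>q\<in>\<K>. u q) \<le> (\<Sum>q\<in>\<K>. m q / t)"
      proof (rule sum_mono)
        fix q assume "q \<in> \<K>"
        then have "t * u q \<le> m q" using lower[of q] by (simp add: \<K>_def m_def u_def)
        then show "u q \<le> m q / t" using t by (simp add: pos_le_divide_eq mult.commute)
      qed
      also have "... = N / t" by (simp add: Nm sum_divide_distrib)
      finally show "(\<Sum>q\<in>\<K>. (6 * real ?d) ^ ?d * u q) \<le> (6 * real ?d) ^ ?d * (N / t)"
        unfolding sum_distrib_left[symmetric] by (intro mult_left_mono) auto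
    qed
    finally show ?thesis .
  qed
  have eG: "emeasure lborel ?G \<le> ennreal (4 * half_gauss\<^sup>2 * 2 ^ ?d * (N / t))"
  proof -
    have "emeasure lborel ?G \<le> ennreal (1 / (t / 2)\<^sup>2 * (LBINT z. (norm (rtrunc j a b g z))\<^sup>2))"
      by (rule integral_Markov_inequality[OF rtrunc_square_integrable[OF j ab ig gB]]) (use t in auto)
    also have "... \<le> ennreal (1 / (t / 2)\<^sup>2 * (half_gauss\<^sup>2 * (2 ^ ?d * t * N)))"
      by (intro ennreal_leI mult_left_mono order_trans[OF rtrunc_L2[OF j ab ig gB]] g2) auto
    also have "1 / (t / 2)\<^sup>2 * (half_gauss\<^sup>2 * (2 ^ ?d * t * N)) = 4 * half_gauss\<^sup>2 * 2 ^ ?d * (N / t)"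
      using t by (simp add: power2_eq_square field_simps)
    finally show ?thesis .
  qed
  have eH: "emeasure lborel ?H \<le> ennreal (2 * hormander_const TYPE(real^'d) * (N / t))"
  proof -
    have "emeasure lborel ?H \<le> ennreal (1 / (t / 2) * (LBINT z. h z))"
      by (rule integral_Markov_inequality[OF ih]) (use t in \<open>auto simp: h_def intro!: sum_nonneg\<close>)
    also have "... \<le> ennreal (1 / (t / 2) * (N * hormander_const TYPE(real^'d)))"
      using t by (intro ennreal_leI mult_left_mono h1) auto
    finally show ?thesis by (simp add: mult_ac)
  qed
  have "emeasure lborel {z. t < norm (\<Sum>i\<in>J. \<alpha> i * complex_of_real (?K (z - x i)))} \<le> emeasure lborel (?U \<union> (?G \<union> ?H))"
    using fK by (intro emeasure_mono sub) (auto intro!: sets.Un sets.finite_UN)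
  also have "... \<le> emeasure lborel ?U + (emeasure lborel ?G + emeasure lborel ?H)"
    using fK by (intro order_trans[OF emeasure_subadditive] add_left_mono emeasure_subadditive) (auto intro!: sets.Un sets.finite_UN)
  also have "... \<le> ennreal ((6 * real ?d) ^ ?d * (N / t)) + (ennreal (4 * half_gauss\<^sup>2 * 2 ^ ?d * (N / t)) + ennreal (2 * hormander_const TYPE(real^'d) * (N / t)))"
    by (intro add_mono eU eG eH)
  also have "... = ennreal (weak_const TYPE('d) / t * N)"
    using N0 t hormander_const_nonneg[where 'a="real^'d"]
    by (simp add: weak_const_def distrib_right add_divide_distrib flip: ennreal_plus)
  finally show ?thesis unfolding sumJ N_def .
qed

text \<open>For fixed \<open>a\<close> and \<open>b\<close> the kernel is bounded and Lipschitz: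
  boundedness controls the mass of \<open>u\<close> outside the grid box, the Lipschitz bound the
  displacement inside cells. Both hold uniformly in \<open>z\<close>. The grid depends on
  \<open>a\<close> and \<open>b\<close>, but the weak type constant for point masses does
  not.\<close>

lemma rtrunc_grid_approx:
  fixes u :: "real^'d \<Rightarrow> complex"
  assumes j: "j \<in> Basis" and ab: "0 < a" "a \<le> b" and u: "integrable lborel u" and e: "e > 0"
  shows "\<exists>N. \<forall>z. norm (rtrunc j a b u z - (\<Sum>k\<in>grid_index N ` grid_box N.
      grid_weight u N k * complex_of_real (rkern j a b (z - grid_point N k)))) \<le> e"
proof -
  let ?K = "rkern j a b"
  have [measurable]: "u \<in> borel_measurable borel" using u by auto
  define C where "C = 2 * (b ^ CARD('d) / b) * (b - a)"
  define l where "l = 2 * b ^ CARD('d) * (b - a) * real CARD('d)"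
  define U where "U = (LBINT y. norm (u y))"
  have C: "\<bar>?K y\<bar> \<le> C" for y using rkern_bounded[OF j ab, of y] by (simp add: C_def)
  have C0: "0 \<le> C" using C[of 0] by linarith
  have l0: "0 \<le> l" using ab by (simp add: l_def)
  define R where "R N y = (1 - indicator (grid_box N) y) * norm (u y)" for N y
  have [measurable]: "R N \<in> borel_measurable borel" for N unfolding R_def by measurable
  have iR: "integrable lborel (R N)" for N
    by (rule Bochner_Integration.integrable_bound[OF u]) (auto simp: R_def indicator_def)
  have "(\<lambda>N. LINT y|lborel. R N y) \<longlonglongrightarrow> (LINT y|(lborel :: (real^'d) measure). 0)"
  proof (rule integral_dominated_convergence[where w="\<lambda>y. norm (u y)"])
    show "AE y in lborel. (\<lambda>N. R N y) \<longlonglongrightarrow> 0"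
    proof (rule AE_I2)
      fix y
      have "\<forall>\<^sub>F N in sequentially. 0 = R N y"
        using eventually_in_grid_box[of y] by eventually_elim (simp add: R_def)
      then show "(\<lambda>N. R N y) \<longlonglongrightarrow> 0" by (rule Lim_transform_eventually[OF tendsto_const])
    qed
  qed (use u iR in \<open>auto simp: R_def indicator_def\<close>)
  then have l1: "(\<lambda>N. C * (LBINT y. R N y) + l / real N * U) \<longlonglongrightarrow> C * 0 + 0 * U"
    by (intro tendsto_intros lim_const_over_n) simp
  then have "\<forall>\<^sub>F N in sequentially. C * (LBINT y. R N y) + l / real N * U < e"
    by (rule order_tendstoD(2)) (use e in simp)
  then have "\<forall>\<^sub>F N in sequentially. N > 0 \<and> C * (LBINT y. R N y) + l / real N * U < e"
    using eventually_gt_at_top[of 0] by eventually_elim simp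
  then obtain N where N: "N > 0" "C * (LBINT y. R N y) + l / real N * U < e"
    unfolding eventually_sequentially by blast
  define p where "p y = grid_point N (grid_index N y)" for y :: "real^'d"
  have [measurable]: "p \<in> borel_measurable borel" unfolding p_def by measurable
  show ?thesis
  proof (intro exI[of _ N] allI)
    fix z
    have i1: "integrable lborel (\<lambda>y. u y * complex_of_real (?K (z - y)))" by (rule integrable_rtrunc_integrand[OF j ab u])
    have i2: "integrable lborel (\<lambda>y. u y * (indicator (grid_box N) y * complex_of_real (?K (z - p y))))"
      by (rule integrable_mult_bounded(1)[OF u, where B=C]) (use C C0 in \<open>auto simp: norm_mult indicator_def\<close>)
    have "rtrunc j a b u z - (\<Sum>k\<in>grid_index N ` grid_box N. grid_weight u N k * complex_of_real (?K (z - grid_point N k))) =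
      (LBINT y. u y * complex_of_real (?K (z - y)) - u y * (indicator (grid_box N) y * complex_of_real (?K (z - p y))))"
      unfolding grid_sum_eq[OF u, symmetric, of N "\<lambda>q. complex_of_real (?K (z - q))"] rtrunc_def
      using i1 i2 by (simp add: p_def mult.assoc)
    also have "norm ... \<le> (LBINT y. C * R N y + l / real N * norm (u y))"
    proof (rule order_trans[OF integral_norm_bound integral_mono])
      fix y
      show "norm (u y * complex_of_real (?K (z - y)) - u y * (indicator (grid_box N) y * complex_of_real (?K (z - p y)))) \<le>
         C * R N y + l / real N * norm (u y)"
      proof (cases "y \<in> grid_box N")
        case True
        have "\<bar>?K (z - y) - ?K (z - p y)\<bar> \<le> 2 * b ^ CARD('d) * (b - a) * norm ((z - y) - (z - p y))"
          using rkern_lipschitz[OF j ab, of "z - y" "z - p y"] by simp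
        also have "norm ((z - y) - (z - p y)) \<le> real CARD('d) / real N"
          using grid_point_close[OF N(1), of y] by (simp add: p_def norm_minus_commute)
        finally have "\<bar>?K (z - y) - ?K (z - p y)\<bar> \<le> l / real N"
          using ab by (simp add: l_def mult_left_mono)
        then have "norm (u y) * \<bar>?K (z - y) - ?K (z - p y)\<bar> \<le> norm (u y) * (l / real N)" by (rule mult_left_mono) simp
        moreover have "u y * complex_of_real (?K (z - y)) - u y * complex_of_real (?K (z - p y)) = u y * complex_of_real (?K (z - y) - ?K (z - p y))"
          by (simp add: right_diff_distrib)
        ultimately show ?thesis using True by (simp add: R_def norm_mult mult.commute del: of_real_diff)
      next
        case False
        have "norm (u y) * \<bar>?K (z - y)\<bar> \<le> norm (u y) * C" using C by (intro mult_left_mono) auto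
        also have "... \<le> norm (u y) * C + l / real N * norm (u y)" using l0 by simp
        finally show ?thesis using False by (simp add: R_def norm_mult mult.commute)
      qed
    qed (use i1 i2 iR u in auto)
    also have "... = C * (LBINT y. R N y) + l / real N * U"
      using iR u by (simp add: U_def)
    finally show "norm (rtrunc j a b u z - (\<Sum>k\<in>grid_index N ` grid_box N. grid_weight u N k * complex_of_real (?K (z - grid_point N k)))) \<le> e"
      using N(2) by linarith
  qed
qed

text \<open>A uniform error of at most \<open>\<tau> / 2\<close> reduces the claim to point masses
  at height \<open>\<tau> / 2\<close>, whence the factor 2.\<close>

lemma rtrunc_weak_type:
  fixes u :: "real^'d \<Rightarrow> complex"
  assumes j: "j \<in> Basis" and ab: "0 < a" "a \<le> b" and u: "integrable lborel u" and t: "\<tau> > 0"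
  shows "emeasure lborel {z. \<tau> < norm (rtrunc j a b u z)} \<le> ennreal (2 * weak_const TYPE('d) / \<tau> * (LBINT y. norm (u y)))"
proof -
  obtain N where N: "\<And>z. norm (rtrunc j a b u z - (\<Sum>k\<in>grid_index N ` grid_box N.
      grid_weight u N k * complex_of_real (rkern j a b (z - grid_point N k)))) \<le> \<tau> / 2"
    using rtrunc_grid_approx[OF j ab u, of "\<tau> / 2"] t by auto
  let ?S = "\<lambda>z. \<Sum>k\<in>grid_index N ` grid_box N. grid_weight u N k * complex_of_real (rkern j a b (z - grid_point N k))"
  have "{z. \<tau> < norm (rtrunc j a b u z)} \<subseteq> {z. \<tau> / 2 < norm (?S z)}"
  proof clarify
    fix z assume "\<tau> < norm (rtrunc j a b u z)"
    then show "\<tau> / 2 < norm (?S z)"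
      using norm_triangle_ineq2[of "rtrunc j a b u z" "?S z"] N[of z] by linarith
  qed
  then have "emeasure lborel {z. \<tau> < norm (rtrunc j a b u z)} \<le> emeasure lborel {z. \<tau> / 2 < norm (?S z)}"
  proof (rule emeasure_mono)
    have "{z\<in>space lborel. \<tau> / 2 < norm (?S z)} \<in> sets lborel" by measurable
    then show "{z. \<tau> / 2 < norm (?S z)} \<in> sets lborel" by simp
  qed
  also have "... \<le> ennreal (weak_const TYPE('d) / (\<tau> / 2) * (\<Sum>k\<in>grid_index N ` grid_box N. norm (grid_weight u N k)))"
    using t by (intro rkern_weak_type_points j ab finite_grid) auto
  also have "... \<le> ennreal (weak_const TYPE('d) / (\<tau> / 2) * (LBINT y. norm (u y)))"
    using t by (intro ennreal_leI mult_left_mono sum_grid_weight_le u) (auto simp: weak_const_nonneg)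
  finally show ?thesis by (simp add: mult_ac)
qed

section \<open>Passing to the limit of the truncations\<close>

definition rapprox :: "'a::euclidean_space \<Rightarrow> nat \<Rightarrow> ('a \<Rightarrow> complex) \<Rightarrow> 'a \<Rightarrow> complex" where
  "rapprox j n = rtrunc j (1 / real (Suc n)) (real (Suc n))"

lemma rapprox_range: "0 < 1 / real (Suc n)" "1 / real (Suc n) \<le> real (Suc n)"
proof -
  have "1 \<le> real (Suc n)" by simp
  then show "1 / real (Suc n) \<le> real (Suc n)"
    by (metis dual_order.trans divide_le_eq_1_pos zero_less_one less_le_trans)
qed simp

lemma measurable_rapprox[measurable (raw)]:
  assumes [measurable]: "g \<in> borel_measurable borel"
  shows "rapprox j n g \<in> borel_measurable borel"
  unfolding rapprox_def by measurable

text \<open>Where the limit exceeds \<open>\<tau>\<close>, all late approximations do, so Fatou's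
  lemma for indicator functions transfers the bound with the same constant.\<close>

lemma rapprox_limit_weak_type:
  fixes u :: "real^'d \<Rightarrow> complex"
  assumes j: "j \<in> Basis" and u: "integrable lborel u" and t: "\<tau> > 0"
    and [measurable]: "v \<in> borel_measurable borel"
    and lim: "AE z in lborel. (\<lambda>n. rapprox j n u z) \<longlonglongrightarrow> v z"
  shows "emeasure lborel {z. \<tau> < norm (v z)} \<le> ennreal (2 * weak_const TYPE('d) / \<tau> * (LBINT y. norm (u y)))"
proof -
  have [measurable]: "u \<in> borel_measurable borel" using u by auto
  let ?A = "\<lambda>n. {z\<in>space lborel. \<tau> < norm (rapprox j n u z)}"
  have m: "{z. \<tau> < norm (v z)} = {z\<in>space lborel. \<tau> < norm (v z)}" by simp
  have "emeasure lborel {z\<in>space lborel. \<tau> < norm (v z)} = (\<integral>\<^sup>+z. indicator {z\<in>space lborel. \<tau> < norm (v z)} z \<partial>lborel)"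
    by (subst nn_integral_indicator) auto
  also have "... \<le> (\<integral>\<^sup>+z. liminf (\<lambda>n. indicator (?A n) z) \<partial>lborel)"
  proof (rule nn_integral_mono_AE)
    show "AE z in lborel. indicator {z\<in>space lborel. \<tau> < norm (v z)} z \<le> liminf (\<lambda>n. indicator (?A n) z :: ennreal)"
      using lim
    proof eventually_elim
      fix z assume l: "(\<lambda>n. rapprox j n u z) \<longlonglongrightarrow> v z"
      show "indicator {z\<in>space lborel. \<tau> < norm (v z)} z \<le> liminf (\<lambda>n. indicator (?A n) z :: ennreal)"
      proof (cases "\<tau> < norm (v z)")
        case True
        have "(\<lambda>n. norm (rapprox j n u z)) \<longlonglongrightarrow> norm (v z)" using l by (rule tendsto_norm)
        then have "\<forall>\<^sub>F n in sequentially. \<tau> < norm (rapprox j n u z)" using True by (rule order_tendstoD)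
        then have "\<forall>\<^sub>F n in sequentially. 1 \<le> (indicator (?A n) z :: ennreal)" by eventually_elim simp
        then have "1 \<le> liminf (\<lambda>n. indicator (?A n) z :: ennreal)" by (rule Liminf_bounded)
        then show ?thesis using True by simp
      qed simp
    qed
  qed
  also have "... \<le> liminf (\<lambda>n. \<integral>\<^sup>+z. indicator (?A n) z \<partial>lborel)"
    by (rule nn_integral_liminf) measurable
  also have "... \<le> ennreal (2 * weak_const TYPE('d) / \<tau> * (LBINT y. norm (u y)))"
  proof (rule Liminf_le)
    show "\<forall>\<^sub>F n in sequentially. (\<integral>\<^sup>+z. indicator (?A n) z \<partial>lborel) \<le> ennreal (2 * weak_const TYPE('d) / \<tau> * (LBINT y. norm (u y)))"
    proof (rule always_eventually, rule allI)
      fix n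
      have "(\<integral>\<^sup>+z. indicator (?A n) z \<partial>lborel) = emeasure lborel (?A n)" by (subst nn_integral_indicator) auto
      also have "... \<le> ennreal (2 * weak_const TYPE('d) / \<tau> * (LBINT y. norm (u y)))"
        using rtrunc_weak_type[OF j rapprox_range u t, of n] by (simp add: rapprox_def)
      finally show "(\<integral>\<^sup>+z. indicator (?A n) z \<partial>lborel) \<le> ennreal (2 * weak_const TYPE('d) / \<tau> * (LBINT y. norm (u y)))" .
    qed
  qed simp
  finally show ?thesis unfolding m .
qed

lemma rtrunc_convolution:
  fixes f \<eta> :: "'a::euclidean_space \<Rightarrow> complex"
  assumes j: "j \<in> Basis" and ab: "0 < a" "a \<le> b" and f: "integrable lborel f" and \<eta>: "integrable lborel \<eta>"
  shows "rtrunc j a b (\<lambda>x. LINT y|lborel. \<eta> y * f (x - y)) x = (LBINT y. f y * rtrunc j a b \<eta> (x - y))"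
proof -
  let ?K = "\<lambda>x. complex_of_real (rkern j a b x)"
  have [measurable]: "f \<in> borel_measurable borel" "\<eta> \<in> borel_measurable borel" using f \<eta> by auto
  have sw: "(LBINT y. \<eta> y * f (z - y)) = (LBINT y. f y * \<eta> (z - y))" for z
    using integral_lborel_reflect[of "\<lambda>y. f y * \<eta> (z - y)" z] by (simp add: mult.commute)
  have ic: "integrable (lborel \<Otimes>\<^sub>M lborel) (\<lambda>(z, y). f y * \<eta> (z - y))" by (rule integrable_convolution[OF f \<eta>])
  let ?B = "2 * (b ^ DIM('a) / b) * (b - a)"
  have i: "integrable (lborel \<Otimes>\<^sub>M lborel) (\<lambda>(z, y). f y * \<eta> (z - y) * ?K (x - z))"
  proof (rule Bochner_Integration.integrable_bound[OF integrable_mult_right[OF integrable_norm[OF ic], where c="?B"]])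
    show "AE w in lborel \<Otimes>\<^sub>M lborel. norm (case w of (z, y) \<Rightarrow> f y * \<eta> (z - y) * ?K (x - z)) \<le> norm (?B * norm (case w of (z, y) \<Rightarrow> f y * \<eta> (z - y)))"
    proof (rule AE_I2, clarify)
      fix z y
      have "norm (f y * \<eta> (z - y) * ?K (x - z)) = \<bar>rkern j a b (x - z)\<bar> * norm (f y * \<eta> (z - y))" by (simp add: norm_mult)
      also have "... \<le> ?B * norm (f y * \<eta> (z - y))" by (intro mult_right_mono rkern_bounded[OF j ab]) simp
      also have "... \<le> \<bar>?B * norm (f y * \<eta> (z - y))\<bar>" by (rule abs_ge_self)
      finally show "norm (f y * \<eta> (z - y) * ?K (x - z)) \<le> norm (?B * norm (f y * \<eta> (z - y)))" by simp
    qed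
  qed measurable
  have "rtrunc j a b (\<lambda>x. LINT y|lborel. \<eta> y * f (x - y)) x = (LBINT z. LBINT y. f y * \<eta> (z - y) * ?K (x - z))"
    unfolding rtrunc_def sw by (simp only: integral_mult_left_zero)
  also have "... = (LBINT y. LBINT z. f y * \<eta> (z - y) * ?K (x - z))"
    by (rule lborel_pair.Fubini_integral[OF i, symmetric])
  also have "... = (LBINT y. f y * rtrunc j a b \<eta> (x - y))"
  proof (intro Bochner_Integration.integral_cong refl)
    fix y
    have "(LBINT z. f y * \<eta> (z - y) * ?K (x - z)) = (LBINT z. f y * (\<eta> z * ?K ((x - y) - z)))"
      using integral_lborel_translate[of "\<lambda>z. f y * \<eta> (z - y) * ?K (x - z)" y] by (simp add: mult.assoc algebra_simps)
    then show "(LBINT z. f y * \<eta> (z - y) * ?K (x - z)) = f y * rtrunc j a b \<eta> (x - y)"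
      unfolding rtrunc_def by (simp only: integral_mult_right_zero)
  qed
  finally show ?thesis .
qed

lemma rtrunc_shift: "rtrunc j a b (\<lambda>x. f (x - p)) z = rtrunc j a b f (z - p)"
  unfolding rtrunc_def using integral_lborel_translate[of "\<lambda>y. f (y - p) * complex_of_real (rkern j a b (z - y))" p]
  by (simp add: algebra_simps)

text \<open>If \<open>f\<close> and the pointwise limit \<open>r\<close> of its truncated Riesz transforms are both integrable, then
  mollifying commutes with the limit. Translates of \<open>f\<close> satisfy this by assumption, a mollification is an
  \<open>L\<^sup>1\<close> limit of combinations of translates, and the weak type inequality controls the error.\<close>

lemma riesz_limit_convolution_AE:
  fixes f r \<eta> E :: "real^'d \<Rightarrow> complex"
  assumes j: "j \<in> Basis" and f: "integrable lborel f" and r: "integrable lborel r" and \<eta>: "integrable lborel \<eta>"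
    and fr: "AE x in lborel. (\<lambda>n. rapprox j n f x) \<longlonglongrightarrow> r x"
    and E: "\<And>x. (\<lambda>n. rapprox j n \<eta> x) \<longlonglongrightarrow> E x" and B: "\<And>n x. norm (rapprox j n \<eta> x) \<le> B"
  shows "AE x in lborel. (LBINT y. f y * E (x - y)) = (LBINT y. \<eta> y * r (x - y))"
proof -
  have [measurable]: "f \<in> borel_measurable borel" "r \<in> borel_measurable borel" "\<eta> \<in> borel_measurable borel" using f r \<eta> by auto
  have [measurable]: "E \<in> borel_measurable borel"
    by (rule borel_measurable_LIMSEQ_metric[where f="\<lambda>n. rapprox j n \<eta>"]) (use E in auto)
  define S where "S N F x = (\<Sum>k\<in>grid_index N ` grid_box N. grid_weight \<eta> N k * F (x - grid_point N k))" for N and F :: "real^'d \<Rightarrow> complex" and x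
  have iS: "integrable lborel (S N F)" if "integrable lborel F" for N F
    unfolding S_def using that by (intro Bochner_Integration.integrable_sum integrable_mult_right) (simp add: integrable_lborel_shift)
  define c where "c F x = (LBINT y. \<eta> y * F (x - y))" for F :: "real^'d \<Rightarrow> complex" and x
  have ic: "integrable lborel (c F)" if "integrable lborel F" for F
    unfolding c_def by (rule integrable_convolution_fst[OF \<eta> that])
  have conv: "(\<lambda>N. LINT x|lborel. norm (c F x - S N F x)) \<longlonglongrightarrow> 0" if "integrable lborel F" for F
    unfolding c_def S_def by (rule grid_convolution_tendsto[OF \<eta> that])
  define fE where "fE x = (LBINT y. f y * E (x - y))" for x
  have [measurable]: "fE \<in> borel_measurable borel" unfolding fE_def by measurable
  have [measurable]: "S N r \<in> borel_measurable borel" "c r \<in> borel_measurable borel" for N using iS[OF r] ic[OF r] by auto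
  have [measurable]: "rapprox j n \<eta> \<in> borel_measurable borel" for n by (rule measurable_rapprox) measurable
  \<comment> \<open>The kernel moves from \<open>c f\<close> onto the mollifier, whose
    approximations are uniformly bounded, so this limit exists at every \<open>x\<close> by
    dominated convergence.\<close>
  have lim1: "(\<lambda>n. rapprox j n (c f) x) \<longlonglongrightarrow> fE x" for x
  proof -
    have "rapprox j n (c f) x = (LBINT y. f y * rapprox j n \<eta> (x - y))" for n
      unfolding rapprox_def c_def by (rule rtrunc_convolution[OF j rapprox_range f \<eta>])
    moreover have "(\<lambda>n. LINT y|lborel. f y * rapprox j n \<eta> (x - y)) \<longlonglongrightarrow> fE x"
      unfolding fE_def
    proof (rule integral_dominated_convergence[where w="\<lambda>y. B * norm (f y)"])
      show "AE y in lborel. (\<lambda>n. f y * rapprox j n \<eta> (x - y)) \<longlonglongrightarrow> f y * E (x - y)"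
        by (intro AE_I2 tendsto_intros E)
      show "AE y in lborel. norm (f y * rapprox j n \<eta> (x - y)) \<le> B * norm (f y)" for n
        using B by (intro AE_I2) (auto simp: norm_mult mult.commute[of B] intro!: mult_left_mono)
    qed (use f in auto)
    ultimately show ?thesis by simp
  qed
  have lim2: "AE x in lborel. (\<lambda>n. rapprox j n (S N f) x) \<longlonglongrightarrow> S N r x" for N
  proof -
    have "AE x in lborel. \<forall>k\<in>grid_index N ` grid_box N. (\<lambda>n. rapprox j n f (x - grid_point N k)) \<longlonglongrightarrow> r (x - grid_point N k)"
    proof (rule AE_finite_allI[OF finite_grid])
      fix k
      show "AE x in lborel. (\<lambda>n. rapprox j n f (x - grid_point N k)) \<longlonglongrightarrow> r (x - grid_point N k)"
        using AE_lborel_affine[OF fr, of 1 "- grid_point N k"] by simp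
    qed
    then show ?thesis
    proof eventually_elim
      fix x assume l: "\<forall>k\<in>grid_index N ` grid_box N. (\<lambda>n. rapprox j n f (x - grid_point N k)) \<longlonglongrightarrow> r (x - grid_point N k)"
      have "rapprox j n (S N f) x = (\<Sum>k\<in>grid_index N ` grid_box N. grid_weight \<eta> N k * rapprox j n f (x - grid_point N k))" for n
      proof -
        have intk: "integrable lborel (\<lambda>y. f (y - p) * complex_of_real (rkern j (1 / real (Suc n)) (real (Suc n)) (x - y)))" for p
          by (intro integrable_rtrunc_integrand[OF j rapprox_range]) (simp add: integrable_lborel_shift f)
        have "rapprox j n (S N f) x = (LBINT y. (\<Sum>k\<in>grid_index N ` grid_box N.
            grid_weight \<eta> N k * (f (y - grid_point N k) * complex_of_real (rkern j (1 / real (Suc n)) (real (Suc n)) (x - y)))))"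
          unfolding rapprox_def rtrunc_def S_def by (simp add: sum_distrib_right mult.assoc)
        also have "... = (\<Sum>k\<in>grid_index N ` grid_box N. LINT y|lborel.
            grid_weight \<eta> N k * (f (y - grid_point N k) * complex_of_real (rkern j (1 / real (Suc n)) (real (Suc n)) (x - y))))"
          by (intro Bochner_Integration.integral_sum integrable_mult_right intk)
        also have "... = (\<Sum>k\<in>grid_index N ` grid_box N. grid_weight \<eta> N k * rtrunc j (1 / real (Suc n)) (real (Suc n)) (\<lambda>x. f (x - grid_point N k)) x)"
          unfolding rtrunc_def by (simp only: integral_mult_right_zero)
        finally show ?thesis unfolding rtrunc_shift rapprox_def .
      qed
      moreover have "(\<lambda>n. \<Sum>k\<in>grid_index N ` grid_box N. grid_weight \<eta> N k * rapprox j n f (x - grid_point N k)) \<longlonglongrightarrow> S N r x"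
        unfolding S_def using l by (intro tendsto_intros) auto
      ultimately show "(\<lambda>n. rapprox j n (S N f) x) \<longlonglongrightarrow> S N r x" by simp
    qed
  qed
  define u where "u N x = c f x - S N f x" for N x
  have iu: "integrable lborel (u N)" for N unfolding u_def using ic[OF f] iS[OF f] by auto
  have lim3: "AE x in lborel. (\<lambda>n. rapprox j n (u N) x) \<longlonglongrightarrow> fE x - S N r x" for N
    using lim2[of N]
  proof eventually_elim
    fix x assume l: "(\<lambda>n. rapprox j n (S N f) x) \<longlonglongrightarrow> S N r x"
    have "rapprox j n (u N) x = rapprox j n (c f) x - rapprox j n (S N f) x" for n
      unfolding rapprox_def rtrunc_def u_def left_diff_distrib
      by (rule Bochner_Integration.integral_diff) (intro integrable_rtrunc_integrand[OF j rapprox_range] ic f iS)+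
    then show "(\<lambda>n. rapprox j n (u N) x) \<longlonglongrightarrow> fE x - S N r x"
      using tendsto_diff[OF lim1 l] by simp
  qed
  \<comment> \<open>If the two candidates differ by more than \<open>2 * \<tau>\<close>, then either
    \<open>fE\<close> is far from \<open>S N r\<close>, which has small measure by the weak type
    bound for \<open>u N\<close>, or \<open>S N r\<close> is far from \<open>c r\<close>, which has
    small measure by Markov. Both bounds tend to 0 with \<open>N\<close>.\<close>
  have null: "emeasure lborel {x\<in>space lborel. 2 * \<tau> < norm (fE x - c r x)} = 0" if t: "\<tau> > 0" for \<tau>
  proof -
    let ?X = "{x\<in>space lborel. 2 * \<tau> < norm (fE x - c r x)}"
    have bd: "emeasure lborel ?X \<le> ennreal (2 * weak_const TYPE('d) / \<tau> * (LBINT y. norm (u N y)) + 1 / \<tau> * (LBINT x. norm (c r x - S N r x)))" for N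
    proof -
      let ?Y = "{x\<in>space lborel. \<tau> < norm (fE x - S N r x)}"
      let ?Z = "{x\<in>space lborel. (\<lambda>x. norm (c r x - S N r x)) x \<ge> \<tau>}"
      have "?X \<subseteq> ?Y \<union> ?Z"
        using norm_triangle_diff(1)[of "fE _" "c r _" "S N r _"]
        by (auto simp: not_less not_le norm_minus_commute[of "S N r _" "c r _"]) (smt (verit))
      then have "emeasure lborel ?X \<le> emeasure lborel (?Y \<union> ?Z)" by (intro emeasure_mono) measurable
      also have "... \<le> emeasure lborel ?Y + emeasure lborel ?Z" by (intro emeasure_subadditive) measurable
      also have "... \<le> ennreal (2 * weak_const TYPE('d) / \<tau> * (LBINT y. norm (u N y))) + ennreal (1 / \<tau> * (LBINT x. norm (c r x - S N r x)))"
      proof (rule add_mono)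
        show "emeasure lborel ?Y \<le> ennreal (2 * weak_const TYPE('d) / \<tau> * (LBINT y. norm (u N y)))"
          using rapprox_limit_weak_type[OF j iu t _ lim3, of N] by simp
        show "emeasure lborel ?Z \<le> ennreal (1 / \<tau> * (LBINT x. norm (c r x - S N r x)))"
          by (rule integral_Markov_inequality) (use ic[OF r] iS[OF r] t in auto)
      qed
      also have "... = ennreal (2 * weak_const TYPE('d) / \<tau> * (LBINT y. norm (u N y)) + 1 / \<tau> * (LBINT x. norm (c r x - S N r x)))"
        using t weak_const_nonneg[where 'd='d] by (intro ennreal_plus[symmetric]) auto
      finally show ?thesis .
    qed
    have "(\<lambda>N. 2 * weak_const TYPE('d) / \<tau> * (LBINT y. norm (u N y)) + 1 / \<tau> * (LBINT x. norm (c r x - S N r x))) \<longlonglongrightarrow>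
       2 * weak_const TYPE('d) / \<tau> * 0 + 1 / \<tau> * 0"
      unfolding u_def by (intro tendsto_intros conv f r)
    then have "(\<lambda>N. ennreal (2 * weak_const TYPE('d) / \<tau> * (LBINT y. norm (u N y)) + 1 / \<tau> * (LBINT x. norm (c r x - S N r x)))) \<longlonglongrightarrow>
       ennreal (2 * weak_const TYPE('d) / \<tau> * 0 + 1 / \<tau> * 0)"
      by (rule tendsto_ennrealI)
    then have "emeasure lborel ?X \<le> ennreal (2 * weak_const TYPE('d) / \<tau> * 0 + 1 / \<tau> * 0)"
      by (rule LIMSEQ_le_const) (use bd in auto)
    then show ?thesis by simp
  qed
  have "AE x in lborel. \<forall>m::nat. \<not> 2 * (1 / real (Suc m)) < norm (fE x - c r x)"
    unfolding AE_all_countable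
  proof
    fix m :: nat
    show "AE x in lborel. \<not> 2 * (1 / real (Suc m)) < norm (fE x - c r x)"
      by (rule AE_I[OF _ null[of "1 / real (Suc m)"]]) auto
  qed
  then show ?thesis
  proof eventually_elim
    fix x assume h: "\<forall>m::nat. \<not> 2 * (1 / real (Suc m)) < norm (fE x - c r x)"
    have "norm (fE x - c r x) \<le> 0"
    proof (rule LIMSEQ_le_const)
      show "(\<lambda>m. 2 * (1 / real (Suc m))) \<longlonglongrightarrow> 0"
        using tendsto_mult_right_zero[OF LIMSEQ_Suc[OF lim_const_over_n[of 1]], of 2] by simp
      show "\<exists>N. \<forall>m\<ge>N. norm (fE x - c r x) \<le> 2 * (1 / real (Suc m))" using h by (auto simp: not_less)
    qed
    then show "(LBINT y. f y * E (x - y)) = (LBINT y. \<eta> y * r (x - y))"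
      by (simp add: fE_def c_def)
  qed
qed

lemma isCont_convolution_bounded:
  fixes f g :: "'a::euclidean_space \<Rightarrow> complex"
  assumes f: "integrable lborel f" and g: "\<And>x. isCont g x" and B: "\<And>x. norm (g x) \<le> B"
  shows "isCont (\<lambda>x. LINT y|lborel. f y * g (x - y)) x0"
proof (rule isCont_lebesgue_integral[where w="\<lambda>y. norm (f y) * B"])
  have [measurable]: "f \<in> borel_measurable borel" "g \<in> borel_measurable borel"
    using f g by (auto intro!: borel_measurable_continuous_onI simp: continuous_on_eq_continuous_at)
  show "(\<lambda>y. f y * g (x - y)) \<in> borel_measurable lborel" for x by measurable
  show "isCont (\<lambda>x. f y * g (x - y)) x0" for y
    by (intro continuous_intros isCont_o2[OF _ g])
  show "\<forall>\<^sub>F x in nhds x0. \<forall>y\<in>space lborel. norm (f y * g (x - y)) \<le> norm (f y) * B"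
    using B by (intro always_eventually) (auto simp: norm_mult intro!: mult_left_mono)
qed (use f in auto)

lemma continuous_AE_zero:
  fixes u :: "'a::euclidean_space \<Rightarrow> complex"
  assumes u: "\<And>x. isCont u x" and ae: "AE x in lborel. u x = 0"
  shows "u x = 0"
proof (rule ccontr)
  assume "u x \<noteq> 0"
  have op: "open {x. u x \<noteq> 0}"
    using u by (intro open_Collect_neq) (auto simp: continuous_on_eq_continuous_at)
  from op have "{x. u x \<noteq> 0} \<in> sets lborel" by simp
  then have "{x. u x \<noteq> 0} \<in> null_sets lborel" using ae by (subst AE_iff_null_sets) auto
  then have "negligible {x. u x \<noteq> 0}" by (simp add: negligible_iff_null_sets null_sets_completionI)
  then show False using \<open>u x \<noteq> 0\<close> open_not_negligible[OF op] by blast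
qed

text \<open>A sample is the value of a convolution at one point, so equality almost everywhere must
  be improved to equality everywhere. Both sides are continuous, and the open set where they differ
  is null, hence empty.\<close>

lemma riesz_limit_convolution:
  fixes f r \<eta> E :: "real^'d \<Rightarrow> complex"
  assumes j: "j \<in> Basis" and f: "integrable lborel f" and r: "integrable lborel r" and \<eta>: "integrable lborel \<eta>"
    and fr: "AE x in lborel. (\<lambda>n. rapprox j n f x) \<longlonglongrightarrow> r x"
    and E: "\<And>x. (\<lambda>n. rapprox j n \<eta> x) \<longlonglongrightarrow> E x" and B: "\<And>n x. norm (rapprox j n \<eta> x) \<le> B"
    and Ec: "\<And>x. isCont E x" and \<eta>c: "\<And>x. isCont \<eta> x" and \<eta>B: "\<And>x. norm (\<eta> x) \<le> B'"
  shows "(LBINT y. f y * E (x - y)) = (LBINT y. r y * \<eta> (x - y))"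
proof -
  have EB: "norm (E x) \<le> B" for x
    using tendsto_norm[OF E[of x]] by (rule LIMSEQ_le_const2) (use B in auto)
  have sw: "(LBINT y. \<eta> y * r (x - y)) = (LBINT y. r y * \<eta> (x - y))" for x
    using integral_lborel_reflect[of "\<lambda>y. r y * \<eta> (x - y)" x] by (simp add: mult.commute)
  have "(LBINT y. f y * E (x - y)) - (LBINT y. r y * \<eta> (x - y)) = 0"
  proof (rule continuous_AE_zero[where u="\<lambda>x. (LBINT y. f y * E (x - y)) - (LBINT y. r y * \<eta> (x - y))"])
    show "isCont (\<lambda>x. (LBINT y. f y * E (x - y)) - (LBINT y. r y * \<eta> (x - y))) x" for x
      by (intro continuous_diff isCont_convolution_bounded[OF f Ec EB] isCont_convolution_bounded[OF r \<eta>c \<eta>B])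
    show "AE x in lborel. (LBINT y. f y * E (x - y)) - (LBINT y. r y * \<eta> (x - y)) = 0"
      using riesz_limit_convolution_AE[OF j f r \<eta> fr E B] by eventually_elim (simp add: sw)
  qed
  then show ?thesis by simp
qed

section \<open>Principal values\<close>

lemma integrable_radial_weight: "integrable lborel (\<lambda>r. indicator {0..} r * (r ^ k * gauss (r::real)))"
proof -
  have s: "1 / sqrt (2 * pi) > 0" by simp
  have "integrable lborel (\<lambda>x. normal_density 0 (1 / sqrt (2 * pi)) x * x ^ k)"
    using integrable_normal_moment[OF s, of 0 k] by simp
  moreover have "normal_density 0 (1 / sqrt (2 * pi)) x * x ^ k = x ^ k * gauss x" for x
    by (simp add: normal_density_def gauss_def power_divide power2_eq_square real_sqrt_divide)
  ultimately have i: "integrable lborel (\<lambda>x. x ^ k * gauss (x::real))" by (simp only:)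
  then show ?thesis
    by (rule Bochner_Integration.integrable_bound) (auto simp: indicator_def)
qed

text \<open>With \<open>k\<close> the dimension this is the total weight of the average over radii,
  and thus the ratio of the limit of \<open>rkern j a b y\<close> to (y . j) / |y|^(d+1).\<close>

definition radial_mass :: "nat \<Rightarrow> real" where
  "radial_mass k = (LBINT r. indicator {0..} r * (r ^ k * gauss (r::real)))"

lemma radial_mass_pos: "radial_mass k > 0"
proof -
  have "0 < exp (- (pi * 4))" by simp
  also have "... = (LBINT r. exp (- (pi * 4)) * indicator {1..2::real} r)" by simp
  also have "... \<le> radial_mass k" unfolding radial_mass_def
  proof (intro integral_mono integrable_radial_weight integrable_mult_right integrable_indicator_Icc)
    fix r :: real
    show "exp (- (pi * 4)) * indicator {1..2} r \<le> indicator {0..} r * (r ^ k * gauss r)"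
    proof (cases "r \<in> {1..2}")
      case True
      then have r: "1 \<le> r" "r \<le> 2" by auto
      have "r * r \<le> 2 * 2" using r by (intro mult_mono) auto
      then have "exp (- (pi * 4)) \<le> gauss r" by (simp add: gauss_def)
      moreover have "1 \<le> r ^ k" using r(1) by (rule one_le_power)
      ultimately have "1 * exp (- (pi * 4)) \<le> r ^ k * gauss r" by (intro mult_mono) auto
      then show ?thesis using r by simp
    qed (auto simp: indicator_def)
  qed
  finally show ?thesis .
qed

text \<open>A component of \<open>truncated_riesz\<close> without its normalising constant, taken
  over \<open>lborel\<close>.\<close>

definition riesz_cut :: "'a::euclidean_space \<Rightarrow> real \<Rightarrow> ('a \<Rightarrow> complex) \<Rightarrow> 'a \<Rightarrow> complex" where
  "riesz_cut j \<epsilon> f x = (LBINT y. indicator {y. \<epsilon> < norm y} y *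
     (f (x - y) * complex_of_real ((y \<bullet> j) / norm y ^ (DIM('a) + 1))))"

lemma riesz_factor_le:
  fixes y j :: "'a::euclidean_space"
  assumes j: "j \<in> Basis" and e: "0 < \<epsilon>" "\<epsilon> \<le> norm y"
  shows "\<bar>(y \<bullet> j) / norm y ^ (DIM('a) + 1)\<bar> \<le> 1 / \<epsilon> ^ DIM('a)"
proof -
  have "\<bar>(y \<bullet> j) / norm y ^ (DIM('a) + 1)\<bar> \<le> norm y / norm y ^ (DIM('a) + 1)"
    unfolding abs_divide power_abs abs_norm_cancel by (intro divide_right_mono Basis_le_norm j) simp
  also have "... = 1 / norm y ^ DIM('a)" using e by (simp add: field_simps)
  also have "... \<le> 1 / \<epsilon> ^ DIM('a)" using e by (intro divide_left_mono power_mono) (auto intro!: mult_pos_pos zero_less_power)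
  finally show ?thesis .
qed

lemma
  fixes f :: "'a::euclidean_space \<Rightarrow> complex"
  assumes j: "j \<in> Basis" and f: "integrable lborel f" and e: "0 < \<epsilon>"
  shows integrable_riesz_cut_integrand: "integrable lborel (\<lambda>y. indicator {y. \<epsilon> < norm y} y *
      (f (x - y) * complex_of_real ((y \<bullet> j) / norm y ^ (DIM('a) + 1))))"
    and norm_riesz_cut_le: "norm (riesz_cut j \<epsilon> f x) \<le> (LBINT y. norm (f y)) / \<epsilon> ^ DIM('a)"
proof -
  have [measurable]: "f \<in> borel_measurable borel" using f by auto
  let ?g = "\<lambda>y. indicator {y. \<epsilon> < norm y} y * (f (x - y) * complex_of_real ((y \<bullet> j) / norm y ^ (DIM('a) + 1)))"
  have fx: "integrable lborel (\<lambda>y. f (x - y))" using f by (simp add: integrable_lborel_reflect)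
  have b: "norm (?g y) \<le> 1 / \<epsilon> ^ DIM('a) * norm (f (x - y))" for y
  proof (cases "\<epsilon> < norm y")
    case True
    then have "\<bar>(y \<bullet> j) / norm y ^ (DIM('a) + 1)\<bar> * norm (f (x - y)) \<le> 1 / \<epsilon> ^ DIM('a) * norm (f (x - y))"
      by (intro mult_right_mono riesz_factor_le[OF j e]) auto
    moreover have "norm (?g y) = \<bar>(y \<bullet> j) / norm y ^ (DIM('a) + 1)\<bar> * norm (f (x - y))"
      unfolding norm_mult norm_of_real using True by (simp only: indicator_simps mem_Collect_eq norm_one mult_1 mult.commute)
    ultimately show ?thesis by (simp only:)
  qed (use e in auto)
  show i: "integrable lborel ?g"
    by (rule Bochner_Integration.integrable_bound[OF integrable_mult_right[OF integrable_norm[OF fx], where c="1 / \<epsilon> ^ DIM('a)"]])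
       (use b e in \<open>auto simp: abs_mult\<close>)
  have "norm (riesz_cut j \<epsilon> f x) \<le> (LBINT y. norm (?g y))" unfolding riesz_cut_def by (rule integral_norm_bound)
  also have "... \<le> (LBINT y. 1 / \<epsilon> ^ DIM('a) * norm (f (x - y)))"
    using b i fx by (intro integral_mono) auto
  also have "... = (LBINT y. norm (f y)) / \<epsilon> ^ DIM('a)"
    using integral_lborel_reflect[of "\<lambda>y. norm (f y)" x] by simp
  finally show "norm (riesz_cut j \<epsilon> f x) \<le> (LBINT y. norm (f y)) / \<epsilon> ^ DIM('a)" .
qed

lemma measurable_riesz_cut[measurable (raw)]:
  fixes f :: "'a::euclidean_space \<Rightarrow> complex"
  assumes [measurable]: "f \<in> borel_measurable borel" "g \<in> borel_measurable M"
  shows "(\<lambda>w. riesz_cut j (g w) f x) \<in> borel_measurable M"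
proof -
  have [measurable]: "{w \<in> space (M \<Otimes>\<^sub>M (lborel :: 'a measure)). g (fst w) < norm (snd w)} \<in> sets (M \<Otimes>\<^sub>M lborel)" by measurable
  show ?thesis unfolding riesz_cut_def indicator_def by measurable
qed

text \<open>Insert \<open>rkern_eq_truncations\<close> and exchange the integrals: for fixed
  \<open>r\<close> the points \<open>y\<close> that remain form an annulus, and integrating over an
  annulus is the difference of two sharp truncations.\<close>

lemma rapprox_eq_average:
  fixes f :: "'a::euclidean_space \<Rightarrow> complex"
  assumes j: "j \<in> Basis" and f: "integrable lborel f"
  shows "rapprox j n f x = (LBINT r. complex_of_real (indicator {0<..} r * (r ^ DIM('a) * gauss r)) *
     (riesz_cut j (r / real (Suc n)) f x - riesz_cut j (r * real (Suc n)) f x))"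
proof -
  have [measurable]: "f \<in> borel_measurable borel" using f by auto
  define m where "m = real (Suc n)"
  have m: "m \<ge> 1" by (simp add: m_def)
  let ?a = "1 / m"
  have am: "0 < ?a" "?a \<le> m" using rapprox_range[of n] by (auto simp: m_def)
  let ?W = "\<lambda>r::real. r ^ DIM('a) * gauss r"
  define Z where "Z y = (y \<bullet> j) / norm y ^ (DIM('a) + 1)" for y :: 'a
  have [measurable]: "Z \<in> borel_measurable borel" unfolding Z_def by measurable
  \<comment> \<open>The inequalities are strict or not so as to match the strict condition in
    \<open>riesz_cut\<close>: they say that |y| lies in the interval from r / m, excluded, to r m,
    included. For fixed \<open>y\<close> this differs from the closed interval in
    \<open>rkern\<close> by one value of \<open>r\<close>.\<close>
  define P where "P y r \<longleftrightarrow> 0 < r \<and> norm y / m \<le> r \<and> r < m * norm y" for y :: 'a and r :: real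
  define G where "G y r = f (x - y) * complex_of_real (Z y * (of_bool (P y r) * ?W r))" for y r
  have [measurable]: "(\<lambda>(y, r). G y r) \<in> borel_measurable (borel \<Otimes>\<^sub>M borel)"
    unfolding G_def P_def of_bool_def by measurable
  have Wi: "integrable lborel (\<lambda>r. of_bool (P y r) * ?W r)" for y
    by (rule Bochner_Integration.integrable_bound[OF integrable_radial_weight[of "DIM('a)"]]) (auto simp: P_def of_bool_def)
  have K: "Z y * (LBINT r. of_bool (P y r) * ?W r) = rkern j ?a m y" if y: "y \<noteq> 0" for y
  proof -
    have t: "norm y > 0" using y by simp
    have "(LBINT r. of_bool (P y r) * ?W r) = (LBINT r. indicator {?a * norm y..m * norm y} r * ?W r)"
    proof (rule integral_cong_AE)
      show "AE r in lborel. of_bool (P y r) * ?W r = indicator {?a * norm y..m * norm y} r * ?W r"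
        using AE_lborel_singleton[of "m * norm y"]
      proof eventually_elim
        fix r assume r: "r \<noteq> m * norm y"
        have "0 < ?a * norm y" using am t by (intro mult_pos_pos)
        then show "of_bool (P y r) * ?W r = indicator {?a * norm y..m * norm y} r * ?W r"
          using r by (auto simp: P_def indicator_def)
      qed
    qed (unfold P_def of_bool_def, measurable)
    then show ?thesis unfolding rkern_eq_truncations[OF y] Z_def by simp
  qed
  have y0: "AE y in lborel. y \<noteq> (0::'a)" by (rule AE_lborel_singleton)
  have fx: "integrable lborel (\<lambda>y. f (x - y))" using f by (simp add: integrable_lborel_reflect)
  have iG: "integrable (lborel \<Otimes>\<^sub>M lborel) (\<lambda>(y, r). G y r)"
  proof (rule lborel_pair.Fubini_integrable)
    have i: "integrable lborel (\<lambda>y. norm (f (x - y) * complex_of_real (rkern j ?a m y)))"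
      by (intro integrable_norm integrable_mult_bounded(1)[OF fx]) (use rkern_bounded[OF j am] in auto)
    have "AE y in lborel. norm (f (x - y) * complex_of_real (rkern j ?a m y)) = (LBINT r. norm (case (y, r) of (y, r) \<Rightarrow> G y r))"
      using y0
    proof eventually_elim
      fix y :: 'a assume y: "y \<noteq> 0"
      have W0: "0 \<le> of_bool (P y r) * ?W r" for r by (auto simp: P_def of_bool_def)
      have "(LBINT r. norm (G y r)) = (LBINT r. (norm (f (x - y)) * \<bar>Z y\<bar>) * (of_bool (P y r) * ?W r))"
      proof (intro Bochner_Integration.integral_cong refl)
        fix r
        have "norm (G y r) = norm (f (x - y)) * (\<bar>Z y\<bar> * \<bar>of_bool (P y r) * ?W r\<bar>)"
          unfolding G_def norm_mult norm_of_real abs_mult[of "Z y"] ..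
        then show "norm (G y r) = (norm (f (x - y)) * \<bar>Z y\<bar>) * (of_bool (P y r) * ?W r)"
          unfolding abs_of_nonneg[OF W0[of r]] by (simp only: mult.assoc)
      qed
      also have "... = norm (f (x - y)) * \<bar>Z y\<bar> * (LBINT r. of_bool (P y r) * ?W r)" by (rule integral_mult_right_zero)
      also have "... = norm (f (x - y)) * \<bar>Z y * (LBINT r. of_bool (P y r) * ?W r)\<bar>"
        using W0 by (simp add: abs_mult abs_of_nonneg Bochner_Integration.integral_nonneg)
      finally show "norm (f (x - y) * complex_of_real (rkern j ?a m y)) = (LBINT r. norm (case (y, r) of (y, r) \<Rightarrow> G y r))"
        by (simp add: K[OF y] norm_mult)
    qed
    then show "integrable lborel (\<lambda>y. LINT r|lborel. norm (case (y, r) of (y, r) \<Rightarrow> G y r))"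
      using i by (subst integrable_cong_AE[symmetric]) auto
    show "AE y in lborel. integrable lborel (\<lambda>r. case (y, r) of (y, r) \<Rightarrow> G y r)"
      unfolding G_def split by (intro AE_I2 integrable_mult_right integrable_of_real Wi)
  qed measurable
  have "rapprox j n f x = (LBINT y. f (x - y) * complex_of_real (rkern j ?a m y))"
    unfolding rapprox_def rtrunc_def m_def[symmetric]
    using integral_lborel_reflect[of "\<lambda>y. f y * complex_of_real (rkern j ?a m (x - y))" x] by simp
  also have "... = (LBINT y. LBINT r. G y r)"
  proof (rule integral_cong_AE)
    show "AE y in lborel. f (x - y) * complex_of_real (rkern j ?a m y) = (LBINT r. G y r)"
      using y0
    proof eventually_elim
      fix y :: 'a assume y: "y \<noteq> 0"
      show "f (x - y) * complex_of_real (rkern j ?a m y) = (LBINT r. G y r)"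
        unfolding G_def integral_mult_right_zero integral_complex_of_real K[OF y] ..
    qed
  qed measurable
  also have "... = (LBINT r. LBINT y. G y r)"
    by (rule lborel_pair.Fubini_integral[OF iG, symmetric])
  also have "... = (LBINT r. complex_of_real (indicator {0<..} r * ?W r) * (riesz_cut j (r / m) f x - riesz_cut j (r * m) f x))"
  proof (intro Bochner_Integration.integral_cong refl)
    fix r :: real
    show "(LBINT y. G y r) = complex_of_real (indicator {0<..} r * ?W r) * (riesz_cut j (r / m) f x - riesz_cut j (r * m) f x)"
    proof (cases "r > 0")
      case True
      then have r: "0 < r / m" "0 < r * m" using m by auto
      let ?g = "\<lambda>e y. indicator {y. e < norm y} y * (f (x - y) * complex_of_real ((y \<bullet> j) / norm y ^ (DIM('a) + 1)))"
      have rr: "r / m \<le> r * m"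
        using True m mult_left_mono[OF am(2), of r] by simp
      have "G y r = complex_of_real (?W r) * (?g (r / m) y - ?g (r * m) y)" for y
      proof -
        have "P y r \<longleftrightarrow> r / m < norm y \<and> \<not> r * m < norm y"
          using True m by (auto simp: P_def pos_divide_less_eq pos_divide_le_eq mult.commute not_less)
        then show ?thesis using rr by (auto simp: G_def Z_def indicator_def mult_ac)
      qed
      then have "(LBINT y. G y r) = complex_of_real (?W r) * (LBINT y. ?g (r / m) y - ?g (r * m) y)"
        by (simp only: integral_mult_right_zero)
      also have "(LBINT y. ?g (r / m) y - ?g (r * m) y) = riesz_cut j (r / m) f x - riesz_cut j (r * m) f x"
        unfolding riesz_cut_def by (intro Bochner_Integration.integral_diff integrable_riesz_cut_integrand j f r)
      finally show ?thesis using True by simp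
    qed (auto simp: G_def P_def)
  qed
  finally show ?thesis unfolding m_def .
qed

text \<open>In the average the inner radius tends to 0, where the truncation tends to
  \<open>l\<close>, and the outer radius tends to infinity, where it vanishes. The weight is
  integrable and the truncations are bounded at this \<open>x\<close>, so dominated convergence
  applies.\<close>

lemma rapprox_tendsto:
  fixes f :: "'a::euclidean_space \<Rightarrow> complex"
  assumes j: "j \<in> Basis" and f: "integrable lborel f"
    and lim: "((\<lambda>\<epsilon>. riesz_cut j \<epsilon> f x) \<longlongrightarrow> l) (at_right 0)"
  shows "(\<lambda>n. rapprox j n f x) \<longlonglongrightarrow> complex_of_real (radial_mass (DIM('a))) * l"
proof -
  have [measurable]: "f \<in> borel_measurable borel" using f by auto
  let ?W = "\<lambda>r::real. indicator {0<..} r * (r ^ DIM('a) * gauss r)"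
  let ?F = "LINT y|lborel. norm (f y)"
  have F0: "0 \<le> ?F" by (intro Bochner_Integration.integral_nonneg) auto
  \<comment> \<open>Near 0 the existence of the limit gives the bound, and away from 0 the size of
    the kernel does. It depends on \<open>x\<close>, which suffices here.\<close>
  obtain M where M: "\<And>\<epsilon>. \<epsilon> > 0 \<Longrightarrow> norm (riesz_cut j \<epsilon> f x) \<le> M"
  proof -
    have "\<forall>\<^sub>F \<epsilon> in at_right 0. dist (riesz_cut j \<epsilon> f x) l < 1" using lim by (rule tendstoD) simp
    then obtain d where d: "d > 0" "\<And>\<epsilon>. 0 < \<epsilon> \<Longrightarrow> \<epsilon> < d \<Longrightarrow> dist (riesz_cut j \<epsilon> f x) l < 1"
      unfolding eventually_at_right_field by auto
    have "norm (riesz_cut j \<epsilon> f x) \<le> max (norm l + 1) (?F / d ^ DIM('a))" if e: "\<epsilon> > 0" for \<epsilon>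
    proof (cases "\<epsilon> < d")
      case True
      then have "norm (riesz_cut j \<epsilon> f x) \<le> norm l + 1"
        using d(2)[OF e True] norm_triangle_ineq2[of "riesz_cut j \<epsilon> f x" l] by (simp add: dist_norm)
      then show ?thesis by simp
    next
      case False
      have "norm (riesz_cut j \<epsilon> f x) \<le> ?F / \<epsilon> ^ DIM('a)" by (rule norm_riesz_cut_le[OF j f e])
      also have "... \<le> ?F / d ^ DIM('a)" using False d e F0
        by (intro divide_left_mono power_mono mult_pos_pos zero_less_power) auto
      finally show ?thesis by simp
    qed
    then show thesis by (rule that)
  qed
  have iW: "integrable lborel (\<lambda>r. indicator {0<..} r * (r ^ DIM('a) * gauss (r::real)))"
    by (rule Bochner_Integration.integrable_bound[OF integrable_radial_weight[of "DIM('a)"]]) (auto simp: indicator_def)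
  have "(\<lambda>n. rapprox j n f x) \<longlonglongrightarrow> (LBINT r. complex_of_real (?W r) * (l - 0))"
    unfolding rapprox_eq_average[OF j f]
  proof (rule integral_dominated_convergence[where w="\<lambda>r. ?W r * (2 * M)"])
    show "AE r in lborel. (\<lambda>n. complex_of_real (?W r) * (riesz_cut j (r / real (Suc n)) f x - riesz_cut j (r * real (Suc n)) f x)) \<longlonglongrightarrow> complex_of_real (?W r) * (l - 0)"
    proof (rule AE_I2)
      fix r :: real
      show "(\<lambda>n. complex_of_real (?W r) * (riesz_cut j (r / real (Suc n)) f x - riesz_cut j (r * real (Suc n)) f x)) \<longlonglongrightarrow> complex_of_real (?W r) * (l - 0)"
      proof (cases "r > 0")
        case True
        have "filterlim (\<lambda>n. r / real (Suc n)) (at_right 0) sequentially"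
          unfolding filterlim_at using LIMSEQ_Suc[OF lim_const_over_n[of r]] True by (auto intro!: always_eventually)
        then have 1: "(\<lambda>n. riesz_cut j (r / real (Suc n)) f x) \<longlonglongrightarrow> l" by (rule filterlim_compose[OF lim])
        have 2: "(\<lambda>n. riesz_cut j (r * real (Suc n)) f x) \<longlonglongrightarrow> 0"
        proof (rule Lim_null_comparison)
          show "\<forall>\<^sub>F n in sequentially. norm (riesz_cut j (r * real (Suc n)) f x) \<le> ?F / r ^ DIM('a) * (1 / real (Suc n)) ^ DIM('a)"
          proof (rule always_eventually, rule allI)
            fix n
            have "0 < r * real (Suc n)" using True by simp
            from norm_riesz_cut_le[OF j f this]
            show "norm (riesz_cut j (r * real (Suc n)) f x) \<le> ?F / r ^ DIM('a) * (1 / real (Suc n)) ^ DIM('a)"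
              by (simp add: power_mult_distrib power_divide)
          qed
          have "(\<lambda>n. ?F / r ^ DIM('a) * (1 / real (Suc n)) ^ DIM('a)) \<longlonglongrightarrow> ?F / r ^ DIM('a) * 0 ^ DIM('a)"
            by (intro tendsto_intros LIMSEQ_Suc[OF lim_const_over_n])
          then show "(\<lambda>n. ?F / r ^ DIM('a) * (1 / real (Suc n)) ^ DIM('a)) \<longlonglongrightarrow> 0"
            using DIM_positive[where 'a='a] by (simp add: power_0_left)
        qed
        show ?thesis by (intro tendsto_intros 1 2)
      qed simp
    qed
    show "AE r in lborel. norm (complex_of_real (?W r) * (riesz_cut j (r / real (Suc n)) f x - riesz_cut j (r * real (Suc n)) f x)) \<le> ?W r * (2 * M)" for n
    proof (rule AE_I2)
      fix r :: real
      show "norm (complex_of_real (?W r) * (riesz_cut j (r / real (Suc n)) f x - riesz_cut j (r * real (Suc n)) f x)) \<le> ?W r * (2 * M)"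
      proof (cases "r > 0")
        case True
        then have "norm (riesz_cut j (r / real (Suc n)) f x - riesz_cut j (r * real (Suc n)) f x) \<le> 2 * M"
          using M[of "r / real (Suc n)"] M[of "r * real (Suc n)"] norm_triangle_ineq4[of "riesz_cut j (r / real (Suc n)) f x" "riesz_cut j (r * real (Suc n)) f x"]
          by simp
        then have "\<bar>?W r\<bar> * norm (riesz_cut j (r / real (Suc n)) f x - riesz_cut j (r * real (Suc n)) f x) \<le> \<bar>?W r\<bar> * (2 * M)"
          by (intro mult_left_mono) auto
        moreover have "\<bar>?W r\<bar> = ?W r" using True by (intro abs_of_nonneg) auto
        ultimately show ?thesis by (simp only: norm_mult norm_of_real)
      qed simp
    qed
    show "integrable lborel (\<lambda>r. ?W r * (2 * M))" using iW by (intro integrable_mult_left)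
  qed measurable
  moreover have "(LBINT r. complex_of_real (?W r) * (l - 0)) = complex_of_real (radial_mass (DIM('a))) * l"
  proof -
    have "(LBINT r. ?W r) = radial_mass (DIM('a))"
      unfolding radial_mass_def by (rule integral_cong_AE) (auto simp: indicator_def)
    then show ?thesis unfolding integral_mult_left_zero integral_complex_of_real by simp
  qed
  ultimately show ?thesis by (simp only:)
qed

section \<open>Rapidly decreasing functions on the lattice\<close>

definition decay1 :: "real \<Rightarrow> real" where "decay1 t = 1 / (1 + t\<^sup>2)"

lemma decay1_pos: "0 < decay1 t" "0 \<le> decay1 t" "decay1 t \<le> 1"
  by (auto simp: decay1_def add_pos_nonneg divide_le_eq_1)

lemma measurable_decay1[measurable]: "decay1 \<in> borel_measurable borel"
  unfolding decay1_def by measurable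

lemma integrable_decay1: "integrable lborel decay1"
proof -
  have d: "(arctan has_real_derivative decay1 x) (at x)" for x
    using DERIV_arctan[of x] by (simp add: decay1_def inverse_eq_divide)
  have "(\<integral>\<^sup>+x. ennreal (decay1 x) * indicator {0..} x \<partial>lborel) = ennreal (pi / 2 - arctan 0)"
    by (rule nn_integral_FTC_atLeast) (use d decay1_pos tendsto_arctan_at_top in auto)
  then have f: "(\<integral>\<^sup>+x. ennreal (indicator {0..} x * decay1 x) \<partial>lborel) < \<infinity>"
  proof -
    have "ennreal (indicator {0..} x * decay1 x) = ennreal (decay1 x) * indicator {0..} x" for x
      by (auto simp: indicator_def)
    then show ?thesis using \<open>_ = ennreal (pi / 2 - arctan 0)\<close> by simp
  qed
  have i: "integrable lborel (\<lambda>x. indicator {0..} x * decay1 x)"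
    by (rule integrableI_nonneg) (use f decay1_pos in auto)
  have "integrable lborel (\<lambda>x. indicator {0..} x * decay1 x + indicator {0..} (0 - x) * decay1 (0 - x))"
    using i integrable_lborel_reflect[of "\<lambda>x. indicator {0..} x * decay1 x" 0] by (intro Bochner_Integration.integrable_add) auto
  then show ?thesis
    by (rule Bochner_Integration.integrable_bound) (auto simp: decay1_def indicator_def)
qed

text \<open>Replacing \<open>t\<close> by its integer part costs a factor 5 and makes the sum a
  shifted sum over the integers, bounded by twice a convergent series over the naturals.\<close>

lemma decay1_sum_bounded: "\<exists>C\<ge>0. \<forall>t. \<forall>S. finite S \<longrightarrow> (\<Sum>m\<in>(S :: int set). decay1 (t - of_int m)) \<le> C"
proof -
  define f where "f n = 2 * inverse ((real (Suc n))\<^sup>2)" for n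
  have sf: "summable f" unfolding f_def
    using inverse_power_summable[of 2, where 'a=real] by (intro summable_mult) (subst summable_Suc_iff, simp)
  have df: "decay1 (real n) \<le> f n" for n
  proof -
    have "(1 + real n)\<^sup>2 \<le> 2 * (1 + (real n)\<^sup>2)" using zero_le_power2[of "real n - 1"] by (simp add: power2_sum power2_diff)
    then show ?thesis unfolding f_def decay1_def by (simp add: field_simps add_pos_nonneg)
  qed
  define D where "D = suminf f"
  have f0: "0 \<le> f n" for n by (simp add: f_def)
  have nat: "(\<Sum>n\<in>A. decay1 (real n)) \<le> D" if "finite A" for A
    unfolding D_def using df by (rule order_trans[OF sum_mono sum_le_suminf[OF sf that]]) (use f0 in auto)
  have D0: "0 \<le> D" using nat[of "{}"] by simp
  have int: "(\<Sum>m\<in>S. decay1 (of_int m)) \<le> 2 * D" if "finite S" for S :: "int set"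
  proof -
    let ?A = "(nat \<circ> abs) ` S"
    have fA: "finite ?A" using that by simp
    have sub: "S \<subseteq> int ` ?A \<union> (\<lambda>n. - int n) ` ?A"
    proof
      fix m assume "m \<in> S"
      then have "nat \<bar>m\<bar> \<in> ?A" by auto
      moreover have "m = int (nat \<bar>m\<bar>) \<or> m = - int (nat \<bar>m\<bar>)" by auto
      ultimately show "m \<in> int ` ?A \<union> (\<lambda>n. - int n) ` ?A" by (metis UnI1 UnI2 imageI)
    qed
    have "(\<Sum>m\<in>S. decay1 (of_int m)) \<le> (\<Sum>m\<in>int ` ?A \<union> (\<lambda>n. - int n) ` ?A. decay1 (of_int m))"
      using fA sub decay1_pos by (intro sum_mono2) auto
    also have "... \<le> (\<Sum>m\<in>int ` ?A. decay1 (of_int m)) + (\<Sum>m\<in>(\<lambda>n. - int n) ` ?A. decay1 (of_int m))"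
      using fA decay1_pos by (subst sum_Un) (auto intro!: sum_nonneg)
    also have "(\<Sum>m\<in>int ` ?A. decay1 (of_int m)) = (\<Sum>n\<in>?A. decay1 (real n))"
      by (subst sum.reindex) (auto simp: inj_on_def)
    also have "(\<Sum>m\<in>(\<lambda>n. - int n) ` ?A. decay1 (of_int m)) = (\<Sum>n\<in>?A. decay1 (real n))"
      by (subst sum.reindex) (auto simp: inj_on_def decay1_def)
    finally show ?thesis using nat[OF fA] by linarith
  qed
  have shift: "decay1 (t - of_int m) \<le> 5 * decay1 (of_int (m - \<lfloor>t\<rfloor>))" for t m
  proof -
    define x where "x = real_of_int (m - \<lfloor>t\<rfloor>)"
    define u where "u = t - of_int m"
    have fr: "0 \<le> t - of_int \<lfloor>t\<rfloor>" "t - of_int \<lfloor>t\<rfloor> \<le> 1" by linarith+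
    define s where "s = t - of_int \<lfloor>t\<rfloor>"
    have u: "u = s - x" and s: "0 \<le> s" "s \<le> 1" using fr by (auto simp: u_def x_def s_def)
    \<comment> \<open>Completing the square; the remainder is positive because the fractional part
      \<open>s\<close> is at most 1. This is where the factor 5 comes from.\<close>
    have "5 * (1 + u\<^sup>2) - (1 + x\<^sup>2) = (2 * x - 5 * s / 2)\<^sup>2 + 4 - 5 / 4 * s\<^sup>2"
      unfolding u by (simp add: power2_eq_square algebra_simps)
    moreover have "s\<^sup>2 \<le> 1" using s by (simp add: power_le_one)
    ultimately have "1 + x\<^sup>2 \<le> 5 * (1 + u\<^sup>2)" using zero_le_power2[of "2 * x - 5 * s / 2"] by linarith
    then show ?thesis unfolding decay1_def x_def[symmetric] u_def[symmetric]
      by (simp add: field_simps add_pos_nonneg)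
  qed
  show ?thesis
  proof (intro exI[of _ "5 * (2 * D)"] conjI allI impI)
    show "0 \<le> 5 * (2 * D)" using D0 by simp
    fix t :: real and S :: "int set" assume S: "finite S"
    have "(\<Sum>m\<in>S. decay1 (t - of_int m)) \<le> (\<Sum>m\<in>S. 5 * decay1 (of_int (m - \<lfloor>t\<rfloor>)))" by (intro sum_mono shift)
    also have "... = 5 * (\<Sum>m\<in>(\<lambda>m. m - \<lfloor>t\<rfloor>) ` S. decay1 (of_int m))"
      by (subst sum.reindex) (auto simp: inj_on_def sum_distrib_left)
    also have "... \<le> 5 * (2 * D)" using S by (intro mult_left_mono int) auto
    finally show "(\<Sum>m\<in>S. decay1 (t - of_int m)) \<le> 5 * (2 * D)" .
  qed
qed

text \<open>A product instead of a radial function, so that the integral and the lattice sums factor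
  into one-dimensional ones.\<close>

definition decay :: "real^'d \<Rightarrow> real" where
  "decay v = (\<Prod>i\<in>UNIV. decay1 (v $ i))"

lemma decay_pos: "0 < decay v" "0 \<le> decay v"
  unfolding decay_def by (auto intro!: prod_pos prod_nonneg decay1_pos)

lemma measurable_decay[measurable]: "decay \<in> borel_measurable borel"
  unfolding decay_def by measurable

lemma integrable_decay: "integrable lborel (decay :: real^'d \<Rightarrow> real)"
proof -
  have "(\<Prod>b\<in>Basis. decay1 (v \<bullet> b)) = decay v" for v :: "real^'d"
  proof -
    have B: "(Basis :: (real^'d) set) = (\<lambda>i. axis i 1) ` UNIV" by (auto simp: Basis_vec_def)
    show ?thesis unfolding B decay_def
      by (subst prod.reindex) (auto simp: inj_on_def axis_eq_axis inner_axis)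
  qed
  then show ?thesis using integrable_lborel_prod[of "\<lambda>_::real^'d. decay1"] integrable_decay1 by simp
qed

lemma decay_sum_bounded: "\<exists>C\<ge>0. \<forall>v::real^'d. \<forall>F. finite F \<longrightarrow> (\<Sum>k\<in>F. decay (v - lattice_vec k)) \<le> C"
proof -
  obtain C where C: "C \<ge> 0" "\<And>t S. finite S \<Longrightarrow> (\<Sum>m\<in>S. decay1 (t - of_int m)) \<le> C"
    using decay1_sum_bounded by blast
  show ?thesis
  proof (intro exI[of _ "C ^ CARD('d)"] conjI allI impI)
    show "0 \<le> C ^ CARD('d)" using C by simp
    fix v :: "real^'d" and F :: "(int^'d) set" assume F: "finite F"
    define S where "S = (\<Union>k\<in>F. range (vec_nth k))"
    have S: "finite S" using F by (auto simp: S_def)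
    have inj: "inj_on vec_nth F" by (auto simp: inj_on_def vec_nth_inject)
    have "(\<Sum>k\<in>F. decay (v - lattice_vec k)) = (\<Sum>g\<in>vec_nth ` F. \<Prod>i\<in>UNIV. decay1 (v $ i - of_int (g i)))"
      by (subst sum.reindex[OF inj]) (simp add: decay_def lattice_vec_def)
    also have "... \<le> (\<Sum>g\<in>PiE UNIV (\<lambda>_. S). \<Prod>i\<in>UNIV. decay1 (v $ i - of_int (g i)))"
      using S by (intro sum_mono2 finite_PiE) (auto simp: S_def intro!: prod_nonneg decay1_pos)
    also have "... = (\<Prod>i\<in>UNIV. \<Sum>m\<in>S. decay1 (v $ i - of_int m))"
      by (rule prod_sum_PiE[symmetric]) (use S in auto)
    also have "... \<le> (\<Prod>i\<in>(UNIV :: 'd set). C)"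
      by (intro prod_mono conjI sum_nonneg decay1_pos C S)
    finally show "(\<Sum>k\<in>F. decay (v - lattice_vec k)) \<le> C ^ CARD('d)" by simp
  qed
qed

text \<open>The reciprocal of \<open>decay v\<close> is at most (1 + |v|^2)^d, hence at most 2^d (1
  + |v|^(2d)); the bounds for the exponents 0 and 2 d combine to the claim.\<close>

lemma rapid_decay:
  fixes g :: "real^'d \<Rightarrow> complex"
  assumes "\<And>n::nat. \<exists>B. \<forall>v. norm v ^ n * norm (g v) \<le> B"
  obtains M where "M \<ge> 0" "\<And>v. norm (g v) \<le> M * decay v"
proof -
  let ?d = "CARD('d)"
  obtain B0 where B0: "\<And>v. norm v ^ 0 * norm (g v) \<le> B0" using assms[of 0] by blast
  obtain B1 where B1: "\<And>v. norm v ^ (2 * ?d) * norm (g v) \<le> B1" using assms[of "2 * ?d"] by blast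
  have nonneg: "0 \<le> B0" "0 \<le> B1" using order_trans[OF _ B0[of 0]] order_trans[OF _ B1[of 0]] by auto
  have "norm (g v) \<le> 2 ^ ?d * (B0 + B1) * decay v" for v
  proof -
    let ?t = "norm v"
    have "inverse (decay v) = (\<Prod>i\<in>UNIV. 1 + (v $ i)\<^sup>2)"
      unfolding decay_def decay1_def by (subst prod_inversef[symmetric]) simp
    also have "... \<le> (\<Prod>i\<in>(UNIV::'d set). 1 + ?t\<^sup>2)"
    proof (intro prod_mono conjI add_left_mono)
      fix i
      have "\<bar>v $ i\<bar>\<^sup>2 \<le> ?t\<^sup>2" by (intro power_mono component_le_norm_cart) simp
      then show "(v $ i)\<^sup>2 \<le> ?t\<^sup>2" by simp
    qed simp
    also have "... = (1 + ?t\<^sup>2) ^ ?d" by simp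
    also have "... \<le> (2 * max 1 (?t\<^sup>2)) ^ ?d" by (intro power_mono) auto
    also have "... = 2 ^ ?d * max 1 (?t\<^sup>2) ^ ?d" by (rule power_mult_distrib)
    also have "... \<le> 2 ^ ?d * (1 + ?t ^ (2 * ?d))"
    proof (rule mult_left_mono)
      show "max 1 (?t\<^sup>2) ^ ?d \<le> 1 + ?t ^ (2 * ?d)"
        by (cases "?t\<^sup>2 \<le> 1") (simp_all add: max_def power_mult)
    qed simp
    finally have "inverse (decay v) * norm (g v) \<le> 2 ^ ?d * (1 + ?t ^ (2 * ?d)) * norm (g v)"
      by (rule mult_right_mono) simp
    also have "... = 2 ^ ?d * (?t ^ 0 * norm (g v) + ?t ^ (2 * ?d) * norm (g v))" by (simp add: algebra_simps)
    also have "... \<le> 2 ^ ?d * (B0 + B1)" by (intro mult_left_mono add_mono B0 B1) simp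
    finally have "decay v * (inverse (decay v) * norm (g v)) \<le> decay v * (2 ^ ?d * (B0 + B1))"
      by (intro mult_left_mono) (simp_all add: decay_pos)
    moreover have "decay v * (inverse (decay v) * norm (g v)) = norm (g v)" using decay_pos(1)[of v] by simp
    ultimately show ?thesis by (simp only: mult.commute)
  qed
  then show thesis using nonneg by (intro that[of "2 ^ ?d * (B0 + B1)"]) auto
qed

section \<open>Decay of Fourier transforms of smooth functions\<close>

lemma has_vector_derivative_partial:
  fixes g :: "real^'d \<Rightarrow> complex"
  assumes "g differentiable (at (x + t *\<^sub>R axis i 1))"
  shows "((\<lambda>t. g (x + t *\<^sub>R axis i 1)) has_vector_derivative partial_derivative i g (x + t *\<^sub>R axis i 1)) (at t)"
proof -
  let ?y = "x + t *\<^sub>R axis i 1"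
  have g: "(g has_derivative frechet_derivative g (at ?y)) (at ?y)"
    using assms by (simp add: frechet_derivative_works)
  have "((\<lambda>t. x + t *\<^sub>R axis i 1) has_derivative (\<lambda>h. h *\<^sub>R axis i 1)) (at t)"
    by (auto intro!: derivative_eq_intros)
  from has_derivative_compose[OF this g]
  have "((\<lambda>t. g (x + t *\<^sub>R axis i 1)) has_derivative (\<lambda>h. frechet_derivative g (at ?y) (h *\<^sub>R axis i 1))) (at t)" by simp
  moreover have "frechet_derivative g (at ?y) (h *\<^sub>R axis i 1) = h *\<^sub>R partial_derivative i g ?y" for h
    unfolding partial_derivative_def using has_derivative_linear[OF g] by (simp add: linear_cmul)
  ultimately show ?thesis by (simp add: has_vector_derivative_def)
qed

lemma partial_derivative_outside:
  assumes K: "closed K" and g: "\<And>x. x \<notin> K \<Longrightarrow> g x = 0" and x: "x \<notin> K"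
  shows "partial_derivative i g x = 0"
proof -
  have "((\<lambda>_. 0) has_derivative (\<lambda>_. 0)) (at x)" by simp
  then have "(g has_derivative (\<lambda>_. 0)) (at x)"
    by (rule has_derivative_transform_within_open[of _ _ _ _ "- K"]) (use assms in auto)
  then have "frechet_derivative g (at x) = (\<lambda>_. 0)" by (rule frechet_derivative_at[symmetric])
  then show ?thesis by (simp add: partial_derivative_def)
qed

lemma integrable_compact_support:
  fixes g :: "'a::euclidean_space \<Rightarrow> complex"
  assumes g: "continuous_on UNIV g" and K: "compact K" "\<And>x. x \<notin> K \<Longrightarrow> g x = 0"
  shows "integrable lborel g" "\<exists>B. \<forall>x. norm (g x) \<le> B"
proof -
  have "integrable lborel (\<lambda>x. indicator K x *\<^sub>R g x)"
    using K g by (intro borel_integrable_compact) (auto intro: continuous_on_subset)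
  moreover have "indicator K x *\<^sub>R g x = g x" for x using K(2)[of x] by (cases "x \<in> K") auto
  ultimately show "integrable lborel g" by simp
  have "bounded (g ` K)" using K g by (intro compact_imp_bounded compact_continuous_image) (auto intro: continuous_on_subset)
  then obtain B where "\<And>x. x \<in> K \<Longrightarrow> norm (g x) \<le> B" by (auto simp: bounded_iff)
  then have "norm (g x) \<le> max B 0" for x using K(2)[of x] by (cases "x \<in> K") (auto simp: le_max_iff_disj)
  then show "\<exists>B. \<forall>x. norm (g x) \<le> B" by blast
qed

text \<open>Integration by parts as the limit of translation differences avoids iterated integrals.\<close>

lemma ft_partial_derivative:
  fixes g :: "real^'d \<Rightarrow> complex"
  assumes g: "\<And>x. g differentiable (at x)" and g': "continuous_on UNIV (partial_derivative i g)"
    and K: "compact K" "\<And>x. x \<notin> K \<Longrightarrow> g x = 0"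
  shows "ft (partial_derivative i g) v = 2 * complex_of_real pi * \<i> * complex_of_real (v $ i) * ft g v"
proof -
  let ?e = "axis i 1 :: real^'d"
  let ?D = "partial_derivative i g"
  have gc: "continuous_on UNIV g" using g by (simp add: continuous_on_eq_continuous_at differentiable_imp_continuous_within)
  have K': "\<And>x. x \<notin> K \<Longrightarrow> ?D x = 0" using partial_derivative_outside[OF compact_imp_closed[OF K(1)], of g] K(2) by blast
  have ig: "integrable lborel g" and iD: "integrable lborel ?D"
    using integrable_compact_support[OF gc K] integrable_compact_support[OF g' K(1) K'] by auto
  obtain B where B: "\<And>x. norm (?D x) \<le> B" using integrable_compact_support(2)[OF g' K(1) K'] by blast
  have B0: "0 \<le> B" using B[of 0] norm_ge_zero order_trans by blast
  have [measurable]: "g \<in> borel_measurable borel" "?D \<in> borel_measurable borel" using ig iD by auto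
  \<comment> \<open>The mean value inequality bounds all difference quotients by \<open>B\<close>;
    with the support this gives an integrable majorant.\<close>
  have lip: "norm (g (x + h *\<^sub>R ?e) - g x) \<le> B * \<bar>h\<bar>" for x h
  proof -
    have "norm ((\<lambda>t. g (x + t *\<^sub>R ?e)) h - (\<lambda>t. g (x + t *\<^sub>R ?e)) 0) \<le> B * norm (h - 0)"
    proof (rule differentiable_bound[of UNIV])
      show "((\<lambda>t. g (x + t *\<^sub>R ?e)) has_derivative (\<lambda>s. s *\<^sub>R ?D (x + t *\<^sub>R ?e))) (at t within UNIV)" for t
        using has_vector_derivative_partial[OF g, where x=x and t=t and i=i] by (simp add: has_vector_derivative_def)
      show "onorm (\<lambda>s. s *\<^sub>R ?D (x + t *\<^sub>R ?e)) \<le> B" for t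
      proof (rule onorm_le)
        fix s show "norm (s *\<^sub>R ?D (x + t *\<^sub>R ?e)) \<le> B * norm s"
          using mult_right_mono[OF B[of "x + t *\<^sub>R ?e"], of "\<bar>s\<bar>"] by (simp add: mult.commute)
      qed
    qed auto
    then show ?thesis by simp
  qed
  obtain R where R: "\<And>x. x \<in> K \<Longrightarrow> norm x \<le> R" using compact_imp_bounded[OF K(1)] by (auto simp: bounded_iff)
  define h where "h n = 1 / real (Suc n)" for n
  have h: "0 < h n" "h n \<le> 1" for n by (auto simp: h_def)
  have h0: "h \<longlonglongrightarrow> 0" unfolding h_def by (rule LIMSEQ_Suc[OF lim_const_over_n])
  define q where "q n x = (g (x + h n *\<^sub>R ?e) - g x) /\<^sub>R h n" for n x
  have "(\<lambda>n. LINT x|lborel. q n x * ee (- (v \<bullet> x))) \<longlonglongrightarrow> (LBINT x. ?D x * ee (- (v \<bullet> x)))"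
  proof (rule integral_dominated_convergence[where w="\<lambda>x. B * indicator (cball 0 (R + 1)) x"])
    show "AE x in lborel. (\<lambda>n. q n x * ee (- (v \<bullet> x))) \<longlonglongrightarrow> ?D x * ee (- (v \<bullet> x))"
    proof (rule AE_I2, rule tendsto_mult_right)
      fix x
      have "((\<lambda>t. g (x + t *\<^sub>R ?e)) has_vector_derivative ?D (x + 0 *\<^sub>R ?e)) (at 0)"
        by (rule has_vector_derivative_partial[OF g])
      then have n: "(\<lambda>t. norm (g (x + t *\<^sub>R ?e) - g x - t *\<^sub>R ?D x) / \<bar>t\<bar>) \<midarrow>0\<rightarrow> 0"
        by (simp add: has_vector_derivative_def has_derivative_iff_norm)
      have l: "(\<lambda>t. (g (x + t *\<^sub>R ?e) - g x) /\<^sub>R t) \<midarrow>0\<rightarrow> ?D x"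
      proof (rule LIM_zero_cancel, rule tendsto_norm_zero_cancel, rule Lim_transform_eventually[OF n])
        have "norm (g (x + t *\<^sub>R ?e) - g x - t *\<^sub>R ?D x) / \<bar>t\<bar> = norm ((g (x + t *\<^sub>R ?e) - g x) /\<^sub>R t - ?D x)" if "t \<noteq> 0" for t
        proof -
          have "(g (x + t *\<^sub>R ?e) - g x) /\<^sub>R t - ?D x = (g (x + t *\<^sub>R ?e) - g x - t *\<^sub>R ?D x) /\<^sub>R t"
            using that by (simp add: scaleR_diff_right)
          then show ?thesis by (simp add: divide_inverse_commute)
        qed
        then show "\<forall>\<^sub>F t in at 0. norm (g (x + t *\<^sub>R ?e) - g x - t *\<^sub>R ?D x) / \<bar>t\<bar> = norm ((g (x + t *\<^sub>R ?e) - g x) /\<^sub>R t - ?D x)"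
          unfolding eventually_at by (intro exI[of _ 1]) auto
      qed
      have "filterlim h (at 0) sequentially" unfolding filterlim_at using h0 h by (auto intro!: always_eventually simp: less_imp_neq[symmetric])
      from filterlim_compose[OF l this] show "(\<lambda>n. q n x) \<longlonglongrightarrow> ?D x" by (simp add: q_def)
    qed
    show "AE x in lborel. norm (q n x * ee (- (v \<bullet> x))) \<le> B * indicator (cball 0 (R + 1)) x" for n
    proof (rule AE_I2)
      fix x :: "real^'d"
      show "norm (q n x * ee (- (v \<bullet> x))) \<le> B * indicator (cball 0 (R + 1)) x"
      proof (cases "norm x \<le> R + 1")
        case True
        then show ?thesis using lip[of x "h n"] h[of n] by (simp add: q_def norm_mult divide_inverse_commute[symmetric] pos_divide_le_eq)
      next
        case False
        have "norm x - norm (h n *\<^sub>R ?e) \<le> norm (x + h n *\<^sub>R ?e)" by (rule norm_diff_ineq)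
        moreover have "norm (h n *\<^sub>R ?e) \<le> 1" using h[of n] by simp
        ultimately have "norm (x + h n *\<^sub>R ?e) > R" using False by linarith
        then have "x + h n *\<^sub>R ?e \<notin> K" "x \<notin> K" using R[of x] R[of "x + h n *\<^sub>R ?e"] False by auto
        then show ?thesis using K(2) False by (simp add: q_def)
      qed
    qed
    show "integrable lborel (\<lambda>x::real^'d. B * indicator (cball 0 (R + 1)) x)"
      using emeasure_bounded_finite[OF bounded_cball, of "0::real^'d" "R+1"]
      by (intro integrable_mult_right integrable_real_indicator) auto
  qed (unfold q_def, measurable)
  \<comment> \<open>A translation in \<open>x\<close> multiplies the transform by a character, so
    the transform of a difference quotient is an explicit factor times
    \<open>ft g v\<close>.\<close>
  moreover have "(LBINT x. q n x * ee (- (v \<bullet> x))) = (ee (h n * (v $ i)) - 1) /\<^sub>R h n * ft g v" for n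
  proof -
    have i1: "integrable lborel (\<lambda>x. g (x + h n *\<^sub>R ?e) * ee (- (v \<bullet> x)))"
      by (rule integrable_mult_ee(2)) (simp add: integrable_lborel_translate ig)
    have i2: "integrable lborel (\<lambda>x. g x * ee (- (v \<bullet> x)))" by (rule integrable_mult_ee(2)[OF ig])
    have "(LBINT x. g (x + h n *\<^sub>R ?e) * ee (- (v \<bullet> x))) = (LBINT x. ee (h n * (v $ i)) * (g x * ee (- (v \<bullet> x))))"
    proof -
      have "g (x + h n *\<^sub>R ?e) * ee (- (v \<bullet> x)) = ee (h n * (v $ i)) * (g (x + h n *\<^sub>R ?e) * ee (- (v \<bullet> (x + h n *\<^sub>R ?e))))" for x
      proof -
        have "- (v \<bullet> x) = h n * (v $ i) + - (v \<bullet> (x + h n *\<^sub>R ?e))" by (simp add: inner_add_right inner_axis)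
        then show ?thesis by (metis (no_types) ee_add mult.left_commute)
      qed
      then have "(LBINT x. g (x + h n *\<^sub>R ?e) * ee (- (v \<bullet> x))) =
          (LBINT x. ee (h n * (v $ i)) * (g (x + h n *\<^sub>R ?e) * ee (- (v \<bullet> (x + h n *\<^sub>R ?e)))))"
        by (rule Bochner_Integration.integral_cong[OF refl])
      also have "... = (LBINT x. ee (h n * (v $ i)) * (g x * ee (- (v \<bullet> x))))"
        by (rule integral_lborel_translate)
      finally show ?thesis .
    qed
    also have "... = ee (h n * (v $ i)) * ft g v" unfolding ft_def by (rule integral_mult_right_zero)
    finally have e: "(LBINT x. g (x + h n *\<^sub>R ?e) * ee (- (v \<bullet> x))) = ee (h n * (v $ i)) * ft g v" .
    have "(LBINT x. q n x * ee (- (v \<bullet> x))) = (LBINT x. (g (x + h n *\<^sub>R ?e) * ee (- (v \<bullet> x)) - g x * ee (- (v \<bullet> x))) /\<^sub>R h n)"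
      unfolding q_def by (intro Bochner_Integration.integral_cong refl) (simp add: left_diff_distrib)
    also have "... = ((LBINT x. g (x + h n *\<^sub>R ?e) * ee (- (v \<bullet> x))) - (LBINT x. g x * ee (- (v \<bullet> x)))) /\<^sub>R h n"
      using i1 i2 by simp
    also have "... = (ee (h n * (v $ i)) - 1) /\<^sub>R h n * ft g v"
      unfolding e ft_def[symmetric] by (simp add: left_diff_distrib)
    finally show ?thesis .
  qed
  moreover have "(\<lambda>n. (ee (h n * (v $ i)) - 1) /\<^sub>R h n * ft g v) \<longlonglongrightarrow> 2 * complex_of_real pi * \<i> * complex_of_real (v $ i) * ft g v"
  proof (rule tendsto_mult_right)
    let ?c = "2 * complex_of_real pi * \<i> * complex_of_real (v $ i)"
    have "((\<lambda>z. exp (?c * z)) has_field_derivative ?c) (at 0)"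
      by (auto intro!: derivative_eq_intros)
    then have l: "(\<lambda>z. (exp (?c * z) - 1) / z) \<midarrow>0\<rightarrow> ?c" by (simp add: DERIV_def)
    have "filterlim (\<lambda>n. complex_of_real (h n)) (at 0) sequentially"
      unfolding filterlim_at using tendsto_of_real[OF h0, where 'a=complex] h by (auto intro!: always_eventually simp: less_imp_neq[symmetric])
    from filterlim_compose[OF l this]
    have "(\<lambda>n. (exp (?c * complex_of_real (h n)) - 1) / complex_of_real (h n)) \<longlonglongrightarrow> ?c" .
    moreover have "(exp (?c * complex_of_real (h n)) - 1) / complex_of_real (h n) = (ee (h n * (v $ i)) - 1) /\<^sub>R h n" for n
      by (simp add: ee_eq_exp scaleR_conv_of_real divide_inverse_commute mult_ac)
    ultimately show "(\<lambda>n. (ee (h n * (v $ i)) - 1) /\<^sub>R h n) \<longlonglongrightarrow> ?c" by simp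
  qed
  ultimately show ?thesis unfolding ft_def[of ?D] using LIMSEQ_unique by simp
qed

text \<open>Differentiating \<open>n\<close> times in one direction multiplies the transform by the
  \<open>n\<close>-th power of that coordinate up to constants, and the derivatives remain
  integrable because the support is compact. So each coordinate power is controlled
  separately.\<close>

lemma ft_smooth_decay:
  fixes g :: "real^'d \<Rightarrow> complex"
  assumes g: "smooth_fun g" and K: "compact K" "\<And>x. x \<notin> K \<Longrightarrow> g x = 0"
  obtains M where "M \<ge> 0" "\<And>v. norm (ft g v) \<le> M * decay v"
proof (rule rapid_decay)
  fix n :: nat
  define G where "G i m = iterated_partial (replicate m i) g" for i m
  have Gd: "G i m differentiable (at x)" for i m x using g by (simp add: smooth_fun_def G_def)
  have Gc: "continuous_on UNIV (G i m)" for i m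
    using Gd by (simp add: continuous_on_eq_continuous_at differentiable_imp_continuous_within)
  have GS: "G i (Suc m) = partial_derivative i (G i m)" for i m by (simp add: G_def iterated_partial_def)
  have GK: "x \<notin> K \<Longrightarrow> G i m x = 0" for i m x
  proof (induction m arbitrary: x)
    case 0 then show ?case using K(2) by (simp add: G_def iterated_partial_def)
  next
    case (Suc m)
    then show ?case unfolding GS by (intro partial_derivative_outside[OF compact_imp_closed[OF K(1)]])
  qed
  have ftG: "ft (G i m) v = (2 * complex_of_real pi * \<i> * complex_of_real (v $ i)) ^ m * ft g v" for i m v
  proof (induction m)
    case (Suc m)
    have "ft (G i (Suc m)) v = 2 * complex_of_real pi * \<i> * complex_of_real (v $ i) * ft (G i m) v"
      unfolding GS by (rule ft_partial_derivative[OF Gd _ K(1) GK]) (use Gc[of i "Suc m"] in \<open>simp add: GS\<close>)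
    then show ?case by (simp add: Suc)
  qed (simp add: G_def iterated_partial_def)
  define A where "A i = (LBINT x. norm (G i n x))" for i
  have "\<bar>v $ i\<bar> ^ n * norm (ft g v) \<le> A i" for v i
  proof -
    have "\<bar>v $ i\<bar> ^ n * norm (ft g v) \<le> (2 * pi * \<bar>v $ i\<bar>) ^ n * norm (ft g v)"
      using pi_gt3 by (intro mult_right_mono power_mono) (auto intro: order_trans[OF _ mult_right_mono[of 1 "2 * pi"]])
    also have "... = norm (ft (G i n) v)" unfolding ftG by (simp add: norm_mult norm_power)
    also have "... \<le> A i" unfolding A_def by (rule norm_ft_le)
    finally show ?thesis .
  qed
  note comp = this
  show "\<exists>B. \<forall>v. norm v ^ n * norm (ft g v) \<le> B"
  proof (intro exI[of _ "real CARD('d) ^ n * (\<Sum>i\<in>UNIV. A i)"] allI)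
    fix v :: "real^'d"
    \<comment> \<open>The largest coordinate controls the norm up to the factor
      \<open>CARD('d)\<close>, so one pure derivative suffices at each \<open>v\<close>.\<close>
    obtain i where i: "\<And>k. \<bar>v $ k\<bar> \<le> \<bar>v $ i\<bar>"
    proof -
      have "finite (range (\<lambda>k. \<bar>v $ k\<bar>))" "range (\<lambda>k. \<bar>v $ k\<bar>) \<noteq> {}" by auto
      from Max_in[OF this] obtain i where "Max (range (\<lambda>k. \<bar>v $ k\<bar>)) = \<bar>v $ i\<bar>" by blast
      then have "\<bar>v $ k\<bar> \<le> \<bar>v $ i\<bar>" for k using Max_ge[of "range (\<lambda>k. \<bar>v $ k\<bar>)" "\<bar>v $ k\<bar>"] by simp
      then show thesis by (rule that)
    qed
    have "norm v \<le> (\<Sum>k\<in>UNIV. \<bar>v $ k\<bar>)" by (rule norm_le_l1_cart)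
    also have "... \<le> (\<Sum>k\<in>(UNIV::'d set). \<bar>v $ i\<bar>)" by (intro sum_mono i)
    finally have "norm v \<le> real CARD('d) * \<bar>v $ i\<bar>" by simp
    then have "norm v ^ n \<le> real CARD('d) ^ n * \<bar>v $ i\<bar> ^ n" unfolding power_mult_distrib[symmetric] by (intro power_mono) auto
    then have "norm v ^ n * norm (ft g v) \<le> real CARD('d) ^ n * (\<bar>v $ i\<bar> ^ n * norm (ft g v))"
      unfolding mult.assoc[symmetric] by (intro mult_right_mono) auto
    also have "... \<le> real CARD('d) ^ n * A i" by (intro mult_left_mono comp) simp
    also have "... \<le> real CARD('d) ^ n * (\<Sum>i\<in>UNIV. A i)"
      by (intro mult_left_mono member_le_sum) (auto simp: A_def intro!: Bochner_Integration.integral_nonneg)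
    finally show "norm v ^ n * norm (ft g v) \<le> real CARD('d) ^ n * (\<Sum>i\<in>UNIV. A i)" .
  qed
qed (rule that)

section \<open>Absolutely summable families on the lattice\<close>

lemma
  fixes a :: "int^'d \<Rightarrow> complex"
  assumes "\<And>F. finite F \<Longrightarrow> (\<Sum>k\<in>F. norm (a k)) \<le> C"
  shows norm_summable_lattice: "(\<lambda>k. norm (a k)) summable_on UNIV"
    and infsum_norm_lattice_le: "(\<Sum>\<^sub>\<infinity>k. norm (a k)) \<le> C"
    and integrable_lattice: "integrable (count_space UNIV) a"
proof -
  show s: "(\<lambda>k. norm (a k)) summable_on UNIV"
    by (rule nonneg_bdd_above_summable_on) (use assms in \<open>auto simp: bdd_above_def\<close>)
  show "(\<Sum>\<^sub>\<infinity>k. norm (a k)) \<le> C" by (rule infsum_le_finite_sums[OF s]) (use assms in auto)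
  show "integrable (count_space UNIV) a"
    using s abs_summable_equivalent[of a UNIV] by (simp add: abs_summable_on_def)
qed

section \<open>Fourier coefficients and Poisson summation\<close>

lemma infsum_eq_integral_count_space:
  fixes a :: "'k \<Rightarrow> complex"
  assumes "integrable (count_space UNIV) a"
  shows "infsum a UNIV = (LINT m|count_space UNIV. a m)"
  using infsetsum_infsum[of a UNIV] assms by (simp add: abs_summable_on_def infsetsum_def)

text \<open>Lattice series are treated as Bochner integrals over \<open>count_space\<close>, so that
  Fubini exchanges them with Lebesgue integrals; a bound on finite partial sums by one integrable
  function is all that has to be checked.\<close>

lemma lattice_sum_integral:
  fixes G :: "int^'d \<Rightarrow> 'a::euclidean_space \<Rightarrow> complex"
  assumes G: "\<And>m. G m \<in> borel_measurable borel"
    and bound: "\<And>x F. finite F \<Longrightarrow> (\<Sum>m\<in>F. norm (G m x)) \<le> w x" and w: "integrable lborel w"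
  shows "(LBINT x. LINT m|count_space UNIV. G m x) = (LINT m|count_space UNIV. LINT x|lborel. G m x)"
    and "integrable (count_space UNIV) (\<lambda>m. LINT x|lborel. G m x)"
proof -
  interpret P: pair_sigma_finite "count_space (UNIV :: (int^'d) set)" "lborel :: 'a measure"
    by (intro pair_sigma_finite.intro sigma_finite_measure_count_space_countable lborel.sigma_finite_measure_axioms) auto
  have Gi: "integrable lborel (G m)" for m
  proof (rule Bochner_Integration.integrable_bound[OF w])
    show "AE x in lborel. norm (G m x) \<le> norm (w x)"
    proof (rule AE_I2)
      fix x
      have "norm (G m x) \<le> w x" using bound[of "{m}" x] by simp
      then show "norm (G m x) \<le> norm (w x)" by simp
    qed
  qed (use G in auto)
  have i: "integrable (count_space UNIV \<Otimes>\<^sub>M lborel) (\<lambda>(m, x). G m x)"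
  proof (rule P.Fubini_integrable)
    show "(\<lambda>(m, x). G m x) \<in> borel_measurable (count_space UNIV \<Otimes>\<^sub>M lborel)"
      by (rule measurable_pair_measure_countable1) (use G in auto)
    show "AE m in count_space UNIV. integrable lborel (\<lambda>x. case (m, x) of (m, x) \<Rightarrow> G m x)" using Gi by simp
    have "integrable (count_space UNIV) (\<lambda>m. complex_of_real (LBINT x. norm (G m x)))"
    proof (rule integrable_lattice)
      fix F :: "(int^'d) set" assume F: "finite F"
      have "(\<Sum>m\<in>F. norm (complex_of_real (LBINT x. norm (G m x)))) = (\<Sum>m\<in>F. LINT x|lborel. norm (G m x))"
        by (intro sum.cong refl) (simp add: abs_of_nonneg Bochner_Integration.integral_nonneg)
      also have "... = (LBINT x. (\<Sum>m\<in>F. norm (G m x)))"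
        using Gi by (intro Bochner_Integration.integral_sum[symmetric]) auto
      also have "... \<le> (LBINT x. w x)"
        using Gi w bound[OF F] by (intro integral_mono Bochner_Integration.integrable_sum) auto
      finally show "(\<Sum>m\<in>F. norm (complex_of_real (LBINT x. norm (G m x)))) \<le> (LBINT x. w x)" .
    qed
    then show "integrable (count_space UNIV) (\<lambda>m. LINT x|lborel. norm (case (m, x) of (m, x) \<Rightarrow> G m x))"
      by (simp add: complex_of_real_integrable_eq)
  qed
  show "(LBINT x. LINT m|count_space UNIV. G m x) = (LINT m|count_space UNIV. LINT x|lborel. G m x)"
    by (rule P.Fubini_integral[OF i])
  show "integrable (count_space UNIV) (\<lambda>m. LINT x|lborel. G m x)" using P.integrable_fst[OF i] .
qed

lemma lattice_vec_add: "lattice_vec (k + m) = lattice_vec k + lattice_vec m"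
  and lattice_vec_diff: "lattice_vec (k - m) = lattice_vec k - lattice_vec m"
  by (simp_all add: lattice_vec_def vec_eq_iff)

lemma sets_unit_cube[measurable]: "unit_cube \<in> sets borel"
proof -
  have "unit_cube = {\<xi>\<in>space borel. \<forall>i\<in>UNIV. - (1/2) < \<xi> $ i \<and> \<xi> $ i < (1/2 :: real)}" by (auto simp: unit_cube_def)
  also have "... \<in> sets borel" by measurable
  finally show ?thesis .
qed

lemma unit_cube_eq_box: "unit_cube = box (- (1/2) *\<^sub>R One) ((1/2) *\<^sub>R (One :: real^'d))"
  by (auto simp: unit_cube_def mem_box_cart)

lemma open_unit_cube: "open (unit_cube :: (real^'d) set)" and bounded_unit_cube: "bounded (unit_cube :: (real^'d) set)"
  unfolding unit_cube_eq_box by auto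

lemma integrable_indicator_unit_cube: "integrable lborel (indicator unit_cube :: real^'d \<Rightarrow> real)"
  using emeasure_bounded_finite[OF bounded_unit_cube] by (intro integrable_real_indicator) auto

text \<open>Uniqueness of Fourier coefficients: powers of \<open>\<Prod>\<^sub>i (1 + cos (2\<pi>(y\<^sub>i - c\<^sub>i))) / 2\<close> are trigonometric
  polynomials that peak at \<open>c\<close>, and only at \<open>c\<close>, within the cube.\<close>

lemma fourier_coefficients_unique:
  fixes D :: "real^'d \<Rightarrow> complex"
  assumes [measurable]: "D \<in> borel_measurable borel" and DM: "\<And>x. norm (D x) \<le> M"
    and zero: "\<And>m. (LBINT y. indicator unit_cube y * D y * ee (y \<bullet> lattice_vec m)) = 0"
    and cont: "isCont D c" and c: "c \<in> unit_cube"
  shows "D c = 0"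
proof (rule ccontr)
  assume Dc: "D c \<noteq> 0"
  let ?Q = "unit_cube :: (real^'d) set"
  have M0: "0 \<le> M" using order_trans[OF norm_ge_zero DM] .
  define fac where "fac i y = (1 + cos (2 * pi * (y $ i - c $ i))) / 2" for i and y :: "real^'d"
  have fac01: "0 \<le> fac i y" "fac i y \<le> 1" for i y
  proof -
    have "0 \<le> 1 + cos (2 * pi * (y $ i - c $ i))" "1 + cos (2 * pi * (y $ i - c $ i)) \<le> 2"
      using cos_ge_minus_one[of "2 * pi * (y $ i - c $ i)"] cos_le_one[of "2 * pi * (y $ i - c $ i)"] by linarith+
    then show "0 \<le> fac i y" "fac i y \<le> 1" by (simp_all only: fac_def divide_nonneg_pos divide_le_eq_1 zero_less_numeral) simp
  qed
  have [measurable]: "fac i \<in> borel_measurable borel" for i unfolding fac_def by measurable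
  \<comment> \<open>The bounded multipliers \<open>p\<close> for which every Fourier coefficient of
    \<open>D * p\<close> vanishes. The class is closed under multiplication by \<open>fac i\<close>,
    because that factor combines three characters and only shifts the coefficient index.\<close>
  define T where "T p \<longleftrightarrow> p \<in> borel_measurable borel \<and> (\<exists>B. \<forall>y. norm (p y) \<le> B) \<and>
     (\<forall>m. (LBINT y. indicator ?Q y * D y * p y * ee (y \<bullet> lattice_vec m)) = 0)" for p :: "real^'d \<Rightarrow> complex"
  have iQ: "integrable lborel (\<lambda>y. indicator ?Q y * D y * p y * q y)"
    if [measurable]: "p \<in> borel_measurable borel" "q \<in> borel_measurable borel" and B: "\<And>y. norm (p y) \<le> B" "\<And>y. norm (q y) \<le> 1" for p q :: "real^'d \<Rightarrow> complex" and B
  proof (rule Bochner_Integration.integrable_bound[OF integrable_mult_right[OF integrable_indicator_unit_cube]])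
    show "AE y in lborel. norm (indicator ?Q y * D y * p y * q y) \<le> norm (M * B * 1 * indicator ?Q y)"
    proof (rule AE_I2)
      fix y
      have B0: "0 \<le> B" using B(1)[of 0] norm_ge_zero order_trans by blast
      have "norm (D y) * norm (p y) * norm (q y) \<le> M * B * 1"
        by (intro mult_mono DM B M0 B0 mult_nonneg_nonneg) auto
      then show "norm (indicator ?Q y * D y * p y * q y) \<le> norm (M * B * 1 * indicator ?Q y)"
        using M0 B0 by (cases "y \<in> ?Q") (auto simp: norm_mult)
    qed
  qed measurable
  have T1: "T (\<lambda>_. 1)" unfolding T_def using zero by (auto intro!: exI[of _ 1])
  have Tfac: "T (\<lambda>y. p y * complex_of_real (fac i y))" if p: "T p" for p i
  proof -
    from p have [measurable]: "p \<in> borel_measurable borel" by (simp add: T_def)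
    from p obtain B where B: "\<And>y. norm (p y) \<le> B" by (auto simp: T_def)
    let ?e = "axis i 1 :: int^'d"
    have ei: "y \<bullet> lattice_vec ?e = y $ i" for y :: "real^'d"
    proof -
      have "lattice_vec ?e = (axis i 1 :: real^'d)" by (simp add: lattice_vec_def vec_eq_iff axis_def)
      then show ?thesis by (simp add: inner_axis)
    qed
    have fe: "complex_of_real (fac i y) = 1 / 2 + ee (- (c $ i)) / 4 * ee (y $ i) + ee (c $ i) / 4 * ee (- (y $ i))" for y
    proof -
      have "ee (- (c $ i)) * ee (y $ i) + ee (c $ i) * ee (- (y $ i)) = ee (y $ i - c $ i) + ee (- (y $ i - c $ i))"
        by (simp flip: ee_add)
      also have "... = complex_of_real (2 * cos (2 * pi * (y $ i - c $ i)))"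
      proof -
        have "ee u + ee (- u) = complex_of_real (2 * cos (2 * pi * u))" for u
          by (simp add: ee_def complex_eq_iff)
        then show ?thesis .
      qed
      finally show ?thesis by (simp add: fac_def field_simps)
    qed
    have iw: "integrable lborel (\<lambda>y. indicator ?Q y * D y * p y * ee (y \<bullet> lattice_vec m))" for m
      by (rule iQ[where B=B]) (auto simp: B)
    have z: "(LBINT y. indicator ?Q y * D y * p y * ee (y \<bullet> lattice_vec m)) = 0" for m using p by (simp add: T_def)
    have "(LBINT y. indicator ?Q y * D y * (p y * complex_of_real (fac i y)) * ee (y \<bullet> lattice_vec m)) = 0" for m
    proof -
      have "indicator ?Q y * D y * (p y * complex_of_real (fac i y)) * ee (y \<bullet> lattice_vec m) =
         1 / 2 * (indicator ?Q y * D y * p y * ee (y \<bullet> lattice_vec m)) +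
         (ee (- (c $ i)) / 4 * (indicator ?Q y * D y * p y * ee (y \<bullet> lattice_vec (m + ?e))) +
         ee (c $ i) / 4 * (indicator ?Q y * D y * p y * ee (y \<bullet> lattice_vec (m - ?e))))" for y
      proof -
        have "ee (y \<bullet> lattice_vec (m + ?e)) = ee (y \<bullet> lattice_vec m) * ee (y $ i)"
          by (simp add: lattice_vec_add inner_add_right ei ee_add)
        moreover have "ee (y \<bullet> lattice_vec (m - ?e)) = ee (y \<bullet> lattice_vec m) * ee (- (y $ i))"
          by (simp add: lattice_vec_diff inner_diff_right ei flip: ee_add)
        ultimately show ?thesis unfolding fe by (simp add: algebra_simps)
      qed
      then have "(LBINT y. indicator ?Q y * D y * (p y * complex_of_real (fac i y)) * ee (y \<bullet> lattice_vec m)) =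
         (LBINT y. 1 / 2 * (indicator ?Q y * D y * p y * ee (y \<bullet> lattice_vec m)) +
         (ee (- (c $ i)) / 4 * (indicator ?Q y * D y * p y * ee (y \<bullet> lattice_vec (m + ?e))) +
         ee (c $ i) / 4 * (indicator ?Q y * D y * p y * ee (y \<bullet> lattice_vec (m - ?e)))))"
        by (rule Bochner_Integration.integral_cong[OF refl])
      also have "... = 0"
        using iw z
        by (subst Bochner_Integration.integral_add, simp, simp, subst Bochner_Integration.integral_add) (simp_all)
      finally show ?thesis .
    qed
    moreover have "norm (p y * complex_of_real (fac i y)) \<le> B" for y
      using mult_mono[OF B[of y], of "\<bar>fac i y\<bar>" 1] fac01[of i y] order_trans[OF norm_ge_zero B] by (simp add: norm_mult)
    ultimately show ?thesis unfolding T_def by (auto intro!: exI[of _ B])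
  qed
  have Tprod: "T (\<lambda>y. p y * complex_of_real (\<Prod>i\<in>A. fac i y))" if "finite A" "T p" for p A
    using that
  proof (induction A rule: finite_induct)
    case (insert i A)
    from Tfac[OF insert.IH[OF insert.prems], of i] show ?case
      using insert.hyps by (simp add: mult_ac)
  qed simp
  define k where "k y = (\<Prod>i\<in>UNIV. fac i y)" for y
  have [measurable]: "k \<in> borel_measurable borel" unfolding k_def by measurable
  have Tk: "T (\<lambda>y. complex_of_real (k y ^ n))" for n
  proof (induction n)
    case 0 then show ?case using T1 by simp
  next
    case (Suc n)
    from Tprod[OF finite Suc, of UNIV] show ?case by (simp add: k_def mult.commute)
  qed
  have k01: "0 \<le> k y" "k y \<le> 1" for y unfolding k_def by (auto intro!: prod_nonneg prod_le_1 fac01)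
  \<comment> \<open>Rotating by \<open>cnj (D c)\<close> gives a real function that is positive at
    \<open>c\<close>, hence on a neighbourhood of it.\<close>
  define R where "R y = Re (cnj (D c) * D y)" for y
  have [measurable]: "R \<in> borel_measurable borel" unfolding R_def by measurable
  define M' where "M' = norm (D c) * M"
  have RM: "\<bar>R y\<bar> \<le> M'" for y
    using abs_Re_le_cmod[of "cnj (D c) * D y"] mult_left_mono[OF DM[of y], of "norm (D c)"]
    by (simp add: R_def M'_def norm_mult)
  have iR: "integrable lborel (\<lambda>y. indicator ?Q y * (R y * k y ^ n))" for n
  proof (rule Bochner_Integration.integrable_bound[OF integrable_mult_right[OF integrable_indicator_unit_cube, where c=M']])
    show "AE y in lborel. norm (indicator ?Q y * (R y * k y ^ n)) \<le> norm (M' * indicator ?Q y)"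
    proof (rule AE_I2)
      fix y
      have "\<bar>R y\<bar> * k y ^ n \<le> M' * 1" using k01 RM[of y] by (intro mult_mono power_le_one) auto
      then show "norm (indicator ?Q y * (R y * k y ^ n)) \<le> norm (M' * indicator ?Q y)"
        using k01 by (auto simp: indicator_def abs_mult)
    qed
  qed measurable
  have R0: "(LBINT y. indicator ?Q y * (R y * k y ^ n)) = 0" for n
  proof -
    have "(LBINT y. indicator ?Q y * D y * complex_of_real (k y ^ n) * ee (y \<bullet> lattice_vec 0)) = 0"
      using Tk[of n] unfolding T_def by blast
    then have z: "(LBINT y. indicator ?Q y * D y * complex_of_real (k y ^ n) * 1) = 0" by (simp add: lattice_vec_def zero_vec_def[symmetric])
    have i: "integrable lborel (\<lambda>y. indicator ?Q y * D y * complex_of_real (k y ^ n) * 1)"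
      by (rule iQ[where B=1]) (use k01 in \<open>auto simp: norm_power abs_of_nonneg power_le_one simp del: of_real_power\<close>)
    have rre: "Re (complex_of_real r * z) = r * Re z" for r z by simp
    have "(LBINT y. indicator ?Q y * (R y * k y ^ n)) = (LBINT y. Re (cnj (D c) * (indicator ?Q y * D y * complex_of_real (k y ^ n) * 1)))"
    proof (intro Bochner_Integration.integral_cong refl)
      fix y
      have "cnj (D c) * (indicator ?Q y * D y * complex_of_real (k y ^ n) * 1) = complex_of_real (indicator ?Q y * k y ^ n) * (cnj (D c) * D y)"
        by (auto simp: indicator_def)
      then show "indicator ?Q y * (R y * k y ^ n) = Re (cnj (D c) * (indicator ?Q y * D y * complex_of_real (k y ^ n) * 1))"
        unfolding R_def by (metis (no_types) rre mult.assoc mult.commute)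
    qed
    also have "... = Re (LBINT y. cnj (D c) * (indicator ?Q y * D y * complex_of_real (k y ^ n) * 1))"
      by (rule integral_Re) (rule integrable_mult_right[OF i])
    also have "... = Re (cnj (D c) * (LBINT y. indicator ?Q y * D y * complex_of_real (k y ^ n) * 1))"
      by (simp only: integral_mult_right_zero)
    also have "... = 0" unfolding z by simp
    finally show ?thesis .
  qed
  define d where "d = (norm (D c))\<^sup>2 / 2"
  have d: "d > 0" using Dc by (simp add: d_def)
  have Rc: "R c = 2 * d" unfolding R_def d_def by (simp add: cmod_power2) (simp add: power2_eq_square)
  have "isCont R c" unfolding R_def by (intro isCont_Re isCont_mult continuous_const cont)
  then have "\<forall>\<^sub>F y in nhds c. R y > d"
    using Rc d by (intro order_tendstoD(1)[of R "R c"]) (simp_all add: isCont_def tendsto_nhds_iff)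
  then obtain r1 where r1: "r1 > 0" "\<And>y. dist y c < r1 \<Longrightarrow> R y > d" by (auto simp: eventually_nhds_metric)
  obtain r2 where r2: "r2 > 0" "ball c r2 \<subseteq> ?Q" using open_unit_cube c by (meson openE)
  define r where "r = min r1 r2 / (2 * real CARD('d))"
  have CD: "real CARD('d) \<ge> 1" using one_le_card_finite[where 'a='d] by linarith
  have r: "r > 0" using r1(1) r2(1) by (simp add: r_def card_gt_0_iff)
  define N where "N s = {y :: real^'d. \<forall>i. \<bar>y $ i - c $ i\<bar> < s}" for s
  have Nball: "y \<in> N r \<Longrightarrow> dist y c < min r1 r2" for y
  proof -
    assume y: "y \<in> N r"
    have "dist y c \<le> (\<Sum>i\<in>UNIV. \<bar>(y - c) $ i\<bar>)" unfolding dist_norm by (rule norm_le_l1_cart)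
    also have "... \<le> (\<Sum>i\<in>(UNIV::'d set). r)" using y by (intro sum_mono) (auto simp: N_def less_imp_le)
    also have "... = min r1 r2 / 2" by (simp add: r_def)
    also have "... < min r1 r2" using r1(1) r2(1) by linarith
    finally show ?thesis .
  qed
  have NQ: "N r \<subseteq> ?Q" using Nball r2(2) by (auto simp: subset_iff dist_commute)
  have [measurable]: "N s \<in> sets borel" for s
  proof -
    have "N s = {y\<in>space borel. \<forall>i\<in>UNIV. \<bar>y $ i - c $ i\<bar> < s}" by (auto simp: N_def)
    also have "... \<in> sets borel" by measurable
    finally show ?thesis .
  qed
  \<comment> \<open>The cube \<open>N r\<close> around \<open>c\<close> lies in the unit cube, so
    \<open>c\<close> keeps distance \<open>r\<close> from the faces. Together with periodicity of
    the cosine this excludes a second peak: in the unit cube but outside \<open>N r\<close>, some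
    coordinate difference lies between \<open>r\<close> and \<open>1 - r\<close>.\<close>
  have gap: "\<bar>c $ i\<bar> + r \<le> 1 / 2" for i
  proof (rule field_le_epsilon)
    fix e :: real assume e: "e > 0"
    define t where "t = max 0 (r - e)"
    have t: "0 \<le> t" "t < r" "r - e \<le> t" using e r by (auto simp: t_def)
    define y where "y = c + (sgn (c $ i) * t) *\<^sub>R axis i 1"
    have "y \<in> N r" unfolding N_def y_def using t r by (auto simp: axis_def abs_mult sgn_if)
    then have "y \<in> ?Q" using NQ by blast
    then have "- (1/2) < y $ i" "y $ i < 1/2" by (auto simp: unit_cube_def)
    moreover have "y $ i = c $ i + sgn (c $ i) * t" by (simp add: y_def axis_def)
    ultimately have "\<bar>c $ i\<bar> + t \<le> 1 / 2 \<or> c $ i = 0" by (auto simp: sgn_if split: if_splits)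
    moreover have "c $ i = 0 \<Longrightarrow> \<bar>c $ i\<bar> + t \<le> 1 / 2"
    proof -
      assume c0: "c $ i = 0"
      define y' where "y' = c + t *\<^sub>R axis i 1"
      have "y' \<in> N r" unfolding N_def y'_def using t r by (auto simp: axis_def)
      then have "y' \<in> ?Q" using NQ by blast
      then have "y' $ i < 1/2" by (auto simp: unit_cube_def)
      then show ?thesis using c0 by (simp add: y'_def axis_def)
    qed
    ultimately show "\<bar>c $ i\<bar> + r \<le> 1 / 2 + e" using t by linarith
  qed
  define a1 where "a1 = (1 + cos (2 * pi * r)) / 2"
  have r_half: "r \<le> 1 / 2" using gap[of undefined] by linarith
  have a1: "0 \<le> a1" "a1 < 1"
  proof -
    have "0 \<le> 1 + cos (2 * pi * r)" using cos_ge_minus_one[of "2 * pi * r"] by linarith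
    then show "0 \<le> a1" by (simp only: a1_def divide_nonneg_pos zero_less_numeral)
    have "cos (2 * pi * r) < cos 0" using r r_half by (intro cos_monotone_0_pi) auto
    then show "a1 < 1" by (simp add: a1_def)
  qed
  have off: "k y \<le> a1" if w: "y \<in> ?Q" "y \<notin> N r" for y
  proof -
    obtain i where i: "r \<le> \<bar>y $ i - c $ i\<bar>" using w(2) by (auto simp: N_def not_less)
    define t where "t = \<bar>y $ i - c $ i\<bar>"
    have "- (1/2) < y $ i" "y $ i < 1/2" using w(1) by (auto simp: unit_cube_def)
    then have "\<bar>y $ i\<bar> < 1 / 2" by linarith
    then have t: "r \<le> t" "t \<le> 1 - r" using i gap[of i] by (auto simp: t_def)
    have cs: "cos (2 * pi * (y $ i - c $ i)) = cos (2 * pi * t)" unfolding t_def abs_if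
      using cos_minus[of "2 * pi * (y $ i - c $ i)"] by (auto simp: algebra_simps)
    have "cos (2 * pi * t) \<le> cos (2 * pi * r)"
    proof (cases "t \<le> 1 / 2")
      case True
      then show ?thesis using t r by (intro cos_monotone_0_pi_le) auto
    next
      case False
      have "cos (2 * pi * t) = cos (2 * pi * (1 - t))"
        using cos_periodic[of "- (2 * pi * t)"] by (simp add: algebra_simps)
      also have "... \<le> cos (2 * pi * r)" using False t r by (intro cos_monotone_0_pi_le) (auto simp: mult_le_cancel_left)
      finally show ?thesis .
    qed
    then have "fac i y \<le> a1" unfolding fac_def a1_def cs by simp
    moreover have "k y = fac i y * (\<Prod>j\<in>UNIV - {i}. fac j y)" unfolding k_def by (rule prod.remove) auto
    moreover have "(\<Prod>j\<in>UNIV - {i}. fac j y) \<le> 1" by (intro prod_le_1) (auto simp: fac01)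
    ultimately show ?thesis using fac01[of i y] mult_left_le[of "\<Prod>j\<in>UNIV - {i}. fac j y" "fac i y"] by linarith
  qed
  \<comment> \<open>A level strictly between the bound \<open>a1\<close> for \<open>k\<close> off
    \<open>N r\<close> and the peak value 1. On a small ball \<open>V\<close> the function
    \<open>k\<close> exceeds it, so high powers of \<open>k\<close> let the ball outweigh the rest
    of the cube.\<close>
  define a2 where "a2 = (1 + a1) / 2"
  have a2: "a1 < a2" "0 < a2" "a2 < 1" using a1 by (auto simp: a2_def)
  have "isCont k c" unfolding k_def fac_def by (intro continuous_intros) simp
  moreover have kc: "k c = 1" by (simp add: k_def fac_def)
  ultimately have "\<forall>\<^sub>F y in nhds c. k y > a2"
    using a2 by (intro order_tendstoD(1)[of k "k c"]) (simp_all add: isCont_def tendsto_nhds_iff)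
  then obtain r3 where r3: "r3 > 0" "\<And>y. dist y c < r3 \<Longrightarrow> k y > a2" by (auto simp: eventually_nhds_metric)
  define s where "s = min r3 (min r1 r2 / (2 * real CARD('d)))"
  define V where "V = ball c s"
  have s: "s > 0" using r3(1) r unfolding s_def r_def by simp
  have V: "V \<subseteq> N r" unfolding V_def N_def
  proof clarify
    fix y i assume "y \<in> ball c s"
    then have "norm (y - c) < r" by (simp add: s_def r_def dist_norm norm_minus_commute)
    then show "\<bar>y $ i - c $ i\<bar> < r" using component_le_norm_cart[of "y - c" i] by simp
  qed
  have Vk: "y \<in> V \<Longrightarrow> a2 \<le> k y" for y using r3(2)[of y] by (simp add: V_def s_def dist_commute)
  have [measurable]: "V \<in> sets borel" by (simp add: V_def)
  have iV: "integrable lborel (indicator V :: real^'d \<Rightarrow> real)"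
    unfolding V_def using emeasure_bounded_finite[OF bounded_ball, of c s] by (intro integrable_real_indicator) auto
  define v where "v = measure lborel V"
  have v: "v > 0" unfolding v_def V_def by (rule content_ball_pos[OF s])
  define q where "q = measure lborel ?Q"
  have ineq: "d * a2 ^ n * v \<le> M' * a1 ^ n * q" for n
  proof -
    have "(LBINT y. d * a2 ^ n * indicator V y - M' * a1 ^ n * indicator ?Q y) \<le> (LBINT y. indicator ?Q y * (R y * k y ^ n))"
    proof (rule integral_mono)
      show "integrable lborel (\<lambda>y. d * a2 ^ n * indicator V y - M' * a1 ^ n * indicator ?Q y)"
        by (intro Bochner_Integration.integrable_diff integrable_mult_right iV integrable_indicator_unit_cube)
      fix y
      show "d * a2 ^ n * indicator V y - M' * a1 ^ n * indicator ?Q y \<le> indicator ?Q y * (R y * k y ^ n)"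
      proof (cases "y \<in> N r")
        case True
        have Rp: "d < R y" using Nball[OF True] r1(2) by simp
        have "d * a2 ^ n * indicator V y \<le> R y * k y ^ n"
        proof (cases "y \<in> V")
          case VT: True
          have "d * a2 ^ n \<le> R y * k y ^ n" using Rp d Vk[OF VT] a2 by (intro mult_mono power_mono) auto
          then show ?thesis using VT by simp
        next
          case False
          then show ?thesis using Rp d k01[of y] by simp
        qed
        moreover have "0 \<le> M' * a1 ^ n" using RM[of y] a1 by (intro mult_nonneg_nonneg) auto
        ultimately show ?thesis using True NQ by auto
      next
        case False
        then have nV: "y \<notin> V" using V by blast
        show ?thesis
        proof (cases "y \<in> ?Q")
          case QT: True
          have "\<bar>R y\<bar> * k y ^ n \<le> M' * a1 ^ n" using RM[of y] off[OF QT False] k01[of y] by (intro mult_mono power_mono) auto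
          then have "- (M' * a1 ^ n) \<le> R y * k y ^ n" using k01[of y] abs_ge_minus_self[of "R y * k y ^ n"] by (simp add: abs_mult)
          then show ?thesis using QT nV by simp
        qed (use nV in simp)
      qed
    qed (rule iR)
    then have "(LBINT y. d * a2 ^ n * indicator V y - M' * a1 ^ n * indicator ?Q y) \<le> 0" by (simp only: R0)
    moreover have "(LBINT y. d * a2 ^ n * indicator V y - M' * a1 ^ n * indicator ?Q y) = d * a2 ^ n * v - M' * a1 ^ n * q"
      using integrable_mult_right[OF iV, of "d * a2 ^ n"] integrable_mult_right[OF integrable_indicator_unit_cube, of "M' * a1 ^ n"]
      by (subst Bochner_Integration.integral_diff) (simp_all add: v_def q_def)
    ultimately show ?thesis by simp
  qed
  \<comment> \<open>Dividing by \<open>a2 ^ n\<close> leaves a geometric factor on the right, which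
    tends to 0 against a positive left side.\<close>
  have "d * v \<le> M' * q * (a1 / a2) ^ n" for n
    using ineq[of n] a2 by (simp add: power_divide field_simps)
  moreover have "(\<lambda>n. M' * q * (a1 / a2) ^ n) \<longlonglongrightarrow> M' * q * 0"
    using a1 a2 by (intro tendsto_intros LIMSEQ_power_zero) auto
  ultimately have "d * v \<le> M' * q * 0" by (intro LIMSEQ_le_const) auto
  then show False using d v by (simp add: mult_le_0_iff)
qed

section \<open>Matrix changes of variables and lattice sums\<close>

lemma
  fixes b :: "real^'d^'d"
  assumes "invertible b"
  shows matrix_inv_cancel: "b *v (matrix_inv b *v x) = x" "matrix_inv b *v (b *v x) = x"
    and matrix_inv_cancel_row: "(x v* b) v* matrix_inv b = x" "(x v* matrix_inv b) v* b = x"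
proof -
  have "b ** matrix_inv b = mat 1 \<and> matrix_inv b ** b = mat 1"
    using someI_ex[OF assms[unfolded invertible_def]] unfolding matrix_inv_def .
  then show "b *v (matrix_inv b *v x) = x" "matrix_inv b *v (b *v x) = x"
    "(x v* b) v* matrix_inv b = x" "(x v* matrix_inv b) v* b = x"
    by (simp_all only: matrix_vector_mul_assoc vector_matrix_mul_assoc matrix_vector_mul_lid vector_matrix_mul_rid)
qed

lemma linear_row_mult: "linear (\<lambda>x. x v* (A :: real^'d^'d))"
  using matrix_vector_mul_linear[of "transpose A"] by (simp add: transpose_matrix_vector)

lemma isCont_row_mult: "isCont (\<lambda>x. x v* (A :: real^'d^'d)) x"
  using linear_continuous_at[OF linear_row_mult[unfolded linear_conv_bounded_linear]] .

lemma isCont_matrix_mult: "isCont (\<lambda>x. (A :: real^'d^'d) *v x) x"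
  by (rule linear_continuous_at[OF matrix_vector_mul_bounded_linear])

lemma measurable_row_mult[measurable]: "(\<lambda>x. x v* (A :: real^'d^'d)) \<in> borel_measurable borel"
  by (intro borel_measurable_continuous_onI continuous_at_imp_continuous_on ballI isCont_row_mult)

lemma measurable_matrix_mult[measurable]: "(\<lambda>x. (A :: real^'d^'d) *v x) \<in> borel_measurable borel"
  by (intro borel_measurable_continuous_onI continuous_at_imp_continuous_on ballI isCont_matrix_mult)

text \<open>The Jacobian is kept as an unnamed positive \<open>c\<close>, which later cancels or is
  absorbed into a bound.\<close>

lemma row_change_of_variables:
  fixes b :: "real^'d^'d"
  assumes b: "invertible b"
  obtains c where "c > 0"
    "\<And>f::real^'d \<Rightarrow> complex. integrable lborel f \<Longrightarrow> integrable lborel (\<lambda>x. f (x v* matrix_inv b))"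
    "\<And>f::real^'d \<Rightarrow> complex. integrable lborel f \<Longrightarrow> (LBINT x. f (x v* matrix_inv b)) = of_real c * (LBINT x. f x)"
proof (rule linear_change_of_variables[OF linear_row_mult linear_row_mult matrix_inv_cancel_row(1,2)[OF b]])
  fix c assume c: "c > 0"
    "\<And>f::real^'d \<Rightarrow> complex. integrable lborel f \<Longrightarrow> integrable lborel (\<lambda>x. f (x v* matrix_inv b))"
    "\<And>f::real^'d \<Rightarrow> complex. integrable lborel f \<Longrightarrow> (LBINT x. f (x v* matrix_inv b)) = of_real c * (LBINT x. f x)"
  show thesis by (rule that[OF c])
qed

text \<open>Stated with finite partial sums at every real shift, so that it passes under integrals
  and yields absolute summability.\<close>

definition lattice_bounded :: "real^'d^'d \<Rightarrow> real \<Rightarrow> (real^'d \<Rightarrow> complex) \<Rightarrow> bool" where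
  "lattice_bounded b C g \<longleftrightarrow> (\<forall>y F. finite F \<longrightarrow> (\<Sum>k\<in>F. norm (g (y - b *v lattice_vec k))) \<le> C)"

lemma lattice_boundedD: "lattice_bounded b C g \<Longrightarrow> finite F \<Longrightarrow> (\<Sum>k\<in>F. norm (g (y - b *v lattice_vec k))) \<le> C"
  by (simp add: lattice_bounded_def)

lemma lattice_vec_0[simp]: "lattice_vec 0 = 0"
  by (simp add: lattice_vec_def vec_eq_iff)

lemma lattice_bounded_norm_le: "lattice_bounded b C g \<Longrightarrow> norm (g y) \<le> C"
  using lattice_boundedD[of b C g "{0}" y] by simp

lemma lattice_bounded_decay:
  fixes g :: "real^'d \<Rightarrow> complex"
  assumes b: "invertible b" and M: "M \<ge> 0" "\<And>v. norm (g (b *v v)) \<le> M * decay v"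
  obtains C where "C \<ge> 0" "lattice_bounded b C g"
proof -
  from decay_sum_bounded[where 'd='d] obtain C where C': "0 \<le> C \<and> (\<forall>v::real^'d. \<forall>F. finite F \<longrightarrow> (\<Sum>k\<in>F. decay (v - lattice_vec k)) \<le> C)" ..
  have C: "C \<ge> 0" "\<And>v F. finite F \<Longrightarrow> (\<Sum>k\<in>F. decay (v - lattice_vec k :: real^'d)) \<le> C"
    using C' by simp_all
  have "(\<Sum>k\<in>F. norm (g (y - b *v lattice_vec k))) \<le> M * C" if F: "finite F" for y F
  proof -
    have "g (y - b *v lattice_vec k) = g (b *v (matrix_inv b *v y - lattice_vec k))" for k
      by (simp add: matrix_vector_mult_diff_distrib matrix_inv_cancel[OF b])
    then have "(\<Sum>k\<in>F. norm (g (y - b *v lattice_vec k))) \<le> (\<Sum>k\<in>F. M * decay (matrix_inv b *v y - lattice_vec k))"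
      using M(2) by (intro sum_mono) simp
    also have "... \<le> M * C" using C(2)[OF F] M(1) by (simp add: sum_distrib_left[symmetric] mult_left_mono)
    finally show ?thesis .
  qed
  then show ?thesis using that[of "M * C"] M(1) C(1) by (simp add: lattice_bounded_def)
qed

section \<open>Orthogonality of characters and Poisson summation\<close>

lemma integral_unit_interval_ee:
  "(LBINT t. indicator {- (1/2)<..<1/2} t * ee (t * of_int n)) = (if n = 0 then 1 else 0)"
proof -
  have "(LBINT t. indicator {- (1/2)<..<1/2} t * ee (t * of_int n)) = (LBINT t. indicator {- (1/2)..1/2} t *\<^sub>R ee (t * of_int n))"
  proof (rule integral_cong_AE)
    have "AE t in lborel. t \<noteq> - (1/2::real) \<and> t \<noteq> 1/2" using AE_lborel_singleton[of "-(1/2)::real"] AE_lborel_singleton[of "1/2::real"] by auto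
    then show "AE t in lborel. indicator {- (1/2)<..<1/2} t * ee (t * of_int n) = indicator {- (1/2)..1/2} t *\<^sub>R ee (t * of_int n)"
      by eventually_elim (auto simp: indicator_def)
  qed auto
  also have "... = (if n = 0 then 1 else 0)"
  proof (cases "n = 0")
    case True
    have "(LBINT t. indicator {- (1/2)..1/2::real} t *\<^sub>R (1::complex)) = of_real (1/2) - of_real (- (1/2))"
      by (rule integral_FTC_Icc) (auto intro!: derivative_eq_intros continuous_intros has_vector_derivative_of_real)
    then show ?thesis using True by simp
  next
    case False
    let ?w = "2 * of_real pi * \<i> * of_int n :: complex"
    have w: "?w \<noteq> 0" using False by simp
    have e: "ee (t * of_int n) = exp (?w * of_real t)" for t unfolding ee_eq_exp by (simp add: mult_ac)
    have "(LBINT t. indicator {- (1/2)..1/2::real} t *\<^sub>R exp (?w * of_real t)) = exp (?w * of_real (1/2)) / ?w - exp (?w * of_real (- (1/2))) / ?w"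
    proof (rule integral_FTC_Icc)
      fix x :: real
      have "((\<lambda>z. exp (?w * z) / ?w) has_field_derivative exp (?w * of_real x)) (at (of_real x))"
        using w by (auto intro!: derivative_eq_intros)
      from has_vector_derivative_real_field[OF this]
      show "((\<lambda>t. exp (?w * of_real t) / ?w) has_vector_derivative exp (?w * of_real x)) (at x within {- (1/2)..1/2})" .
    qed (auto intro!: continuous_intros)
    moreover have "exp (?w * of_real (1/2)) = exp (?w * of_real (- (1/2)))"
    proof -
      have "exp (?w * of_real (1/2)) = ee (of_int n) * ee (- (1/2) * of_int n)" unfolding ee_add[symmetric] e[symmetric]
        by (simp add: field_simps)
      then show ?thesis unfolding e[symmetric] by (simp add: ee_of_int e)
    qed
    ultimately show ?thesis using False by (simp add: e)
  qed
  finally show ?thesis .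
qed

lemma integral_unit_cube_ee:
  fixes k :: "int^'d"
  shows "(LBINT \<omega>. indicator unit_cube \<omega> * ee (\<omega> \<bullet> lattice_vec k)) = (if k = 0 then 1 else 0)"
proof -
  define f where "f b t = indicator {- (1/2)<..<1/2} t * ee (t * (lattice_vec k \<bullet> b))" for b :: "real^'d" and t
  have e: "indicator unit_cube \<omega> * ee (\<omega> \<bullet> lattice_vec k) = (\<Prod>b\<in>Basis. f b (\<omega> \<bullet> b))" for \<omega>
  proof -
    have "ee (\<omega> \<bullet> lattice_vec k) = (\<Prod>b\<in>Basis. ee ((\<omega> \<bullet> b) * (lattice_vec k \<bullet> b)))"
      by (subst euclidean_inner) (simp add: ee_sum)
    moreover have "(indicator unit_cube \<omega> :: complex) = (\<Prod>b\<in>Basis. indicator {- (1/2)<..<1/2} (\<omega> \<bullet> b))"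
    proof (cases "\<omega> \<in> unit_cube")
      case True
      then have "\<omega> \<bullet> b \<in> {- (1/2)<..<1/2}" if "b \<in> Basis" for b
        using that by (auto simp: Basis_vec_def unit_cube_def inner_axis)
      then show ?thesis using True by (auto intro!: prod.neutral[symmetric])
    next
      case False
      then obtain i where i: "\<not> (- (1/2) < \<omega> $ i \<and> \<omega> $ i < 1/2)" by (auto simp: unit_cube_def)
      have "axis i 1 \<in> (Basis :: (real^'d) set)" by (simp add: axis_in_Basis_iff)
      moreover have "indicator {- (1/2)<..<1/2} (\<omega> \<bullet> axis i 1) = (0::complex)" using i by (auto simp: inner_axis indicator_def)
      ultimately show ?thesis using False by (auto intro!: prod_zero[symmetric])
    qed
    ultimately show ?thesis by (simp add: f_def prod.distrib)
  qed
  have fi: "integrable lborel (f b)" for b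
  proof (rule Bochner_Integration.integrable_bound[where f="indicator {-(1/2)..1/2} :: real \<Rightarrow> real"])
    show "integrable lborel (indicator {- (1/2)..1/2} :: real \<Rightarrow> real)" by simp
    show "f b \<in> borel_measurable lborel" unfolding f_def by measurable
  qed (auto simp: f_def indicator_def)
  have v: "(LBINT t. f b t) = (if k $ i = 0 then 1 else 0)" if "b = axis i 1" for b i
  proof -
    have "lattice_vec k \<bullet> b = of_int (k $ i)" by (simp add: that inner_axis lattice_vec_def)
    then show ?thesis unfolding f_def by (simp only: integral_unit_interval_ee)
  qed
  have "(LBINT \<omega>. indicator unit_cube \<omega> * ee (\<omega> \<bullet> lattice_vec k)) = (\<Prod>b\<in>Basis. LINT t|lborel. f b t)"
    unfolding e by (rule integral_lborel_prod) (rule fi)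
  also have "... = (if k = 0 then 1 else 0)"
  proof (cases "k = 0")
    case True
    then show ?thesis by (auto intro!: prod.neutral simp: Basis_vec_def v)
  next
    case False
    then obtain i where i: "k $ i \<noteq> 0" by (auto simp: vec_eq_iff)
    have "axis i 1 \<in> (Basis :: (real^'d) set)" by (simp add: axis_in_Basis_iff)
    then have "(\<Prod>b\<in>(Basis :: (real^'d) set). LINT t|lborel. f b t) = 0"
      by (intro prod_zero) (auto intro!: bexI[of _ "axis i 1"] simp: v[OF refl] i)
    then show ?thesis using False by simp
  qed
  finally show ?thesis .
qed

text \<open>As functions of \<open>u\<close> both sides are bounded and continuous, so it suffices
  to compare Fourier coefficients on the unit cube. On the left orthogonality picks them out; on the
  right \<open>Y\<close> lives in a single period, so each coefficient is a full Fourier integral of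
  \<open>Y\<close>. The band limit excludes overlapping periods.\<close>

lemma poisson_summation_band_limited:
  fixes Y :: "real^'d \<Rightarrow> complex"
  assumes b: "invertible b" and Yc: "\<And>x. isCont Y x" and Yi: "integrable lborel Y" and YM: "\<And>x. norm (Y x) \<le> M"
    and Y0: "\<And>\<xi>. Y \<xi> \<noteq> 0 \<Longrightarrow> \<xi> v* b \<in> unit_cube" and lb: "lattice_bounded b C (ft Y)"
    and c: "c > 0" "\<And>f::real^'d \<Rightarrow> complex. integrable lborel f \<Longrightarrow> (LBINT x. f (x v* matrix_inv b)) = of_real c * (LBINT x. f x)"
    and u: "u \<in> unit_cube"
  shows "of_real c * (LINT m|count_space UNIV. ft Y (y - b *v lattice_vec m) * ee (- (u \<bullet> lattice_vec m))) =
     Y (u v* matrix_inv b) * ee (- ((u v* matrix_inv b) \<bullet> y))"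
proof -
  let ?B = "matrix_inv b"
  let ?\<psi> = "ft Y"
  let ?Q = "unit_cube :: (real^'d) set"
  define P where "P u = (LINT m|count_space UNIV. ?\<psi> (y - b *v lattice_vec m) * ee (- (u \<bullet> lattice_vec m)))" for u
  define q where "q u = Y (u v* ?B) * ee (- ((u v* ?B) \<bullet> y))" for u
  define D where "D u = of_real c * P u - q u" for u
  have abs: "norm (?\<psi> (y - b *v lattice_vec m) * ee t) = norm (?\<psi> (y - b *v lattice_vec m))" for m t
    by (simp add: norm_mult)
  have int: "integrable (count_space UNIV) (\<lambda>m. ?\<psi> (y - b *v lattice_vec m))"
    by (rule integrable_lattice[where C=C]) (rule lattice_boundedD[OF lb])
  have intP: "integrable (count_space UNIV) (\<lambda>m. ?\<psi> (y - b *v lattice_vec m) * ee (- (u \<bullet> lattice_vec m)))" for u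
    by (rule integrable_lattice[where C=C]) (simp only: abs lattice_boundedD[OF lb])
  have Pc: "isCont P u" for u unfolding P_def
  proof (rule isCont_lebesgue_integral[where w="\<lambda>m. norm (?\<psi> (y - b *v lattice_vec m))"])
    show "integrable (count_space UNIV) (\<lambda>m. norm (?\<psi> (y - b *v lattice_vec m)))" using int by (rule integrable_norm)
    fix m :: "int^'d"
    have "isCont (\<lambda>h. ee (- (h \<bullet> lattice_vec m))) u" by (intro isCont_ee continuous_intros)
    then show "isCont (\<lambda>h. ?\<psi> (y - b *v lattice_vec m) * ee (- (h \<bullet> lattice_vec m))) u" by (intro isCont_mult continuous_const)
  qed (auto simp: abs)
  have PC: "norm (P u) \<le> C" for u
  proof -
    have "norm (P u) = norm (\<Sum>\<^sub>\<infinity>m. ?\<psi> (y - b *v lattice_vec m) * ee (- (u \<bullet> lattice_vec m)))"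
      unfolding P_def by (simp only: infsum_eq_integral_count_space[OF intP])
    also have "... \<le> (\<Sum>\<^sub>\<infinity>m. norm (?\<psi> (y - b *v lattice_vec m) * ee (- (u \<bullet> lattice_vec m))))"
      by (rule norm_infsum_bound, rule norm_summable_lattice[where C=C]) (simp only: abs lattice_boundedD[OF lb])
    also have "... \<le> C" by (rule infsum_norm_lattice_le) (simp only: abs lattice_boundedD[OF lb])
    finally show ?thesis .
  qed
  have qc: "isCont q u" for u unfolding q_def
    by (intro isCont_mult isCont_o2[OF isCont_row_mult Yc] isCont_ee isCont_minus continuous_inner isCont_row_mult continuous_const)
  have Dc: "isCont D u" for u unfolding D_def by (intro isCont_diff isCont_mult continuous_const Pc qc)
  have meas: "f \<in> borel_measurable borel" if "\<And>x. isCont f x" for f :: "real^'d \<Rightarrow> complex"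
    using that by (intro borel_measurable_continuous_onI continuous_at_imp_continuous_on) auto
  have [measurable]: "P \<in> borel_measurable borel" "q \<in> borel_measurable borel" "D \<in> borel_measurable borel"
    by (intro meas Pc qc Dc)+
  have [measurable]: "Y \<in> borel_measurable borel" by (intro meas Yc)
  have qM: "norm (q u) \<le> M" for u using YM by (simp add: q_def norm_mult)
  have DM: "norm (D u) \<le> c * C + M" for u
  proof -
    have "norm (of_real c * P u) \<le> c * C" using PC[of u] c(1) by (simp add: norm_mult)
    then show ?thesis unfolding D_def using norm_triangle_ineq4[of "of_real c * P u" "q u"] qM[of u] by linarith
  qed
  have iQ: "integrable lborel (\<lambda>u. indicator ?Q u * f u :: complex)" if [measurable]: "f \<in> borel_measurable borel" and fK: "\<And>u. norm (f u) \<le> K" for f K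
  proof -
    have "integrable lborel (indicator ?Q :: _ \<Rightarrow> complex)"
      using integrable_of_real[OF integrable_indicator_unit_cube, where 'a=complex] by (simp add: of_real_indicator)
    from integrable_mult_bounded(1)[OF this that(1) fK] show ?thesis .
  qed
  have coeffP: "(LBINT u. indicator ?Q u * P u * ee (u \<bullet> lattice_vec n)) = ?\<psi> (y - b *v lattice_vec n)" for n
  proof -
    let ?G = "\<lambda>m u. indicator ?Q u * (?\<psi> (y - b *v lattice_vec m) * ee (- (u \<bullet> lattice_vec m))) * ee (u \<bullet> lattice_vec n)"
    have "(LBINT u. indicator ?Q u * P u * ee (u \<bullet> lattice_vec n)) = (LBINT u. LINT m|count_space UNIV. ?G m u)"
      unfolding P_def by (simp only: integral_mult_right_zero integral_mult_left_zero)
    also have "... = (LINT m|count_space UNIV. LINT u|lborel. ?G m u)"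
    proof (rule lattice_sum_integral(1)[where w="\<lambda>u. C * indicator ?Q u"])
      show "integrable lborel (\<lambda>u. C * indicator ?Q u)" by (rule integrable_mult_right[OF integrable_indicator_unit_cube])
      fix x :: "real^'d" and F :: "(int^'d) set" assume F: "finite F"
      show "(\<Sum>m\<in>F. norm (?G m x)) \<le> C * indicator ?Q x"
        using lattice_boundedD[OF lb F, of y] by (cases "x \<in> ?Q") (auto simp: norm_mult)
    qed measurable
    also have "... = (LINT m|count_space UNIV. (if m = n then ?\<psi> (y - b *v lattice_vec n) else 0))"
    proof (rule Bochner_Integration.integral_cong[OF refl])
      fix m
      have "?G m u = ?\<psi> (y - b *v lattice_vec m) * (indicator ?Q u * ee (u \<bullet> lattice_vec (n - m)))" for u
      proof -
        have "ee (u \<bullet> lattice_vec (n - m)) = ee (- (u \<bullet> lattice_vec m)) * ee (u \<bullet> lattice_vec n)"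
          by (simp add: lattice_vec_diff inner_diff_right flip: ee_add)
        then show ?thesis by (simp add: mult_ac)
      qed
      then have "(LBINT u. ?G m u) = ?\<psi> (y - b *v lattice_vec m) * (if n - m = 0 then 1 else 0)"
        by (simp only: integral_mult_right_zero integral_unit_cube_ee)
      then show "(LBINT u. ?G m u) = (if m = n then ?\<psi> (y - b *v lattice_vec n) else 0)" by auto
    qed
    also have "... = ?\<psi> (y - b *v lattice_vec n)"
    proof -
      let ?a = "\<lambda>m. if m = n then ?\<psi> (y - b *v lattice_vec n) else 0"
      have "integrable (count_space UNIV) ?a"
        by (rule integrable_lattice[where C="norm (?\<psi> (y - b *v lattice_vec n))"]) (simp add: if_distrib[of norm] sum.delta cong: if_cong)
      from infsum_eq_integral_count_space[OF this] have "(LINT m|count_space UNIV. ?a m) = infsum ?a UNIV" by simp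
      also have "... = infsum ?a {n}" by (rule infsum_cong_neutral) auto
      finally show ?thesis by simp
    qed
    finally show ?thesis .
  qed
  have coeffq: "(LBINT u. indicator ?Q u * q u * ee (u \<bullet> lattice_vec n)) = of_real c * ?\<psi> (y - b *v lattice_vec n)" for n
  proof -
    let ?F = "\<lambda>\<xi>. Y \<xi> * ee (- (y - b *v lattice_vec n) \<bullet> \<xi>)"
    \<comment> \<open>The indicator may be dropped because \<open>Y0\<close> confines the support;
      \<open>?F\<close> is the integrand after the linear substitution.\<close>
    have "indicator ?Q u * q u * ee (u \<bullet> lattice_vec n) = ?F (u v* ?B)" for u
    proof (cases "Y (u v* ?B) = 0")
      case False
      then have "u \<in> ?Q" using Y0[OF False] by (simp add: matrix_inv_cancel_row[OF b])
      moreover have "u \<bullet> lattice_vec n = (u v* ?B) \<bullet> (b *v lattice_vec n)"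
        by (simp only: dot_lmul_matrix[symmetric] matrix_inv_cancel_row[OF b])
      moreover have "ee (- (y - b *v lattice_vec n) \<bullet> (u v* ?B)) = ee (- ((u v* ?B) \<bullet> y)) * ee ((u v* ?B) \<bullet> (b *v lattice_vec n))"
        by (simp add: inner_diff_right inner_diff_left inner_commute flip: ee_add)
      ultimately show ?thesis by (simp add: q_def)
    qed (simp add: q_def)
    then have "(LBINT u. indicator ?Q u * q u * ee (u \<bullet> lattice_vec n)) = (LBINT u. ?F (u v* ?B))" by simp
    also have "... = of_real c * (LBINT \<xi>. ?F \<xi>)"
      by (rule c(2)) (rule integrable_mult_ee(1)[OF Yi])
    also have "(LBINT \<xi>. ?F \<xi>) = ?\<psi> (y - b *v lattice_vec n)" by (simp only: ft_def inner_minus_left)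
    finally show ?thesis .
  qed
  have "D u = 0"
  proof (rule fourier_coefficients_unique[OF _ DM _ Dc u])
    fix m
    have "integrable lborel (\<lambda>u. indicator ?Q u * (P u * ee (u \<bullet> lattice_vec m)))"
      by (rule iQ[where K=C]) (use PC in \<open>auto simp: norm_mult\<close>)
    moreover have "integrable lborel (\<lambda>u. indicator ?Q u * (q u * ee (u \<bullet> lattice_vec m)))"
      by (rule iQ[where K=M]) (use qM in \<open>auto simp: norm_mult\<close>)
    moreover have "indicator ?Q u * D u * ee (u \<bullet> lattice_vec m) =
      of_real c * (indicator ?Q u * (P u * ee (u \<bullet> lattice_vec m))) - indicator ?Q u * (q u * ee (u \<bullet> lattice_vec m))" for u
      by (simp add: D_def algebra_simps)
    ultimately have "(LBINT u. indicator ?Q u * D u * ee (u \<bullet> lattice_vec m)) =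
      of_real c * (LBINT u. indicator ?Q u * P u * ee (u \<bullet> lattice_vec m)) - (LBINT u. indicator ?Q u * q u * ee (u \<bullet> lattice_vec m))"
      by (simp add: mult.assoc)
    then show "(LBINT u. indicator ?Q u * D u * ee (u \<bullet> lattice_vec m)) = 0" by (simp only: coeffP coeffq) simp
  qed measurable
  then show ?thesis by (simp add: D_def P_def q_def)
qed

section \<open>Sampling integrable functions\<close>

definition sample :: "real \<Rightarrow> real^'d^'d \<Rightarrow> int^'d \<Rightarrow> (real^'d \<Rightarrow> complex) \<Rightarrow> (real^'d \<Rightarrow> complex) \<Rightarrow> complex" where
  "sample \<alpha> b k F g = (LBINT x. F x * g (\<alpha> *\<^sub>R x - b *v lattice_vec k))"

lemma integrable_sample:
  assumes "integrable lborel F" "lattice_bounded b C g" and [measurable]: "g \<in> borel_measurable borel"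
  shows "integrable lborel (\<lambda>x. F x * g (\<alpha> *\<^sub>R x - b *v lattice_vec k))"
  by (rule integrable_mult_bounded(1)[OF assms(1) _ lattice_bounded_norm_le[OF assms(2)]]) measurable

text \<open>The sum over \<open>k\<close> is taken under the integral, at the point
  \<open>\<alpha> *\<^sub>R x\<close>. The constant does not see the scale, which is why the
  supremum over all scales stays finite.\<close>

lemma sum_norm_sample_le:
  assumes F: "integrable lborel F" and lb: "lattice_bounded b C g" and g: "g \<in> borel_measurable borel"
    and K: "finite K"
  shows "(\<Sum>k\<in>K. norm (sample \<alpha> b k F g)) \<le> C * (LBINT x. norm (F x))"
proof -
  note i = integrable_norm[OF integrable_sample[OF F lb g]]
  have "(\<Sum>k\<in>K. norm (sample \<alpha> b k F g)) \<le> (\<Sum>k\<in>K. LINT x|lborel. norm (F x * g (\<alpha> *\<^sub>R x - b *v lattice_vec k)))"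
    unfolding sample_def by (intro sum_mono integral_norm_bound)
  also have "... = (LBINT x. (\<Sum>k\<in>K. norm (F x * g (\<alpha> *\<^sub>R x - b *v lattice_vec k))))"
    using i by (intro Bochner_Integration.integral_sum[symmetric])
  also have "... \<le> (LBINT x. C * norm (F x))"
  proof (rule integral_mono)
    show "integrable lborel (\<lambda>x. \<Sum>k\<in>K. norm (F x * g (\<alpha> *\<^sub>R x - b *v lattice_vec k)))"
      using i by (intro Bochner_Integration.integrable_sum)
    show "integrable lborel (\<lambda>x. C * norm (F x))" using F by (intro integrable_mult_right integrable_norm)
    fix x
    have "(\<Sum>k\<in>K. norm (F x * g (\<alpha> *\<^sub>R x - b *v lattice_vec k))) = norm (F x) * (\<Sum>k\<in>K. norm (g (\<alpha> *\<^sub>R x - b *v lattice_vec k)))"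
      by (simp add: norm_mult sum_distrib_left)
    also have "... \<le> norm (F x) * C" using lattice_boundedD[OF lb K] by (intro mult_left_mono) auto
    finally show "(\<Sum>k\<in>K. norm (F x * g (\<alpha> *\<^sub>R x - b *v lattice_vec k))) \<le> C * norm (F x)" by (simp add: mult.commute)
  qed
  finally show ?thesis by simp
qed

section \<open>Fundamental cells and step functions from samples\<close>

definition cell :: "real^'d^'d \<Rightarrow> (real^'d) set" where
  "cell b = {u. \<forall>i. 0 \<le> (matrix_inv b *v u) $ i \<and> (matrix_inv b *v u) $ i < 1}"

definition cell_index :: "real^'d^'d \<Rightarrow> real^'d \<Rightarrow> int^'d" where
  "cell_index b u = (\<chi> i. \<lfloor>(matrix_inv b *v u) $ i\<rfloor>)"

lemma sets_cell[measurable]: "cell (b :: real^'d^'d) \<in> sets borel"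
proof -
  have "cell b = {u\<in>space borel. \<forall>i\<in>UNIV. 0 \<le> (matrix_inv b *v u) $ i \<and> (matrix_inv b *v u) $ i < 1}" by (auto simp: cell_def)
  also have "... \<in> sets borel" by measurable
  finally show ?thesis .
qed

lemma matrix_mult_bound:
  fixes A :: "real^'d^'d"
  shows "\<exists>K>0. \<forall>x. norm (A *v x) \<le> norm x * K"
  using bounded_linear.pos_bounded[OF matrix_vector_mul_bounded_linear[of A]] .

lemma mem_cell_iff:
  assumes b: "invertible b"
  shows "u - b *v lattice_vec k \<in> cell b \<longleftrightarrow> k = cell_index b u"
proof -
  have "(matrix_inv b *v (u - b *v lattice_vec k)) $ i = (matrix_inv b *v u) $ i - of_int (k $ i)" for i
    by (simp add: matrix_vector_mult_diff_distrib matrix_inv_cancel[OF b] lattice_vec_def)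
  then have "u - b *v lattice_vec k \<in> cell b \<longleftrightarrow> (\<forall>i. of_int (k $ i) \<le> (matrix_inv b *v u) $ i \<and> (matrix_inv b *v u) $ i < of_int (k $ i) + 1)"
    by (auto simp: cell_def algebra_simps)
  also have "... \<longleftrightarrow> (\<forall>i. \<lfloor>(matrix_inv b *v u) $ i\<rfloor> = k $ i)" by (simp only: floor_eq_iff)
  finally show ?thesis by (auto simp: cell_index_def vec_eq_iff)
qed

lemma bounded_cell:
  assumes b: "invertible b"
  shows "\<exists>D\<ge>0. \<forall>u\<in>cell (b :: real^'d^'d). norm u \<le> D"
proof -
  from matrix_mult_bound[of b] obtain K where K: "K > 0 \<and> (\<forall>x. norm (b *v x) \<le> norm x * K)" ..
  have "norm u \<le> real CARD('d) * K" if u: "u \<in> cell b" for u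
  proof -
    have "norm (matrix_inv b *v u) \<le> (\<Sum>i\<in>UNIV. \<bar>(matrix_inv b *v u) $ i\<bar>)" by (rule norm_le_l1_cart)
    also have "... \<le> (\<Sum>i\<in>(UNIV::'d set). 1)" using u by (intro sum_mono) (auto simp: cell_def less_imp_le)
    finally have n: "norm (matrix_inv b *v u) \<le> real CARD('d)" by simp
    have "norm u = norm (b *v (matrix_inv b *v u))" by (simp only: matrix_inv_cancel[OF b])
    also have "... \<le> norm (matrix_inv b *v u) * K" using K by blast
    also have "... \<le> real CARD('d) * K" using n K by (intro mult_right_mono) auto
    finally show ?thesis .
  qed
  then show ?thesis using K by (intro exI[of _ "real CARD('d) * K"]) auto
qed

lemma integrable_indicator_cell:
  assumes b: "invertible b"
  shows "integrable lborel (indicator (cell (b :: real^'d^'d)) :: real^'d \<Rightarrow> real)"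
proof -
  have "bounded (cell b)" using bounded_cell[OF b] by (auto simp: bounded_iff)
  from emeasure_bounded_finite[OF this] show ?thesis by (intro integrable_real_indicator) auto
qed

lemma integral_indicator_cell_affine:
  assumes b: "invertible (b :: real^'d^'d)" and \<alpha>: "\<alpha> \<noteq> 0"
  shows "integrable lborel (\<lambda>x. indicator (cell b) (\<alpha> *\<^sub>R x - b *v lattice_vec k) :: real)"
    and "(LBINT x. (indicator (cell b) (\<alpha> *\<^sub>R x - b *v lattice_vec k) :: real)) = measure lborel (cell b) / \<bar>\<alpha>\<bar> ^ CARD('d)"
proof -
  have e: "\<alpha> *\<^sub>R x - b *v lattice_vec k = - (b *v lattice_vec k) + \<alpha> *\<^sub>R x" for x by simp
  show "integrable lborel (\<lambda>x. indicator (cell b) (\<alpha> *\<^sub>R x - b *v lattice_vec k) :: real)"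
    unfolding e by (simp only: integrable_lborel_affine_iff[OF \<alpha>] integrable_indicator_cell[OF b])
  show "(LBINT x. (indicator (cell b) (\<alpha> *\<^sub>R x - b *v lattice_vec k) :: real)) = measure lborel (cell b) / \<bar>\<alpha>\<bar> ^ CARD('d)"
    unfolding e using integral_lborel_affine[OF \<alpha>, of "indicator (cell b) :: _ \<Rightarrow> real" "- (b *v lattice_vec k)"]
    by (simp add: divide_inverse mult.commute)
qed

text \<open>Sampling \<open>g\<close> against the lattice translates of an approximate identity gives step functions
  converging to \<open>g\<close>, constant on the cells of the rescaled lattice.\<close>

lemma sampling_lower_bound_compact:
  fixes g h :: "real^'d \<Rightarrow> complex" and a :: "nat \<Rightarrow> real"
  assumes b: "invertible b" and h: "integrable lborel h" "(LBINT x. h x) = 1"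
    and a: "filterlim (\<lambda>j. \<bar>a j\<bar>) at_top sequentially"
    and gc: "continuous_on UNIV g" and gR: "\<And>x. norm x > R \<Longrightarrow> g x = 0" and e: "e > 0"
  shows "\<forall>\<^sub>F j in sequentially. \<exists>K. finite K \<and>
    (LBINT x. norm (g x)) \<le> measure lborel (cell b) * (\<Sum>k\<in>K. norm (sample (a j) b k g h)) + e"
proof -
  have [measurable]: "h \<in> borel_measurable borel" using h(1) by (simp add: borel_measurable_integrable[of lborel, simplified])
  have [measurable]: "g \<in> borel_measurable borel" using gc by (rule borel_measurable_continuous_onI)
  have gz: "x \<notin> cball 0 R \<Longrightarrow> g x = 0" for x using gR by simp
  obtain G where G: "\<And>x. norm (g x) \<le> G" using integrable_compact_support(2)[OF gc compact_cball gz] by blast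
  have G0: "0 \<le> G" using G[of 0] norm_ge_zero order_trans by blast
  from bounded_cell[OF b] obtain D where D: "D \<ge> 0 \<and> (\<forall>u\<in>cell b. norm u \<le> D)" ..
  from matrix_mult_bound[of "matrix_inv b"] obtain KB where KB: "KB > 0 \<and> (\<forall>x. norm (matrix_inv b *v x) \<le> norm x * KB)" ..
  \<comment> \<open>\<open>kk j x\<close> is the cell containing \<open>a j *\<^sub>R x\<close>;
    \<open>\<tau> j k\<close> is the sample after the substitution that makes \<open>h\<close>
    independent of the scale; \<open>K j\<close> contains every cell index met by the ball of radius
    \<open>R\<close>; and \<open>U j\<close> is the step function with value
    \<open>\<tau> j k\<close> on the \<open>k\<close>-th rescaled cell, cut off to that
    ball.\<close>
  define kk where "kk j x = cell_index b (a j *\<^sub>R x)" for j x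
  define z where "z j k u = (1 / a j) *\<^sub>R (u + b *v lattice_vec k)" for j k u
  define \<tau> where "\<tau> j k = (LBINT u. g (z j k u) * h u)" for j k
  define N where "N j = \<lceil>\<bar>a j\<bar> * \<bar>R\<bar> * KB\<rceil> + 1" for j
  define K where "K j = {k :: int^'d. \<forall>i. - N j \<le> k $ i \<and> k $ i \<le> N j}" for j
  define U where "U j x = indicator (cball 0 R) x * (\<Sum>k\<in>K j. indicator (cell b) (a j *\<^sub>R x - b *v lattice_vec k) * \<tau> j k)" for j x
  have fin: "finite (K j)" for j unfolding K_def by (rule finite_vec_bounded)
  have kkK: "kk j x \<in> K j" if "x \<in> cball 0 R" for j x
  proof -
    have "\<bar>(matrix_inv b *v (a j *\<^sub>R x)) $ i\<bar> \<le> of_int (N j - 1)" for i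
    proof -
      have "\<bar>(matrix_inv b *v (a j *\<^sub>R x)) $ i\<bar> \<le> norm (matrix_inv b *v (a j *\<^sub>R x))" by (rule component_le_norm_cart)
      also have "... \<le> norm (a j *\<^sub>R x) * KB" using KB by blast
      also have "... \<le> \<bar>a j\<bar> * \<bar>R\<bar> * KB" using that KB by (auto intro!: mult_mono)
      also have "... \<le> of_int (N j - 1)" by (simp add: N_def)
      finally show ?thesis .
    qed
    then have "- of_int (N j - 1) \<le> (matrix_inv b *v (a j *\<^sub>R x)) $ i" "(matrix_inv b *v (a j *\<^sub>R x)) $ i \<le> of_int (N j - 1)" for i
      by (simp_all only: abs_le_iff) (metis minus_le_iff)
    then have "- N j \<le> \<lfloor>(matrix_inv b *v (a j *\<^sub>R x)) $ i\<rfloor>" "\<lfloor>(matrix_inv b *v (a j *\<^sub>R x)) $ i\<rfloor> \<le> N j" for i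
      by (smt (verit) floor_of_int floor_mono of_int_minus)+
    then show ?thesis by (simp add: K_def kk_def cell_index_def)
  qed
  have UT: "U j x = \<tau> j (kk j x)" if x: "x \<in> cball 0 R" for j x
  proof -
    have "(\<Sum>k\<in>K j. indicator (cell b) (a j *\<^sub>R x - b *v lattice_vec k) * \<tau> j k) = (\<Sum>k\<in>K j. if k = kk j x then \<tau> j k else 0)"
      by (intro sum.cong refl) (simp add: indicator_def mem_cell_iff[OF b] kk_def)
    then show ?thesis using kkK[OF x] x fin by (simp add: U_def)
  qed
  have zmeas[measurable]: "z j k \<in> borel_measurable borel" for j k unfolding z_def by measurable
  have gh: "norm (g (z j k u) * h u) \<le> norm (G * norm (h u))" for j k u
    using G[of "z j k u"] G0 by (simp add: norm_mult abs_of_nonneg mult_right_mono)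
  have ih: "integrable lborel (\<lambda>u. G * norm (h u))" using h(1) by (intro integrable_mult_right integrable_norm)
  have \<tau>b: "norm (\<tau> j k) \<le> (LBINT u. G * norm (h u))" for j k
  proof -
    have i: "integrable lborel (\<lambda>u. g (z j k u) * h u)" by (rule Bochner_Integration.integrable_bound[OF ih]) (use gh in auto)
    have "norm (\<tau> j k) \<le> (LBINT u. norm (g (z j k u) * h u))" unfolding \<tau>_def by (rule integral_norm_bound)
    also have "... \<le> (LBINT u. G * norm (h u))"
      using i ih G by (intro integral_mono integrable_norm) (auto simp: norm_mult mult_right_mono)
    finally show ?thesis .
  qed
  have lim: "(\<lambda>j. \<tau> j (kk j x)) \<longlonglongrightarrow> g x" for x
  proof -
    have "(\<lambda>j. LINT u|lborel. g (z j (kk j x) u) * h u) \<longlonglongrightarrow> (LBINT u. g x * h u)"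
    proof (rule integral_dominated_convergence[OF _ _ ih])
      show "AE u in lborel. (\<lambda>j. g (z j (kk j x) u) * h u) \<longlonglongrightarrow> g x * h u"
      proof (rule AE_I2)
        fix u :: "real^'d"
        \<comment> \<open>The evaluation point differs from \<open>x\<close> by \<open>u - w\<close>
          divided by \<open>a j\<close>, where \<open>w\<close> lies in the bounded fundamental
          cell, so it tends to \<open>x\<close>. As \<open>h\<close> has integral 1, the averages
          tend to \<open>g x\<close>.\<close>
        have "(\<lambda>j. z j (kk j x) u) \<longlonglongrightarrow> x"
        proof (rule Lim_transform_bound[where g="\<lambda>j. (norm u + D) / \<bar>a j\<bar>", THEN LIM_zero_cancel])
          show "(\<lambda>j. (norm u + D) / \<bar>a j\<bar>) \<longlonglongrightarrow> 0" using a by (intro tendsto_divide_0[OF tendsto_const] filterlim_at_top_imp_at_infinity)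
          have "\<forall>\<^sub>F j in sequentially. \<bar>a j\<bar> > 0" using a unfolding filterlim_at_top_dense by blast
          then show "\<forall>\<^sub>F j in sequentially. norm (z j (kk j x) u - x) \<le> norm ((norm u + D) / \<bar>a j\<bar>)"
          proof eventually_elim
            case (elim j)
            define w where "w = a j *\<^sub>R x - b *v lattice_vec (kk j x)"
            have "w \<in> cell b" unfolding w_def using mem_cell_iff[OF b, of "a j *\<^sub>R x" "kk j x"] by (simp add: kk_def)
            then have w: "norm w \<le> D" using D by blast
            have "z j (kk j x) u - x = (1 / a j) *\<^sub>R (u - w)"
            proof -
              have "x = (1 / a j) *\<^sub>R (a j *\<^sub>R x)" using elim by simp
              then have "z j (kk j x) u - x = (1 / a j) *\<^sub>R (u + b *v lattice_vec (kk j x)) - (1 / a j) *\<^sub>R (a j *\<^sub>R x)"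
                unfolding z_def by simp
              then show ?thesis by (simp only: w_def scaleR_diff_right[symmetric]) (simp add: algebra_simps)
            qed
            then have "norm (z j (kk j x) u - x) = norm (u - w) / \<bar>a j\<bar>" by simp
            also have "... \<le> (norm u + D) / \<bar>a j\<bar>" using norm_triangle_ineq4[of u w] w by (intro divide_right_mono) auto
            finally show ?case using D by simp
          qed
        qed
        moreover have "isCont g x" using gc by (simp add: continuous_on_eq_continuous_at)
        ultimately have "(\<lambda>j. g (z j (kk j x) u)) \<longlonglongrightarrow> g x" by (rule isCont_tendsto_compose[rotated])
        then show "(\<lambda>j. g (z j (kk j x) u) * h u) \<longlonglongrightarrow> g x * h u" by (intro tendsto_intros)
      qed
      show "\<And>j. AE u in lborel. norm (g (z j (kk j x) u) * h u) \<le> G * norm (h u)"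
        using G by (auto simp: norm_mult intro!: AE_I2 mult_right_mono)
    qed measurable
    then show ?thesis by (simp add: \<tau>_def h(2))
  qed
  have "(\<lambda>x. indicator (cell b) (a j *\<^sub>R x - b *v lattice_vec k) :: complex) \<in> borel_measurable borel" for j k
    by (rule measurable_compose[OF _ borel_measurable_indicator[OF sets_cell]]) measurable
  then have Umeas[measurable]: "U j \<in> borel_measurable borel" for j
    unfolding U_def by (intro borel_measurable_times borel_measurable_sum borel_measurable_indicator) auto
  have "(\<lambda>j. LINT x|lborel. norm (U j x)) \<longlonglongrightarrow> (LBINT x. norm (g x))"
  proof (rule integral_dominated_convergence[where w="\<lambda>x. (LBINT u. G * norm (h u)) * indicator (cball 0 R) x"])
    show "integrable lborel (\<lambda>x::real^'d. (LBINT u. G * norm (h u)) * indicator (cball 0 R) x)"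
      using emeasure_bounded_finite[OF bounded_cball, of "0::real^'d" R] by (intro integrable_mult_right integrable_real_indicator) auto
    show "AE x in lborel. (\<lambda>j. norm (U j x)) \<longlonglongrightarrow> norm (g x)"
    proof (rule AE_I2)
      fix x
      show "(\<lambda>j. norm (U j x)) \<longlonglongrightarrow> norm (g x)"
      proof (cases "x \<in> cball 0 R")
        case True
        then show ?thesis using tendsto_norm[OF lim[of x]] by (simp only: UT[OF True])
      next
        case False
        then show ?thesis using gz[OF False] by (simp add: U_def)
      qed
    qed
    show "AE x in lborel. norm (norm (U j x)) \<le> (LBINT u. G * norm (h u)) * indicator (cball 0 R) x" for j
    proof (rule AE_I2)
      fix x
      show "norm (norm (U j x)) \<le> (LBINT u. G * norm (h u)) * indicator (cball 0 R) x"
      proof (cases "x \<in> cball 0 R")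
        case True
        then show ?thesis using \<tau>b UT[OF True] by simp
      qed (simp add: U_def)
    qed
  qed measurable
  then have "\<forall>\<^sub>F j in sequentially. (LBINT x. norm (g x)) - e < (LBINT x. norm (U j x))"
    using e by (intro order_tendstoD) auto
  moreover have "\<forall>\<^sub>F j in sequentially. \<bar>a j\<bar> > 0" using a unfolding filterlim_at_top_dense by blast
  ultimately show ?thesis
  proof eventually_elim
    case (elim j)
    then have a0: "a j \<noteq> 0" by simp
    \<comment> \<open>The substitution contributes \<open>\<bar>a j\<bar> ^ CARD('d)\<close>, which
      cancels against the volume of the rescaled cell; only the measure of the unscaled cell is
      left.\<close>
    have \<tau>s: "\<tau> j k = of_real (\<bar>a j\<bar> ^ CARD('d)) * sample (a j) b k g h" for k
    proof -
      let ?f = "\<lambda>y. g y * h (a j *\<^sub>R y - b *v lattice_vec k)"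
      have "1 / a j \<noteq> 0" using a0 by simp
      from integral_lborel_affine[OF this, of ?f "(1 / a j) *\<^sub>R (b *v lattice_vec k)"]
      have "(LBINT u. ?f ((1 / a j) *\<^sub>R (b *v lattice_vec k) + (1 / a j) *\<^sub>R u)) = \<bar>a j\<bar> ^ CARD('d) *\<^sub>R sample (a j) b k g h"
        by (simp add: sample_def power_divide)
      moreover have "?f ((1 / a j) *\<^sub>R (b *v lattice_vec k) + (1 / a j) *\<^sub>R u) = g (z j k u) * h u" for u
      proof -
        have "(1 / a j) *\<^sub>R (b *v lattice_vec k) + (1 / a j) *\<^sub>R u = z j k u" by (simp add: z_def algebra_simps)
        moreover have "a j *\<^sub>R z j k u - b *v lattice_vec k = u" using a0 by (simp add: z_def)
        ultimately show ?thesis by (simp only:)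
      qed
      ultimately show ?thesis by (simp only: \<tau>_def scaleR_conv_of_real)
    qed
    let ?I = "\<lambda>k x. indicator (cell b) (a j *\<^sub>R x - b *v lattice_vec k) :: real"
    have "(LBINT x. norm (U j x)) \<le> (LBINT x. (\<Sum>k\<in>K j. ?I k x * norm (\<tau> j k)))"
    proof (rule integral_mono')
      show "integrable lborel (\<lambda>x. \<Sum>k\<in>K j. ?I k x * norm (\<tau> j k))"
        by (intro Bochner_Integration.integrable_sum integrable_mult_left integral_indicator_cell_affine(1)[OF b a0])
      fix x
      have "norm (U j x) \<le> 1 * (\<Sum>k\<in>K j. norm (indicator (cell b) (a j *\<^sub>R x - b *v lattice_vec k) * \<tau> j k))"
        unfolding U_def norm_mult[of "indicator (cball 0 R) x"] by (intro mult_mono sum_norm_le norm_sum) (auto simp: indicator_def)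
      also have "... = (\<Sum>k\<in>K j. ?I k x * norm (\<tau> j k))" unfolding mult_1 by (intro sum.cong) (auto simp: norm_mult indicator_def)
      finally show "norm (U j x) \<le> (\<Sum>k\<in>K j. ?I k x * norm (\<tau> j k))" .
      show "0 \<le> (\<Sum>k\<in>K j. ?I k x * norm (\<tau> j k))" by (intro sum_nonneg) auto
    qed
    also have "... = (\<Sum>k\<in>K j. LINT x|lborel. ?I k x * norm (\<tau> j k))"
      by (intro Bochner_Integration.integral_sum integrable_mult_left integral_indicator_cell_affine(1)[OF b a0])
    also have "... = (\<Sum>k\<in>K j. measure lborel (cell b) * norm (sample (a j) b k g h))"
    proof (rule sum.cong[OF refl])
      fix k
      have "(LBINT x. ?I k x * norm (\<tau> j k)) = measure lborel (cell b) / \<bar>a j\<bar> ^ CARD('d) * norm (\<tau> j k)"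
        by (simp only: integral_mult_left_zero integral_indicator_cell_affine(2)[OF b a0])
      also have "... = measure lborel (cell b) * norm (sample (a j) b k g h)"
      proof -
        have "norm (\<tau> j k) = \<bar>a j\<bar> ^ CARD('d) * norm (sample (a j) b k g h)" unfolding \<tau>s by (simp only: norm_mult norm_of_real) simp
        then show ?thesis using a0 by simp
      qed
      finally show "(LBINT x. ?I k x * norm (\<tau> j k)) = measure lborel (cell b) * norm (sample (a j) b k g h)" .
    qed
    finally have "(LBINT x. norm (g x)) \<le> measure lborel (cell b) * (\<Sum>k\<in>K j. norm (sample (a j) b k g h)) + e"
      using elim by (simp add: sum_distrib_left)
    then show ?case using fin by blast
  qed
qed

text \<open>By density the compactly supported case suffices: replacing \<open>F\<close> by
  \<open>g\<close> changes the integral by the L^1 distance and the sums of samples by at most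
  \<open>C\<close> times it, at every scale. The compact case is then needed at a single large
  \<open>j\<close>.\<close>

lemma sampling_lower_bound:
  fixes F h :: "real^'d \<Rightarrow> complex" and a :: "nat \<Rightarrow> real"
  assumes b: "invertible b" and h: "integrable lborel h" "(LBINT x. h x) = 1" and lb: "lattice_bounded b C h"
    and a: "filterlim (\<lambda>j. \<bar>a j\<bar>) at_top sequentially" and F: "integrable lborel F"
    and S: "\<And>j K. j > 0 \<Longrightarrow> finite K \<Longrightarrow> (\<Sum>k\<in>K. norm (sample (a j) b k F h)) \<le> S"
  shows "(LBINT x. norm (F x)) \<le> measure lborel (cell b) * S"
proof (rule field_le_epsilon)
  fix e0 :: real assume e0: "e0 > 0"
  let ?V = "measure lborel (cell b)"
  have hm[measurable]: "h \<in> borel_measurable borel" using h(1) by (simp add: borel_measurable_integrable[of lborel, simplified])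
  have C0: "0 \<le> C" using lattice_boundedD[OF lb, of "{}"] by simp
  \<comment> \<open>The errors add up to \<open>?V * C * e\<close> from the samples,
    \<open>e\<close> from the compact case and \<open>e\<close> from the integral.\<close>
  define e where "e = e0 / (?V * C + 2)"
  have VC: "0 < ?V * C + 2" using C0 by (simp add: add_nonneg_pos)
  have e: "e > 0" "e * (?V * C + 2) = e0" using e0 VC by (simp_all add: e_def)
  obtain g R where g: "continuous_on UNIV g" "\<forall>x. norm x > R \<longrightarrow> g x = 0" "integrable lborel g"
    "(LBINT x. norm (F x - g x)) < e"
    using L1_approx_compact_support[OF F e(1)] by metis
  have "\<forall>\<^sub>F j in sequentially. \<exists>K. finite K \<and> (LBINT x. norm (g x)) \<le> ?V * (\<Sum>k\<in>K. norm (sample (a j) b k g h)) + e"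
    by (rule sampling_lower_bound_compact[OF b h a g(1) _ e(1)]) (use g(2) in blast)
  moreover have "\<forall>\<^sub>F j in sequentially. (j::nat) > 0" by (rule eventually_gt_at_top)
  ultimately have "\<forall>\<^sub>F j in sequentially. j > 0 \<and> (\<exists>K. finite K \<and> (LBINT x. norm (g x)) \<le> ?V * (\<Sum>k\<in>K. norm (sample (a j) b k g h)) + e)"
    by eventually_elim blast
  then have "\<exists>j. j > 0 \<and> (\<exists>K. finite K \<and> (LBINT x. norm (g x)) \<le> ?V * (\<Sum>k\<in>K. norm (sample (a j) b k g h)) + e)"
    by (rule eventually_happens'[OF sequentially_bot])
  then obtain j K where j: "j > 0" and K: "finite K" and le: "(LBINT x. norm (g x)) \<le> ?V * (\<Sum>k\<in>K. norm (sample (a j) b k g h)) + e"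
    by metis
  have Fg: "integrable lborel (\<lambda>x. F x - g x)" using F g(3) by simp
  have "norm (sample (a j) b k g h) \<le> norm (sample (a j) b k F h) + norm (sample (a j) b k (\<lambda>x. F x - g x) h)" for k
  proof -
    have "sample (a j) b k g h = sample (a j) b k F h - sample (a j) b k (\<lambda>x. F x - g x) h"
      unfolding sample_def using integrable_sample[OF F lb hm, of "a j" k] integrable_sample[OF g(3) lb hm, of "a j" k]
      by (simp add: left_diff_distrib)
    then show ?thesis using norm_triangle_ineq4 by metis
  qed
  then have "(\<Sum>k\<in>K. norm (sample (a j) b k g h)) \<le> (\<Sum>k\<in>K. norm (sample (a j) b k F h)) + (\<Sum>k\<in>K. norm (sample (a j) b k (\<lambda>x. F x - g x) h))"
    unfolding sum.distrib[symmetric] by (rule sum_mono)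
  also have "... \<le> S + C * e"
  proof (rule add_mono[OF S[OF j K]])
    have "(\<Sum>k\<in>K. norm (sample (a j) b k (\<lambda>x. F x - g x) h)) \<le> C * (LBINT x. norm (F x - g x))"
      by (rule sum_norm_sample_le[OF Fg lb hm K])
    also have "... \<le> C * e" using g(4) C0 by (intro mult_left_mono) auto
    finally show "(\<Sum>k\<in>K. norm (sample (a j) b k (\<lambda>x. F x - g x) h)) \<le> C * e" .
  qed
  finally have "?V * (\<Sum>k\<in>K. norm (sample (a j) b k g h)) \<le> ?V * (S + C * e)" by (intro mult_left_mono) auto
  moreover have "(LBINT x. norm (F x)) \<le> (LBINT x. norm (g x)) + (LBINT x. norm (F x - g x))"
  proof -
    have "(LBINT x. norm (F x)) \<le> (LBINT x. norm (g x) + norm (F x - g x))"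
      using F g(3) Fg by (intro integral_mono Bochner_Integration.integrable_add integrable_norm) (auto intro: norm_triangle_sub)
    also have "... = (LBINT x. norm (g x)) + (LBINT x. norm (F x - g x))"
      using g(3) Fg by (intro Bochner_Integration.integral_add integrable_norm)
    finally show ?thesis .
  qed
  ultimately have "(LBINT x. norm (F x)) \<le> ?V * (S + C * e) + e + e" using le g(4) by linarith
  also have "... = ?V * S + e0" unfolding e(2)[symmetric] by (simp add: algebra_simps)
  finally show "(LBINT x. norm (F x)) \<le> ?V * S + e0" .
qed

section \<open>Sampling the Riesz transform\<close>

lemma norm_vec_le_sum: "norm (v :: complex^'d) \<le> (\<Sum>i\<in>UNIV. norm (v $ i))"
  unfolding norm_vec_def by (rule L2_set_le_sum) simp

lemma norm_smult_vec: "norm (c *s (v :: complex^'d)) = norm c * norm v"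
  by (simp add: norm_vec_def L2_set_right_distrib norm_mult)

lemma
  fixes f :: "'a \<Rightarrow> complex^'d"
  assumes "\<And>i. integrable M (\<lambda>x. f x $ i)"
  shows integrable_vec: "integrable M f"
    and integral_vec_nth: "(LINT x|M. f x) $ i = (LINT x|M. f x $ i)"
proof -
  have bl: "bounded_linear (\<lambda>z::complex. axis i z :: complex^'d)" for i
  proof (rule bounded_linear_intro[where K=1])
    show "norm (axis i z :: complex^'d) \<le> norm z * 1" for z
      by (rule order_trans[OF norm_vec_le_sum]) (simp add: axis_def if_distrib cong: if_cong)
  qed (simp_all add: vec_eq_iff axis_def)
  have "f = (\<lambda>x. \<Sum>i\<in>UNIV. axis i (f x $ i))"
    by (rule ext) (simp add: vec_eq_iff axis_def)
  moreover have "integrable M (\<lambda>x. \<Sum>i\<in>UNIV. axis i (f x $ i))"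
    by (intro Bochner_Integration.integrable_sum integrable_bounded_linear[OF bl] assms)
  ultimately show i: "integrable M f" by simp
  show "(LINT x|M. f x) $ i = (LINT x|M. f x $ i)"
    by (rule integral_bounded_linear[OF bounded_linear_vec_nth i, symmetric])
qed

text \<open>Instantiated with \<open>Y\<close> the conjugate of \<open>ft \<phi>\<close>, for which
  \<open>ft Y\<close> is \<open>cnj \<phi>\<close>, the function that \<open>f\<close> is sampled
  against. The assumptions are what the comparison of discrete and continuous Riesz transforms uses
  of the Schwartz function; \<open>Y1\<close> records that its integral is 1.\<close>

locale band_limited_sampling =
  fixes b :: "real^'d^'d" and \<nu> Y :: "real^'d \<Rightarrow> complex" and C M :: real
  assumes b: "invertible b" and cutoff: "cutoff_fun \<nu>"
    and Yc: "isCont Y \<xi>" and Yi: "integrable lborel Y" and YM: "norm (Y \<xi>) \<le> M"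
    and Y0: "Y \<xi> \<noteq> 0 \<Longrightarrow> \<xi> v* b \<in> unit_cube" and Y1: "Y 0 = 1"
    and ft_Yi: "integrable lborel (ft Y)" and lb: "lattice_bounded b C (ft Y)"
begin

lemma \<nu>_cont: "continuous_on UNIV \<nu>"
proof -
  have "\<nu> differentiable (at x)" for x
    using cutoff by (auto simp: cutoff_fun_def smooth_fun_def iterated_partial_def dest: spec[of _ "[]"])
  then show ?thesis by (intro continuous_at_imp_continuous_on ballI differentiable_imp_continuous_within)
qed

lemma \<nu>_isCont: "isCont \<nu> x"
  using \<nu>_cont by (simp add: continuous_on_eq_continuous_at)

lemma \<nu>_support: "compact (fun_support \<nu>)" "x \<notin> fun_support \<nu> \<Longrightarrow> \<nu> x = 0" "\<nu> x \<noteq> 0 \<Longrightarrow> x \<in> unit_cube"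
proof -
  show "compact (fun_support \<nu>)" using cutoff by (simp add: cutoff_fun_def)
  show z: "x \<notin> fun_support \<nu> \<Longrightarrow> \<nu> x = 0" for x unfolding fun_support_def using closure_subset[of "{x. \<nu> x \<noteq> 0}"] by auto
  show "\<nu> x \<noteq> 0 \<Longrightarrow> x \<in> unit_cube" using z[of x] cutoff by (auto simp: cutoff_fun_def)
qed

lemma \<nu>_integrable: "integrable lborel \<nu>" and \<nu>_bounded: "\<exists>B. \<forall>x. norm (\<nu> x) \<le> B"
  using integrable_compact_support[OF \<nu>_cont \<nu>_support(1,2)] by auto

lemma \<nu>_0: "\<nu> 0 = 1"
  using cutoff eventually_nhds_x_imp_x[of "\<lambda>\<xi>. \<nu> \<xi> = 1" 0] by (simp add: cutoff_fun_def)

lemma measurable_\<nu>[measurable]: "\<nu> \<in> borel_measurable borel"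
  using \<nu>_cont by (rule borel_measurable_continuous_onI)

lemma measurable_Y[measurable]: "Y \<in> borel_measurable borel"
  using Yc by (intro borel_measurable_continuous_onI continuous_at_imp_continuous_on) auto

text \<open>The cut-off of the discrete Riesz kernel transplanted to the frequencies of
  \<open>Y\<close>: the discrete convolution multiplies by it in place of \<open>Y\<close>, apart
  from the direction cosine.\<close>

definition X :: "real^'d \<Rightarrow> complex" where "X \<xi> = \<nu> (\<xi> v* b) * Y \<xi>"

lemma X_isCont: "isCont X \<xi>"
  unfolding X_def by (intro isCont_mult Yc isCont_o2[OF isCont_row_mult \<nu>_isCont])

lemma measurable_X[measurable]: "X \<in> borel_measurable borel"
  unfolding X_def by measurable

lemma X_integrable: "integrable lborel X"
proof -
  from \<nu>_bounded obtain B where B: "\<forall>x. norm (\<nu> x) \<le> B" ..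
  show ?thesis unfolding X_def by (rule integrable_mult_bounded(2)[OF Yi _ B[THEN spec]]) measurable
qed

lemma X_bounded: "\<exists>B. \<forall>\<xi>. norm (X \<xi>) \<le> B"
proof -
  from \<nu>_bounded obtain B where B: "\<forall>x. norm (\<nu> x) \<le> B" ..
  have "norm (X \<xi>) \<le> B * M" for \<xi>
  proof -
    have "0 \<le> B" using B[THEN spec, of 0] norm_ge_zero[of "\<nu> 0"] by linarith
    then show ?thesis unfolding X_def norm_mult using B YM by (intro mult_mono) auto
  qed
  then show ?thesis by blast
qed

section \<open>The sampling kernel for the Riesz transform\<close>

definition kernel :: "real^'d \<Rightarrow> complex" where "kernel = ft X"

definition cutoff_kernel :: "real^'d \<Rightarrow> complex" where "cutoff_kernel = ft (\<lambda>\<xi>. \<nu> (\<xi> v* b))"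

lemma scaled_cutoff: "continuous_on UNIV (\<lambda>\<xi>. \<nu> (\<xi> v* b))" "integrable lborel (\<lambda>\<xi>. \<nu> (\<xi> v* b))"
proof -
  show c: "continuous_on UNIV (\<lambda>\<xi>. \<nu> (\<xi> v* b))"
    by (intro continuous_at_imp_continuous_on ballI isCont_o2[OF isCont_row_mult \<nu>_isCont])
  let ?K = "(\<lambda>\<omega>. \<omega> v* matrix_inv b) ` fun_support \<nu>"
  have "compact ?K"
    by (intro compact_continuous_image \<nu>_support continuous_at_imp_continuous_on ballI isCont_row_mult)
  moreover have "\<nu> (\<xi> v* b) = 0" if "\<xi> \<notin> ?K" for \<xi>
  proof (rule \<nu>_support(2))
    have "\<xi> = (\<xi> v* b) v* matrix_inv b" by (simp add: matrix_inv_cancel_row[OF b])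
    then show "\<xi> v* b \<notin> fun_support \<nu>" using that by (metis image_eqI)
  qed
  ultimately show "integrable lborel (\<lambda>\<xi>. \<nu> (\<xi> v* b))" using integrable_compact_support(1)[OF c] by blast
qed

text \<open>The linear substitution by \<open>b\<close> reduces this to the transform of the smooth
  compactly supported \<open>\<nu>\<close>.\<close>

lemma cutoff_kernel_decay: "\<exists>B. \<forall>y. norm (cutoff_kernel y) \<le> B * decay (matrix_inv b *v y)"
proof (rule row_change_of_variables[OF b])
  fix c assume c: "c > 0"
    "\<And>f::real^'d \<Rightarrow> complex. integrable lborel f \<Longrightarrow> integrable lborel (\<lambda>x. f (x v* matrix_inv b))"
    "\<And>f::real^'d \<Rightarrow> complex. integrable lborel f \<Longrightarrow> (LBINT x. f (x v* matrix_inv b)) = of_real c * (LBINT x. f x)"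
  have sm: "smooth_fun \<nu>" using cutoff by (simp add: cutoff_fun_def)
  have eq: "of_real c * cutoff_kernel y = ft \<nu> (matrix_inv b *v y)" for y
  proof -
    let ?f = "\<lambda>\<xi>. \<nu> (\<xi> v* b) * ee (- (y \<bullet> \<xi>))"
    have "(LBINT \<omega>. ?f (\<omega> v* matrix_inv b)) = of_real c * (LBINT \<xi>. ?f \<xi>)"
      by (rule c(3)) (rule integrable_mult_ee(2)[OF scaled_cutoff(2)])
    moreover have "?f (\<omega> v* matrix_inv b) = \<nu> \<omega> * ee (- ((matrix_inv b *v y) \<bullet> \<omega>))" for \<omega>
      by (simp add: matrix_inv_cancel_row[OF b] inner_commute[of y] inner_commute[of "matrix_inv b *v y"] dot_lmul_matrix)
    ultimately show ?thesis by (simp add: cutoff_kernel_def ft_def)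
  qed
  show ?thesis
  proof (rule ft_smooth_decay[OF sm \<nu>_support(1,2)])
    fix B assume B: "B \<ge> 0" "\<And>v. norm (ft \<nu> v) \<le> B * decay v"
    have "norm (cutoff_kernel y) \<le> B / c * decay (matrix_inv b *v y)" for y
    proof -
      have "c * norm (cutoff_kernel y) = norm (of_real c * cutoff_kernel y)" using c(1) by (simp add: norm_mult)
      also have "... \<le> B * decay (matrix_inv b *v y)" unfolding eq by (rule B(2))
      finally show ?thesis using c(1) by (simp add: field_simps)
    qed
    then show ?thesis by blast
  qed
qed

lemma cutoff_kernel_integrable: "integrable lborel cutoff_kernel"
proof (rule linear_change_of_variables[OF matrix_vector_mul_linear matrix_vector_mul_linear matrix_inv_cancel(2,1)[OF b]])
  fix c' assume c': "c' > 0"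
    "\<And>f::real^'d \<Rightarrow> complex. integrable lborel f \<Longrightarrow> integrable lborel (\<lambda>x. f (matrix_inv b *v x))"
    "\<And>f::real^'d \<Rightarrow> complex. integrable lborel f \<Longrightarrow> (LBINT x. f (matrix_inv b *v x)) = of_real c' * (LBINT x. f x)"
  from cutoff_kernel_decay obtain B where B: "\<forall>y. norm (cutoff_kernel y) \<le> B * decay (matrix_inv b *v y)" ..
  have "integrable lborel (\<lambda>y. complex_of_real (decay (matrix_inv b *v y)))"
    by (rule c'(2)) (rule integrable_of_real[OF integrable_decay])
  then have "integrable lborel (\<lambda>y. B * decay (matrix_inv b *v y))"
    by (intro integrable_mult_right) (simp add: complex_of_real_integrable_eq)
  then show ?thesis
  proof (rule Bochner_Integration.integrable_bound)
    show "cutoff_kernel \<in> borel_measurable lborel" unfolding cutoff_kernel_def using measurable_ft[OF scaled_cutoff(2)] by simp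
    show "AE y in lborel. norm (cutoff_kernel y) \<le> norm (B * decay (matrix_inv b *v y))"
      using B by (intro AE_I2) (metis abs_ge_self order_trans real_norm_def)
  qed
qed

text \<open>A product on the Fourier side becomes a convolution. Integrability and lattice bounds of
  \<open>kernel\<close> thus come from \<open>cutoff_kernel\<close>, where smoothness is available,
  and from \<open>ft Y\<close>, where they are assumed.\<close>

lemma kernel_convolution: "kernel y = (LBINT u. cutoff_kernel u * ft Y (y - u))"
proof -
  from \<nu>_bounded obtain B where B: "\<forall>x. norm (\<nu> x) \<le> B" ..
  have inv: "\<nu> (\<xi> v* b) = (LBINT u. cutoff_kernel u * ee (u \<bullet> \<xi>))" for \<xi>
    unfolding cutoff_kernel_def
  proof (rule fourier_inversion[OF scaled_cutoff(2), symmetric])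
    show "integrable lborel (ft (\<lambda>\<xi>. \<nu> (\<xi> v* b)))" using cutoff_kernel_integrable by (simp add: cutoff_kernel_def)
    show "isCont (\<lambda>\<xi>. \<nu> (\<xi> v* b)) \<xi>" by (rule isCont_o2[OF isCont_row_mult \<nu>_isCont])
  qed (use B in blast)
  let ?G = "\<lambda>\<xi> u. Y \<xi> * cutoff_kernel u * ee (- ((y - u) \<bullet> \<xi>))"
  have "integrable (lborel \<Otimes>\<^sub>M lborel) (\<lambda>(\<xi>, u). ?G \<xi> u)"
    by (rule integrable_prod_bounded[OF Yi cutoff_kernel_integrable, where B=1]) (simp_all, measurable)
  from lborel_pair.Fubini_integral[OF this]
  have F: "(LBINT u. LBINT \<xi>. ?G \<xi> u) = (LBINT \<xi>. LBINT u. ?G \<xi> u)" .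
  have "kernel y = (LBINT \<xi>. LBINT u. ?G \<xi> u)"
    unfolding kernel_def ft_def
  proof (rule Bochner_Integration.integral_cong[OF refl])
    fix \<xi>
    have "X \<xi> * ee (- (y \<bullet> \<xi>)) = Y \<xi> * ee (- (y \<bullet> \<xi>)) * (LBINT u. cutoff_kernel u * ee (u \<bullet> \<xi>))"
      by (simp add: X_def inv mult_ac)
    also have "... = (LBINT u. Y \<xi> * ee (- (y \<bullet> \<xi>)) * (cutoff_kernel u * ee (u \<bullet> \<xi>)))" by simp
    also have "... = (LBINT u. ?G \<xi> u)"
    proof (rule Bochner_Integration.integral_cong[OF refl])
      fix u
      have "ee (- ((y - u) \<bullet> \<xi>)) = ee (- (y \<bullet> \<xi>)) * ee (u \<bullet> \<xi>)" by (simp add: inner_diff_left flip: ee_add)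
      then show "Y \<xi> * ee (- (y \<bullet> \<xi>)) * (cutoff_kernel u * ee (u \<bullet> \<xi>)) = ?G \<xi> u" by (simp add: mult_ac)
    qed
    finally show "X \<xi> * ee (- (y \<bullet> \<xi>)) = (LBINT u. ?G \<xi> u)" .
  qed
  also have "... = (LBINT u. LBINT \<xi>. ?G \<xi> u)" by (rule F[symmetric])
  also have "... = (LBINT u. cutoff_kernel u * ft Y (y - u))"
  proof (rule Bochner_Integration.integral_cong[OF refl])
    fix u
    have "?G \<xi> u = cutoff_kernel u * (Y \<xi> * ee (- ((y - u) \<bullet> \<xi>)))" for \<xi> by simp
    then show "(LBINT \<xi>. ?G \<xi> u) = cutoff_kernel u * ft Y (y - u)" by (simp only: ft_def integral_mult_right_zero)
  qed
  finally show ?thesis .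
qed

lemma kernel_integrable: "integrable lborel kernel"
  using integrable_convolution_fst[OF cutoff_kernel_integrable ft_Yi] by (simp add: kernel_convolution[abs_def])

lemma kernel_isCont: "isCont kernel x"
  unfolding kernel_def by (rule isCont_ft[OF X_integrable])

lemma measurable_kernel[measurable]: "kernel \<in> borel_measurable borel"
  unfolding kernel_def by (rule measurable_ft[OF X_integrable])

lemma kernel_integral: "(LBINT x. kernel x) = 1"
proof -
  from X_bounded obtain B where B: "\<forall>x. norm (X x) \<le> B" ..
  \<comment> \<open>Fourier inversion at the origin: the integral of the kernel is
    \<open>X 0\<close>, a product of two ones.\<close>
  have "(LBINT \<xi>. ft X \<xi> * ee (\<xi> \<bullet> 0)) = X 0"
    by (rule fourier_inversion[OF X_integrable B[THEN spec] X_isCont]) (use kernel_integrable in \<open>simp add: kernel_def\<close>)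
  then show ?thesis by (simp add: kernel_def X_def \<nu>_0 Y1)
qed

text \<open>Convolution with an integrable function averages the lattice sums of \<open>ft Y\<close>
  over shifts, and their bound is uniform in the shift.\<close>

lemma kernel_lattice_bounded: "lattice_bounded b (C * (LBINT u. norm (cutoff_kernel u))) kernel"
  unfolding lattice_bounded_def
proof (intro allI impI)
  fix y and F :: "(int^'d) set" assume F: "finite F"
  have [measurable]: "ft Y \<in> borel_measurable borel" by (rule measurable_ft[OF Yi])
  have [measurable]: "cutoff_kernel \<in> borel_measurable borel" unfolding cutoff_kernel_def by (rule measurable_ft[OF scaled_cutoff(2)])
  have i: "integrable lborel (\<lambda>u. norm (cutoff_kernel u * ft Y (y - b *v lattice_vec k - u)))" for k
    by (rule integrable_norm, rule integrable_mult_bounded(1)[OF cutoff_kernel_integrable _ lattice_bounded_norm_le[OF lb]]) measurable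
  have "(\<Sum>k\<in>F. norm (kernel (y - b *v lattice_vec k))) \<le> (\<Sum>k\<in>F. LINT u|lborel. norm (cutoff_kernel u * ft Y (y - b *v lattice_vec k - u)))"
    unfolding kernel_convolution by (intro sum_mono integral_norm_bound)
  also have "... = (LBINT u. (\<Sum>k\<in>F. norm (cutoff_kernel u * ft Y (y - b *v lattice_vec k - u))))"
    by (rule Bochner_Integration.integral_sum[symmetric]) (rule i)
  also have "... \<le> (LBINT u. C * norm (cutoff_kernel u))"
  proof (rule integral_mono)
    show "integrable lborel (\<lambda>u. \<Sum>k\<in>F. norm (cutoff_kernel u * ft Y (y - b *v lattice_vec k - u)))"
      by (intro Bochner_Integration.integrable_sum i)
    show "integrable lborel (\<lambda>u. C * norm (cutoff_kernel u))" by (intro integrable_mult_right integrable_norm cutoff_kernel_integrable)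
    fix u
    have "(\<Sum>k\<in>F. norm (cutoff_kernel u * ft Y (y - b *v lattice_vec k - u))) = norm (cutoff_kernel u) * (\<Sum>k\<in>F. norm (ft Y ((y - u) - b *v lattice_vec k)))"
      by (simp add: norm_mult sum_distrib_left algebra_simps)
    also have "... \<le> norm (cutoff_kernel u) * C" using lattice_boundedD[OF lb F] by (intro mult_left_mono) auto
    finally show "(\<Sum>k\<in>F. norm (cutoff_kernel u * ft Y (y - b *v lattice_vec k - u))) \<le> C * norm (cutoff_kernel u)" by (simp add: mult.commute)
  qed
  finally show "(\<Sum>k\<in>F. norm (kernel (y - b *v lattice_vec k))) \<le> C * (LBINT u. norm (cutoff_kernel u))" by simp
qed

section \<open>Fourier representation of samples of the Riesz transform\<close>

definition riesz_coeff :: "real^'d \<Rightarrow> real \<Rightarrow> int^'d \<Rightarrow> (real^'d \<Rightarrow> complex) \<Rightarrow> complex" where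
  "riesz_coeff j \<alpha> k f = (LBINT \<xi>. X \<xi> * (of_real ((\<xi> \<bullet> j) / norm \<xi>) * ee (\<xi> \<bullet> (b *v lattice_vec k)) * ft f (\<alpha> *\<^sub>R \<xi>)))"

lemma abs_direction_le: "j \<in> Basis \<Longrightarrow> \<bar>(\<xi> \<bullet> j) / norm (\<xi>::'a::euclidean_space)\<bar> \<le> 1"
  using Basis_le_norm[of j \<xi>] by (cases "\<xi> = 0") (auto simp: divide_le_eq_1)

text \<open>Nothing is assumed about the Fourier transform of \<open>r\<close>, so the transform is
  moved onto the test function by \<open>riesz_limit_convolution\<close>. There the limit is
  explicit, since \<open>kernel\<close> has an integrable Fourier transform, and Fubini brings out
  \<open>ft f\<close>.\<close>

lemma sample_riesz_limit:
  assumes j: "j \<in> Basis" and f: "integrable lborel f" and r: "integrable lborel r" and \<alpha>: "\<alpha> \<noteq> 0"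
    and fr: "AE x in lborel. (\<lambda>n. rapprox j n f x) \<longlonglongrightarrow> r x"
  shows "sample \<alpha> b k r kernel = - \<i> * of_real (half_gauss * sgn \<alpha>) * riesz_coeff j \<alpha> k f"
proof -
  let ?bk = "b *v lattice_vec k"
  define G where "G \<xi> = X \<xi> * ee (\<xi> \<bullet> ?bk)" for \<xi>
  have Gi: "integrable lborel G"
    unfolding G_def by (rule integrable_mult_bounded(1)[OF X_integrable, where B=1]) (simp_all, measurable)
  have [measurable]: "G \<in> borel_measurable borel" unfolding G_def by measurable
  \<comment> \<open>Reflected, dilated and translated so that the convolution of \<open>r\<close>
    with it at the origin is the sample.\<close>
  define \<eta> where "\<eta> x = kernel (- ?bk + (- \<alpha>) *\<^sub>R x)" for x
  have \<eta>G: "\<eta> x = (LBINT \<xi>. G \<xi> * ee (\<alpha> * (\<xi> \<bullet> x)))" for x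
    unfolding \<eta>_def kernel_def ft_def
  proof (rule Bochner_Integration.integral_cong[OF refl])
    fix \<xi>
    have "- ((- ?bk + (- \<alpha>) *\<^sub>R x) \<bullet> \<xi>) = \<xi> \<bullet> ?bk + \<alpha> * (\<xi> \<bullet> x)"
      by (simp add: inner_simps inner_commute)
    then have "ee (- ((- ?bk + (- \<alpha>) *\<^sub>R x) \<bullet> \<xi>)) = ee (\<xi> \<bullet> ?bk) * ee (\<alpha> * (\<xi> \<bullet> x))"
      by (simp only: ee_add)
    then show "X \<xi> * ee (- ((- ?bk + (- \<alpha>) *\<^sub>R x) \<bullet> \<xi>)) = G \<xi> * ee (\<alpha> * (\<xi> \<bullet> x))" by (simp add: G_def)
  qed
  have \<eta>i: "integrable lborel \<eta>"
    unfolding \<eta>_def using kernel_integrable \<alpha> by (subst integrable_lborel_affine_iff) auto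
  have \<eta>c: "isCont \<eta> x" for x
    unfolding \<eta>_def by (rule isCont_o2[OF _ kernel_isCont]) (intro continuous_intros)
  define E where "E x = (LBINT \<xi>. G \<xi> * (ee (\<alpha> * (\<xi> \<bullet> x)) * (- \<i> * of_real (half_gauss * (sgn \<alpha> * ((\<xi> \<bullet> j) / norm \<xi>))))))" for x
  have ra: "rapprox j n \<eta> x = (LBINT \<xi>. G \<xi> * (ee (\<alpha> * (\<xi> \<bullet> x)) * (- \<i> * of_real (rmult j (1 / real (Suc n)) (real (Suc n)) (\<alpha> *\<^sub>R \<xi>)))))" for n x
  proof -
    let ?k = "rkern j (1 / real (Suc n)) (real (Suc n))"
    note rg = rapprox_range[of n]
    have ki: "integrable lborel (\<lambda>u. complex_of_real (?k u))" using integrable_rkern[OF j rg] by (rule integrable_of_real)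
    have ki': "integrable lborel (\<lambda>y. complex_of_real (?k (x - y)))"
      using ki by (simp only: integrable_lborel_reflect[of "\<lambda>u. complex_of_real (?k u)"])
    let ?H = "\<lambda>\<xi> y. G \<xi> * complex_of_real (?k (x - y)) * ee (\<alpha> * (\<xi> \<bullet> y))"
    have "integrable (lborel \<Otimes>\<^sub>M lborel) (\<lambda>(\<xi>, y). ?H \<xi> y)"
      by (rule integrable_prod_bounded[OF Gi ki', where B=1]) (simp_all, measurable)
    from lborel_pair.Fubini_integral[OF this]
    have F: "(LBINT y. LBINT \<xi>. ?H \<xi> y) = (LBINT \<xi>. LBINT y. ?H \<xi> y)" .
    have "rapprox j n \<eta> x = (LBINT y. LBINT \<xi>. ?H \<xi> y)"
      unfolding rapprox_def rtrunc_def
    proof (rule Bochner_Integration.integral_cong[OF refl])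
      fix y
      have "?H \<xi> y = (G \<xi> * ee (\<alpha> * (\<xi> \<bullet> y))) * complex_of_real (?k (x - y))" for \<xi> by simp
      then show "\<eta> y * complex_of_real (?k (x - y)) = (LBINT \<xi>. ?H \<xi> y)" by (simp only: \<eta>G integral_mult_left_zero)
    qed
    also have "... = (LBINT \<xi>. LBINT y. ?H \<xi> y)" by (rule F)
    also have "... = (LBINT \<xi>. G \<xi> * (ee (\<alpha> * (\<xi> \<bullet> x)) * (- \<i> * of_real (rmult j (1 / real (Suc n)) (real (Suc n)) (\<alpha> *\<^sub>R \<xi>)))))"
    proof (rule Bochner_Integration.integral_cong[OF refl])
      fix \<xi>
      let ?h = "\<lambda>u. (G \<xi> * ee (\<alpha> * (\<xi> \<bullet> x))) * (complex_of_real (?k u) * ee (- ((\<alpha> *\<^sub>R \<xi>) \<bullet> u)))"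
      have "?H \<xi> y = ?h (x - y)" for y
      proof -
        have "ee (\<alpha> * (\<xi> \<bullet> y)) = ee (\<alpha> * (\<xi> \<bullet> x)) * ee (- ((\<alpha> *\<^sub>R \<xi>) \<bullet> (x - y)))"
          by (simp add: inner_diff_right algebra_simps flip: ee_add)
        then show ?thesis by (simp add: mult_ac)
      qed
      then have "(LBINT y. ?H \<xi> y) = (LBINT u. ?h u)" by (simp only: integral_lborel_reflect[of ?h])
      also have "... = (G \<xi> * ee (\<alpha> * (\<xi> \<bullet> x))) * ft (\<lambda>u. complex_of_real (?k u)) (\<alpha> *\<^sub>R \<xi>)" by (simp only: ft_def integral_mult_right_zero)
      finally show "(LBINT y. ?H \<xi> y) = G \<xi> * (ee (\<alpha> * (\<xi> \<bullet> x)) * (- \<i> * of_real (rmult j (1 / real (Suc n)) (real (Suc n)) (\<alpha> *\<^sub>R \<xi>))))"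
        by (simp only: ft_rkern[OF j rg] mult.assoc)
    qed
    finally show ?thesis .
  qed
  have hgG: "integrable lborel (\<lambda>\<xi>. half_gauss * norm (G \<xi>))" using Gi by (intro integrable_mult_right integrable_norm)
  have rb: "norm (G \<xi> * (ee t * (- \<i> * of_real (rmult j (1 / real (Suc n)) (real (Suc n)) (\<alpha> *\<^sub>R \<xi>))))) \<le> half_gauss * norm (G \<xi>)" for \<xi> t n
    using abs_rmult_le[OF j rapprox_range[of n], of "\<alpha> *\<^sub>R \<xi>"] by (simp add: norm_mult mult.commute[of half_gauss] mult_left_mono)
  \<comment> \<open>Homogeneity of degree 0: the scale survives only through its sign.\<close>
  have dir: "((\<alpha> *\<^sub>R \<xi>) \<bullet> j) / norm (\<alpha> *\<^sub>R \<xi>) = sgn \<alpha> * ((\<xi> \<bullet> j) / norm \<xi>)" for \<xi>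
    using \<alpha> by (simp add: sgn_if)
  have Elim: "(\<lambda>n. rapprox j n \<eta> x) \<longlonglongrightarrow> E x" for x
    unfolding ra E_def
  proof (rule integral_dominated_convergence[OF _ _ hgG])
    show "AE \<xi> in lborel. (\<lambda>n. G \<xi> * (ee (\<alpha> * (\<xi> \<bullet> x)) * (- \<i> * of_real (rmult j (1 / real (Suc n)) (real (Suc n)) (\<alpha> *\<^sub>R \<xi>))))) \<longlonglongrightarrow>
       G \<xi> * (ee (\<alpha> * (\<xi> \<bullet> x)) * (- \<i> * of_real (half_gauss * (sgn \<alpha> * ((\<xi> \<bullet> j) / norm \<xi>)))))"
      unfolding dir[symmetric] by (intro AE_I2 tendsto_intros tendsto_of_real rmult_tendsto)
    show "AE \<xi> in lborel. norm (G \<xi> * (ee (\<alpha> * (\<xi> \<bullet> x)) * (- \<i> * of_real (rmult j (1 / real (Suc n)) (real (Suc n)) (\<alpha> *\<^sub>R \<xi>))))) \<le> half_gauss * norm (G \<xi>)" for n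
      by (intro AE_I2 rb)
  qed measurable
  have Ebd: "norm (rapprox j n \<eta> x) \<le> (LBINT \<xi>. half_gauss * norm (G \<xi>))" for n x
    unfolding ra by (rule order_trans[OF integral_norm_bound], rule integral_mono'[OF hgG rb]) (simp add: less_imp_le[OF half_gauss_pos])
  have dle: "\<bar>(\<xi> \<bullet> j) / norm \<xi>\<bar> \<le> 1" for \<xi> :: "real^'d" by (rule abs_direction_le[OF j])
  have Ec: "isCont E x" for x
    unfolding E_def
  proof (rule isCont_lebesgue_integral[OF _ _ _ hgG])
    fix \<xi> :: "real^'d"
    show "isCont (\<lambda>h. G \<xi> * (ee (\<alpha> * (\<xi> \<bullet> h)) * (- \<i> * of_real (half_gauss * (sgn \<alpha> * ((\<xi> \<bullet> j) / norm \<xi>)))))) x"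
      by (intro isCont_mult continuous_const isCont_ee continuous_inner continuous_ident)
  next
    have "norm (G \<xi> * (ee t * (- \<i> * of_real (half_gauss * (sgn \<alpha> * ((\<xi> \<bullet> j) / norm \<xi>)))))) \<le> half_gauss * norm (G \<xi>)" for \<xi> t
    proof -
      have "norm (G \<xi> * (ee t * (- \<i> * of_real (half_gauss * (sgn \<alpha> * ((\<xi> \<bullet> j) / norm \<xi>)))))) = norm (G \<xi>) * \<bar>half_gauss * (sgn \<alpha> * ((\<xi> \<bullet> j) / norm \<xi>))\<bar>"
        by (simp only: norm_mult norm_of_real norm_ee norm_minus_cancel norm_ii mult_1)
      also have "\<bar>half_gauss * (sgn \<alpha> * ((\<xi> \<bullet> j) / norm \<xi>))\<bar> = half_gauss * \<bar>(\<xi> \<bullet> j) / norm \<xi>\<bar>"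
        using \<alpha> half_gauss_pos by (simp add: abs_mult abs_sgn_eq)
      also have "norm (G \<xi>) * (half_gauss * \<bar>(\<xi> \<bullet> j) / norm \<xi>\<bar>) \<le> norm (G \<xi>) * (half_gauss * 1)"
        using dle[of \<xi>] half_gauss_pos by (intro mult_left_mono) auto
      finally show ?thesis by (simp add: mult.commute)
    qed
    then show "\<forall>\<^sub>F h in nhds x. \<forall>\<xi>\<in>space lborel. norm (G \<xi> * (ee (\<alpha> * (\<xi> \<bullet> h)) * (- \<i> * of_real (half_gauss * (sgn \<alpha> * ((\<xi> \<bullet> j) / norm \<xi>)))))) \<le> half_gauss * norm (G \<xi>)"
      by simp
  qed measurable
  \<comment> \<open>The convolution identity is used at the single point 0.\<close>
  have "(LBINT y. f y * E (0 - y)) = (LBINT y. r y * \<eta> (0 - y))"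
  proof (rule riesz_limit_convolution[OF j f r \<eta>i fr Elim Ebd Ec \<eta>c])
    show "norm (\<eta> x) \<le> C * (LBINT u. norm (cutoff_kernel u))" for x
      unfolding \<eta>_def by (rule lattice_bounded_norm_le[OF kernel_lattice_bounded])
  qed
  also have "... = sample \<alpha> b k r kernel" by (simp add: sample_def \<eta>_def)
  finally have "sample \<alpha> b k r kernel = (LBINT y. f y * E (0 - y))" by simp
  also have "... = - \<i> * of_real (half_gauss * sgn \<alpha>) * riesz_coeff j \<alpha> k f"
  proof -
    let ?c = "- \<i> * complex_of_real (half_gauss * sgn \<alpha>)"
    let ?H = "\<lambda>\<xi> y. G \<xi> * f y * (ee (- (\<alpha> * (\<xi> \<bullet> y))) * of_real ((\<xi> \<bullet> j) / norm \<xi>))"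
    have fm[measurable]: "f \<in> borel_measurable borel" using f by (simp add: borel_measurable_integrable[of lborel, simplified])
    have "integrable (lborel \<Otimes>\<^sub>M lborel) (\<lambda>(\<xi>, y). ?H \<xi> y)"
    proof (rule integrable_prod_bounded[OF Gi f, where B=1])
      show "norm (ee (- (\<alpha> * (\<xi> \<bullet> y))) * complex_of_real ((\<xi> \<bullet> j) / norm \<xi>)) \<le> 1" for \<xi> y :: "real^'d"
        using dle[of \<xi>] by (simp only: norm_mult norm_ee norm_of_real mult_1)
    qed measurable
    from lborel_pair.Fubini_integral[OF this]
    have F: "(LBINT y. LBINT \<xi>. ?H \<xi> y) = (LBINT \<xi>. LBINT y. ?H \<xi> y)" .
    have "f y * E (0 - y) = ?c * (LBINT \<xi>. ?H \<xi> y)" for y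
    proof -
      have "f y * (G \<xi> * (ee (\<alpha> * (\<xi> \<bullet> (0 - y))) * (- \<i> * of_real (half_gauss * (sgn \<alpha> * ((\<xi> \<bullet> j) / norm \<xi>)))))) = ?c * ?H \<xi> y" for \<xi>
        by (simp only: of_real_mult) (simp add: mult_ac)
      then have "(LBINT \<xi>. f y * (G \<xi> * (ee (\<alpha> * (\<xi> \<bullet> (0 - y))) * (- \<i> * of_real (half_gauss * (sgn \<alpha> * ((\<xi> \<bullet> j) / norm \<xi>))))))) = (LBINT \<xi>. ?c * ?H \<xi> y)"
        by (intro Bochner_Integration.integral_cong refl)
      then show ?thesis unfolding E_def by (simp only: integral_mult_right_zero)
    qed
    then have "(LBINT y. f y * E (0 - y)) = ?c * (LBINT y. LBINT \<xi>. ?H \<xi> y)" by (simp only: integral_mult_right_zero)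
    also have "... = ?c * (LBINT \<xi>. LBINT y. ?H \<xi> y)" by (simp only: F)
    also have "(LBINT \<xi>. LBINT y. ?H \<xi> y) = riesz_coeff j \<alpha> k f"
      unfolding riesz_coeff_def
    proof (rule Bochner_Integration.integral_cong[OF refl])
      fix \<xi>
      have "?H \<xi> y = (G \<xi> * of_real ((\<xi> \<bullet> j) / norm \<xi>)) * (f y * ee (- ((\<alpha> *\<^sub>R \<xi>) \<bullet> y)))" for y by (simp add: mult_ac)
      then have "(LBINT y. ?H \<xi> y) = (G \<xi> * of_real ((\<xi> \<bullet> j) / norm \<xi>)) * ft f (\<alpha> *\<^sub>R \<xi>)" by (simp only: ft_def integral_mult_right_zero)
      then show "(LBINT y. ?H \<xi> y) = X \<xi> * (of_real ((\<xi> \<bullet> j) / norm \<xi>) * ee (\<xi> \<bullet> ?bk) * ft f (\<alpha> *\<^sub>R \<xi>))"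
        by (simp add: G_def mult_ac)
    qed
    finally show ?thesis .
  qed
  finally show ?thesis .
qed

end

context band_limited_sampling
begin

section \<open>The discrete Riesz convolution of samples\<close>

lemma discrete_riesz_kernel_nth:
  "discrete_riesz_kernel b \<nu> k $ i =
     (LBINT u. - \<i> * of_real ((u v* matrix_inv b) $ i / norm (u v* matrix_inv b)) * \<nu> u * ee (u \<bullet> lattice_vec k))"
  and norm_discrete_riesz_kernel_nth: "norm (discrete_riesz_kernel b \<nu> k $ i) \<le> (LBINT u. norm (\<nu> u))"
  and integrable_riesz_symbol_nth: "integrable lborel (\<lambda>u. - \<i> * of_real ((u v* matrix_inv b) $ i / norm (u v* matrix_inv b)) * \<nu> u * ee (u \<bullet> lattice_vec k))"
proof -
  let ?f = "\<lambda>i u. - \<i> * complex_of_real ((u v* matrix_inv b) $ i / norm (u v* matrix_inv b)) * \<nu> u * ee (u \<bullet> lattice_vec k)"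
  have le: "norm (?f i u) \<le> norm (\<nu> u)" for i u
  proof -
    have "\<bar>(u v* matrix_inv b) $ i / norm (u v* matrix_inv b)\<bar> \<le> 1"
      using component_le_norm_cart[of "u v* matrix_inv b" i] by (auto simp: divide_le_eq_1)
    then show ?thesis unfolding norm_mult norm_of_real norm_ee norm_minus_cancel norm_ii mult_1 mult_1_right by (rule mult_left_le_one_le[rotated 2]) auto
  qed
  show i: "integrable lborel (?f i)" for i
    by (rule Bochner_Integration.integrable_bound[OF \<nu>_integrable]) (measurable, use le in auto)
  let ?v = "\<lambda>\<xi>. indicator unit_cube \<xi> *\<^sub>R (exp (2 * complex_of_real pi * \<i> * complex_of_real (\<xi> \<bullet> lattice_vec k)) *s riesz_symbol b \<nu> \<xi>)"
  \<comment> \<open>The symbol contains the factor \<open>\<nu>\<close>, which vanishes off the unit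
    cube, so the integral over the cube equals one over the whole space.\<close>
  have comp: "?v \<xi> $ i = ?f i \<xi>" for \<xi> i
  proof (cases "\<xi> \<in> unit_cube")
    case False
    then show ?thesis using \<nu>_support(3)[of \<xi>] by auto
  qed (simp add: riesz_symbol_def ee_eq_exp)
  have il: "integrable lebesgue (\<lambda>\<xi>. ?v \<xi> $ i)" for i
    unfolding comp using i[of i] by (subst integrable_completion) (auto simp: borel_measurable_integrable)
  have "discrete_riesz_kernel b \<nu> k $ i = (LINT \<xi>|lebesgue. ?v \<xi> $ i)"
    unfolding discrete_riesz_kernel_def set_lebesgue_integral_def by (rule integral_vec_nth[OF il])
  also have "... = (LBINT u. ?f i u)"
    unfolding comp using i[of i] by (intro integral_completion) (simp add: borel_measurable_integrable)
  finally show e: "discrete_riesz_kernel b \<nu> k $ i = (LBINT u. ?f i u)" .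
  show "norm (discrete_riesz_kernel b \<nu> k $ i) \<le> (LBINT u. norm (\<nu> u))"
    unfolding e by (rule order_trans[OF integral_norm_bound]) (intro integral_mono integrable_norm i \<nu>_integrable le)
qed

text \<open>An absolutely summable \<open>s\<close> against a bounded kernel converges absolutely,
  so taking components commutes with the infinite sum and the result is again a
  \<open>count_space\<close> integral.\<close>

lemma seq_conv_nth:
  assumes s: "\<And>F. finite F \<Longrightarrow> (\<Sum>m\<in>F. norm (s m)) \<le> S"
  shows "seq_conv s (discrete_riesz_kernel b \<nu>) k $ i = (LINT m|count_space UNIV. s m * discrete_riesz_kernel b \<nu> (k - m) $ i)"
proof -
  let ?z = "discrete_riesz_kernel b \<nu>"
  let ?N = "LINT \<omega>|lborel. norm (\<nu> \<omega>)"
  have Nz: "norm (?z m) \<le> real CARD('d) * ?N" for m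
  proof -
    have "norm (?z m) \<le> (\<Sum>i\<in>(UNIV::'d set). ?N)"
      by (rule order_trans[OF norm_vec_le_sum]) (intro sum_mono norm_discrete_riesz_kernel_nth)
    then show ?thesis by simp
  qed
  have N0: "0 \<le> ?N" by simp
  have 1: "(\<Sum>m\<in>F. norm (s m *s ?z (k - m))) \<le> S * (real CARD('d) * ?N)" if F: "finite F" for F
  proof -
    have "(\<Sum>m\<in>F. norm (s m *s ?z (k - m))) \<le> (\<Sum>m\<in>F. norm (s m) * (real CARD('d) * ?N))"
      unfolding norm_smult_vec by (intro sum_mono mult_left_mono Nz) auto
    also have "... \<le> S * (real CARD('d) * ?N)" unfolding sum_distrib_right[symmetric] using s[OF F] N0 by (intro mult_right_mono) auto
    finally show ?thesis .
  qed
  have "(\<lambda>m. norm (s m *s ?z (k - m))) summable_on UNIV"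
    by (rule nonneg_bdd_above_summable_on) (use 1 in \<open>auto simp: bdd_above_def\<close>)
  then have sv: "(\<lambda>m. s m *s ?z (k - m)) summable_on UNIV" by (rule abs_summable_summable)
  have ic: "integrable (count_space UNIV) (\<lambda>m. s m * ?z (k - m) $ i)"
  proof (rule integrable_lattice)
    fix F :: "(int^'d) set" assume F: "finite F"
    have "(\<Sum>m\<in>F. norm (s m * ?z (k - m) $ i)) \<le> (\<Sum>m\<in>F. norm (s m *s ?z (k - m)))"
    proof (rule sum_mono)
      fix m
      show "norm (s m * ?z (k - m) $ i) \<le> norm (s m *s ?z (k - m))"
        using Finite_Cartesian_Product.norm_nth_le[where x="s m *s ?z (k - m)" and i=i] by simp
    qed
    then show "(\<Sum>m\<in>F. norm (s m * ?z (k - m) $ i)) \<le> S * (real CARD('d) * ?N)" using 1[OF F] by linarith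
  qed
  have "seq_conv s ?z k $ i = (\<Sum>\<^sub>\<infinity>m. (s m *s ?z (k - m)) $ i)"
    unfolding seq_conv_def
    using infsum_bounded_linear_strong[OF _ bounded_linear_vec_nth[of i], of "\<lambda>m. s m *s ?z (k - m)" UNIV] sv
      summable_on_bounded_linear[OF bounded_linear_vec_nth[of i] sv] by simp
  also have "... = (LINT m|count_space UNIV. s m * ?z (k - m) $ i)"
    using infsum_eq_integral_count_space[OF ic] by simp
  finally show ?thesis .
qed

text \<open>On the Fourier side both the discrete convolution with the Riesz kernel and sampling the Riesz
  transform multiply by \<open>\<xi>\<^sub>i / |\<xi>|\<close>; Poisson summation identifies the two.\<close>

lemma seq_conv_sample_nth:
  assumes f: "integrable lborel f"
  shows "seq_conv (\<lambda>m. sample \<alpha> b m f (ft Y)) (discrete_riesz_kernel b \<nu>) k $ i = - \<i> * riesz_coeff (axis i 1) \<alpha> k f"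
proof -
  let ?B = "matrix_inv b"
  let ?s = "\<lambda>m. sample \<alpha> b m f (ft Y)"
  define \<zeta> where "\<zeta> u = - \<i> * complex_of_real ((u v* ?B) $ i / norm (u v* ?B)) * \<nu> u" for u
  have ftm[measurable]: "ft Y \<in> borel_measurable borel" by (rule measurable_ft[OF Yi])
  have fm[measurable]: "f \<in> borel_measurable borel" using f by (simp add: borel_measurable_integrable[of lborel, simplified])
  have \<zeta>m[measurable]: "\<zeta> \<in> borel_measurable borel" unfolding \<zeta>_def by measurable
  have \<zeta>i: "integrable lborel \<zeta>" using integrable_riesz_symbol_nth[of i 0] by (simp add: \<zeta>_def[abs_def])
  define S where "S = C * (LBINT x. norm (f x))"
  have s: "(\<Sum>m\<in>F. norm (?s m)) \<le> S" if "finite F" for F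
    unfolding S_def by (rule sum_norm_sample_le[OF f lb ftm that])
  show ?thesis
  proof (rule row_change_of_variables[OF b])
    fix c assume c: "c > 0"
      "\<And>f::real^'d \<Rightarrow> complex. integrable lborel f \<Longrightarrow> integrable lborel (\<lambda>x. f (x v* matrix_inv b))"
      "\<And>f::real^'d \<Rightarrow> complex. integrable lborel f \<Longrightarrow> (LBINT x. f (x v* matrix_inv b)) = of_real c * (LBINT x. f x)"
    \<comment> \<open>The Fourier series of the samples: the sum is taken under the integral over
      \<open>x\<close> and evaluated by Poisson summation at the point
      \<open>\<alpha> *\<^sub>R x\<close>.\<close>
    have inner: "of_real c * (LINT m|count_space UNIV. ?s m * ee (- (u \<bullet> lattice_vec m))) = Y (u v* ?B) * ft f (\<alpha> *\<^sub>R (u v* ?B))"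
      if u: "u \<in> unit_cube" for u
    proof -
      let ?G = "\<lambda>m x. f x * (ft Y (\<alpha> *\<^sub>R x - b *v lattice_vec m) * ee (- (u \<bullet> lattice_vec m)))"
      have "?s m * ee (- (u \<bullet> lattice_vec m)) = (LBINT x. ?G m x)" for m
        unfolding sample_def integral_mult_left_zero[symmetric] by (simp only: mult.assoc)
      then have "(LINT m|count_space UNIV. ?s m * ee (- (u \<bullet> lattice_vec m))) = (LINT m|count_space UNIV. LINT x|lborel. ?G m x)" by simp
      also have "... = (LBINT x. LINT m|count_space UNIV. ?G m x)"
      proof (rule lattice_sum_integral(1)[where w="\<lambda>x. norm (f x) * C", symmetric])
        show "integrable lborel (\<lambda>x. norm (f x) * C)" using f by (intro integrable_mult_left integrable_norm)
        fix x and F :: "(int^'d) set" assume F: "finite F"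
        have "(\<Sum>m\<in>F. norm (?G m x)) = norm (f x) * (\<Sum>m\<in>F. norm (ft Y (\<alpha> *\<^sub>R x - b *v lattice_vec m)))"
          by (simp add: norm_mult sum_distrib_left)
        also have "... \<le> norm (f x) * C" using lattice_boundedD[OF lb F] by (intro mult_left_mono) auto
        finally show "(\<Sum>m\<in>F. norm (?G m x)) \<le> norm (f x) * C" .
      qed measurable
      also have "of_real c * ... = (LBINT x. f x * (Y (u v* ?B) * ee (- ((u v* ?B) \<bullet> (\<alpha> *\<^sub>R x)))))"
      proof (subst integral_mult_right_zero[symmetric], rule Bochner_Integration.integral_cong[OF refl])
        fix x
        have "of_real c * (LINT m|count_space UNIV. ?G m x) = f x * (of_real c * (LINT m|count_space UNIV. ft Y (\<alpha> *\<^sub>R x - b *v lattice_vec m) * ee (- (u \<bullet> lattice_vec m))))"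
          by (simp only: integral_mult_right_zero mult.left_commute)
        also have "... = f x * (Y (u v* ?B) * ee (- ((u v* ?B) \<bullet> (\<alpha> *\<^sub>R x))))"
          by (rule arg_cong[where f="(*) (f x)"], rule poisson_summation_band_limited[OF b Yc Yi YM]) (fact Y0 lb c(1) c(3) u)+
        finally show "of_real c * (LINT m|count_space UNIV. ?G m x) = f x * (Y (u v* ?B) * ee (- ((u v* ?B) \<bullet> (\<alpha> *\<^sub>R x))))" .
      qed
      also have "... = (LBINT x. Y (u v* ?B) * (f x * ee (- ((\<alpha> *\<^sub>R (u v* ?B)) \<bullet> x))))"
        by (intro Bochner_Integration.integral_cong refl) simp
      finally show ?thesis by (simp only: ft_def integral_mult_right_zero)
    qed
    let ?H = "\<lambda>m u. ?s m * (\<zeta> u * ee (u \<bullet> lattice_vec (k - m)))"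
    have "seq_conv ?s (discrete_riesz_kernel b \<nu>) k $ i = (LINT m|count_space UNIV. ?s m * discrete_riesz_kernel b \<nu> (k - m) $ i)"
      by (rule seq_conv_nth) (rule s)
    also have "... = (LINT m|count_space UNIV. LINT u|lborel. ?H m u)"
      unfolding discrete_riesz_kernel_nth by (simp only: \<zeta>_def integral_mult_right_zero)
    also have "... = (LBINT u. LINT m|count_space UNIV. ?H m u)"
    proof (rule lattice_sum_integral(1)[where w="\<lambda>u. S * norm (\<zeta> u)", symmetric])
      show "integrable lborel (\<lambda>u. S * norm (\<zeta> u))" using \<zeta>i by (intro integrable_mult_right integrable_norm)
      fix x and F :: "(int^'d) set" assume F: "finite F"
      have "(\<Sum>m\<in>F. norm (?H m x)) = (\<Sum>m\<in>F. norm (?s m)) * norm (\<zeta> x)"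
        by (simp add: norm_mult sum_distrib_right)
      also have "... \<le> S * norm (\<zeta> x)" using s[OF F] by (intro mult_right_mono) auto
      finally show "(\<Sum>m\<in>F. norm (?H m x)) \<le> S * norm (\<zeta> x)" .
    qed measurable
    finally have e1: "seq_conv ?s (discrete_riesz_kernel b \<nu>) k $ i = (LBINT u. LINT m|count_space UNIV. ?H m u)" .
    \<comment> \<open>The integrand of \<open>riesz_coeff\<close>, on the frequency side; the
      substitution by the inverse of \<open>b\<close> brings the symbol to this form.\<close>
    define \<Phi> where "\<Phi> \<xi> = X \<xi> * (of_real ((\<xi> \<bullet> axis i 1) / norm \<xi>) * ee (\<xi> \<bullet> (b *v lattice_vec k)) * ft f (\<alpha> *\<^sub>R \<xi>))" for \<xi>
    have \<Phi>i: "integrable lborel \<Phi>"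
      unfolding \<Phi>_def
    proof (rule integrable_mult_bounded(1)[OF X_integrable])
      have [measurable]: "ft f \<in> borel_measurable borel" by (rule measurable_ft[OF f])
      show "(\<lambda>\<xi>. of_real ((\<xi> \<bullet> axis i 1) / norm \<xi>) * ee (\<xi> \<bullet> (b *v lattice_vec k)) * ft f (\<alpha> *\<^sub>R \<xi>)) \<in> borel_measurable borel" by measurable
      fix \<xi> :: "real^'d"
      have "\<bar>(\<xi> \<bullet> axis i 1) / norm \<xi>\<bar> \<le> 1" by (rule abs_direction_le) (simp add: axis_in_Basis_iff)
      then show "norm (of_real ((\<xi> \<bullet> axis i 1) / norm \<xi>) * ee (\<xi> \<bullet> (b *v lattice_vec k)) * ft f (\<alpha> *\<^sub>R \<xi>)) \<le> 1 * 1 * (LBINT x. norm (f x))"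
        unfolding norm_mult norm_of_real norm_ee by (intro mult_mono norm_ft_le) auto
    qed
    have "of_real c * (LINT m|count_space UNIV. ?H m u) = - \<i> * \<Phi> (u v* ?B)" for u
    proof (cases "u \<in> unit_cube")
      case True
      have "?H m u = (\<zeta> u * ee (u \<bullet> lattice_vec k)) * (?s m * ee (- (u \<bullet> lattice_vec m)))" for m
      proof -
        have "ee (u \<bullet> lattice_vec (k - m)) = ee (u \<bullet> lattice_vec k) * ee (- (u \<bullet> lattice_vec m))"
          by (simp add: lattice_vec_diff inner_diff_right flip: ee_add)
        then show ?thesis by (simp add: mult_ac)
      qed
      then have "(LINT m|count_space UNIV. ?H m u) = (LINT m|count_space UNIV. (\<zeta> u * ee (u \<bullet> lattice_vec k)) * (?s m * ee (- (u \<bullet> lattice_vec m))))"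
        by (rule Bochner_Integration.integral_cong[OF refl])
      then have "of_real c * (LINT m|count_space UNIV. ?H m u) =
          (\<zeta> u * ee (u \<bullet> lattice_vec k)) * (of_real c * (LINT m|count_space UNIV. ?s m * ee (- (u \<bullet> lattice_vec m))))"
        unfolding integral_mult_right_zero by (simp only: mult.left_commute[of "complex_of_real c"])
      also have "... = (\<zeta> u * ee (u \<bullet> lattice_vec k)) * (Y (u v* ?B) * ft f (\<alpha> *\<^sub>R (u v* ?B)))"
        by (simp only: inner[OF True])
      also have "u \<bullet> lattice_vec k = (u v* ?B) \<bullet> (b *v lattice_vec k)"
        by (simp only: dot_lmul_matrix[symmetric] matrix_inv_cancel_row[OF b])
      also have "(\<zeta> u * ee ((u v* ?B) \<bullet> (b *v lattice_vec k))) * (Y (u v* ?B) * ft f (\<alpha> *\<^sub>R (u v* ?B))) = - \<i> * \<Phi> (u v* ?B)"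
        by (simp add: \<Phi>_def X_def \<zeta>_def matrix_inv_cancel_row[OF b] inner_axis mult_ac)
      finally show ?thesis .
    next
      \<comment> \<open>Off the cube Poisson summation says nothing, but both sides vanish with
        \<open>\<nu>\<close>.\<close>
      case False
      then have "\<nu> u = 0" using \<nu>_support(3) by blast
      then show ?thesis by (simp add: \<zeta>_def \<Phi>_def X_def matrix_inv_cancel_row[OF b])
    qed
    then have "of_real c * (LBINT u. LINT m|count_space UNIV. ?H m u) = (LBINT u. - \<i> * \<Phi> (u v* ?B))"
      unfolding integral_mult_right_zero[symmetric, where c="complex_of_real c"] by (rule Bochner_Integration.integral_cong[OF refl])
    also have "... = of_real c * (- \<i> * (LBINT \<xi>. \<Phi> \<xi>))"
      unfolding integral_mult_right_zero c(3)[OF \<Phi>i] by (simp only: mult.left_commute)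
    finally have "(LBINT u. LINT m|count_space UNIV. ?H m u) = - \<i> * (LBINT \<xi>. \<Phi> \<xi>)"
      using c(1) by (simp only: mult_cancel_left of_real_eq_0_iff) simp
    then show ?thesis unfolding e1 riesz_coeff_def \<Phi>_def .
  qed
qed

text \<open>Both quantities are multiples of the same \<open>riesz_coeff\<close>; in absolute value
  the factor i and the sign of the scale disappear.\<close>

lemma norm_seq_conv_sample_nth:
  assumes f: "integrable lborel f" and r: "integrable lborel r" and \<alpha>: "\<alpha> \<noteq> 0"
    and fr: "AE x in lborel. (\<lambda>n. rapprox (axis i 1) n f x) \<longlonglongrightarrow> r x"
  shows "norm (sample \<alpha> b k r kernel) = half_gauss * norm (seq_conv (\<lambda>m. sample \<alpha> b m f (ft Y)) (discrete_riesz_kernel b \<nu>) k $ i)"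
proof -
  have j: "(axis i 1 :: real^'d) \<in> Basis" by (simp add: axis_in_Basis_iff)
  have "norm (complex_of_real (half_gauss * sgn \<alpha>)) = half_gauss"
    using \<alpha> half_gauss_pos by (simp only: norm_of_real abs_mult) (simp add: abs_sgn_eq)
  then show ?thesis
    unfolding sample_riesz_limit[OF j f r \<alpha> fr] seq_conv_sample_nth[OF f] by (simp only: norm_mult norm_minus_cancel norm_ii mult_1)
qed

end

section \<open>Norm equivalence\<close>

text \<open>Completeness of Lebesgue measure. It allows every integral over \<open>lebesgue\<close>
  in the definitions to be replaced by one of a Borel version over \<open>lborel\<close>.\<close>

lemma measurable_lebesgue_AE_eq:
  fixes g g0 :: "'a::euclidean_space \<Rightarrow> 'b::topological_space"
  assumes g0: "g0 \<in> borel_measurable borel" and ae: "AE x in lborel. g x = g0 x"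
  shows "g \<in> borel_measurable lebesgue"
proof (rule measurableI)
  fix A :: "'b set" assume A: "A \<in> sets borel"
  have "AE x in lebesgue. x \<in> g0 -` A \<longleftrightarrow> x \<in> g -` A"
    unfolding AE_completion_iff using ae by eventually_elim simp
  moreover have "g0 -` A \<in> sets lebesgue"
    using measurable_sets[OF g0 A] by (intro sets_completionI_sets) simp
  ultimately have "g -` A \<in> sets lebesgue" by (rule completion.in_sets_AE) simp
  then show "g -` A \<inter> space lebesgue \<in> sets lebesgue" by simp
qed simp

lemma
  fixes g g0 :: "'a::euclidean_space \<Rightarrow> 'b::{banach, second_countable_topology}"
  assumes g0: "g0 \<in> borel_measurable borel" and ae: "AE x in lborel. g x = g0 x"
  shows integral_lebesgue_AE_eq: "(LINT x|lebesgue. g x) = (LBINT x. g0 x)"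
    and integrable_lebesgue_AE_eq: "integrable lebesgue g \<longleftrightarrow> integrable lborel g0"
proof -
  have m: "g \<in> borel_measurable lebesgue" "g0 \<in> borel_measurable lebesgue"
    using measurable_lebesgue_AE_eq[OF g0 ae] measurable_lebesgue_AE_eq[OF g0 AE_I2[OF refl]] by auto
  have ae': "AE x in lebesgue. g x = g0 x" unfolding AE_completion_iff by (rule ae)
  show "(LINT x|lebesgue. g x) = (LBINT x. g0 x)"
    using integral_cong_AE[OF m ae'] integral_completion[of g0 lborel] g0 by simp
  show "integrable lebesgue g \<longleftrightarrow> integrable lborel g0"
    using integrable_cong_AE[OF m ae'] integrable_completion[of g0 lborel] g0 by simp
qed

lemma integrable_lebesgue_borel_version:
  fixes g :: "'a::euclidean_space \<Rightarrow> complex"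
  assumes g: "integrable lebesgue g"
  shows "\<exists>g0. integrable lborel g0 \<and> (AE x in lborel. g x = g0 x)"
proof -
  have gm: "g \<in> borel_measurable lebesgue" using g by (rule borel_measurable_integrable)
  then have R: "(\<lambda>x. Re (g x)) \<in> borel_measurable lebesgue" and I: "(\<lambda>x. Im (g x)) \<in> borel_measurable lebesgue" by measurable
  from completion_ex_borel_measurable_real[OF R] obtain u where u: "u \<in> borel_measurable lborel" "AE x in lborel. Re (g x) = u x" by blast
  from completion_ex_borel_measurable_real[OF I] obtain v where v: "v \<in> borel_measurable lborel" "AE x in lborel. Im (g x) = v x" by blast
  let ?g0 = "\<lambda>x. complex_of_real (u x) + \<i> * complex_of_real (v x)"
  have m: "?g0 \<in> borel_measurable borel" using u(1) v(1) by simp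
  have ae: "AE x in lborel. g x = ?g0 x" using u(2) v(2) by eventually_elim (simp add: complex_eq_iff)
  show ?thesis using integrable_lebesgue_AE_eq[OF m ae] g ae by blast
qed

section \<open>Borel versions of Hardy space functions\<close>

definition riesz_const :: "'d::finite itself \<Rightarrow> real" where
  "riesz_const _ = Gamma ((real CARD('d) + 1) / 2) * pi powr (- ((real CARD('d) + 1) / 2))"

lemma riesz_const_pos: "riesz_const TYPE('d::finite) > 0"
  unfolding riesz_const_def by (intro mult_pos_pos Gamma_real_pos) auto

text \<open>The exceptional set of \<open>f = f0\<close> stays null under the reflection
  \<open>y \<mapsto> x - y\<close>, so the equality holds at every \<open>x\<close> and every
  radius, with no exceptional points depending on the radius.\<close>

lemma truncated_riesz_nth:
  fixes f :: "real^'d \<Rightarrow> complex"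
  assumes f0: "integrable lborel f0" and ae: "AE x in lborel. f x = f0 x" and e: "\<epsilon> > 0"
  shows "truncated_riesz \<epsilon> f x $ i = of_real (riesz_const TYPE('d)) * riesz_cut (axis i 1) \<epsilon> f0 x"
proof -
  let ?v = "\<lambda>f y. indicator {y. \<epsilon> < norm y} y *\<^sub>R (\<chi> i. f (x - y) * complex_of_real (riesz_kernel y $ i))"
  let ?h = "\<lambda>i y. indicator {y. \<epsilon> < norm y} y * (f0 (x - y) * complex_of_real ((y \<bullet> axis i 1) / norm y ^ (DIM(real^'d) + 1)))"
  have h: "integrable lborel (?h i)" for i
    by (rule integrable_riesz_cut_integrand[OF _ f0 e]) (simp add: axis_in_Basis_iff)
  have comp: "?v f0 y $ i = of_real (riesz_const TYPE('d)) * ?h i y" for y i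
    by (simp add: riesz_kernel_def riesz_const_def inner_axis indicator_def)
  have i: "integrable lborel (\<lambda>y. ?v f0 y $ i)" for i unfolding comp by (rule integrable_mult_right[OF h])
  have "AE y in lborel. f (x + (-1) *\<^sub>R y) = f0 (x + (-1) *\<^sub>R y)" by (rule AE_lborel_affine[OF ae]) simp
  then have ae': "AE y in lborel. ?v f y = ?v f0 y" by eventually_elim simp
  have m: "?v f0 \<in> borel_measurable borel" using borel_measurable_integrable[OF integrable_vec[OF i]] by simp
  have "truncated_riesz \<epsilon> f x = (LBINT y. ?v f0 y)"
    unfolding truncated_riesz_def set_lebesgue_integral_def by (rule integral_lebesgue_AE_eq[OF m ae'])
  then have "truncated_riesz \<epsilon> f x $ i = (LBINT y. ?v f0 y $ i)" by (simp only: integral_vec_nth[OF i])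
  then show ?thesis unfolding comp by (simp only: integral_mult_right_zero riesz_cut_def)
qed

text \<open>The bridge from the principal value to the smooth truncations: where the sharp
  truncations converge, so do their averages, with the factor \<open>radial_mass\<close> for the
  weight and the division by \<open>riesz_const\<close> for the normalisation.\<close>

lemma hardy_space_borel_version:
  fixes f :: "real^'d \<Rightarrow> complex"
  assumes f: "f \<in> hardy_space"
  shows "\<exists>f0 r. integrable lborel f0 \<and> (AE x in lborel. f x = f0 x) \<and> (\<forall>i. integrable lborel (r i) \<and>
    (AE x in lborel. riesz_transform f x $ i = r i x) \<and>
    (AE x in lborel. (\<lambda>n. rapprox (axis i 1) n f0 x) \<longlonglongrightarrow> of_real (radial_mass CARD('d) / riesz_const TYPE('d)) * r i x))"
proof -
  let ?c = "riesz_const TYPE('d)"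
  have fi: "integrable lebesgue f" and ri: "integrable lebesgue (riesz_transform f)"
    and pv: "AE x in lborel. \<exists>l. ((\<lambda>\<epsilon>. truncated_riesz \<epsilon> f x) \<longlongrightarrow> l) (at_right 0)"
    using f by (auto simp: hardy_space_def AE_completion_iff)
  from integrable_lebesgue_borel_version[OF fi] obtain f0 where f0: "integrable lborel f0 \<and> (AE x in lborel. f x = f0 x)" ..
  have "\<exists>g0. integrable lborel g0 \<and> (AE x in lborel. riesz_transform f x $ i = g0 x)" for i
    by (rule integrable_lebesgue_borel_version) (rule integrable_bounded_linear[OF bounded_linear_vec_nth ri])
  then have "\<forall>i. \<exists>g0. integrable lborel g0 \<and> (AE x in lborel. riesz_transform f x $ i = g0 x)" ..
  from choice[OF this] obtain r where r: "\<forall>i. integrable lborel (r i) \<and> (AE x in lborel. riesz_transform f x $ i = r i x)" ..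
  have "AE x in lborel. (\<lambda>n. rapprox (axis i 1) n f0 x) \<longlonglongrightarrow> of_real (radial_mass CARD('d) / ?c) * r i x" for i
  proof -
    have "AE x in lborel. riesz_transform f x $ i = r i x" using r by blast
    with pv show ?thesis
    proof eventually_elim
      case (elim x)
      then obtain l where l: "((\<lambda>\<epsilon>. truncated_riesz \<epsilon> f x) \<longlongrightarrow> l) (at_right 0)" by blast
      \<comment> \<open>At these \<open>x\<close> the limit exists, so \<open>Lim\<close> returns
        it.\<close>
      have "riesz_transform f x = l" unfolding riesz_transform_def by (rule tendsto_Lim[OF _ l]) simp
      then have li: "l $ i = r i x" using elim by simp
      have "((\<lambda>\<epsilon>. truncated_riesz \<epsilon> f x $ i / of_real ?c) \<longlongrightarrow> l $ i / of_real ?c) (at_right 0)"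
        using riesz_const_pos[where 'd='d] by (intro tendsto_divide tendsto_vec_nth l tendsto_const) simp
      moreover have "\<forall>\<^sub>F \<epsilon> in at_right (0::real). truncated_riesz \<epsilon> f x $ i / of_real ?c = riesz_cut (axis i 1) \<epsilon> f0 x"
        using eventually_at_right_less
      proof eventually_elim
        case (elim \<epsilon>)
        then show ?case using truncated_riesz_nth[of f0 f \<epsilon> x i] f0 riesz_const_pos[where 'd='d] by simp
      qed
      ultimately have "((\<lambda>\<epsilon>. riesz_cut (axis i 1) \<epsilon> f0 x) \<longlongrightarrow> l $ i / of_real ?c) (at_right 0)"
        by (rule Lim_transform_eventually)
      then have "(\<lambda>n. rapprox (axis i 1) n f0 x) \<longlonglongrightarrow> of_real (radial_mass (DIM(real^'d))) * (l $ i / of_real ?c)"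
        using f0 by (intro rapprox_tendsto) (auto simp: axis_in_Basis_iff)
      then show ?case by (simp add: li)
    qed
  qed
  then show ?thesis using f0 r by blast
qed

lemma
  fixes f :: "real^'d \<Rightarrow> complex"
  assumes f0: "integrable lborel f0" "AE x in lborel. f x = f0 x"
    and r: "\<And>i. integrable lborel (r i)" "\<And>i. AE x in lborel. riesz_transform f x $ i = r i x"
  shows hardy_norm_le: "hardy_norm f \<le> (LBINT x. norm (f0 x)) + (\<Sum>i\<in>UNIV. LINT x|lborel. norm (r i x))"
    and hardy_norm_ge: "(LBINT x. norm (f0 x)) + (LBINT x. norm (r i x)) \<le> hardy_norm f"
proof -
  let ?v = "\<lambda>x. \<chi> i. r i x"
  have v: "integrable lborel ?v" by (rule integrable_vec) (simp add: r)
  have "AE x in lborel. \<forall>i\<in>UNIV. riesz_transform f x $ i = r i x" using r(2) by (intro AE_ball_countable') auto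
  then have ae: "AE x in lborel. norm (riesz_transform f x) = norm (?v x)" proof eventually_elim
    case (elim x)
    then have "riesz_transform f x = ?v x" by (simp add: vec_eq_iff)
    then show ?case by simp
  qed
  have ae0: "AE x in lborel. norm (f x) = norm (f0 x)" using f0(2) by eventually_elim simp
  have m: "(\<lambda>x. norm (?v x)) \<in> borel_measurable borel" "(\<lambda>x. norm (f0 x)) \<in> borel_measurable borel"
    using borel_measurable_integrable[OF integrable_norm[OF v]] borel_measurable_integrable[OF integrable_norm[OF f0(1)]] by simp_all
  have eq: "hardy_norm f = (LBINT x. norm (f0 x)) + (LBINT x. norm (?v x))"
    unfolding hardy_norm_def integral_lebesgue_AE_eq[OF m(1) ae] integral_lebesgue_AE_eq[OF m(2) ae0] ..
  have "(LBINT x. norm (?v x)) \<le> (LBINT x. (\<Sum>i\<in>UNIV. norm (r i x)))"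
    using v r(1) norm_vec_le_sum[of "?v _"] by (intro integral_mono integrable_norm Bochner_Integration.integrable_sum) auto
  also have "... = (\<Sum>i\<in>UNIV. LINT x|lborel. norm (r i x))"
    using r(1) by (intro Bochner_Integration.integral_sum integrable_norm)
  finally show "hardy_norm f \<le> (LBINT x. norm (f0 x)) + (\<Sum>i\<in>UNIV. LINT x|lborel. norm (r i x))" by (simp add: eq)
  have "(LBINT x. norm (r i x)) \<le> (LBINT x. norm (?v x))"
    using v r(1) Finite_Cartesian_Product.norm_nth_le[where x="?v _" and i=i] by (intro integral_mono integrable_norm) auto
  then show "(LBINT x. norm (f0 x)) + (LBINT x. norm (r i x)) \<le> hardy_norm f" by (simp add: eq)
qed

lemma mat_vector_mult: "mat c *v (x :: real^'d) = c *\<^sub>R x"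
  by (simp add: vec_eq_iff matrix_vector_mult_def mat_def if_distrib[of "\<lambda>t. t * _"] cong: if_cong)

text \<open>Compact support of the transform gives its integrability, so Fourier inversion recovers
  \<open>cnj \<phi>\<close> from \<open>?Y\<close>; the lattice bound is the Schwartz decay of
  \<open>\<phi>\<close> after the linear substitution by \<open>b\<close>.\<close>

lemma band_limited_sampling_schwartz:
  fixes b :: "real^'d^'d" and \<nu> \<phi> :: "real^'d \<Rightarrow> complex"
  assumes b: "invertible b" and \<nu>: "cutoff_fun \<nu>"
    and \<phi>: "integrable lebesgue \<phi>" "(LINT x|lebesgue. \<phi> x) = 1" "schwartz_fun \<phi>"
    and supp: "fun_support (fourier \<phi>) \<subseteq> (\<lambda>\<xi>. \<xi> v* matrix_inv b) ` unit_cube"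
  shows "(\<exists>C. band_limited_sampling b \<nu> (\<lambda>\<xi>. cnj (ft \<phi> \<xi>)) C (LBINT x. norm (\<phi> x))) \<and>
    ft (\<lambda>\<xi>. cnj (ft \<phi> \<xi>)) = (\<lambda>x. cnj (\<phi> x)) \<and> \<phi> \<in> borel_measurable borel"
proof -
  let ?Y = "\<lambda>\<xi>. cnj (ft \<phi> \<xi>)"
  have sch: "smooth_fun \<phi>" "\<exists>B. \<forall>x. norm x ^ n * norm (\<phi> x) \<le> B" for n
  proof -
    have *: "smooth_fun \<phi>" "\<forall>(n::nat) ks. \<exists>B. \<forall>x. norm x ^ n * norm (iterated_partial ks \<phi> x) \<le> B"
      using \<phi>(3) by (simp_all add: schwartz_fun_def)
    show "smooth_fun \<phi>" by (rule *(1))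
    show "\<exists>B. \<forall>x. norm x ^ n * norm (\<phi> x) \<le> B"
      using *(2)[THEN spec[of _ n], THEN spec[of _ "[]"]] by (simp add: iterated_partial_def)
  qed
  have "\<phi> differentiable (at x)" for x
    using sch(1) by (auto simp: smooth_fun_def iterated_partial_def dest: spec[of _ "[]"])
  then have \<phi>c: "isCont \<phi> x" for x by (rule differentiable_imp_continuous_within)
  then have \<phi>m: "\<phi> \<in> borel_measurable borel"
    by (intro borel_measurable_continuous_onI continuous_at_imp_continuous_on) auto
  have \<phi>i: "integrable lborel \<phi>" using \<phi>(1) integrable_completion[of \<phi> lborel] \<phi>m by simp
  have \<phi>1: "(LBINT x. \<phi> x) = 1" using \<phi>(2) integral_completion[of \<phi> lborel] \<phi>m by simp
  obtain BB where BB: "\<forall>x. norm (\<phi> x) \<le> BB" using sch(2)[of 0] by auto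
  have four: "fourier \<phi> = ft \<phi>"
  proof
    fix \<xi>
    have "fourier \<phi> \<xi> = (LINT x|lebesgue. \<phi> x * ee (- (\<xi> \<bullet> x)))" unfolding fourier_def ee_eq_exp by simp
    also have "... = ft \<phi> \<xi>" unfolding ft_def by (rule integral_completion) (use \<phi>m in simp)
    finally show "fourier \<phi> \<xi> = ft \<phi> \<xi>" .
  qed
  have Yc: "isCont ?Y \<xi>" for \<xi> using isCont_ft[OF \<phi>i] by (intro isCont_cnj)
  have YM: "norm (?Y \<xi>) \<le> (LBINT x. norm (\<phi> x))" for \<xi> using norm_ft_le by simp
  let ?K = "fun_support (fourier \<phi>)"
  have bl: "bounded_linear (\<lambda>\<xi>. \<xi> v* matrix_inv b)" using linear_row_mult by (simp add: linear_conv_bounded_linear)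
  have "bounded ?K" by (rule bounded_subset[OF bounded_linear_image[OF bounded_unit_cube bl] supp])
  then have K: "compact ?K" by (simp add: compact_eq_bounded_closed fun_support_def)
  have YK: "?Y \<xi> = 0" if "\<xi> \<notin> ?K" for \<xi>
    using that closure_subset[of "{x. fourier \<phi> x \<noteq> 0}"] unfolding fun_support_def four by auto
  have Yi: "integrable lborel ?Y"
    by (rule integrable_compact_support(1)[OF _ K YK]) (intro continuous_at_imp_continuous_on ballI Yc)
  have Y0: "\<xi> v* b \<in> unit_cube" if "?Y \<xi> \<noteq> 0" for \<xi>
  proof -
    have "\<xi> \<in> ?K" using YK that by blast
    then have "\<xi> \<in> (\<lambda>\<xi>. \<xi> v* matrix_inv b) ` unit_cube" using supp by blast
    then show ?thesis by (auto simp: matrix_inv_cancel_row[OF b])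
  qed
  have fi: "integrable lborel (ft \<phi>)"
    using integrable_bounded_linear[OF bounded_linear_cnj Yi] by simp
  have ftY: "ft ?Y = (\<lambda>x. cnj (\<phi> x))"
  proof
    fix x
    have "ft ?Y x = cnj (ft (ft \<phi>) (- x))" by (simp add: ft_cnj)
    also have "ft (ft \<phi>) (- x) = (LBINT \<xi>. ft \<phi> \<xi> * ee (\<xi> \<bullet> x))"
      unfolding ft_def[of "ft \<phi>"] by (simp add: inner_commute)
    also have "... = \<phi> x" by (rule fourier_inversion[OF \<phi>i BB[THEN spec] \<phi>c fi])
    finally show "ft ?Y x = cnj (\<phi> x)" .
  qed
  from matrix_mult_bound[of "matrix_inv b"] obtain KB where KB: "KB > 0 \<and> (\<forall>x. norm (matrix_inv b *v x) \<le> norm x * KB)" ..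
  have "\<exists>B. \<forall>v. norm v ^ n * norm (cnj (\<phi> (b *v v))) \<le> B" for n
  proof -
    from sch(2)[of n] obtain B where B: "\<forall>x. norm x ^ n * norm (\<phi> x) \<le> B" ..
    have "norm v ^ n * norm (cnj (\<phi> (b *v v))) \<le> KB ^ n * B" for v
    proof -
      have "norm v \<le> norm (b *v v) * KB" using KB[THEN conjunct2, THEN spec, of "b *v v"] by (simp add: matrix_inv_cancel[OF b])
      then have "norm v ^ n \<le> (norm (b *v v) * KB) ^ n" by (intro power_mono) auto
      then have "norm v ^ n * norm (\<phi> (b *v v)) \<le> (norm (b *v v) * KB) ^ n * norm (\<phi> (b *v v))" by (intro mult_right_mono) auto
      also have "... = KB ^ n * (norm (b *v v) ^ n * norm (\<phi> (b *v v)))" by (simp add: power_mult_distrib)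
      also have "... \<le> KB ^ n * B" using B KB by (intro mult_left_mono) auto
      finally show ?thesis by simp
    qed
    then show ?thesis by blast
  qed
  then have "\<exists>C. lattice_bounded b C (ft ?Y)"
  proof (rule rapid_decay)
    fix M assume M: "M \<ge> 0" "\<And>v. norm (cnj (\<phi> (b *v v))) \<le> M * decay v"
    show ?thesis by (rule lattice_bounded_decay[OF b M(1), of "ft ?Y"]) (use M(2) in \<open>auto simp: ftY\<close>)
  qed
  then obtain C where C: "lattice_bounded b C (ft ?Y)" ..
  have "integrable lborel (ft ?Y)" unfolding ftY by (rule integrable_bounded_linear[OF bounded_linear_cnj \<phi>i])
  moreover have "?Y 0 = 1" by (simp add: ft_def \<phi>1)
  ultimately have "band_limited_sampling b \<nu> ?Y C (LBINT x. norm (\<phi> x))"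
    by (intro band_limited_sampling.intro b \<nu> Yc Yi YM Y0 C)
  then show ?thesis using ftY \<phi>m by blast
qed

section \<open>Discrete Hardy norms and finite partial sums\<close>

lemma discrete_hardy_norm_scale:
  assumes "c > 0"
  shows "discrete_hardy_norm b \<nu> (\<lambda>k. of_real c * s k) = c * discrete_hardy_norm b \<nu> s"
    and "s \<in> discrete_hardy_space b \<nu> \<Longrightarrow> (\<lambda>k. of_real c * s k) \<in> discrete_hardy_space b \<nu>"
proof -
  have "(of_real c * z) *s w = c *\<^sub>R (z *s w)" for z :: complex and w :: "complex^'a"
    by (simp add: vec_eq_iff scaleR_conv_of_real[where 'a=complex] mult.assoc)
  then have e: "seq_conv (\<lambda>k. of_real c * s k) z k = c *\<^sub>R seq_conv s z k" for z k
    unfolding seq_conv_def by (simp only: infsum_scaleR_right)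
  have n: "norm (of_real c * s k) = c * norm (s k)" for k using assms by (simp add: norm_mult)
  have n': "norm (c *\<^sub>R w) = c * norm w" for w :: "complex^'a" using assms by simp
  show "discrete_hardy_norm b \<nu> (\<lambda>k. of_real c * s k) = c * discrete_hardy_norm b \<nu> s"
    unfolding discrete_hardy_norm_def e n n' by (simp only: infsum_cmult_right' distrib_left)
  show "s \<in> discrete_hardy_space b \<nu> \<Longrightarrow> (\<lambda>k. of_real c * s k) \<in> discrete_hardy_space b \<nu>"
    unfolding discrete_hardy_space_def mem_Collect_eq e n n' using assms by (simp add: summable_on_cmult_right')
qed

lemma SUP_mult_left_real:
  fixes f :: "'i \<Rightarrow> real"
  assumes A: "A \<noteq> {}" "bdd_above (f ` A)" and c: "c > 0"
  shows "(SUP x\<in>A. c * f x) = (SUP x\<in>A. f x) * c"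
proof (rule antisym)
  have le: "x \<in> A \<Longrightarrow> c * f x \<le> (SUP x\<in>A. f x) * c" for x
    using cSUP_upper[OF _ A(2)] c by (simp add: mult.commute)
  then show "(SUP x\<in>A. c * f x) \<le> (SUP x\<in>A. f x) * c" using A(1) by (intro cSUP_least)
  have "bdd_above ((\<lambda>x. c * f x) ` A)" using le by (auto simp: bdd_above_def)
  then have "f x \<le> (SUP x\<in>A. c * f x) / c" if "x \<in> A" for x
    using cSUP_upper[OF that, of "\<lambda>x. c * f x"] c by (simp add: field_simps)
  then have "(SUP x\<in>A. f x) \<le> (SUP x\<in>A. c * f x) / c" using A(1) by (intro cSUP_least)
  then show "(SUP x\<in>A. f x) * c \<le> (SUP x\<in>A. c * f x)" using c by (simp add: field_simps)
qed

lemma discrete_hardy_space_bound: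
  fixes s :: "int^'d \<Rightarrow> complex"
  assumes "\<And>F. finite F \<Longrightarrow> (\<Sum>k\<in>F. norm (s k)) \<le> P"
    and "\<And>F. finite F \<Longrightarrow> (\<Sum>k\<in>F. norm (seq_conv s (discrete_riesz_kernel b \<nu>) k)) \<le> Q"
  shows "s \<in> discrete_hardy_space b \<nu>" "discrete_hardy_norm b \<nu> s \<le> P + Q"
proof -
  let ?w = "\<lambda>k. complex_of_real (norm (seq_conv s (discrete_riesz_kernel b \<nu>) k))"
  have w: "(\<Sum>k\<in>F. norm (?w k)) \<le> Q" if "finite F" for F using assms(2)[OF that] by simp
  show "s \<in> discrete_hardy_space b \<nu>"
    using norm_summable_lattice[of s P] norm_summable_lattice[of ?w Q] assms(1) w by (simp add: discrete_hardy_space_def)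
  show "discrete_hardy_norm b \<nu> s \<le> P + Q"
    using infsum_norm_lattice_le[of s P] infsum_norm_lattice_le[of ?w Q] assms(1) w by (simp add: discrete_hardy_norm_def)
qed

lemma sum_le_discrete_hardy_norm:
  fixes s :: "int^'d \<Rightarrow> complex"
  assumes s: "s \<in> discrete_hardy_space b \<nu>" and F: "finite F"
  shows "(\<Sum>k\<in>F. norm (s k)) \<le> discrete_hardy_norm b \<nu> s"
    and "(\<Sum>k\<in>F. norm (seq_conv s (discrete_riesz_kernel b \<nu>) k)) \<le> discrete_hardy_norm b \<nu> s"
proof -
  let ?w = "\<lambda>k. norm (seq_conv s (discrete_riesz_kernel b \<nu>) k)"
  have "(\<lambda>k. norm (s k)) summable_on UNIV" "?w summable_on UNIV" using s by (auto simp: discrete_hardy_space_def)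
  then have "(\<Sum>k\<in>F. norm (s k)) \<le> (\<Sum>\<^sub>\<infinity>k. norm (s k))" "(\<Sum>k\<in>F. ?w k) \<le> (\<Sum>\<^sub>\<infinity>k. ?w k)"
    using F by (auto intro!: finite_sum_le_infsum)
  moreover have "0 \<le> (\<Sum>\<^sub>\<infinity>k. norm (s k))" "0 \<le> (\<Sum>\<^sub>\<infinity>k. ?w k)" by (auto intro!: infsum_nonneg)
  ultimately show "(\<Sum>k\<in>F. norm (s k)) \<le> discrete_hardy_norm b \<nu> s" "(\<Sum>k\<in>F. ?w k) \<le> discrete_hardy_norm b \<nu> s"
    unfolding discrete_hardy_norm_def by linarith+
qed

theorem corollary10:
  fixes \<alpha> :: "nat \<Rightarrow> real"
    and a :: "nat \<Rightarrow> real^'d^'d::finite"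
    and b :: "real^'d^'d"
    and \<nu> \<phi> :: "real^'d \<Rightarrow> complex"
  assumes "\<And>j. j > 0 \<Longrightarrow> \<alpha> j \<noteq> 0"
    and "filterlim (\<lambda>j. \<bar>\<alpha> j\<bar>) at_top sequentially"
    and "\<And>j. j > 0 \<Longrightarrow> a j = mat (\<alpha> j)"
    and "invertible b"
    and "cutoff_fun \<nu>"
    and "integrable lebesgue \<phi>"
    and "(LINT x|lebesgue. \<phi> x) = 1"
    and "schwartz_fun \<phi>"
    and "fun_support (fourier \<phi>) \<subseteq> (\<lambda>\<xi>. \<xi> v* matrix_inv b) ` unit_cube"
  shows "\<exists>A>0. \<exists>B>0. \<forall>f\<in>hardy_space.
     analysis_op a b \<phi> f \<in> linf_hardy_space b \<nu> \<and>
     linf_hardy_norm b \<nu> (analysis_op a b \<phi> f) =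
       (SUP j\<in>{0<..}. discrete_hardy_norm b \<nu> (\<lambda>k. pairing f (affine_system a b \<phi> j k))) * \<bar>det b\<bar> \<and>
     hardy_norm f \<le> A * linf_hardy_norm b \<nu> (analysis_op a b \<phi> f) \<and>
     linf_hardy_norm b \<nu> (analysis_op a b \<phi> f) \<le> B * hardy_norm f"
proof -
  let ?Y = "\<lambda>\<xi>. cnj (ft \<phi> \<xi>)"
  let ?M = "LINT x|lborel. norm (\<phi> x)"
  let ?z = "discrete_riesz_kernel b \<nu>"
  note \<alpha> = assms(1,2) and b = assms(4)
  have prep: "(\<exists>C. band_limited_sampling b \<nu> ?Y C ?M) \<and> ft ?Y = (\<lambda>x. cnj (\<phi> x)) \<and> \<phi> \<in> borel_measurable borel"
    by (rule band_limited_sampling_schwartz[OF assms(4-9)])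
  then have ftY: "ft ?Y = (\<lambda>x. cnj (\<phi> x))" and \<phi>m[measurable]: "\<phi> \<in> borel_measurable borel" by blast+
  from prep obtain C where "band_limited_sampling b \<nu> ?Y C ?M" by blast
  then interpret K: band_limited_sampling b \<nu> ?Y C ?M .
  have ftYm: "ft ?Y \<in> borel_measurable borel" by (rule measurable_ft[OF K.Yi])
  have ftY1: "(LBINT x. ft ?Y x) = 1"
  proof -
    have "(LBINT x. \<phi> x) = 1" using assms(7) integral_completion[of \<phi> lborel] by simp
    then show ?thesis by (simp add: ftY)
  qed
  define D where "D = \<bar>det b\<bar>"
  define V where "V = measure lborel (cell b)"
  define C' where "C' = C * (LBINT u. norm (K.cutoff_kernel u))"
  \<comment> \<open>The smooth truncations converge to this multiple of the Riesz transform.\<close>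
  define \<kappa> where "\<kappa> = radial_mass CARD('d) / riesz_const TYPE('d)"
  let ?n = "real CARD('d)"
  \<comment> \<open>In both constants the first term accounts for \<open>f\<close> and the second
    for the components of the Riesz transform. Lower bounds carry the measure \<open>V\<close> of a
    cell, upper bounds a lattice bound; the ratio of \<open>half_gauss\<close> and
    \<open>\<kappa>\<close> converts discrete to continuous Riesz transforms.\<close>
  define A0 where "A0 = V + ?n * (V * half_gauss / \<kappa>)"
  define B0 where "B0 = C + ?n * (C' * \<kappa> / half_gauss)"
  note hg = half_gauss_pos
  have D: "D > 0" using b by (simp add: D_def invertible_det_nz)
  have \<kappa>: "\<kappa> > 0" using radial_mass_pos[of "CARD('d)"] riesz_const_pos[where 'd='d] by (simp add: \<kappa>_def)
  have V: "V \<ge> 0" by (simp add: V_def)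
  have C: "C \<ge> 0" using lattice_boundedD[OF K.lb, of "{}"] by simp
  have C': "C' \<ge> 0" using C by (simp add: C'_def)
  have A0: "A0 \<ge> 0" using V hg \<kappa> by (simp add: A0_def)
  have B0: "B0 \<ge> 0" using C C' hg \<kappa> by (simp add: B0_def)
  \<comment> \<open>\<open>A0\<close> and \<open>B0\<close> are only known to be nonnegative, so 1
    is added to obtain positive constants. The factor \<open>D\<close> is the determinant in the
    analysis operator.\<close>
  have main: "analysis_op a b \<phi> f \<in> linf_hardy_space b \<nu> \<and>
     linf_hardy_norm b \<nu> (analysis_op a b \<phi> f) =
       (SUP j\<in>{0<..}. discrete_hardy_norm b \<nu> (\<lambda>k. pairing f (affine_system a b \<phi> j k))) * \<bar>det b\<bar> \<and>
     hardy_norm f \<le> ((A0 + 1) / D) * linf_hardy_norm b \<nu> (analysis_op a b \<phi> f) \<and>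
     linf_hardy_norm b \<nu> (analysis_op a b \<phi> f) \<le> (D * B0 + 1) * hardy_norm f"
    if f: "f \<in> hardy_space" for f
  proof -
    obtain f0 r where f0: "integrable lborel f0" "AE x in lborel. f x = f0 x"
      and r: "\<And>i. integrable lborel (r i)" "\<And>i. AE x in lborel. riesz_transform f x $ i = r i x"
      and lim: "\<And>i. AE x in lborel. (\<lambda>n. rapprox (axis i 1) n f0 x) \<longlonglongrightarrow> of_real \<kappa> * r i x"
      using hardy_space_borel_version[OF f] unfolding \<kappa>_def by blast
    define s where "s j = (\<lambda>k. pairing f (affine_system a b \<phi> j k))" for j
    define N where "N j = discrete_hardy_norm b \<nu> (s j)" for j
    define H where "H = hardy_norm f"
    have [measurable]: "f0 \<in> borel_measurable borel" using borel_measurable_integrable[OF f0(1)] by simp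
    have ge: "(LBINT x. norm (f0 x)) + (LBINT x. norm (r i x)) \<le> H" for i
      unfolding H_def by (rule hardy_norm_ge[OF f0 r])
    have nn: "0 \<le> (LBINT x. norm (r i x))" "0 \<le> (LBINT x. norm (f0 x))" for i
      by (simp_all add: Bochner_Integration.integral_nonneg)
    have f0H: "(LBINT x. norm (f0 x)) \<le> H" using ge[of undefined] nn(1)[of undefined] by linarith
    have rH: "(LBINT x. norm (r i x)) \<le> H" for i using ge[of i] nn(2) by linarith
    have H0: "0 \<le> H" using f0H nn(2) by linarith
    have s: "s j = (\<lambda>k. sample (\<alpha> j) b k f0 (ft ?Y))" if j: "j > 0" for j
    proof
      fix k
      have "AE x in lborel. f x * cnj (affine_system a b \<phi> j k x) = f0 x * cnj (\<phi> (\<alpha> j *\<^sub>R x - b *v lattice_vec k))"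
        using f0(2) by eventually_elim (simp add: affine_system_def assms(3)[OF j] mat_vector_mult)
      then show "s j k = sample (\<alpha> j) b k f0 (ft ?Y)"
        unfolding s_def pairing_def sample_def ftY by (intro integral_lebesgue_AE_eq) measurable
    qed
    \<comment> \<open>The actual limit of the truncations, to which the sampling identity applies
      without further constants.\<close>
    define r' where "r' i x = of_real \<kappa> * r i x" for i x
    have r'i: "integrable lborel (r' i)" for i unfolding r'_def by (rule integrable_mult_right[OF r(1)])
    have r'n: "(LBINT x. norm (r' i x)) = \<kappa> * (LBINT x. norm (r i x))" for i
      using \<kappa> by (simp add: r'_def norm_mult)
    have w: "norm (sample (\<alpha> j) b k (r' i) K.kernel) = half_gauss * norm (seq_conv (s j) ?z k $ i)" if j: "j > 0" for j k i
      unfolding s[OF j] by (rule K.norm_seq_conv_sample_nth[OF f0(1) r'i \<alpha>(1)[OF j]]) (use lim in \<open>simp add: r'_def\<close>)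
    have sb: "(\<Sum>k\<in>F. norm (s j k)) \<le> C * H" if j: "j > 0" and F: "finite F" for j F
      unfolding s[OF j] using order_trans[OF sum_norm_sample_le[OF f0(1) K.lb ftYm F] mult_left_mono[OF f0H C]] .
    have wb: "(\<Sum>k\<in>F. norm (seq_conv (s j) ?z k)) \<le> ?n * (C' * \<kappa> / half_gauss) * H" if j: "j > 0" and F: "finite F" for j F
    proof -
      have "(\<Sum>k\<in>F. norm (seq_conv (s j) ?z k)) \<le> (\<Sum>k\<in>F. \<Sum>i\<in>UNIV. norm (seq_conv (s j) ?z k $ i))"
        by (intro sum_mono norm_vec_le_sum)
      also have "... = (\<Sum>i\<in>UNIV. \<Sum>k\<in>F. norm (seq_conv (s j) ?z k $ i))" by (rule sum.swap)
      also have "... \<le> (\<Sum>i\<in>(UNIV::'d set). C' * \<kappa> / half_gauss * H)"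
      proof (rule sum_mono)
        fix i
        have "half_gauss * (\<Sum>k\<in>F. norm (seq_conv (s j) ?z k $ i)) = (\<Sum>k\<in>F. norm (sample (\<alpha> j) b k (r' i) K.kernel))"
          by (simp add: w[OF j] sum_distrib_left)
        also have "... \<le> C' * (LBINT x. norm (r' i x))"
          unfolding C'_def by (rule sum_norm_sample_le[OF r'i K.kernel_lattice_bounded K.measurable_kernel F])
        also have "... \<le> C' * (\<kappa> * H)" unfolding r'n using rH[of i] C' \<kappa> by (intro mult_left_mono) auto
        finally show "(\<Sum>k\<in>F. norm (seq_conv (s j) ?z k $ i)) \<le> C' * \<kappa> / half_gauss * H" using hg by (simp add: field_simps)
      qed
      finally show ?thesis by simp
    qed
    have sp: "s j \<in> discrete_hardy_space b \<nu>" and NB: "N j \<le> B0 * H" if j: "j > 0" for j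
      using discrete_hardy_space_bound[OF sb[OF j] wb[OF j]] by (auto simp: N_def B0_def distrib_right)
    \<comment> \<open>Boundedness ensures that the supremum over the scales is a genuine least upper
      bound.\<close>
    have bdd: "bdd_above (N ` {0<..})" using NB by (auto simp: bdd_above_def)
    have ne: "{0::nat<..} \<noteq> {}" by auto
    define L where "L = (SUP j\<in>{0<..}. N j)"
    have NL: "N j \<le> L" if "j > 0" for j unfolding L_def using that bdd by (intro cSUP_upper) auto
    have LB: "L \<le> B0 * H" unfolding L_def using NB ne by (intro cSUP_least) auto
    have T: "analysis_op a b \<phi> f j = (\<lambda>k. of_real D * s j k)" for j
      by (rule ext) (simp add: analysis_op_def s_def D_def)
    have TN: "discrete_hardy_norm b \<nu> (analysis_op a b \<phi> f j) = D * N j" for j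
      unfolding T N_def by (rule discrete_hardy_norm_scale(1)[OF D])
    have norm_eq: "linf_hardy_norm b \<nu> (analysis_op a b \<phi> f) = L * D"
      unfolding linf_hardy_norm_def TN L_def by (rule SUP_mult_left_real[OF ne bdd D])
    have mem: "analysis_op a b \<phi> f \<in> linf_hardy_space b \<nu>"
      unfolding linf_hardy_space_def mem_Collect_eq TN
    proof (intro conjI allI impI)
      show "analysis_op a b \<phi> f j \<in> discrete_hardy_space b \<nu>" if "j > 0" for j
        unfolding T by (rule discrete_hardy_norm_scale(2)[OF D sp[OF that]])
      have "D * N j \<le> D * (B0 * H)" if "j > 0" for j using NB[OF that] D by (intro mult_left_mono) auto
      then show "bdd_above ((\<lambda>j. D * N j) ` {0<..})" by (auto simp: bdd_above_def)
    qed
    \<comment> \<open>\<open>cnj \<phi>\<close> has integral 1, so the step functions built from the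
      samples recover \<open>f0\<close> as the scales grow.\<close>
    have f0L: "(LBINT x. norm (f0 x)) \<le> V * L"
      unfolding V_def
    proof (rule sampling_lower_bound[OF b K.ft_Yi ftY1 K.lb \<alpha>(2) f0(1)])
      fix j :: nat and F :: "(int^'d) set" assume j: "j > 0" and F: "finite F"
      show "(\<Sum>k\<in>F. norm (sample (\<alpha> j) b k f0 (ft ?Y))) \<le> L"
        using order_trans[OF sum_le_discrete_hardy_norm(1)[OF sp[OF j] F] NL[OF j, unfolded N_def]] by (simp only: s[OF j])
    qed
    \<comment> \<open>The same argument for \<open>r' i\<close> and the kernel, which also has
      integral 1; its samples are the discrete Riesz components up to
      \<open>half_gauss\<close>.\<close>
    have rL: "(LBINT x. norm (r i x)) \<le> V * half_gauss / \<kappa> * L" for i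
    proof -
      have "(LBINT x. norm (r' i x)) \<le> V * (half_gauss * L)"
        unfolding V_def
      proof (rule sampling_lower_bound[OF b K.kernel_integrable K.kernel_integral K.kernel_lattice_bounded \<alpha>(2) r'i])
        fix j :: nat and F :: "(int^'d) set" assume j: "j > 0" and F: "finite F"
        have "(\<Sum>k\<in>F. norm (sample (\<alpha> j) b k (r' i) K.kernel)) = half_gauss * (\<Sum>k\<in>F. norm (seq_conv (s j) ?z k $ i))"
          by (simp add: w[OF j] sum_distrib_left)
        also have "... \<le> half_gauss * (\<Sum>k\<in>F. norm (seq_conv (s j) ?z k))"
          using hg by (intro mult_left_mono sum_mono Finite_Cartesian_Product.norm_nth_le) auto
        also have "... \<le> half_gauss * L"
          using order_trans[OF sum_le_discrete_hardy_norm(2)[OF sp[OF j] F] NL[OF j, unfolded N_def]] hg by (intro mult_left_mono) auto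
        finally show "(\<Sum>k\<in>F. norm (sample (\<alpha> j) b k (r' i) K.kernel)) \<le> half_gauss * L" .
      qed
      then show ?thesis unfolding r'n using \<kappa> by (simp add: field_simps)
    qed
    have L0: "0 \<le> L" using NL[of 1] sum_le_discrete_hardy_norm(1)[OF sp[of 1], of "{}"] by (simp add: N_def)
    have "H \<le> V * L + (\<Sum>i\<in>(UNIV::'d set). V * half_gauss / \<kappa> * L)"
      unfolding H_def by (rule order_trans[OF hardy_norm_le[OF f0 r]]) (intro add_mono sum_mono f0L rL)
    also have "... = A0 * L" by (simp add: A0_def distrib_right)
    also have "... \<le> (A0 + 1) * L" using L0 by (intro mult_right_mono) auto
    also have "... = ((A0 + 1) / D) * (L * D)" using D by simp
    finally have lower: "H \<le> ((A0 + 1) / D) * (L * D)" .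
    have "L * D \<le> B0 * H * D" using LB D by (intro mult_right_mono) auto
    also have "... \<le> (D * B0 + 1) * H" using H0 by (simp add: algebra_simps)
    finally have upper: "L * D \<le> (D * B0 + 1) * H" .
    show ?thesis using mem norm_eq lower upper unfolding L_def N_def s_def H_def D_def by simp
  qed
  show ?thesis
  proof (rule exI[of _ "(A0 + 1) / D"], rule conjI, use A0 D in simp, rule exI[of _ "D * B0 + 1"], rule conjI)
    have "0 \<le> D * B0" using D B0 by simp
    then show "D * B0 + 1 > 0" by simp
  qed (use main in blast)
qed

end
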